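(* Let $k\in\mathbb{N}$. Then $W_k(\mathbb{R})_{\mathrm{loc}}\subsetneq NC^k(\mathbb{R})$. Specifically, fix $\psi\in C_c^\infty(\mathbb{R})$ such that $\psi\equiv1$ on $[-1,1]$ and $\operatorname{supp}\psi\subseteq[-2,2]$, and define $$\kappa(x):=1_{(0,\infty)}(x)\,\psi(x)\,\sqrt{x}\,e^{-\frac{i}{x}},\qquad x\in\mathbb{R}$$ (so $\kappa(x)=0$ for $x\le0$). If $f\in C^k(\mathbb{R})$ and $f^{(k)}=\kappa$, then $f\in C^{k,\frac14}(\mathbb{R})\setminus W_k(\mathbb{R})_{\mathrm{loc}}\subseteq NC^k(\mathbb{R})\setminus W_k(\mathbb{R})_{\mathrm{loc}}$.
   Context: $\mathbb{N}=\{1,2,\dots\}$; $C^k(\mathbb{R})$ is the space of $k$-times continuously differentiable functions $\mathbb{R}\to\mathbb{C}$; $\mathbb{C}[\lambda]$ is the set of complex polynomials in one real variable. Divided differences. $f^{[0]}:=f$ and, recursively, for distinct $\lambda_1,\dots,\lambda_{j+1}\in\mathbb{R}$, $f^{[j]}(\lambda_1,\dots,\lambda_{j+1}):=\frac{f^{[j-1]}(\lambda_1,\dots,\lambda_j)-f^{[j-1]}(\lambda_1,\dots,\lambda_{j-1},\lambda_{j+1})}{\lambda_j-\lambda_{j+1}}$. If $f\in C^j(\mathbb{R})$, then $f^{[j]}$ extends uniquely to a continuous function on $\mathbb{R}^{j+1}$, also denoted $f^{[j]}$. Integral projective tensor products. For a Polish space $\Omega$ with Borel $\sigma$-algebra $\mathcal{B}_\Omega$,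 $\ell^\infty(\Omega,\mathcal{B}_\Omega)$ is the space of bounded Borel functions $\Omega\to\mathbb{C}$, and $\|\varphi\|_{\ell^\infty(\Omega)}=\sup_\Omega|\varphi|$. Let $\Omega_1,\dots,\Omega_m$ be Polish spaces and $\Omega=\Omega_1\times\cdots\times\Omega_m$. An $\ell^\infty$-integral projective decomposition (IPD) of $\varphi\colon\Omega\to\mathbb{C}$ is a tuple $(\Sigma,\rho,\varphi_1,\dots,\varphi_m)$ where $(\Sigma,\mathscr{H},\rho)$ is a $\sigma$-finite measure space, each $\varphi_j\colon\Omega_j\times\Sigma\to\mathbb{C}$ is product measurable with $\varphi_j(\cdot,\sigma)\in\ell^\infty(\Omega_j,\mathcal{B}_{\Omega_j})$ for all $\sigma$, $\int_\Sigma\prod_{j=1}^m\|\varphi_j(\cdot,\sigma)\|_{\ell^\infty(\Omega_j)}\,\rho(d\sigma)<\infty$ (integral with respect to the completion of $\rho$), and $\varphi(\omega_1,\dots,\omega_m)=\int_\Sigma\varphi_1(\omega_1,\sigma)\cdots\varphi_m(\omega_m,\sigma)\,\rho(d\sigma)$ for all $(\omega_1,\dots,\omega_m)\in\Omega$. The norm $\|\varphi\|_{\ell^\infty(\Omega_1,\mathcal{B}_{\Omega_1})\hat\otimes_i\cdots\hat\otimes_i\ell^\infty(\Omega_m,\mathcal{B}_{\Omega_m})}$ is the infimum of $\int_\Sigma\prod_{j}\|\varphi_j(\cdot,\sigma)\|_{\ell^\infty(\Omega_j)}\,\rho(d\sigma)$ over all $\ell^\infty$-IPDs of $\varphi$ ($\inf\emptyset=\infty$),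 and $\ell^\infty(\Omega_1,\mathcal{B}_{\Omega_1})\hat\otimes_i\cdots\hat\otimes_i\ell^\infty(\Omega_m,\mathcal{B}_{\Omega_m})$ is the space of $\varphi\in\ell^\infty(\Omega,\mathcal{B}_\Omega)$ for which it is finite. When all factors are equal, this is written as an $m$-th power $(\cdot)^{\hat\otimes_i m}$. Noncommutative $C^k$ functions. $NC^k(\mathbb{R})$ is the set of $f\in C^k(\mathbb{R})$ for which there is a sequence $(q_n)_{n\in\mathbb{N}}$ in $\mathbb{C}[\lambda]$ such that for all $r>0$ and $j\in\{0,\dots,k\}$, $q_n^{[j]}|_{[-r,r]^{j+1}}\to f^{[j]}|_{[-r,r]^{j+1}}$ in $\ell^\infty([-r,r],\mathcal{B}_{[-r,r]})^{\hat\otimes_i(j+1)}$ as $n\to\infty$. Hölder space. $C^{k,\varepsilon}(\mathbb{R})$ is the set of $g\in C^k(\mathbb{R})$ with $\sup_{x\neq y}|g^{(k)}(x)-g^{(k)}(y)|/|x-y|^\varepsilon<\infty$. Wiener space. $W_k(\mathbb{R})$ is the set of functions $f(\lambda)=\int_{\mathbb{R}}e^{i\lambda\xi}\,\mu(d\xi)$ ($\lambda\in\mathbb{R}$), where $\mu$ is a complex Borel measure on $\mathbb{R}$ with $\int_{\mathbb{R}}|\xi|^k\,|\mu|(d\xi)<\infty$. $W_k(\mathbb{R})_{\mathrm{loc}}$ is the set of $f\in C^k(\mathbb{R})$ such that for every $r>0$ there is $g\in W_k(\mathbb{R})$ with $g|_{[-r,r]}=f|_{[-r,r]}$. *)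

theory Defs
  imports "HOL-Analysis.Analysis" "HOL-Computational_Algebra.Polynomial"
begin

section \<open>Functions of class \<open>C\<^sup>k\<close>\<close>

definition nth_deriv :: "nat \<Rightarrow> (real \<Rightarrow> complex) \<Rightarrow> real \<Rightarrow> complex" where
  "nth_deriv k f = ((\<lambda>g x. vector_derivative g (at x)) ^^ k) f"

definition C_k :: "nat \<Rightarrow> (real \<Rightarrow> complex) set" where
  "C_k k = {f. (\<forall>j<k. \<forall>x. nth_deriv j f differentiable (at x)) \<and>
               continuous_on UNIV (nth_deriv k f)}"

definition C_c_inf :: "(real \<Rightarrow> complex) set" where
  "C_c_inf = {f. (\<forall>k. f \<in> C_k k) \<and> compact (closure {x. f x \<noteq> 0})}"

definition Holder :: "nat \<Rightarrow> real \<Rightarrow> (real \<Rightarrow> complex) set" where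
  "Holder k \<epsilon> = {g \<in> C_k k.
     bdd_above {norm (nth_deriv k g x - nth_deriv k g y) / \<bar>x - y\<bar> powr \<epsilon> | x y. x \<noteq> y}}"

section \<open>Divided differences\<close>

text \<open>Points of \<open>\<real>\<^sup>j\<^sup>+\<^sup>1\<close> are the functions in \<open>{..<Suc j} \<rightarrow>\<^sub>E UNIV\<close>, i.e. the coordinates are
  numbered \<open>0, \<dots>, j\<close>. The recursive formula \<open>divdiff_rec j f x\<close> reads only these coordinates
  of \<open>x\<close>, and it is meaningful only if they are distinct.\<close>

fun divdiff_rec :: "nat \<Rightarrow> (real \<Rightarrow> complex) \<Rightarrow> (nat \<Rightarrow> real) \<Rightarrow> complex" where
  "divdiff_rec 0 f x = f (x 0)"
| "divdiff_rec (Suc j) f x =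
     (divdiff_rec j f x - divdiff_rec j f (x(j := x (Suc j)))) / of_real (x j - x (Suc j))"

text \<open>The continuous extension to all of \<open>\<real>\<^sup>j\<^sup>+\<^sup>1\<close>, which is unique because the points with distinct
  coordinates are dense, and which exists for \<open>f \<in> C_k j\<close>. The topology on
  \<^typ>\<open>nat \<Rightarrow> real\<close> is the product topology, which induces the usual one on \<open>\<real>\<^sup>j\<^sup>+\<^sup>1\<close>.\<close>

definition divdiff :: "nat \<Rightarrow> (real \<Rightarrow> complex) \<Rightarrow> (nat \<Rightarrow> real) \<Rightarrow> complex" where
  "divdiff j f = (THE F. F \<in> extensional ({..<Suc j} \<rightarrow>\<^sub>E UNIV) \<and>
      continuous_on ({..<Suc j} \<rightarrow>\<^sub>E UNIV) F \<and>
      (\<forall>x \<in> {..<Suc j} \<rightarrow>\<^sub>E UNIV. inj_on x {..<Suc j} \<longrightarrow> F x = divdiff_rec j f x))"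

section \<open>Integral projective tensor products\<close>

definition linf :: "'a::topological_space set \<Rightarrow> ('a \<Rightarrow> complex) set" where
  "linf S = {\<phi> \<in> borel_measurable (restrict_space borel S). bounded (\<phi> ` S)}"

definition linf_norm :: "'a set \<Rightarrow> ('a \<Rightarrow> complex) \<Rightarrow> ennreal" where
  "linf_norm S \<phi> = (SUP \<omega>\<in>S. ennreal (norm (\<phi> \<omega>)))"

text \<open>The factors are \<open>\<Omega> 0, \<dots>, \<Omega> (m - 1)\<close>, each a subset (Polish in its subspace topology, e.g.
  closed) of a Polish space, with its subspace Borel \<open>\<sigma>\<close>-algebra.\<close>

definition ipd_cost ::
    "nat \<Rightarrow> (nat \<Rightarrow> 'a set) \<Rightarrow> 's measure \<Rightarrow> (nat \<Rightarrow> 'a \<Rightarrow> 's \<Rightarrow> complex) \<Rightarrow> ennreal" where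
  "ipd_cost m \<Omega> \<rho> \<eta> =
     (\<integral>\<^sup>+ \<sigma>. (\<Prod>j<m. linf_norm (\<Omega> j) (\<lambda>\<omega>. \<eta> j \<omega> \<sigma>)) \<partial>completion \<rho>)"

definition is_ipd ::
    "nat \<Rightarrow> (nat \<Rightarrow> 'a::polish_space set) \<Rightarrow> ((nat \<Rightarrow> 'a) \<Rightarrow> complex) \<Rightarrow>
      's measure \<Rightarrow> (nat \<Rightarrow> 'a \<Rightarrow> 's \<Rightarrow> complex) \<Rightarrow> bool" where
  "is_ipd m \<Omega> \<phi> \<rho> \<eta> \<longleftrightarrow>
     sigma_finite_measure \<rho> \<and>
     (\<forall>j<m. (\<lambda>(\<omega>, \<sigma>). \<eta> j \<omega> \<sigma>) \<in> borel_measurable (restrict_space borel (\<Omega> j) \<Otimes>\<^sub>M \<rho>)) \<and>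
     (\<forall>j<m. \<forall>\<sigma>\<in>space \<rho>. (\<lambda>\<omega>. \<eta> j \<omega> \<sigma>) \<in> linf (\<Omega> j)) \<and>
     ipd_cost m \<Omega> \<rho> \<eta> < \<infinity> \<and>
     (\<forall>\<omega> \<in> Pi\<^sub>E {..<m} \<Omega>. \<phi> \<omega> = (LINT \<sigma>|\<rho>. (\<Prod>j<m. \<eta> j (\<omega> j) \<sigma>)))"

text \<open>A definition cannot quantify over the type of the points of \<open>\<Sigma>\<close>. Here \<open>\<Sigma>\<close> ranges over all
  \<open>\<sigma>\<close>-finite measure spaces (with arbitrary underlying set and arbitrary \<open>\<sigma>\<close>-algebra) whose points
  are real sequences. This loses nothing: by \<open>is_ipd_to_sequences\<close> below, an IPD over a measure
  space of any type can be replaced by one over a space of real sequences, at no greater cost.\<close>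

definition ipt_norm ::
    "nat \<Rightarrow> (nat \<Rightarrow> 'a::polish_space set) \<Rightarrow> ((nat \<Rightarrow> 'a) \<Rightarrow> complex) \<Rightarrow> ennreal" where
  "ipt_norm m \<Omega> \<phi> =
     Inf {ipd_cost m \<Omega> \<rho> \<eta> | (\<rho> :: (nat \<Rightarrow> real) measure) \<eta>. is_ipd m \<Omega> \<phi> \<rho> \<eta>}"

definition ipt_space ::
    "nat \<Rightarrow> (nat \<Rightarrow> 'a::polish_space set) \<Rightarrow> ((nat \<Rightarrow> 'a) \<Rightarrow> complex) set" where
  "ipt_space m \<Omega> = {\<phi> \<in> linf (Pi\<^sub>E {..<m} \<Omega>). ipt_norm m \<Omega> \<phi> < \<infinity>}"

lemma sets_pair_factor:
  fixes M :: "'s measure" and B :: "'b measure"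
  assumes "A \<in> sets (B \<Otimes>\<^sub>M M)"
  shows "\<exists>C. countable C \<and> C \<subseteq> sets M \<and>
    (\<forall>(h :: 's \<Rightarrow> 'c) N. h ` space M = space N \<longrightarrow> (\<forall>c\<in>C. \<exists>D\<in>sets N. c = h -` D \<inter> space M) \<longrightarrow>
      (\<exists>A'\<in>sets (B \<Otimes>\<^sub>M N). A = {p \<in> space B \<times> space M. (fst p, h (snd p)) \<in> A'}))"
proof -
  define Q where "Q A C \<longleftrightarrow> (\<forall>(h :: 's \<Rightarrow> 'c) N. h ` space M = space N \<longrightarrow>
      (\<forall>c\<in>C. \<exists>D\<in>sets N. c = h -` D \<inter> space M) \<longrightarrow>
      (\<exists>A'\<in>sets (B \<Otimes>\<^sub>M N). A = {p \<in> space B \<times> space M. (fst p, h (snd p)) \<in> A'}))" for A C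
  have QI: "Q A C" if "\<And>(h :: 's \<Rightarrow> 'c) N. h ` space M = space N \<Longrightarrow>
      (\<And>c. c \<in> C \<Longrightarrow> \<exists>D\<in>sets N. c = h -` D \<inter> space M) \<Longrightarrow>
      (\<exists>A'\<in>sets (B \<Otimes>\<^sub>M N). A = {p \<in> space B \<times> space M. (fst p, h (snd p)) \<in> A'})" for A C
    unfolding Q_def using that by (intro allI impI) simp
  have QD: "\<exists>A'\<in>sets (B \<Otimes>\<^sub>M N). A = {p \<in> space B \<times> space M. (fst p, h (snd p)) \<in> A'}"
    if "Q A C" "h ` space M = space N" "\<And>c. c \<in> C \<Longrightarrow> \<exists>D\<in>sets N. c = h -` D \<inter> space M"
    for A C and h :: "'s \<Rightarrow> 'c" and N
    using that unfolding Q_def by (elim allE[where x = h] allE[where x = N]) simp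
  have "A \<in> sigma_sets (space B \<times> space M) {a \<times> b |a b. a \<in> sets B \<and> b \<in> sets M}"
    using assms by (simp add: sets_pair_measure)
  then have "\<exists>C. countable C \<and> C \<subseteq> sets M \<and> Q A C"
  proof (induction rule: sigma_sets.induct)
    case (Basic a)
    then obtain U V where a: "a = U \<times> V" "U \<in> sets B" "V \<in> sets M" by auto
    have "Q a {V}"
    proof (rule QI)
      fix h :: "'s \<Rightarrow> 'c" and N
      assume "\<And>c. c \<in> {V} \<Longrightarrow> \<exists>D\<in>sets N. c = h -` D \<inter> space M"
      then obtain D where D: "D \<in> sets N" "V = h -` D \<inter> space M" by auto
      have "U \<times> D \<in> sets (B \<Otimes>\<^sub>M N)" using a D by auto
      moreover have "a = {p \<in> space B \<times> space M. (fst p, h (snd p)) \<in> U \<times> D}"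
        using a D sets.sets_into_space[OF a(2)] by auto
      ultimately show "\<exists>A'\<in>sets (B \<Otimes>\<^sub>M N). a = {p \<in> space B \<times> space M. (fst p, h (snd p)) \<in> A'}"
        by (rule rev_bexI)
    qed
    with a show ?case by (intro exI[of _ "{V}"]) auto
  next
    case Empty
    have "Q {} {}" by (rule QI) (auto intro!: bexI[of _ "{}"])
    then show ?case by (intro exI[of _ "{}"]) auto
  next
    case (Compl a)
    then obtain C where C: "countable C" "C \<subseteq> sets M" "Q a C" by auto
    have "Q (space B \<times> space M - a) C"
    proof (rule QI)
      fix h :: "'s \<Rightarrow> 'c" and N
      assume *: "h ` space M = space N" "\<And>c. c \<in> C \<Longrightarrow> \<exists>D\<in>sets N. c = h -` D \<inter> space M"
      have "\<exists>A'\<in>sets (B \<Otimes>\<^sub>M N). a = {p \<in> space B \<times> space M. (fst p, h (snd p)) \<in> A'}"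
        by (rule QD[OF C(3) *(1)]) (rule *(2))
      then obtain A' where A': "A' \<in> sets (B \<Otimes>\<^sub>M N)"
        "a = {p \<in> space B \<times> space M. (fst p, h (snd p)) \<in> A'}" by (rule bexE)
      have "space (B \<Otimes>\<^sub>M N) - A' \<in> sets (B \<Otimes>\<^sub>M N)" using A' by auto
      moreover have "space B \<times> space M - a =
          {p \<in> space B \<times> space M. (fst p, h (snd p)) \<in> space (B \<Otimes>\<^sub>M N) - A'}"
        using A'(2) *(1) by (auto simp: space_pair_measure)
      ultimately show "\<exists>A'\<in>sets (B \<Otimes>\<^sub>M N).
          space B \<times> space M - a = {p \<in> space B \<times> space M. (fst p, h (snd p)) \<in> A'}"
        by (rule rev_bexI)
    qed
    with C show ?case by auto
  next
    case (Union a)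
    then obtain C where C: "\<And>i. countable (C i)" "\<And>i. C i \<subseteq> sets M" "\<And>i. Q (a i) (C i)"
      by metis
    have "Q (\<Union>i. a i) (\<Union>i. C i)"
    proof (rule QI)
      fix h :: "'s \<Rightarrow> 'c" and N
      assume *: "h ` space M = space N"
        "\<And>c. c \<in> (\<Union>i. C i) \<Longrightarrow> \<exists>D\<in>sets N. c = h -` D \<inter> space M"
      have "\<exists>A'. A' \<in> sets (B \<Otimes>\<^sub>M N) \<and> a i = {p \<in> space B \<times> space M. (fst p, h (snd p)) \<in> A'}" for i
      proof -
        have "\<exists>A'\<in>sets (B \<Otimes>\<^sub>M N). a i = {p \<in> space B \<times> space M. (fst p, h (snd p)) \<in> A'}"
          by (rule QD[OF C(3) *(1)]) (rule *(2), auto)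
        then show ?thesis by (simp only: Bex_def)
      qed
      then have "\<exists>A'. \<forall>i. A' i \<in> sets (B \<Otimes>\<^sub>M N) \<and>
          a i = {p \<in> space B \<times> space M. (fst p, h (snd p)) \<in> A' i}"
        by (intro choice allI)
      then obtain A' where A0: "\<forall>i. A' i \<in> sets (B \<Otimes>\<^sub>M N) \<and>
          a i = {p \<in> space B \<times> space M. (fst p, h (snd p)) \<in> A' i}"
        by (rule exE)
      have A': "A' i \<in> sets (B \<Otimes>\<^sub>M N)"
        "a i = {p \<in> space B \<times> space M. (fst p, h (snd p)) \<in> A' i}" for i
        by (rule A0[THEN spec, THEN conjunct1], rule A0[THEN spec, THEN conjunct2])
      have "(\<Union>i. A' i) \<in> sets (B \<Otimes>\<^sub>M N)" using A'(1) by auto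
      moreover have "(\<Union>i. a i) = {p \<in> space B \<times> space M. (fst p, h (snd p)) \<in> (\<Union>i. A' i)}"
        unfolding A'(2) by auto
      ultimately show "\<exists>A'\<in>sets (B \<Otimes>\<^sub>M N).
          (\<Union>i. a i) = {p \<in> space B \<times> space M. (fst p, h (snd p)) \<in> A'}"
        by (rule rev_bexI)
    qed
    with C(1,2) show ?case by (intro exI[of _ "\<Union>i. C i"]) auto
  qed
  then show ?thesis by (simp only: Q_def)
qed

lemma borel_measurable_pair_factor:
  fixes M :: "'s measure" and B :: "'b measure" and f :: "'b \<Rightarrow> 's \<Rightarrow> complex"
  assumes f: "(\<lambda>(w, \<sigma>). f w \<sigma>) \<in> borel_measurable (B \<Otimes>\<^sub>M M)"
  shows "\<exists>C. countable C \<and> C \<subseteq> sets M \<and>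
    (\<forall>(h :: 's \<Rightarrow> 'c) N. h ` space M = space N \<longrightarrow> (\<forall>c\<in>C. \<exists>D\<in>sets N. c = h -` D \<inter> space M) \<longrightarrow>
      (\<forall>w\<in>space B. \<forall>\<sigma>\<in>space M. f w (inv_into (space M) h (h \<sigma>)) = f w \<sigma>) \<and>
      (\<lambda>(w, s). f w (inv_into (space M) h s)) \<in> borel_measurable (B \<Otimes>\<^sub>M N))"
proof -
  obtain \<B> :: "complex set set" where \<B>: "countable \<B>" "topological_basis \<B>"
    using ex_countable_basis by blast
  define pre where "pre b = (\<lambda>(w, \<sigma>). f w \<sigma>) -` b \<inter> space (B \<Otimes>\<^sub>M M)" for b
  have pre: "pre b \<in> sets (B \<Otimes>\<^sub>M M)" if "b \<in> \<B>" for b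
    unfolding pre_def using f topological_basis_open[OF \<B>(2) that]
    by (intro measurable_sets[OF f]) auto
  have "\<forall>b\<in>\<B>. \<exists>C. countable C \<and> C \<subseteq> sets M \<and>
    (\<forall>(h :: 's \<Rightarrow> 'c) N. h ` space M = space N \<longrightarrow> (\<forall>c\<in>C. \<exists>D\<in>sets N. c = h -` D \<inter> space M) \<longrightarrow>
      (\<exists>A'\<in>sets (B \<Otimes>\<^sub>M N). pre b = {p \<in> space B \<times> space M. (fst p, h (snd p)) \<in> A'}))"
    by (intro ballI sets_pair_factor pre)
  from bchoice[OF this] obtain C where C0: "\<forall>b\<in>\<B>. countable (C b) \<and> C b \<subseteq> sets M \<and>
    (\<forall>(h :: 's \<Rightarrow> 'c) N. h ` space M = space N \<longrightarrow> (\<forall>c\<in>C b. \<exists>D\<in>sets N. c = h -` D \<inter> space M) \<longrightarrow>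
      (\<exists>A'\<in>sets (B \<Otimes>\<^sub>M N). pre b = {p \<in> space B \<times> space M. (fst p, h (snd p)) \<in> A'}))"
    by (rule exE)
  have C: "\<And>b. b \<in> \<B> \<Longrightarrow> countable (C b)" "\<And>b. b \<in> \<B> \<Longrightarrow> C b \<subseteq> sets M"
    using C0 by auto
  have fac: "\<exists>A'\<in>sets (B \<Otimes>\<^sub>M N). pre b = {p \<in> space B \<times> space M. (fst p, h (snd p)) \<in> A'}"
    if "b \<in> \<B>" "h ` space M = space N" "\<forall>c\<in>C b. \<exists>D\<in>sets N. c = h -` D \<inter> space M"
    for b and h :: "'s \<Rightarrow> 'c" and N
    by (rule C0[THEN bspec, THEN conjunct2, THEN conjunct2, THEN spec, THEN spec, THEN mp, THEN mp])
      (use that in auto)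
  show ?thesis
  proof (intro exI[of _ "\<Union>b\<in>\<B>. C b"] conjI allI impI)
    show "countable (\<Union>b\<in>\<B>. C b)" using C \<B> by auto
    show "(\<Union>b\<in>\<B>. C b) \<subseteq> sets M" using C by auto
  next
    fix h :: "'s \<Rightarrow> 'c" and N
    assume *: "h ` space M = space N" "\<forall>c\<in>\<Union>b\<in>\<B>. C b. \<exists>D\<in>sets N. c = h -` D \<inter> space M"
    let ?i = "inv_into (space M) h"
    have A: "\<exists>A'\<in>sets (B \<Otimes>\<^sub>M N). \<forall>w\<in>space B. \<forall>\<sigma>\<in>space M. f w \<sigma> \<in> b \<longleftrightarrow> (w, h \<sigma>) \<in> A'"
      if b: "b \<in> \<B>" for b
    proof -
      from fac[OF b *(1)] *(2) b obtain A' where "A' \<in> sets (B \<Otimes>\<^sub>M N)"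
        "pre b = {p \<in> space B \<times> space M. (fst p, h (snd p)) \<in> A'}" by blast
      then show ?thesis
        by (intro bexI[of _ A']) (auto simp: pre_def space_pair_measure set_eq_iff)
    qed
    show fi: "\<forall>w\<in>space B. \<forall>\<sigma>\<in>space M. f w (?i (h \<sigma>)) = f w \<sigma>"
    proof (intro ballI, rule ccontr)
      fix w \<sigma> assume w: "w \<in> space B" "\<sigma> \<in> space M" and ne: "f w (?i (h \<sigma>)) \<noteq> f w \<sigma>"
      have i: "?i (h \<sigma>) \<in> space M" "h (?i (h \<sigma>)) = h \<sigma>"
        using w by (auto intro: inv_into_into f_inv_into_f)
      have "open (- {f w \<sigma>})" "f w (?i (h \<sigma>)) \<in> - {f w \<sigma>}" using ne by auto
      then obtain b where b: "b \<in> \<B>" "f w (?i (h \<sigma>)) \<in> b" "b \<subseteq> - {f w \<sigma>}"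
        using topological_basisE[OF \<B>(2)] by metis
      with A[OF b(1)] w i show False by (metis ComplD insertI1 subsetD)
    qed
    have "(\<lambda>(w, s). f w (?i s)) -` b \<inter> space (B \<Otimes>\<^sub>M N) \<in> sets (B \<Otimes>\<^sub>M N)" if b: "b \<in> \<B>" for b
    proof -
      from A[OF b] obtain A' where A': "A' \<in> sets (B \<Otimes>\<^sub>M N)"
        "\<And>w \<sigma>. w \<in> space B \<Longrightarrow> \<sigma> \<in> space M \<Longrightarrow> f w \<sigma> \<in> b \<longleftrightarrow> (w, h \<sigma>) \<in> A'" by blast
      have "f w (?i s) \<in> b \<longleftrightarrow> (w, s) \<in> A'" if "w \<in> space B" "s \<in> space N" for w s
        using A'(2)[OF that(1), of "?i s"] that(2) *(1)
        by (metis f_inv_into_f inv_into_into)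
      then have "(\<lambda>(w, s). f w (?i s)) -` b \<inter> space (B \<Otimes>\<^sub>M N) = A'"
        using sets.sets_into_space[OF A'(1)] by (auto simp: space_pair_measure)
      with A' show ?thesis by simp
    qed
    then show "(\<lambda>(w, s). f w (?i s)) \<in> borel_measurable (B \<Otimes>\<^sub>M N)"
      unfolding borel_eq_countable_basis[OF \<B>] by (intro measurable_measure_of) auto
  qed
qed

lemma is_ipd_to_sequences:
  fixes \<rho> :: "'s measure"
  assumes ipd: "is_ipd m \<Omega> \<phi> \<rho> \<eta>"
  shows "\<exists>(\<rho>' :: (nat \<Rightarrow> real) measure) \<eta>'.
    is_ipd m \<Omega> \<phi> \<rho>' \<eta>' \<and> ipd_cost m \<Omega> \<rho>' \<eta>' \<le> ipd_cost m \<Omega> \<rho> \<eta>"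
proof -
  let ?B = "\<lambda>j. restrict_space borel (\<Omega> j)"
  interpret sigma_finite_measure \<rho> using ipd by (simp add: is_ipd_def)
  have spB: "space (?B j) = \<Omega> j" for j by (simp add: space_restrict_space)
  have "\<forall>j\<in>{..<m}. \<exists>C. countable C \<and> C \<subseteq> sets \<rho> \<and>
    (\<forall>(h :: 's \<Rightarrow> nat \<Rightarrow> real) N. h ` space \<rho> = space N \<longrightarrow>
        (\<forall>c\<in>C. \<exists>D\<in>sets N. c = h -` D \<inter> space \<rho>) \<longrightarrow>
      (\<forall>w\<in>space (?B j). \<forall>\<sigma>\<in>space \<rho>. \<eta> j w (inv_into (space \<rho>) h (h \<sigma>)) = \<eta> j w \<sigma>) \<and>
      (\<lambda>(w, s). \<eta> j w (inv_into (space \<rho>) h s)) \<in> borel_measurable (?B j \<Otimes>\<^sub>M N))"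
    using ipd by (intro ballI borel_measurable_pair_factor) (simp add: is_ipd_def)
  from bchoice[OF this] obtain C where C0: "\<forall>j\<in>{..<m}. countable (C j) \<and> C j \<subseteq> sets \<rho> \<and>
    (\<forall>(h :: 's \<Rightarrow> nat \<Rightarrow> real) N. h ` space \<rho> = space N \<longrightarrow>
        (\<forall>c\<in>C j. \<exists>D\<in>sets N. c = h -` D \<inter> space \<rho>) \<longrightarrow>
      (\<forall>w\<in>space (?B j). \<forall>\<sigma>\<in>space \<rho>. \<eta> j w (inv_into (space \<rho>) h (h \<sigma>)) = \<eta> j w \<sigma>) \<and>
      (\<lambda>(w, s). \<eta> j w (inv_into (space \<rho>) h s)) \<in> borel_measurable (?B j \<Otimes>\<^sub>M N))"
    by (rule exE)
  have C: "\<And>j. j < m \<Longrightarrow> countable (C j)" "\<And>j. j < m \<Longrightarrow> C j \<subseteq> sets \<rho>"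
    using C0 by auto
  have fac: "(\<forall>w\<in>space (?B j). \<forall>\<sigma>\<in>space \<rho>. \<eta> j w (inv_into (space \<rho>) h (h \<sigma>)) = \<eta> j w \<sigma>) \<and>
      (\<lambda>(w, s). \<eta> j w (inv_into (space \<rho>) h s)) \<in> borel_measurable (?B j \<Otimes>\<^sub>M N)"
    if "j < m" "h ` space \<rho> = space N" "\<forall>c\<in>C j. \<exists>D\<in>sets N. c = h -` D \<inter> space \<rho>"
    for j and h :: "'s \<Rightarrow> nat \<Rightarrow> real" and N
    by (rule C0[THEN bspec, THEN conjunct2, THEN conjunct2, THEN spec, THEN spec, THEN mp, THEN mp])
      (use that in auto)
  obtain F where F: "countable F" "F \<subseteq> sets \<rho>" "\<Union> F = space \<rho>" "\<forall>a\<in>F. emeasure \<rho> a \<noteq> \<infinity>"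
    by (rule exE[OF sigma_finite_countable]) (auto intro: that)
  define G where "G = insert {} (F \<union> (\<Union>j<m. C j))"
  have "countable G" "G \<noteq> {}" using F C by (auto simp: G_def)
  then obtain E :: "nat \<Rightarrow> 's set" where E: "range E = G" using range_from_nat_into[of G] by (metis (no_types))
  have E_sets: "E n \<in> sets \<rho>" for n
  proof -
    have "G \<subseteq> sets \<rho>" using F(2) C(2) by (auto simp: G_def subset_eq)
    then show ?thesis using E by blast
  qed
  define h :: "'s \<Rightarrow> nat \<Rightarrow> real" where "h \<sigma> n = indicator (E n) \<sigma>" for \<sigma> n
  define N0 :: "(nat \<Rightarrow> real) measure" where "N0 = restrict_space borel (h ` space \<rho>)"
  define N where "N = distr \<rho> N0 h"
  let ?i = "inv_into (space \<rho>) h"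
  have "h \<in> measurable \<rho> borel"
    by (rule measurable_coordinatewise_then_product) (use E_sets in \<open>auto simp: h_def\<close>)
  then have h[measurable]: "h \<in> measurable \<rho> N0"
    unfolding N0_def by (intro measurable_restrict_space2) auto
  have spN: "h ` space \<rho> = space N" by (simp add: N_def N0_def space_restrict_space)
  have setsN: "sets N = sets N0" by (simp add: N_def)
  have pull: "\<exists>D\<in>sets N. c = h -` D \<inter> space \<rho>" if c: "c \<in> G" for c
  proof -
    obtain n where n: "c = E n" using c E by (metis imageE)
    let ?D = "{s. s n = 1} \<inter> h ` space \<rho>"
    have "(\<lambda>s :: nat \<Rightarrow> real. s n) \<in> borel_measurable borel"
      by (rule measurable_product_coordinates)
    then have "{s :: nat \<Rightarrow> real. s n = 1} \<in> sets borel"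
      using measurable_sets[of "\<lambda>s :: nat \<Rightarrow> real. s n" borel borel "{1}"] by (auto simp: vimage_def)
    then have "?D \<in> sets N"
      unfolding setsN N0_def sets_restrict_space by blast
    moreover have "c = h -` ?D \<inter> space \<rho>"
      using sets.sets_into_space[OF E_sets[of n]] by (auto simp: n h_def indicator_def)
    ultimately show ?thesis by blast
  qed
  have inv: "\<eta> j w (?i (h \<sigma>)) = \<eta> j w \<sigma>" if "j < m" "w \<in> \<Omega> j" "\<sigma> \<in> space \<rho>" for j w \<sigma>
    using fac[OF that(1) spN] pull that by (auto simp: G_def spB)
  have meas: "(\<lambda>(w, s). \<eta> j w (?i s)) \<in> borel_measurable (?B j \<Otimes>\<^sub>M N)" if "j < m" for j
    using fac[OF that spN] pull that by (auto simp: G_def)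
  define \<eta>' where "\<eta>' j w s = \<eta> j w (?i s)" for j w s
  have i_in: "?i s \<in> space \<rho>" if "s \<in> space N" for s
    using that spN by (metis inv_into_into)

  have "sigma_finite_measure N"
  proof
    have "\<forall>a\<in>F. \<exists>D. D \<in> sets N \<and> a = h -` D \<inter> space \<rho>" using pull by (auto simp: G_def)
    from bchoice[OF this] obtain D
      where D0: "\<forall>a\<in>F. D a \<in> sets N \<and> a = h -` D a \<inter> space \<rho>" by (rule exE)
    have D: "D a \<in> sets N" "a = h -` D a \<inter> space \<rho>" if "a \<in> F" for a
      by (rule D0[THEN bspec, OF that, THEN conjunct1], rule D0[THEN bspec, OF that, THEN conjunct2])
    show "\<exists>A. countable A \<and> A \<subseteq> sets N \<and> \<Union> A = space N \<and> (\<forall>a\<in>A. emeasure N a \<noteq> \<infinity>)"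
    proof (intro exI[of _ "D ` F"] conjI ballI)
      show "countable (D ` F)" "D ` F \<subseteq> sets N" using F D by auto
      show "\<Union> (D ` F) = space N"
      proof
        show "\<Union> (D ` F) \<subseteq> space N" using D sets.sets_into_space by blast
        show "space N \<subseteq> \<Union> (D ` F)"
        proof
          fix s assume "s \<in> space N"
          then obtain \<sigma> where \<sigma>: "\<sigma> \<in> space \<rho>" "s = h \<sigma>" using spN by blast
          then obtain a where "a \<in> F" "\<sigma> \<in> a" using F by blast
          then show "s \<in> \<Union> (D ` F)" using D(2)[of a] \<sigma> by blast
        qed
      qed
      fix b assume "b \<in> D ` F"
      then obtain a where a: "a \<in> F" "b = D a" by blast
      have "emeasure N b = emeasure \<rho> (h -` D a \<inter> space \<rho>)"
        unfolding N_def a(2) using D(1)[OF a(1)] setsN h by (intro emeasure_distr) auto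
      also have "\<dots> = emeasure \<rho> a" using D(2)[OF a(1)] by simp
      finally show "emeasure N b \<noteq> \<infinity>" using F(4) a(1) by simp
    qed
  qed

  moreover have cost: "ipd_cost m \<Omega> N \<eta>' \<le> ipd_cost m \<Omega> \<rho> \<eta>"
  proof -
    define P where "P \<sigma> = (\<Prod>j<m. linf_norm (\<Omega> j) (\<lambda>\<omega>. \<eta> j \<omega> \<sigma>))" for \<sigma>
    define P' where "P' s = (\<Prod>j<m. linf_norm (\<Omega> j) (\<lambda>\<omega>. \<eta>' j \<omega> s))" for s
    have eq: "P' (h \<sigma>) = P \<sigma>" if "\<sigma> \<in> space \<rho>" for \<sigma>
      unfolding P_def P'_def linf_norm_def \<eta>'_def using inv that
      by (intro prod.cong SUP_cong) auto
    have "(\<integral>\<^sup>+ s. P' s \<partial>N) \<le> (\<integral>\<^sup>+ \<sigma>. P \<sigma> \<partial>\<rho>)"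
      unfolding nn_integral_def[of N]
    proof (rule SUP_least)
      fix g assume "g \<in> {g. simple_function N g \<and> g \<le> P'}"
      then have g: "simple_function N g" "g \<le> P'" by auto
      have gm: "g \<in> borel_measurable N" by (rule borel_measurable_simple_function[OF g(1)])
      have "integral\<^sup>S N g = (\<integral>\<^sup>+ s. g s \<partial>N)" by (rule nn_integral_eq_simple_integral[symmetric, OF g(1)])
      also have "\<dots> = (\<integral>\<^sup>+ \<sigma>. g (h \<sigma>) \<partial>\<rho>)"
        unfolding N_def using gm setsN h
        by (intro nn_integral_distr) (auto cong: measurable_cong_sets)
      also have "\<dots> \<le> (\<integral>\<^sup>+ \<sigma>. P \<sigma> \<partial>\<rho>)"
      proof (rule nn_integral_mono)
        fix \<sigma> assume "\<sigma> \<in> space \<rho>"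
        then show "g (h \<sigma>) \<le> P \<sigma>" using g(2) eq by (metis le_funD)
      qed
      finally show "integral\<^sup>S N g \<le> (\<integral>\<^sup>+ \<sigma>. P \<sigma> \<partial>\<rho>)" .
    qed
    then show ?thesis
      by (simp add: ipd_cost_def nn_integral_completion P_def P'_def)
  qed

  moreover have "\<phi> \<omega> = (LINT s|N. (\<Prod>j<m. \<eta>' j (\<omega> j) s))" if \<omega>: "\<omega> \<in> Pi\<^sub>E {..<m} \<Omega>" for \<omega>
  proof -
    have "(\<lambda>s. \<eta>' j (\<omega> j) s) \<in> borel_measurable N" if "j < m" for j
    proof -
      have "(\<lambda>s. (\<omega> j, s)) \<in> measurable N (?B j \<Otimes>\<^sub>M N)"
        using \<omega> that by (intro measurable_Pair1') (auto simp: spB)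
      from measurable_compose[OF this meas[OF that]] show ?thesis by (simp add: \<eta>'_def)
    qed
    then have m: "(\<lambda>s. \<Prod>j<m. \<eta>' j (\<omega> j) s) \<in> borel_measurable N"
      by (intro borel_measurable_prod) auto
    have "(LINT s|N. (\<Prod>j<m. \<eta>' j (\<omega> j) s)) = (LINT \<sigma>|\<rho>. (\<Prod>j<m. \<eta>' j (\<omega> j) (h \<sigma>)))"
      unfolding N_def using m setsN h
      by (intro integral_distr) (auto cong: measurable_cong_sets)
    also have "\<dots> = (LINT \<sigma>|\<rho>. (\<Prod>j<m. \<eta> j (\<omega> j) \<sigma>))"
      using inv \<omega> by (intro Bochner_Integration.integral_cong prod.cong) (auto simp: \<eta>'_def)
    also have "\<dots> = \<phi> \<omega>" using ipd \<omega> by (simp add: is_ipd_def)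
    finally show ?thesis by simp
  qed

  moreover have "(\<lambda>\<omega>. \<eta>' j \<omega> s) \<in> linf (\<Omega> j)" if "j < m" "s \<in> space N" for j s
    using ipd i_in that by (auto simp: is_ipd_def \<eta>'_def)
  ultimately have "is_ipd m \<Omega> \<phi> N \<eta>'"
    unfolding is_ipd_def
  proof (intro conjI)
    show "\<forall>j<m. (\<lambda>(\<omega>, \<sigma>). \<eta>' j \<omega> \<sigma>) \<in> borel_measurable (?B j \<Otimes>\<^sub>M N)"
      using meas by (simp add: \<eta>'_def)
    show "ipd_cost m \<Omega> N \<eta>' < \<infinity>"
      using cost ipd unfolding is_ipd_def by (metis order.strict_trans1)
  qed simp_all
  with cost show ?thesis by blast
qed

section \<open>Noncommutative \<open>C\<^sup>k\<close> functions\<close>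

definition NC :: "nat \<Rightarrow> (real \<Rightarrow> complex) set" where
  "NC k = {f \<in> C_k k. \<exists>q :: nat \<Rightarrow> complex poly. \<forall>r>0. \<forall>j\<le>k.
     divdiff j f \<in> ipt_space (Suc j) (\<lambda>_. {-r..r}) \<and>
     (\<forall>n. divdiff j (\<lambda>t. poly (q n) (of_real t)) \<in> ipt_space (Suc j) (\<lambda>_. {-r..r})) \<and>
     (\<lambda>n. ipt_norm (Suc j) (\<lambda>_. {-r..r})
            (\<lambda>x. divdiff j (\<lambda>t. poly (q n) (of_real t)) x - divdiff j f x)) \<longlonglongrightarrow> 0}"

section \<open>Complex measures and Wiener spaces\<close>

definition complex_measure :: "(real set \<Rightarrow> complex) \<Rightarrow> bool" where
  "complex_measure \<mu> \<longleftrightarrow>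
     (\<forall>A :: nat \<Rightarrow> real set. range A \<subseteq> sets borel \<longrightarrow> disjoint_family A \<longrightarrow>
        (\<lambda>n. \<mu> (A n)) sums \<mu> (\<Union>n. A n))"

definition total_variation :: "(real set \<Rightarrow> complex) \<Rightarrow> real measure" where
  "total_variation \<mu> = measure_of UNIV (sets borel)
     (\<lambda>A. SUP E \<in> {E :: nat \<Rightarrow> real set. range E \<subseteq> sets borel \<and> disjoint_family E \<and> (\<Union>n. E n) = A}.
            \<Sum>n. ennreal (norm (\<mu> (E n))))"

text \<open>For a signed measure \<open>\<nu>\<close>, the positive part \<open>\<nu>\<^sup>+\<close> of its Jordan decomposition; note that
  \<^const>\<open>ennreal\<close> maps negative numbers to \<open>0\<close>, and that \<open>B = {}\<close> is allowed.\<close>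

definition pos_part_measure :: "(real set \<Rightarrow> real) \<Rightarrow> real measure" where
  "pos_part_measure \<nu> = measure_of UNIV (sets borel)
     (\<lambda>A. SUP B \<in> {B \<in> sets borel. B \<subseteq> A}. ennreal (\<nu> B))"

text \<open>The integral with respect to \<open>\<mu>\<close>, by the Jordan decompositions of its real and imaginary
  parts; the negative part of \<open>\<nu>\<close> is the positive part of \<open>- \<nu>\<close>.\<close>

definition cm_integral :: "(real set \<Rightarrow> complex) \<Rightarrow> (real \<Rightarrow> complex) \<Rightarrow> complex" where
  "cm_integral \<mu> g =
     (LINT x|pos_part_measure (\<lambda>A. Re (\<mu> A)). g x) - (LINT x|pos_part_measure (\<lambda>A. - Re (\<mu> A)). g x) +
     \<i> * ((LINT x|pos_part_measure (\<lambda>A. Im (\<mu> A)). g x) - (LINT x|pos_part_measure (\<lambda>A. - Im (\<mu> A)). g x))"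

definition Wiener :: "nat \<Rightarrow> (real \<Rightarrow> complex) set" where
  "Wiener k = {f. \<exists>\<mu>. complex_measure \<mu> \<and>
     (\<integral>\<^sup>+ \<xi>. ennreal (\<bar>\<xi>\<bar> ^ k) \<partial>total_variation \<mu>) < \<infinity> \<and>
     (\<forall>t. f t = cm_integral \<mu> (\<lambda>\<xi>. exp (\<i> * of_real (t * \<xi>))))}"

definition Wiener_loc :: "nat \<Rightarrow> (real \<Rightarrow> complex) set" where
  "Wiener_loc k = {f \<in> C_k k. \<forall>r>0. \<exists>g \<in> Wiener k. \<forall>x\<in>{-r..r}. g x = f x}"

section \<open>The function \<open>\<kappa>\<close>\<close>

definition kappa :: "(real \<Rightarrow> complex) \<Rightarrow> real \<Rightarrow> complex" where
  "kappa \<psi> x = indicator {0<..} x * \<psi> x * of_real (sqrt x) * exp (- (\<i> / of_real x))"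

end

theory Submission
  imports Defs
begin

text \<open>A function of class \<open>C\<^sup>k\<close> belongs to \<open>NC\<^sup>k\<close> if polynomials approximate it in the seminorms given by the
  projective tensor norms of its divided differences.

  Let \<open>f\<^sup>(\<^sup>k\<^sup>)\<close> be Hoelder continuous. Near the diagonal \<open>f\<^sup>[\<^sup>k\<^sup>]\<close> is expanded over dyadic scales: the differences of
  Taylor polynomials at the centres of cells of size \<open>2\<^sup>-\<^sup>s\<close> and \<open>2\<^sup>-\<^sup>s\<^sup>-\<^sup>1\<close> are elementary tensors summing
  geometrically by the Hoelder condition, and the indicator of a pair of neighbouring cells has bounded norm. Off the
  diagonal the order is reduced by the recursion for divided differences, whose kernel \<open>1 / (x\<^sub>0 - x\<^sub>i)\<close> has norm of
  order \<open>2\<^sup>s\<close> on cells at distance \<open>2\<^sup>-\<^sup>s\<close>. The resulting bound by the Hoelder norm reduces the claim to polynomial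
  approximation in a weaker Hoelder norm.

  If \<open>f\<close> is a Fourier transform of \<open>\<mu>\<close>, cut \<open>\<mu>\<close> into unit intervals \<open>[d, d + 1)\<close>: each piece contributes \<open>e\<^sup>i\<^sup>d\<^sup>x\<close>
  times a rapidly convergent power series, with norm \<open>O((1 + \<bar>d\<bar>)\<^sup>k \<bar>\<mu>\<bar>[d, d + 1))\<close>.

  Finally \<open>exp (i v\<^sup>2) \<kappa> (1 / v\<^sup>2) = 1 / v\<close> for \<open>v \<ge> 1\<close> has unbounded integrals over \<open>[1, V]\<close>, whereas for \<open>\<kappa>\<close> replaced by
  \<open>exp (i \<xi> x)\<close> these integrals are bounded uniformly in \<open>V\<close> and \<open>\<xi>\<close>, by van der Corput's lemma away from the
  stationary point \<open>v = \<xi>\<^sup>1\<^sup>/\<^sup>4\<close>. So \<open>\<kappa>\<close> is not, on \<open>(0, 1]\<close>, the Fourier transform of a finite measure.\<close>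

section \<open>Discrete tensor decompositions\<close>

text \<open>All norm bounds come from one kind of decomposition: countable sums of products of Borel
  functions of modulus at most 1, with the cost carried by scalar weights. Such kernels form a
  Banach algebra, so bounds are assembled from sums, products and series, and integral
  decompositions enter only in the comparison with \<open>ipt_norm\<close>. There are about 2^s
  cells of size 2^-s, and no estimate may lose a factor for each of them. Functions of two
  neighbouring cells are therefore split by the difference of the cell indices, which takes
  boundedly many values, and each such diagonal has cost 1. One reduction of the order gains 2^-s,
  which exactly offsets the norm 2^s of the Cauchy kernel. Only the factor 2^(-s \<epsilon>) is left
  to sum over the scales, so this argument breaks down for a top derivative that is merely
  continuous. Polynomials are not dense in the Hoelder norm of exponent 1/4. The estimate by the
  Hoelder norm holds for every exponent in (0, 1], and it is applied with 1/8.\<close>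

definition sep_rep :: "nat \<Rightarrow> real set \<Rightarrow> ((nat \<Rightarrow> real) \<Rightarrow> complex) \<Rightarrow>
    (nat \<Rightarrow> real) \<Rightarrow> real \<Rightarrow> (nat \<Rightarrow> nat \<Rightarrow> real \<Rightarrow> complex) \<Rightarrow> bool" where
  "sep_rep m S \<phi> w c a \<longleftrightarrow>
     (\<forall>p. 0 \<le> w p) \<and> (w has_sum c) UNIV \<and>
     (\<forall>p i. a p i \<in> borel_measurable borel \<and> (\<forall>y. norm (a p i y) \<le> 1)) \<and>
     (\<forall>x. (\<forall>i<m. x i \<in> S) \<longrightarrow> ((\<lambda>p. of_real (w p) * (\<Prod>i<m. a p i (x i))) has_sum \<phi> x) UNIV)"

text \<open>\<open>sep_rep\<close> is an IPD over the counting measure on the naturals with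
  normalised factors. These are Borel and bounded on the whole line, so passing to a smaller S costs
  nothing. An attained bound C in place of an infimum lets bounds be combined without
  epsilons.\<close>

definition sep :: "nat \<Rightarrow> real set \<Rightarrow> real \<Rightarrow> ((nat \<Rightarrow> real) \<Rightarrow> complex) \<Rightarrow> bool" where
  "sep m S C \<phi> \<longleftrightarrow> (\<exists>w c a. sep_rep m S \<phi> w c a \<and> c \<le> C)"

lemma sep_repD:
  assumes "sep_rep m S \<phi> w c a"
  shows "\<And>p. 0 \<le> w p" "(w has_sum c) UNIV" "0 \<le> c"
    "\<And>p i. a p i \<in> borel_measurable borel" "\<And>p i y. norm (a p i y) \<le> 1"
    "\<And>x. (\<And>i. i < m \<Longrightarrow> x i \<in> S) \<Longrightarrow>
      ((\<lambda>p. of_real (w p) * (\<Prod>i<m. a p i (x i))) has_sum \<phi> x) UNIV"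
  using assms has_sum_nonneg[of w UNIV c] by (auto simp: sep_rep_def)

text \<open>Any countable index type may be used: outside the range of \<open>to_nat\<close> the
  weights are padded with 0. Below, the index is \<open>unit\<close> for a single product and a pair
  for series and products.\<close>

lemma sep_countableI:
  fixes w :: "'i::countable \<Rightarrow> real" and a :: "'i \<Rightarrow> nat \<Rightarrow> real \<Rightarrow> complex"
  assumes w: "\<And>p. 0 \<le> w p" "(w has_sum c) UNIV" "c \<le> C"
    and a: "\<And>p i. a p i \<in> borel_measurable borel" "\<And>p i y. norm (a p i y) \<le> 1"
    and \<phi>: "\<And>x. (\<And>i. i < m \<Longrightarrow> x i \<in> S) \<Longrightarrow>
      ((\<lambda>p. of_real (w p) * (\<Prod>i<m. a p i (x i))) has_sum \<phi> x) UNIV"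
  shows "sep m S C \<phi>"
proof -
  let ?R = "range (to_nat :: 'i \<Rightarrow> nat)"
  define w' where "w' n = (if n \<in> ?R then w (from_nat n) else 0)" for n
  have tr: "((\<lambda>n. if n \<in> ?R then g (from_nat n) else 0) has_sum s) UNIV"
    if "(g has_sum s) UNIV" for g :: "'i \<Rightarrow> 'b::{topological_comm_monoid_add,t2_space}" and s
  proof -
    have "((\<lambda>n. g (from_nat n)) has_sum s) ?R"
      using that by (subst has_sum_reindex) (auto simp: o_def)
    then show ?thesis by (subst has_sum_cong_neutral) auto
  qed
  show ?thesis
    unfolding sep_def sep_rep_def
  proof (intro exI conjI allI impI)
    show "0 \<le> w' p" for p using w(1) by (simp add: w'_def)
    show "(w' has_sum c) UNIV" unfolding w'_def by (rule tr[OF w(2)])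
    show "a (from_nat p) i \<in> borel_measurable borel" "norm (a (from_nat p) i y) \<le> 1" for p i y
      using a by auto
    fix x :: "nat \<Rightarrow> real" assume "\<forall>i<m. x i \<in> S"
    then have "((\<lambda>p. of_real (w p) * (\<Prod>i<m. a p i (x i))) has_sum \<phi> x) UNIV" using \<phi> by simp
    from tr[OF this]
    show "((\<lambda>p. of_real (w' p) * (\<Prod>i<m. a (from_nat p) i (x i))) has_sum \<phi> x) UNIV"
      by (rule has_sum_cong[THEN iffD1, rotated]) (simp add: w'_def)
  qed (rule w(3))
qed

section \<open>The Banach algebra of separable kernels\<close>

lemma sep_mono: "sep m S C \<phi> \<Longrightarrow> C \<le> D \<Longrightarrow> T \<subseteq> S \<Longrightarrow> sep m T D \<phi>"
  unfolding sep_def sep_rep_def by (meson order_trans subset_iff)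

lemma sep_cong:
  assumes "sep m S C \<phi>" "\<And>x. (\<And>i. i < m \<Longrightarrow> x i \<in> S) \<Longrightarrow> \<phi> x = \<psi> x"
  shows "sep m S C \<psi>"
proof -
  obtain w c a where "sep_rep m S \<phi> w c a" "c \<le> C"
    using assms(1) unfolding sep_def by blast
  moreover from this(1) have "sep_rep m S \<psi> w c a"
    using assms(2) by (auto simp: sep_rep_def)
  ultimately show ?thesis unfolding sep_def by blast
qed

lemma norm_prod_le_1:
  fixes f :: "nat \<Rightarrow> complex"
  assumes "\<And>i. norm (f i) \<le> 1"
  shows "norm (\<Prod>i<m. f i) \<le> 1"
  unfolding prod_norm[symmetric] using assms by (intro prod_le_1) auto

text \<open>Each product of factors has modulus at most 1, so the tensor norm dominates the supremum
  norm. This gives boundedness in \<open>ipt_space\<close> and the M-test for series of divided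
  differences.\<close>

lemma sep_bound:
  assumes "sep m S C \<phi>" "\<And>i. i < m \<Longrightarrow> x i \<in> S"
  shows "norm (\<phi> x) \<le> C"
proof -
  obtain w c a where rep_w: "sep_rep m S \<phi> w c a" "c \<le> C"
    using assms(1) unfolding sep_def by blast
  note * = sep_repD(1,2)[OF rep_w(1)] rep_w(2) sep_repD(3-6)[OF rep_w(1)]
  have le: "norm (of_real (w p) * (\<Prod>i<m. a p i (x i))) \<le> w p" for p
    using *(1)[of p] norm_prod_le_1[of "\<lambda>i. a p i (x i)" m] *(6)
    by (simp add: norm_mult mult_left_le)
  have "norm (\<phi> x) \<le> c"
    by (rule norm_infsum_le[OF *(7)[OF assms(2)] *(2)]) (use le in auto)
  with *(3) show ?thesis by simp
qed

text \<open>Completeness of the tensor norm: the decompositions of the terms are concatenated over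
  pairs (n, p), and the double family of weights is summable because its row sums are.\<close>

lemma sep_sums:
  assumes \<phi>: "\<And>n::nat. sep m S (C n) (\<phi> n)" and C: "C sums D"
    and \<psi>: "\<And>x. (\<And>i. i < m \<Longrightarrow> x i \<in> S) \<Longrightarrow> (\<lambda>n. \<phi> n x) sums \<psi> x"
  shows "sep m S D \<psi>"
proof -
  obtain w c a where rep: "\<And>n. sep_rep m S (\<phi> n) (w n) (c n) (a n)" and cC: "\<And>n. c n \<le> C n"
    using \<phi> unfolding sep_def by metis
  note w = sep_repD(1,2)[OF rep] cC sep_repD(3)[OF rep] and a = sep_repD(4,5)[OF rep]
    and s = sep_repD(6)[OF rep]
  have csm: "summable c"
    by (rule summable_comparison_test[OF _ sums_summable[OF C]]) (use w in auto)
  have cs: "(c has_sum suminf c) UNIV"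
    using csm w(4) by (intro sums_nonneg_imp_has_sum summable_sums)
  have sm: "(\<lambda>(n, p). w n p) summable_on UNIV \<times> UNIV"
    by (rule summable_on_SigmaI[where g = c]) (use w cs in \<open>auto simp: summable_on_def\<close>)
  show ?thesis
  proof (rule sep_countableI[where w = "\<lambda>(n, p). w n p" and a = "\<lambda>(n, p). a n p"])
    show "0 \<le> (case p of (n, p) \<Rightarrow> w n p)" for p using w(1) by (cases p) simp
    show "((\<lambda>(n, p). w n p) has_sum suminf c) UNIV"
      using has_sum_SigmaI[of UNIV "\<lambda>(n, p). w n p" "\<lambda>_. UNIV" c] w(2) cs sm by simp
    show "suminf c \<le> D"
      using suminf_le[OF w(3) csm sums_summable[OF C]] sums_unique[OF C] by simp
    show "(case p of (n, p) \<Rightarrow> a n p) i \<in> borel_measurable borel"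
      "norm ((case p of (n, p) \<Rightarrow> a n p) i y) \<le> 1" for p i y
      using a by (auto split: prod.split)
    fix x assume x: "\<And>i. i < m \<Longrightarrow> x i \<in> S"
    let ?f = "\<lambda>(n, p). of_real (w n p) * (\<Prod>i<m. a n p i (x i))"
    have le: "norm (?f q) \<le> (case q of (n, p) \<Rightarrow> w n p)" for q
      using w(1) norm_prod_le_1[of "\<lambda>i. a (fst q) (snd q) i (x i)" m] a(2)
      by (cases q) (simp add: norm_mult mult_left_le)
    have fs: "?f summable_on UNIV \<times> UNIV"
      unfolding summable_on_iff_abs_summable_on_complex
      by (rule Infinite_Sum.abs_summable_on_comparison_test'[OF sm le])
    then obtain s' where s': "(?f has_sum s') (UNIV \<times> UNIV)" by (auto simp: summable_on_def)
    have "((\<lambda>n. \<phi> n x) has_sum s') UNIV"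
      by (rule has_sum_SigmaD[OF s']) (use s[OF x] in auto)
    from sums_unique2[OF has_sum_imp_sums[OF this] \<psi>[OF x]] have "s' = \<psi> x" .
    with s' show "((\<lambda>p. of_real (case p of (n, p) \<Rightarrow> w n p) *
        (\<Prod>i<m. (case p of (n, p) \<Rightarrow> a n p) i (x i))) has_sum \<psi> x) UNIV"
      by (simp add: case_prod_unfold)
  qed
qed

text \<open>Multiplying the factors coordinate by coordinate, with products of weights over pairs of
  indices, makes the norm submultiplicative.\<close>

lemma sep_mult:
  assumes "sep m S C \<phi>" "sep m S D \<psi>"
  shows "sep m S (C * D) (\<lambda>x. \<phi> x * \<psi> x)"
proof -
  obtain w c a where rep_w: "sep_rep m S \<phi> w c a" "c \<le> C"
    using assms(1) unfolding sep_def by blast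
  note w = sep_repD(1,2)[OF rep_w(1)] rep_w(2) sep_repD(3)[OF rep_w(1)]
    and a = sep_repD(4,5)[OF rep_w(1)] and s = sep_repD(6)[OF rep_w(1)]
  obtain v d b where rep_v: "sep_rep m S \<psi> v d b" "d \<le> D"
    using assms(2) unfolding sep_def by blast
  note v = sep_repD(1,2)[OF rep_v(1)] rep_v(2) sep_repD(3)[OF rep_v(1)]
    and b = sep_repD(4,5)[OF rep_v(1)] and t = sep_repD(6)[OF rep_v(1)]
  have sm: "(\<lambda>(p, q). w p * v q) summable_on UNIV \<times> UNIV"
  proof (rule summable_on_SigmaI[where g = "\<lambda>p. w p * d"])
    show "(\<lambda>p. w p * d) summable_on UNIV"
      using w(2) by (intro summable_on_cmult_left) (auto simp: summable_on_def)
  qed (use w v in \<open>auto intro!: has_sum_cmult_right\<close>)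
  have ws: "((\<lambda>(p, q). w p * v q) has_sum c * d) UNIV"
    using has_sum_SigmaI[of UNIV "\<lambda>(p, q). w p * v q" "\<lambda>_. UNIV" "\<lambda>p. w p * d" "c * d"] sm w v
    by (auto intro!: has_sum_cmult_right has_sum_cmult_left)
  show ?thesis
  proof (rule sep_countableI[where w = "\<lambda>(p, q). w p * v q" and
        a = "\<lambda>(p, q) i y. a p i y * b q i y", OF _ ws])
    show "0 \<le> (case p of (p, q) \<Rightarrow> w p * v q)" for p using w(1) v(1) by (cases p) simp
    show "c * d \<le> C * D" using w v by (intro mult_mono) auto
    show "(case p of (p, q) \<Rightarrow> \<lambda>i y. a p i y * b q i y) i \<in> borel_measurable borel" for p i
      using a b by (auto split: prod.split)
    show "norm ((case p of (p, q) \<Rightarrow> \<lambda>i y. a p i y * b q i y) i y) \<le> 1" for p i y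
      using a b by (auto split: prod.split simp: norm_mult intro!: mult_le_one)
    fix x assume x: "\<And>i. i < m \<Longrightarrow> x i \<in> S"
    let ?f = "\<lambda>p. of_real (w p) * (\<Prod>i<m. a p i (x i))"
    let ?g = "\<lambda>q. of_real (v q) * (\<Prod>i<m. b q i (x i))"
    have le: "norm ((\<lambda>(p, q). ?f p * ?g q) r) \<le> (case r of (p, q) \<Rightarrow> w p * v q)" for r
    proof -
      have "norm (?f p) \<le> w p" "norm (?g p) \<le> v p" for p
        using w(1) norm_prod_le_1[of "\<lambda>i. a p i (x i)" m] a(2)
          v(1) norm_prod_le_1[of "\<lambda>i. b p i (x i)" m] b(2)
        by (simp_all add: norm_mult mult_left_le)
      then show ?thesis
        using w(1) v(1) by (auto simp: norm_mult split: prod.split intro!: mult_mono)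
    qed
    have fs: "(\<lambda>(p, q). ?f p * ?g q) summable_on UNIV \<times> UNIV"
      unfolding summable_on_iff_abs_summable_on_complex
      by (rule Infinite_Sum.abs_summable_on_comparison_test'[OF sm le])
    have "((\<lambda>(p, q). ?f p * ?g q) has_sum \<phi> x * \<psi> x) (UNIV \<times> UNIV)"
      by (rule has_sum_SigmaI[where g = "\<lambda>p. ?f p * \<psi> x"])
        (use s[OF x] t[OF x] fs in \<open>auto intro!: has_sum_cmult_right has_sum_cmult_left\<close>)
    then show "((\<lambda>p. of_real (case p of (p, q) \<Rightarrow> w p * v q) *
        (\<Prod>i<m. (case p of (p, q) \<Rightarrow> \<lambda>i y. a p i y * b q i y) i (x i))) has_sum \<phi> x * \<psi> x) UNIV"
      by (simp add: case_prod_unfold prod.distrib mult_ac)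
  qed
qed

lemma sep_var:
  assumes g: "g \<in> borel_measurable borel" and S: "S \<in> sets borel" and i: "i < m"
    and B: "\<And>y. y \<in> S \<Longrightarrow> norm (g y) \<le> B" "0 \<le> B"
  shows "sep m S B (\<lambda>x. g (x i))"
proof -
  \<comment> \<open>The bound holds on S only, hence the value 0 elsewhere. For B = 0 no division is
    possible; then g vanishes on S, and h = 0 serves with weight 0.\<close>
  define h where "h y = (if y \<in> S \<and> B \<noteq> 0 then g y / of_real B else 0)" for y
  have hm: "h \<in> borel_measurable borel"
    unfolding h_def using g S by measurable
  have hn: "norm (h y) \<le> 1" for y
    using B by (auto simp: h_def norm_divide divide_simps)
  have hg: "of_real B * h y = g y" if "y \<in> S" for y
    using that B(1)[OF that] by (auto simp: h_def)
  show ?thesis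
  proof (rule sep_countableI[where w = "\<lambda>p::unit. B" and a = "\<lambda>_ l. if l = i then h else (\<lambda>_. 1)" and c = B])
    show "((\<lambda>p::unit. B) has_sum B) UNIV" by (simp add: has_sum_finite_iff)
    fix x assume x: "\<And>i. i < m \<Longrightarrow> x i \<in> S"
    have "(\<Prod>l<m. (if l = i then h else (\<lambda>_. 1)) (x l)) = (\<Prod>l<m. if l = i then h (x l) else 1)"
      by (intro prod.cong) auto
    also have "\<dots> = h (x i)" using i by simp
    finally show "((\<lambda>p::unit. of_real B * (\<Prod>l<m. (if l = i then h else (\<lambda>_. 1)) (x l))) has_sum g (x i)) UNIV"
      using hg[OF x[OF i]] by (simp add: has_sum_finite_iff)
  qed (use B hm hn in auto)
qed

lemma sep_const:
  assumes "S \<in> sets borel" "0 < m" "norm c \<le> B"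
  shows "sep m S B (\<lambda>x. c)"
proof -
  have "sep m S B (\<lambda>x. (\<lambda>_. c) (x 0))"
    using assms by (intro sep_var) (auto intro: order_trans[OF norm_ge_zero])
  then show ?thesis by simp
qed

lemma sep_zero: "0 \<le> C \<Longrightarrow> sep m S C (\<lambda>x. 0)"
  by (rule sep_countableI[where w = "\<lambda>_::unit. 0" and c = 0 and a = "\<lambda>_ _ _. 0"]) (auto simp: has_sum_finite_iff)

lemma sep_add:
  assumes "sep m S C \<phi>" "sep m S D \<psi>"
  shows "sep m S (C + D) (\<lambda>x. \<phi> x + \<psi> x)"
proof (rule sep_sums[where \<phi> = "\<lambda>n. if n = 0 then \<phi> else if n = 1 then \<psi> else (\<lambda>_. 0)"
      and C = "\<lambda>n. if n = 0 then C else if n = 1 then D else 0"])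
  show "sep m S (if n = 0 then C else if n = 1 then D else 0)
      (if n = 0 then \<phi> else if n = 1 then \<psi> else (\<lambda>_. 0))" for n :: nat
    using assms sep_zero by auto
  show "(\<lambda>n::nat. if n = 0 then C else if n = 1 then D else 0) sums (C + D)"
    using sums_finite[of "{0, 1::nat}" "\<lambda>n::nat. if n = 0 then C else if n = 1 then D else 0"] by auto
  show "(\<lambda>n::nat. (if n = 0 then \<phi> else if n = 1 then \<psi> else (\<lambda>_. 0)) x) sums (\<phi> x + \<psi> x)" for x
    using sums_finite[of "{0, 1::nat}"
        "\<lambda>n::nat. (if n = 0 then \<phi> else if n = 1 then \<psi> else (\<lambda>_. 0)) x"] by auto
qed

lemma sep_sum:
  assumes "finite A" "\<And>a. a \<in> A \<Longrightarrow> sep m S (C a) (\<phi> a)"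
  shows "sep m S (\<Sum>a\<in>A. C a) (\<lambda>x. \<Sum>a\<in>A. \<phi> a x)"
  using assms by (induction A rule: finite_induct) (auto intro: sep_zero sep_add)

lemma sep_cmult:
  assumes "sep m S C \<phi>" "S \<in> sets borel" "0 < m" "norm c * C \<le> D"
  shows "sep m S D (\<lambda>x. c * \<phi> x)"
  using sep_mono[OF sep_mult[OF sep_const[OF assms(2,3) order_refl] assms(1)]] assms(4) by blast

lemma sep_diff:
  assumes "sep m S C \<phi>" "sep m S D \<psi>" "S \<in> sets borel" "0 < m"
  shows "sep m S (C + D) (\<lambda>x. \<phi> x - \<psi> x)"
  using sep_add[OF assms(1) sep_cmult[where c = "-1", OF assms(2,3,4)]] by simp

lemma sep_prod:
  assumes "finite A" "\<And>a. a \<in> A \<Longrightarrow> sep m S (C a) (\<phi> a)" "S \<in> sets borel" "0 < m"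
  shows "sep m S (\<Prod>a\<in>A. C a) (\<lambda>x. \<Prod>a\<in>A. \<phi> a x)"
  using assms(1,2) by (induction A rule: finite_induct) (auto intro: sep_const[OF assms(3,4)] sep_mult)

lemma sep_power:
  assumes "sep m S C \<phi>" "S \<in> sets borel" "0 < m"
  shows "sep m S (C ^ n) (\<lambda>x. \<phi> x ^ n)"
  by (induction n) (auto intro: sep_const[OF assms(2,3)] sep_mult assms(1))

text \<open>Factors that land on the same coordinate are multiplied together, so \<pi> may identify
  coordinates as well as insert dummy ones; a coordinate outside the range of \<pi> gets the empty
  product 1.\<close>

lemma sep_reindex:
  assumes "sep m' S C \<phi>" and \<pi>: "\<And>i. i < m' \<Longrightarrow> \<pi> i < m"
  shows "sep m S C (\<lambda>x. \<phi> (\<lambda>i. x (\<pi> i)))"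
proof -
  obtain w c a where rep_w: "sep_rep m' S \<phi> w c a" "c \<le> C"
    using assms(1) unfolding sep_def by blast
  note w = sep_repD(1,2)[OF rep_w(1)] rep_w(2) sep_repD(3)[OF rep_w(1)]
    and a = sep_repD(4,5)[OF rep_w(1)] and s = sep_repD(6)[OF rep_w(1)]
  show ?thesis
  proof (rule sep_countableI[where w = w and c = c and a = "\<lambda>p l y. \<Prod>i\<in>{i\<in>{..<m'}. \<pi> i = l}. a p i y"])
    show "(\<lambda>y. \<Prod>i\<in>{i\<in>{..<m'}. \<pi> i = l}. a p i y) \<in> borel_measurable borel" for p l
      using a by (intro borel_measurable_prod) auto
    show "norm (\<Prod>i\<in>{i\<in>{..<m'}. \<pi> i = l}. a p i y) \<le> 1" for p l y
      unfolding prod_norm[symmetric] using a by (intro prod_le_1) auto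
    fix x assume x: "\<And>i. i < m \<Longrightarrow> x i \<in> S"
    have "(\<Prod>l<m. \<Prod>i\<in>{i\<in>{..<m'}. \<pi> i = l}. a p i (x l)) = (\<Prod>i<m'. a p i (x (\<pi> i)))" for p
    proof -
      have "(\<Prod>l<m. \<Prod>i\<in>{i\<in>{..<m'}. \<pi> i = l}. a p i (x l)) =
          (\<Prod>l<m. \<Prod>i\<in>{i\<in>{..<m'}. \<pi> i = l}. a p i (x (\<pi> i)))"
        by (intro prod.cong) auto
      also have "\<dots> = (\<Prod>i<m'. a p i (x (\<pi> i)))"
        by (rule prod.group) (use \<pi> in auto)
      finally show ?thesis .
    qed
    then show "((\<lambda>p. of_real (w p) * (\<Prod>l<m. \<Prod>i\<in>{i\<in>{..<m'}. \<pi> i = l}. a p i (x l)))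
        has_sum \<phi> (\<lambda>i. x (\<pi> i))) UNIV"
      using s[of "\<lambda>i. x (\<pi> i)"] x \<pi> by simp
  qed (use w in auto)
qed

text \<open>The indicator of a diagonal is a mean of characters of a finite cyclic group.\<close>

lemma sum_roots_of_unity_indicator:
  fixes d :: int and K :: nat
  assumes "\<bar>d\<bar> < int K"
  shows "(\<Sum>s<K. exp (2 * pi * \<i> * of_int d / of_nat K) ^ s) = (if d = 0 then of_nat K else 0)"
proof (cases "d = 0")
  case False
  have K: "K > 0" using assms by auto
  let ?z = "exp (2 * pi * \<i> * of_int d / of_nat K) :: complex"
  have ne: "?z \<noteq> 1"
  proof
    assume "?z = 1"
    then obtain n where "Im (2 * pi * \<i> * of_int d / of_nat K) = of_int (2 * n) * pi"
      unfolding exp_eq_1 by blast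
    then have "2 * pi * of_int d = of_int (2 * n) * pi * of_nat K"
      using K by (simp add: field_simps)
    then have "pi * (2 * real_of_int d) = pi * (2 * (real_of_int n * real K))" by (simp add: algebra_simps)
    then have "2 * real_of_int d = 2 * (real_of_int n * real K)"
      by (simp only: mult_cancel_left pi_neq_zero simp_thms)
    then have "real_of_int d = real_of_int (n * int K)" by simp
    then have "d = n * int K" by (simp only: of_int_eq_iff)
    moreover from this False have "n \<noteq> 0" by auto
    ultimately have "\<bar>d\<bar> \<ge> int K"
      using mult_right_mono[of 1 "\<bar>n\<bar>" "int K"] by (simp add: abs_mult)
    with assms show False by simp
  qed
  have "?z ^ K = exp (2 * pi * \<i> * of_int d)"
    unfolding exp_of_nat_mult[symmetric] using K by (simp add: field_simps)
  also have "\<dots> = 1" unfolding exp_eq_1 by (intro conjI exI[of _ d]) auto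
  finally show ?thesis using False ne by (simp add: geometric_sum)
qed auto

text \<open>Each of the K characters splits into a function of x i and one of x j, both unimodular,
  and has weight 1 / K. The cost is thus 1 however many values M takes on S, whereas a sum over
  pairs of level sets would cost their number.\<close>

lemma sep_diagonal:
  fixes M :: "real \<Rightarrow> int"
  assumes M: "M \<in> measurable borel (count_space UNIV)" and S: "S \<in> sets borel"
    and i: "i < m" "j < m" and bd: "\<And>y. y \<in> S \<Longrightarrow> \<bar>M y\<bar> \<le> int L"
  shows "sep m S 1 (\<lambda>x. if M (x i) - M (x j) = n then 1 else 0)"
proof -
  \<comment> \<open>The modulus of M (x i) - M (x j) - n is at most 2 L + |n| < K, so among these
    values only 0 is a multiple of K.\<close>
  define K where "K = 2 * L + nat \<bar>n\<bar> + 1"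
  have K: "K > 0" by (simp add: K_def)
  let ?z = "\<lambda>d. exp (2 * pi * \<i> * of_int d / of_nat K) :: complex"
  let ?h = "\<lambda>s x. ?z (M (x i)) ^ s * ?z (- M (x j)) ^ s * ?z (- n) ^ s"
  have nz: "norm (?z d) = 1" for d
    using norm_exp_i_times[of "2 * pi * of_int d / of_nat K"] by (simp add: mult_ac)
  have "sep m S (\<Sum>s<K. 1 / K) (\<lambda>x. \<Sum>s<K. (1 / K) * ?h s x)"
  proof (rule sep_sum)
    fix s
    have 1: "sep m S 1 (\<lambda>x. ?z (M (x i)) ^ s)"
      by (rule sep_var[OF _ S i(1)]) (use M nz in \<open>auto simp: norm_power\<close>)
    have 2: "sep m S 1 (\<lambda>x. ?z (- M (x j)) ^ s)"
      by (rule sep_var[OF _ S i(2)]) (use M nz in \<open>auto simp: norm_power\<close>)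
    have 3: "sep m S 1 (\<lambda>x. ?z (- n) ^ s)"
      by (rule sep_const[OF S]) (use i nz[of "- n"] in \<open>auto simp: norm_power\<close>)
    show "sep m S (1 / K) (\<lambda>x. (1 / K) * ?h s x)"
      by (rule sep_cmult[OF sep_mult[OF sep_mult[OF 1 2] 3] S]) (use i in \<open>auto simp: norm_divide\<close>)
  qed simp
  then have "sep m S 1 (\<lambda>x. \<Sum>s<K. (1 / K) * ?h s x)" using K by simp
  then show ?thesis
  proof (rule sep_cong)
    fix x assume x: "\<And>i. i < m \<Longrightarrow> x i \<in> S"
    let ?d = "M (x i) - M (x j) - n"
    have "?h s x = ?z ?d ^ s" for s
      unfolding power_mult_distrib[symmetric] exp_add[symmetric]
      by (simp add: field_simps add_divide_distrib diff_divide_distrib)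
    then have "(\<Sum>s<K. (1 / K) * ?h s x) = (1 / K) * (\<Sum>s<K. ?z ?d ^ s)"
      by (simp add: sum_distrib_left)
    also have "\<dots> = (if ?d = 0 then 1 else 0)"
    proof -
      have "\<bar>?d\<bar> < int K"
        using bd[OF x[OF i(1)]] bd[OF x[OF i(2)]] unfolding K_def by linarith
      from sum_roots_of_unity_indicator[OF this] show ?thesis using K by simp
    qed
    finally show "(\<Sum>s<K. (1 / K) * ?h s x) = (if M (x i) - M (x j) = n then 1 else 0)" by simp
  qed
qed

section \<open>Comparison with the integral projective norm\<close>

lemma prod_mono_lessThan_ennreal:
  fixes f g :: "nat \<Rightarrow> ennreal"
  assumes "\<And>i. f i \<le> g i"
  shows "prod f {..<n} \<le> prod g {..<n}"
  by (induction n) (use assms in \<open>auto intro: mult_mono\<close>)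

lemma sep_imp_ipt_norm:
  assumes sep: "sep (Suc j) S C \<phi>"
  shows "ipt_norm (Suc j) (\<lambda>_. S) \<phi> \<le> ennreal C"
proof -
  obtain w c a where rep_w: "sep_rep (Suc j) S \<phi> w c a" "c \<le> C"
    using sep unfolding sep_def by blast
  note w = sep_repD(1,2)[OF rep_w(1)] rep_w(2) sep_repD(3)[OF rep_w(1)]
    and a = sep_repD(4,5)[OF rep_w(1)] and s = sep_repD(6)[OF rep_w(1)]
  \<comment> \<open>The weight is absorbed into the factor of coordinate 0, which exists because
    there are Suc j >= 1 factors.\<close>
  define \<eta> where "\<eta> i y p = (if i = 0 then of_real (w p) else 1) * a p i y" for i y p
  have prod: "(\<Prod>i<Suc j. \<eta> i (x i) p) = of_real (w p) * (\<Prod>i<Suc j. a p i (x i))" for x p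
    unfolding \<eta>_def prod.distrib by (simp add: prod.lessThan_Suc_shift del: prod.lessThan_Suc)
  have cost: "ipd_cost (Suc j) (\<lambda>_. S) (count_space UNIV) \<eta> \<le> ennreal C"
  proof -
    have "ipd_cost (Suc j) (\<lambda>_. S) (count_space UNIV) \<eta> =
        (\<integral>\<^sup>+ p. (\<Prod>i<Suc j. linf_norm S (\<lambda>y. \<eta> i y p)) \<partial>count_space UNIV)"
      by (simp add: ipd_cost_def nn_integral_completion)
    also have "\<dots> \<le> (\<integral>\<^sup>+ p. ennreal (w p) \<partial>count_space UNIV)"
    proof (rule nn_integral_mono)
      fix p
      have "(\<Prod>i<Suc j. linf_norm S (\<lambda>y. \<eta> i y p)) \<le> (\<Prod>i<Suc j. if i = 0 then ennreal (w p) else 1)"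
      proof (rule prod_mono_lessThan_ennreal)
        fix i
        show "linf_norm S (\<lambda>y. \<eta> i y p) \<le> (if i = 0 then ennreal (w p) else 1)"
          unfolding linf_norm_def \<eta>_def using w(1)[of p] a(2)[of p i]
          by (auto intro!: SUP_least ennreal_leI simp: norm_mult mult_left_le)
      qed
      also have "\<dots> = ennreal (w p)" by (simp add: prod.lessThan_Suc_shift del: prod.lessThan_Suc)
      finally show "(\<Prod>i<Suc j. linf_norm S (\<lambda>y. \<eta> i y p)) \<le> ennreal (w p)" .
    qed
    also have "\<dots> = (\<Sum>p. ennreal (w p))" by (rule nn_integral_count_space_nat)
    also have "\<dots> = ennreal c"
      using has_sum_imp_sums[OF w(2)] w(1) by (simp add: suminf_ennreal2 sums_iff)
    also have "\<dots> \<le> ennreal C" using w by (intro ennreal_leI)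
    finally show ?thesis .
  qed
  have "is_ipd (Suc j) (\<lambda>_. S) \<phi> (count_space (UNIV :: nat set)) \<eta>"
    unfolding is_ipd_def
  proof (intro conjI allI impI ballI)
    show "sigma_finite_measure (count_space (UNIV :: nat set))"
      by (rule sigma_finite_measure_count_space)
    have \<eta>: "(\<lambda>y. \<eta> i y p) \<in> borel_measurable (restrict_space borel S)" for i p
      unfolding \<eta>_def using a by (intro borel_measurable_times measurable_restrict_space1) auto
    show "(\<lambda>(\<omega>, \<sigma>). \<eta> i \<omega> \<sigma>) \<in> borel_measurable (restrict_space borel S \<Otimes>\<^sub>M count_space UNIV)" for i
    proof -
      have "(\<lambda>z. (\<lambda>p y. \<eta> i y p) (snd z) (fst z)) \<in>
          borel_measurable (restrict_space borel S \<Otimes>\<^sub>M count_space UNIV)"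
        by (rule measurable_compose_countable'[where I = UNIV and g = snd])
          (use \<eta> in \<open>auto intro!: measurable_compose[OF measurable_fst]\<close>)
      then show ?thesis by (simp add: case_prod_unfold)
    qed
    show "(\<lambda>\<omega>. \<eta> i \<omega> \<sigma>) \<in> linf S" for i \<sigma>
    proof -
      have "norm (\<eta> i y \<sigma>) \<le> max 1 (w \<sigma>)" for y
        using a(2)[of \<sigma> i y] w(1)[of \<sigma>] by (auto simp: \<eta>_def norm_mult mult_left_le le_max_iff_disj)
      then show ?thesis using \<eta> by (auto simp: linf_def bounded_iff intro!: exI[of _ "max 1 (w \<sigma>)"])
    qed
    show "ipd_cost (Suc j) (\<lambda>_. S) (count_space UNIV) \<eta> < \<infinity>"
      using cost by (auto simp: order.strict_iff_order top_unique)
    fix x assume "x \<in> {..<Suc j} \<rightarrow>\<^sub>E S"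
    then have "\<And>i. i < Suc j \<Longrightarrow> x i \<in> S" by auto
    note hs = s[OF this]
    have "integrable (count_space UNIV) (\<lambda>p. of_real (w p) * (\<Prod>i<Suc j. a p i (x i)))"
      unfolding integrable_count_space_nat_iff
      using has_sum_imp_summable[OF hs]
      by (simp only: summable_on_iff_abs_summable_on_complex summable_on_imp_summable)
    from sums_integral_count_space_nat[OF this] has_sum_imp_sums[OF hs]
    show "\<phi> x = (LINT p|count_space UNIV. (\<Prod>i<Suc j. \<eta> i (x i) p))"
      unfolding prod by (rule sums_unique2[symmetric])
  qed
  \<comment> \<open>\<open>ipt_norm\<close> ranges over measures on real sequences, while this
    decomposition lives on the naturals; the transfer does not raise the cost.\<close>
  from is_ipd_to_sequences[OF this] obtain \<rho>' :: "(nat \<Rightarrow> real) measure" and \<eta>' where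
    "is_ipd (Suc j) (\<lambda>_. S) \<phi> \<rho>' \<eta>'"
    "ipd_cost (Suc j) (\<lambda>_. S) \<rho>' \<eta>' \<le> ipd_cost (Suc j) (\<lambda>_. S) (count_space UNIV) \<eta>" by blast
  then have "ipt_norm (Suc j) (\<lambda>_. S) \<phi> \<le> ipd_cost (Suc j) (\<lambda>_. S) (count_space UNIV) \<eta>"
    unfolding ipt_norm_def by (intro Inf_lower2[of "ipd_cost (Suc j) (\<lambda>_. S) \<rho>' \<eta>'"]) blast
  with cost show ?thesis by simp
qed

section \<open>Divided differences\<close>

abbreviation vderiv :: "(real \<Rightarrow> complex) \<Rightarrow> real \<Rightarrow> complex" where
  "vderiv f \<equiv> \<lambda>y. vector_derivative f (at y)"

lemma nth_deriv_0 [simp]: "nth_deriv 0 f = f"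
  by (simp add: nth_deriv_def)

lemma nth_deriv_Suc: "nth_deriv (Suc k) f = nth_deriv k (vderiv f)"
  unfolding nth_deriv_def by (subst funpow_Suc_right) simp

lemma nth_deriv_Suc': "nth_deriv (Suc k) f = vderiv (nth_deriv k f)"
  unfolding nth_deriv_def by simp

lemma C_k_0: "f \<in> C_k 0 \<longleftrightarrow> continuous_on UNIV f"
  by (simp add: C_k_def)

lemma C_k_Suc: "f \<in> C_k (Suc k) \<longleftrightarrow> (\<forall>x. f differentiable (at x)) \<and> vderiv f \<in> C_k k"
  unfolding C_k_def by (auto simp: All_less_Suc2 nth_deriv_Suc)

lemma C_k_SucD: "f \<in> C_k (Suc k) \<Longrightarrow> (f has_vector_derivative vderiv f x) (at x)"
  by (simp add: C_k_Suc vector_derivative_works)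

lemma C_k_SucI:
  assumes "\<And>x. (f has_vector_derivative f' x) (at x)" "f' \<in> C_k k"
  shows "f \<in> C_k (Suc k)" "vderiv f = f'"
proof -
  show eq: "vderiv f = f'" using vector_derivative_at[OF assms(1)] by auto
  show "f \<in> C_k (Suc k)" unfolding C_k_Suc eq using assms differentiableI_vector by blast
qed

lemma C_k_Suc_lower: "f \<in> C_k (Suc k) \<Longrightarrow> f \<in> C_k k"
proof (induction k arbitrary: f)
  case 0
  then have "\<forall>x. isCont f x" using C_k_SucD has_vector_derivative_continuous by blast
  then show ?case by (simp add: C_k_0 continuous_at_imp_continuous_on)
qed (use C_k_Suc in blast)

lemma C_k_mono: "f \<in> C_k k \<Longrightarrow> j \<le> k \<Longrightarrow> f \<in> C_k j"
  by (induction k) (auto simp: le_Suc_eq intro: C_k_Suc_lower)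

lemma C_k_continuous: "f \<in> C_k k \<Longrightarrow> continuous_on UNIV f"
  using C_k_mono[of f k 0] by (simp add: C_k_0)

lemma C_k_add: "f \<in> C_k k \<Longrightarrow> g \<in> C_k k \<Longrightarrow> (\<lambda>y. f y + g y) \<in> C_k k"
proof (induction k arbitrary: f g)
  case 0
  then show ?case by (auto simp: C_k_0 intro: continuous_intros)
next
  case (Suc k)
  show ?case
    by (rule C_k_SucI(1)[where f' = "\<lambda>y. vderiv f y + vderiv g y"])
      (use Suc C_k_SucD in \<open>auto intro!: has_vector_derivative_add simp: C_k_Suc\<close>)
qed

lemma C_k_mult: "f \<in> C_k k \<Longrightarrow> g \<in> C_k k \<Longrightarrow> (\<lambda>y. f y * g y) \<in> C_k k"
proof (induction k arbitrary: f g)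
  case 0
  then show ?case by (auto simp: C_k_0 intro: continuous_intros)
next
  case (Suc k)
  show ?case
  proof (rule C_k_SucI(1))
    show "((\<lambda>y. f y * g y) has_vector_derivative f x * vderiv g x + vderiv f x * g x) (at x)" for x
      using Suc.prems by (intro has_vector_derivative_mult C_k_SucD)
    show "(\<lambda>y. f y * vderiv g y + vderiv f y * g y) \<in> C_k k"
      using Suc.prems by (intro C_k_add Suc.IH) (auto simp: C_k_Suc intro: C_k_Suc_lower)
  qed
qed

lemma C_k_const: "(\<lambda>y. c) \<in> C_k k"
proof (induction k arbitrary: c)
  case (Suc k)
  show ?case by (rule C_k_SucI(1)[OF has_vector_derivative_const Suc])
qed (simp add: C_k_0)

lemma C_k_cmult: "f \<in> C_k k \<Longrightarrow> (\<lambda>y. c * f y) \<in> C_k k"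
  by (intro C_k_mult C_k_const)

lemma C_k_diff: "f \<in> C_k k \<Longrightarrow> g \<in> C_k k \<Longrightarrow> (\<lambda>y. f y - g y) \<in> C_k k"
  using C_k_add[of f k "\<lambda>y. - 1 * g y"] C_k_cmult[of g k "- 1"] by simp

lemma C_k_sum: "(\<And>i. i \<in> A \<Longrightarrow> f i \<in> C_k k) \<Longrightarrow> (\<lambda>y. \<Sum>i\<in>A. f i y) \<in> C_k k"
  by (induction A rule: infinite_finite_induct) (auto intro: C_k_const C_k_add)

lemma C_k_of_real: "(\<lambda>y. of_real y - c) \<in> C_k k"
proof (cases k)
  case (Suc k')
  have "((\<lambda>y. of_real y - c :: complex) has_vector_derivative 1 - 0) (at x)" for x :: real
    using has_vector_derivative_of_real[OF DERIV_ident]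
    by (intro has_vector_derivative_diff) (auto intro!: derivative_eq_intros)
  then show ?thesis unfolding Suc by (rule C_k_SucI(1)[OF _ C_k_const])
qed (auto simp: C_k_0 intro!: continuous_intros)

lemma C_k_power: "f \<in> C_k k \<Longrightarrow> (\<lambda>y. f y ^ l) \<in> C_k k"
  by (induction l) (auto intro: C_k_const C_k_mult)

subsection \<open>Distinct points\<close>

text \<open>The Lagrange formula for the divided difference at distinct nodes. Indexing by a set of
  nodes builds in the symmetry that the recursion of \<open>divdiff_rec\<close> hides.\<close>

definition LG :: "nat set \<Rightarrow> (real \<Rightarrow> complex) \<Rightarrow> (nat \<Rightarrow> real) \<Rightarrow> complex" where
  "LG A f x = (\<Sum>i\<in>A. f (x i) / (\<Prod>l\<in>A - {i}. of_real (x i - x l)))"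

lemma LG_reindex:
  assumes "inj_on \<pi> A"
  shows "LG (\<pi> ` A) f x = LG A f (\<lambda>i. x (\<pi> i))"
proof -
  have "LG (\<pi> ` A) f x = (\<Sum>i\<in>A. f (x (\<pi> i)) / (\<Prod>l\<in>\<pi> ` A - {\<pi> i}. of_real (x (\<pi> i) - x l)))"
    unfolding LG_def by (simp add: sum.reindex[OF assms] o_def)
  also have "\<dots> = LG A f (\<lambda>i. x (\<pi> i))"
    unfolding LG_def
  proof (intro sum.cong refl)
    fix i assume i: "i \<in> A"
    have "\<pi> ` A - {\<pi> i} = \<pi> ` (A - {i})" using assms i by (auto simp: inj_on_def)
    then have "(\<Prod>l\<in>\<pi> ` A - {\<pi> i}. of_real (x (\<pi> i) - x l)) =
        (\<Prod>l\<in>A - {i}. (of_real (x (\<pi> i) - x (\<pi> l)) :: complex))"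
      using prod.reindex[of \<pi> "A - {i}" "\<lambda>l. (of_real (x (\<pi> i) - x l) :: complex)"]
        inj_on_subset[OF assms, of "A - {i}"] by (auto simp: o_def)
    then show "f (x (\<pi> i)) / (\<Prod>l\<in>\<pi> ` A - {\<pi> i}. of_real (x (\<pi> i) - x l)) =
        f (x (\<pi> i)) / (\<Prod>l\<in>A - {i}. of_real (x (\<pi> i) - x (\<pi> l)))" by simp
  qed
  finally show ?thesis .
qed

lemma LG_remove:
  assumes "finite A" "inj_on x A" "b \<in> A"
  shows "LG (A - {b}) f x = (\<Sum>i\<in>A. f (x i) / (\<Prod>l\<in>A - {i}. of_real (x i - x l)) * of_real (x i - x b))"
proof -
  have "LG (A - {b}) f x =
      (\<Sum>i\<in>A - {b}. f (x i) / (\<Prod>l\<in>A - {i}. of_real (x i - x l)) * of_real (x i - x b))"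
    unfolding LG_def
  proof (intro sum.cong refl)
    fix i assume i: "i \<in> A - {b}"
    have ne: "x i \<noteq> x b" using i assms by (auto simp: inj_on_def)
    have "(\<Prod>l\<in>A - {i}. (of_real (x i - x l) :: complex)) =
        of_real (x i - x b) * (\<Prod>l\<in>A - {i} - {b}. of_real (x i - x l))"
      using assms i by (intro prod.remove) auto
    moreover have "A - {i} - {b} = A - {b} - {i}" by auto
    ultimately show "f (x i) / (\<Prod>l\<in>A - {b} - {i}. of_real (x i - x l)) =
        f (x i) / (\<Prod>l\<in>A - {i}. of_real (x i - x l)) * of_real (x i - x b)"
      using ne by (simp del: of_real_diff)
  qed
  also have "\<dots> = (\<Sum>i\<in>A. f (x i) / (\<Prod>l\<in>A - {i}. of_real (x i - x l)) * of_real (x i - x b))"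
    using assms by (intro sum.mono_neutral_left) auto
  finally show ?thesis .
qed

text \<open>\<open>LG_remove\<close> writes both terms on the right over the common index set A; the
  claim is then x a - x b = (x i - x b) - (x i - x a), term by term.\<close>

lemma LG_pair:
  assumes "finite A" "inj_on x A" "a \<in> A" "b \<in> A"
  shows "of_real (x a - x b) * LG A f x = LG (A - {b}) f x - LG (A - {a}) f x"
  unfolding LG_remove[OF assms(1,2,3)] LG_remove[OF assms(1,2,4)] sum_subtractf[symmetric]
  unfolding LG_def sum_distrib_left
proof (intro sum.cong refl)
  have "(p - q) * (u / v) = u / v * (r - q) - u / v * (r - p)" for p q r u v :: complex
    by (simp add: algebra_simps diff_divide_distrib)
  then show "of_real (x a - x b) * (f (x i) / (\<Prod>l\<in>A - {i}. of_real (x i - x l))) =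
      f (x i) / (\<Prod>l\<in>A - {i}. of_real (x i - x l)) * of_real (x i - x b) -
      f (x i) / (\<Prod>l\<in>A - {i}. of_real (x i - x l)) * of_real (x i - x a)" for i
    unfolding of_real_diff .
qed

lemma LG_const:
  assumes "finite A" "card A \<ge> 2" "inj_on x A"
  shows "LG A (\<lambda>_. c) x = 0"
  using assms
proof (induction "card A" arbitrary: A rule: less_induct)
  case less
  obtain a b where ab: "a \<in> A" "b \<in> A" "a \<noteq> b"
    using less.prems by (metis card_2_iff' card_le_Suc0_iff_eq not_less_eq_eq numeral_2_eq_2)
  have ne: "x a \<noteq> x b" using ab less.prems by (auto simp: inj_on_def)
  have eq: "LG (A - {b}) (\<lambda>_. c) x = LG (A - {a}) (\<lambda>_. c) x"
  proof (cases "card A = 2")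
    case True
    then have "A = {a, b}" using ab less.prems by (metis card_2_iff insert_iff singletonD doubleton_eq_iff)
    then have "A - {b} = {a}" "A - {a} = {b}" using ab by auto
    then show ?thesis by (simp add: LG_def)
  next
    case False
    have "LG (A - {z}) (\<lambda>_. c) x = 0" if "z \<in> A" for z
    proof (rule less.hyps)
      show "card (A - {z}) < card A" using that less.prems by (intro psubset_card_mono) auto
      show "2 \<le> card (A - {z})" using that less.prems False by simp
      show "inj_on x (A - {z})" using less.prems by (meson Diff_subset inj_on_subset)
    qed (use less.prems in auto)
    with ab show ?thesis by simp
  qed
  have "of_real (x a - x b) * LG A (\<lambda>_. c) x = 0"
    using LG_pair[OF less.prems(1,3) ab(1,2), of "\<lambda>_. c"] eq by simp
  then show ?case using ne by (simp del: of_real_diff)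
qed

lemma LG_add: "LG A (\<lambda>y. f y + g y) x = LG A f x + LG A g x"
  by (simp add: LG_def add_divide_distrib sum.distrib)

lemma LG_cmult: "LG A (\<lambda>y. c * f y) x = c * LG A f x"
  by (simp add: LG_def sum_distrib_left)

definition skip :: "nat \<Rightarrow> (nat \<Rightarrow> 'a) \<Rightarrow> nat \<Rightarrow> 'a" where
  "skip b x i = x (if i < b then i else Suc i)"

lemma LG_skip:
  assumes "b \<le> Suc j"
  shows "LG {..j} f (skip b x) = LG ({..Suc j} - {b}) f x"
proof -
  have "(\<lambda>i. if i < b then i else Suc i) ` {..j} = {..Suc j} - {b}"
  proof
    show "{..Suc j} - {b} \<subseteq> (\<lambda>i. if i < b then i else Suc i) ` {..j}"
    proof
      fix i assume i: "i \<in> {..Suc j} - {b}"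
      show "i \<in> (\<lambda>i. if i < b then i else Suc i) ` {..j}"
        using i assms by (intro image_eqI[of _ _ "if i < b then i else i - 1"]) auto
    qed
  qed (use assms in auto)
  then show ?thesis
    using LG_reindex[of "\<lambda>i. if i < b then i else Suc i" "{..j}" f x]
    by (auto simp: inj_on_def skip_def[abs_def] split: if_splits)
qed

lemma divdiff_rec_eq_LG:
  assumes "inj_on x {..j}"
  shows "divdiff_rec j f x = LG {..j} f x"
  using assms
proof (induction j arbitrary: x)
  case 0
  then show ?case by (simp add: LG_def)
next
  case (Suc j)
  have ne: "x j \<noteq> x (Suc j)" using inj_on_eq_iff[OF Suc.prems, of j "Suc j"] by simp
  have 1: "LG {..j} f x = LG ({..Suc j} - {Suc j}) f x" by (simp add: atMost_Suc)
  have "x(j := x (Suc j)) = (\<lambda>i. x (if i = j then Suc j else i))" by auto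
  moreover have "(\<lambda>i. if i = j then Suc j else i) ` {..j} = {..Suc j} - {j}"
    by (auto simp: image_iff)
  moreover have "inj_on (\<lambda>i. if i = j then Suc j else i) {..j}" by (auto simp: inj_on_def)
  ultimately have 2: "LG {..j} f (x(j := x (Suc j))) = LG ({..Suc j} - {j}) f x"
    using LG_reindex[of "\<lambda>i. if i = j then Suc j else i" "{..j}" f x] by simp
  have i1: "inj_on x {..j}" using Suc.prems by (rule inj_on_subset) auto
  have i2: "inj_on (x(j := x (Suc j))) {..j}"
  proof (rule inj_onI)
    fix a b assume "a \<in> {..j}" "b \<in> {..j}" "(x(j := x (Suc j))) a = (x(j := x (Suc j))) b"
    then show "a = b"
      using inj_on_eq_iff[OF Suc.prems, of a b] inj_on_eq_iff[OF Suc.prems, of a "Suc j"]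
        inj_on_eq_iff[OF Suc.prems, of "Suc j" b] by (auto split: if_splits)
  qed
  have "of_real (x j - x (Suc j)) * LG {..Suc j} f x =
      LG {..j} f x - LG {..j} f (x(j := x (Suc j)))"
    unfolding 1 2 by (rule LG_pair) (use Suc.prems in auto)
  then have "(LG {..j} f x - LG {..j} f (x(j := x (Suc j)))) / of_real (x j - x (Suc j)) = LG {..Suc j} f x"
    using ne by (metis nonzero_mult_div_cancel_left of_real_eq_0_iff right_minus_eq)
  then show ?case by (simp only: divdiff_rec.simps Suc.IH[OF i1] Suc.IH[OF i2])
qed

text \<open>Induction through the two end nodes p and q of the longer block: splitting x p - x q at
  the node p + i applies the recursion to one factor of each product, and what remains collapses to
  the Leibniz formulas for the blocks without q and without p.\<close>

lemma LG_leibniz: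
  assumes "inj_on x {p..p + d}"
  shows "LG {p..p + d} (\<lambda>y. f y * g y) x = (\<Sum>i\<le>d. LG {p..p + i} f x * LG {p + i..p + d} g x)"
  using assms
proof (induction d arbitrary: p)
  case 0
  then show ?case by (simp add: LG_def)
next
  case (Suc d)
  let ?q = "p + Suc d"
  have rm: "LG {a..<b} f x - LG {Suc a..b} f x = of_real (x a - x b) * LG {a..b} f x"
    if "p \<le> a" "a \<le> b" "b \<le> ?q" for a b f
  proof -
    have "{a..b} - {b} = {a..<b}" "{a..b} - {a} = {Suc a..b}" using that by auto
    then show ?thesis
      using LG_pair[of "{a..b}" x a b f] that inj_on_subset[OF Suc.prems, of "{a..b}"] by auto
  qed
  have ne: "x p \<noteq> x ?q" using inj_on_eq_iff[OF Suc.prems, of p ?q] by simp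
  have at: "{p..<?q} = {p..p + d}" by auto
  have at': "{p..<Suc (p + i)} = {p..p + i}" for i by auto
  have ih1: "LG {p..<?q} (\<lambda>y. f y * g y) x = (\<Sum>i\<le>d. LG {p..p + i} f x * LG {p + i..<?q} g x)"
    using Suc.IH[of p] inj_on_subset[OF Suc.prems, of "{p..p + d}"]
    by (simp add: atLeastLessThanSuc_atLeastAtMost)
  have ih2: "LG {Suc p..?q} (\<lambda>y. f y * g y) x =
      (\<Sum>i\<le>d. LG {Suc p..Suc p + i} f x * LG {Suc p + i..?q} g x)"
    using Suc.IH[of "Suc p"] inj_on_subset[OF Suc.prems, of "{Suc p..?q}"] by simp
  have "of_real (x p - x ?q) * (\<Sum>i\<le>Suc d. LG {p..p + i} f x * LG {p + i..?q} g x) =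
      (\<Sum>i\<le>Suc d. of_real (x p - x (p + i)) * LG {p..p + i} f x * LG {p + i..?q} g x) +
      (\<Sum>i\<le>Suc d. LG {p..p + i} f x * (of_real (x (p + i) - x ?q) * LG {p + i..?q} g x))"
    unfolding sum_distrib_left sum.distrib[symmetric] by (intro sum.cong) (auto simp: algebra_simps)
  also have "(\<Sum>i\<le>Suc d. of_real (x p - x (p + i)) * LG {p..p + i} f x * LG {p + i..?q} g x) =
      (\<Sum>i\<le>d. of_real (x p - x (p + Suc i)) * LG {p..p + Suc i} f x * LG {p + Suc i..?q} g x)"
    by (subst sum.atMost_Suc_shift) simp
  also have "\<dots> = (\<Sum>i\<le>d. (LG {p..p + i} f x - LG {Suc p..Suc p + i} f x) * LG {Suc p + i..?q} g x)"
    by (intro sum.cong refl) (subst rm[symmetric], auto simp: atLeastLessThanSuc_atLeastAtMost)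
  also have "(\<Sum>i\<le>Suc d. LG {p..p + i} f x * (of_real (x (p + i) - x ?q) * LG {p + i..?q} g x)) =
      (\<Sum>i\<le>d. LG {p..p + i} f x * (of_real (x (p + i) - x ?q) * LG {p + i..?q} g x))"
    by simp
  also have "\<dots> = (\<Sum>i\<le>d. LG {p..p + i} f x * (LG {p + i..<?q} g x - LG {Suc p + i..?q} g x))"
    by (intro sum.cong refl) (subst rm[symmetric], auto)
  also have "(\<Sum>i\<le>d. (LG {p..p + i} f x - LG {Suc p..Suc p + i} f x) * LG {Suc p + i..?q} g x) +
      (\<Sum>i\<le>d. LG {p..p + i} f x * (LG {p + i..<?q} g x - LG {Suc p + i..?q} g x)) =
      LG {p..<?q} (\<lambda>y. f y * g y) x - LG {Suc p..?q} (\<lambda>y. f y * g y) x"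
    unfolding ih1 ih2 sum.distrib[symmetric] sum_subtractf[symmetric]
    by (intro sum.cong) (auto simp: algebra_simps)
  also have "\<dots> = of_real (x p - x ?q) * LG {p..?q} (\<lambda>y. f y * g y) x"
    by (rule rm) auto
  finally show ?case using ne by (simp del: of_real_diff sum.atMost_Suc)
qed

subsection \<open>The continuous extension\<close>

text \<open>The Hermite--Genocchi formula, in the form of the recursion
  \<open>f\<^sup>[\<^sup>j\<^sup>+\<^sup>1\<^sup>](x, z) = \<integral>\<^sub>0\<^sup>1 t\<^sup>j f'\<^sup>[\<^sup>j\<^sup>](z + t (x - z)) dt\<close>.\<close>

fun gdd :: "nat \<Rightarrow> (real \<Rightarrow> complex) \<Rightarrow> (nat \<Rightarrow> real) \<Rightarrow> complex" where
  "gdd 0 f x = f (x 0)"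
| "gdd (Suc j) f x = integral {0..1}
     (\<lambda>t. of_real (t ^ j) * gdd j (vderiv f) (\<lambda>i. x (Suc j) + t * (x i - x (Suc j))))"

declare gdd.simps(2) [simp del]

lemma gdd_cong: "(\<And>i. i \<le> j \<Longrightarrow> x i = y i) \<Longrightarrow> gdd j f x = gdd j f y"
proof (induction j arbitrary: f x y)
  case (Suc j)
  have "gdd j (vderiv f) (\<lambda>i. x (Suc j) + t * (x i - x (Suc j))) =
      gdd j (vderiv f) (\<lambda>i. y (Suc j) + t * (y i - y (Suc j)))" for t
    by (rule Suc.IH) (use Suc.prems in auto)
  then show ?case by (simp add: gdd.simps(2))
qed simp

lemma continuous_on_fst_coordinate [continuous_intros]:
  "continuous_on A (\<lambda>p :: (nat \<Rightarrow> real) \<times> real. fst p i)"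
  by (rule continuous_on_product_then_coordinatewise) (intro continuous_intros)

lemma gdd_continuous: "f \<in> C_k j \<Longrightarrow> continuous_on UNIV (gdd j f)"
proof (induction j arbitrary: f)
  case 0
  then show ?case
    using continuous_on_compose2[of UNIV f UNIV "\<lambda>x :: nat \<Rightarrow> real. x 0"] continuous_on_product_coordinates
    by (simp add: C_k_0)
next
  case (Suc j)
  have IH: "continuous_on UNIV (gdd j (vderiv f))" using Suc by (simp add: C_k_Suc)
  have "continuous_on UNIV (\<lambda>x. integral (cbox 0 1)
     (\<lambda>t. of_real (t ^ j) * gdd j (vderiv f) (\<lambda>i. x (Suc j) + t * (x i - x (Suc j)))))"
  proof (rule integral_continuous_on_param)
    have "continuous_on (UNIV \<times> cbox 0 1)
        (\<lambda>p :: (nat \<Rightarrow> real) \<times> real. \<lambda>i. fst p (Suc j) + snd p * (fst p i - fst p (Suc j)))"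
      by (intro continuous_on_coordinatewise_then_product continuous_intros)
    from continuous_on_compose2[OF IH this]
    show "continuous_on (UNIV \<times> cbox 0 1) (\<lambda>(x, t). of_real (t ^ j) *
        gdd j (vderiv f) (\<lambda>i. x (Suc j) + t * (x i - x (Suc j))))"
      unfolding case_prod_unfold by (intro continuous_intros) auto
  qed
  then show ?case by (simp add: cbox_interval gdd.simps(2))
qed

text \<open>At distinct nodes the factor t^j cancels the scaling of the j differences in each
  denominator of the Lagrange formula, so every term integrates to a difference quotient of f along
  the segment from z to x i.\<close>

lemma gdd_eq_LG:
  assumes "f \<in> C_k j" "inj_on x {..j}"
  shows "gdd j f x = LG {..j} f x"
  using assms
proof (induction j arbitrary: f x)
  case 0
  then show ?case by (simp add: LG_def)
next
  case (Suc j)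
  define z where "z = x (Suc j)"
  define P where "P i = (\<Prod>l\<in>{..j} - {i}. (of_real (x i - x l) :: complex))" for i
  have ne: "x i \<noteq> z" if "i \<le> j" for i
    using inj_on_eq_iff[OF Suc.prems(2), of i "Suc j"] that by (simp add: z_def)
  have der: "(f has_vector_derivative vderiv f y) (at y)" for y using Suc.prems C_k_SucD by blast
  have int: "((\<lambda>t. vderiv f (z + t * (x i - z)) / P i) has_integral
      (f (x i) - f z) / of_real (x i - z) / P i) {0..1}" if "i \<le> j" for i
  proof -
    have "((\<lambda>t. z + t * (x i - z)) has_vector_derivative x i - z) (at t)" for t
      by (auto intro!: derivative_eq_intros simp: has_real_derivative_iff_has_vector_derivative[symmetric])
    from vector_diff_chain_at[OF this der]
    have "((\<lambda>t. f (z + t * (x i - z))) has_vector_derivative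
        (x i - z) *\<^sub>R vderiv f (z + t * (x i - z))) (at t)" for t
      by (simp add: o_def)
    then have "((\<lambda>t. (x i - z) *\<^sub>R vderiv f (z + t * (x i - z))) has_integral
        f (z + 1 * (x i - z)) - f (z + 0 * (x i - z))) {0..1}"
      by (intro fundamental_theorem_of_calculus) (auto intro: has_vector_derivative_at_within)
    from has_integral_mult_right[OF this, of "1 / of_real (x i - z) / P i"] ne[OF that]
    show ?thesis by (simp add: scaleR_conv_of_real del: of_real_diff)
  qed
  have "((\<lambda>t. \<Sum>i\<le>j. vderiv f (z + t * (x i - z)) / P i) has_integral
      (\<Sum>i\<le>j. (f (x i) - f z) / of_real (x i - z) / P i)) {0..1}"
    by (intro has_integral_sum int) auto
  then have "((\<lambda>t. of_real (t ^ j) * gdd j (vderiv f) (\<lambda>i. z + t * (x i - z))) has_integral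
      (\<Sum>i\<le>j. (f (x i) - f z) / of_real (x i - z) / P i)) {0..1}"
  \<comment> \<open>At t = 0 all nodes collapse to z, so the Lagrange formula is used off this null
    set.\<close>
  proof (rule has_integral_spike[of "{0}", rotated 2])
    fix t :: real assume t: "t \<in> {0..1} - {0}"
    have "inj_on (\<lambda>i. z + t * (x i - z)) {..j}"
      using Suc.prems(2) t by (auto simp: inj_on_def)
    then have "gdd j (vderiv f) (\<lambda>i. z + t * (x i - z)) = LG {..j} (vderiv f) (\<lambda>i. z + t * (x i - z))"
      using Suc.prems by (intro Suc.IH) (auto simp: C_k_Suc)
    also have "of_real (t ^ j) * \<dots> = (\<Sum>i\<le>j. vderiv f (z + t * (x i - z)) / P i)"
      unfolding LG_def sum_distrib_left
    proof (intro sum.cong refl)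
      fix i assume i: "i \<in> {..j}"
      have "(\<Prod>l\<in>{..j} - {i}. (of_real (z + t * (x i - z) - (z + t * (x l - z))) :: complex)) =
          (\<Prod>l\<in>{..j} - {i}. of_real t * of_real (x i - x l))"
        by (intro prod.cong) (auto simp: algebra_simps)
      also have "\<dots> = of_real (t ^ j) * P i"
        unfolding P_def prod.distrib using i by simp
      finally show "of_real (t ^ j) * (vderiv f (z + t * (x i - z)) /
          (\<Prod>l\<in>{..j} - {i}. of_real (z + t * (x i - z) - (z + t * (x l - z))))) =
          vderiv f (z + t * (x i - z)) / P i"
        using t by (simp del: of_real_diff of_real_mult of_real_add)
    qed
    finally show "of_real (t ^ j) * gdd j (vderiv f) (\<lambda>i. z + t * (x i - z)) =
        (\<Sum>i\<le>j. vderiv f (z + t * (x i - z)) / P i)" .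
  qed auto
  then have 1: "gdd (Suc j) f x = (\<Sum>i\<le>j. (f (x i) - f z) / of_real (x i - z) / P i)"
    by (simp add: z_def integral_unique gdd.simps(2))
  have P: "(\<Prod>l\<in>{..Suc j} - {i}. of_real (x i - x l)) = of_real (x i - z) * P i" if "i \<le> j" for i
  proof -
    have "{..Suc j} - {i} = insert (Suc j) ({..j} - {i})" using that by auto
    then show ?thesis using that by (simp add: P_def z_def)
  qed
  have LG: "LG {..Suc j} g x = (\<Sum>i\<le>j. g (x i) / of_real (x i - z) / P i) +
      g z / (\<Prod>l\<le>j. of_real (z - x l))" for g
  proof -
    have "LG {..Suc j} g x = (\<Sum>i\<le>j. g (x i) / (\<Prod>l\<in>{..Suc j} - {i}. of_real (x i - x l))) +
        g z / (\<Prod>l\<in>{..Suc j} - {Suc j}. of_real (z - x l))"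
      unfolding LG_def z_def by simp
    moreover have "{..Suc j} - {Suc j} = {..j}" by auto
    moreover have "(\<Sum>i\<le>j. g (x i) / (\<Prod>l\<in>{..Suc j} - {i}. of_real (x i - x l))) =
        (\<Sum>i\<le>j. g (x i) / of_real (x i - z) / P i)"
      by (intro sum.cong refl) (simp only: atMost_iff P divide_divide_eq_left)
    ultimately show ?thesis by (simp only:)
  qed
  \<comment> \<open>Subtracting the constant f z, whose divided difference is 0, removes the term of
    the node z.\<close>
  have "LG {..Suc j} f x = LG {..Suc j} f x - LG {..Suc j} (\<lambda>_. f z) x"
    using LG_const[of "{..Suc j}" x "f z"] Suc.prems by simp
  also have "\<dots> = (\<Sum>i\<le>j. (f (x i) - f z) / of_real (x i - z) / P i)"
    unfolding LG by (simp add: sum_subtractf[symmetric] diff_divide_distrib)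
  finally show ?case using 1 by simp
qed

text \<open>Move x along the straight line towards the sequence c of distinct points. Two of the
  first j + 1 entries coincide for only finitely many t > 0, so F and G agree on the line for small
  t > 0 and, by continuity, at t = 0.\<close>

lemma eq_by_density:
  fixes F G :: "(nat \<Rightarrow> real) \<Rightarrow> complex"
  assumes S: "convex S" and c: "\<And>i::nat. c i \<in> S" "inj c"
    and FG: "continuous_on {x. \<forall>i. x i \<in> S} F" "continuous_on {x. \<forall>i. x i \<in> S} G"
    and eq: "\<And>x. (\<And>i. x i \<in> S) \<Longrightarrow> inj_on x {..j} \<Longrightarrow> F x = G x"
    and x: "\<And>i. x i \<in> S"
  shows "F x = G x"
proof -
  define \<gamma> where "\<gamma> t i = x i + t * (c i - x i)" for t :: real and i :: nat
  have \<gamma>S: "\<gamma> t i \<in> S" if "t \<in> {0..1}" for t i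
    using convexD_alt[OF S x[of i] c(1)[of i], of t] that
    by (simp add: \<gamma>_def algebra_simps)
  have cont\<gamma>: "continuous_on {0..1} \<gamma>"
    unfolding \<gamma>_def by (intro continuous_on_coordinatewise_then_product continuous_intros)
  define h where "h t = F (\<gamma> t) - G (\<gamma> t)" for t
  have conth: "continuous_on {0..1} h"
    unfolding h_def using \<gamma>S
    by (intro continuous_intros continuous_on_compose2[OF FG(1) cont\<gamma>] continuous_on_compose2[OF FG(2) cont\<gamma>]) auto
  define B where "B = (\<Union>i\<le>j. \<Union>l\<le>j. {(x l - x i) / ((c i - x i) - (c l - x l))})"
  have "finite B" by (simp add: B_def)
  then obtain d where d: "d > 0" "\<forall>t\<in>B. t \<noteq> 0 \<longrightarrow> d \<le> dist 0 t" using finite_set_avoid by blast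
  have h0: "h t = 0" if t: "0 < t" "t < min d 1" for t
  proof -
    have "t \<notin> B" using t d by (auto simp: dist_norm)
    have "inj_on (\<gamma> t) {..j}"
    proof (rule inj_onI, rule ccontr)
      fix i l assume il: "i \<in> {..j}" "l \<in> {..j}" "\<gamma> t i = \<gamma> t l" "i \<noteq> l"
      then have e: "t * ((c i - x i) - (c l - x l)) = x l - x i" by (simp add: \<gamma>_def algebra_simps)
      show False
      proof (cases "(c i - x i) - (c l - x l) = 0")
        case True
        with e have "x l = x i" by simp
        with True have "c i = c l" by simp
        with c il show False by (auto simp: inj_def)
      next
        case False
        with e have "t = (x l - x i) / ((c i - x i) - (c l - x l))" by (simp add: field_simps)
        with \<open>t \<notin> B\<close> il show False unfolding B_def by blast
      qed
    qed
    then show ?thesis unfolding h_def using eq \<gamma>S t by auto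
  qed
  have "(h \<longlongrightarrow> h 0) (at_right 0)"
    using conth by (simp add: continuous_on_Icc_at_rightD)
  moreover have "(h \<longlongrightarrow> 0) (at_right 0)"
    by (rule tendsto_eventually) (use h0 d in \<open>auto simp: eventually_at_right intro!: exI[of _ "min d 1"]\<close>)
  ultimately have "h 0 = 0" using tendsto_unique trivial_limit_at_right_real by blast
  moreover have "\<gamma> 0 = x" by (auto simp: \<gamma>_def)
  ultimately show ?thesis by (simp add: h_def)
qed

lemma eq_by_density_UNIV:
  fixes F G :: "(nat \<Rightarrow> real) \<Rightarrow> complex"
  assumes "continuous_on UNIV F" "continuous_on UNIV G"
    and "\<And>x. inj_on x {..j} \<Longrightarrow> F x = G x"
  shows "F x = G x"
  by (rule eq_by_density[of UNIV real F G j]) (use assms in \<open>auto simp: inj_def\<close>)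

text \<open>The integrals defining \<open>gdd\<close> involve derivatives of f, yet only the values
  on a convex set containing the nodes matter, because tuples of distinct points of the set are
  dense. This transfers bounds between functions that agree on an interval only.\<close>

lemma gdd_eq_on:
  assumes S: "convex S" and c: "\<And>i::nat. c i \<in> S" "inj c"
    and "f \<in> C_k j" "g \<in> C_k j" "\<And>y. y \<in> S \<Longrightarrow> f y = g y" "\<And>i. i \<le> j \<Longrightarrow> x i \<in> S"
  shows "gdd j f x = gdd j g x"
proof -
  define x' where "x' i = (if i \<le> j then x i else c 0)" for i
  have "gdd j f x' = gdd j g x'"
  proof (rule eq_by_density[OF S c])
    fix y assume "\<And>i. y i \<in> S" "inj_on y {..j}"
    then show "gdd j f y = gdd j g y" using assms by (simp add: gdd_eq_LG LG_def)
  qed (use assms in \<open>auto simp: x'_def intro!: continuous_on_subset[OF gdd_continuous, of _ _ "{x. \<forall>i. x i \<in> S}"]\<close>)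
  then show ?thesis using gdd_cong[of j x x'] by (simp add: x'_def)
qed

text \<open>Here and below, algebraic identities are verified at distinct nodes through
  \<open>LG\<close> and extended by density, instead of being proved for iterated integrals.\<close>

lemma gdd_add:
  assumes "f \<in> C_k j" "g \<in> C_k j"
  shows "gdd j (\<lambda>y. f y + g y) x = gdd j f x + gdd j g x"
  by (rule eq_by_density_UNIV[where j = j])
    (use assms gdd_continuous C_k_add in \<open>auto intro!: continuous_intros simp: gdd_eq_LG LG_add\<close>)

lemma gdd_cmult:
  assumes "f \<in> C_k j"
  shows "gdd j (\<lambda>y. c * f y) x = c * gdd j f x"
  by (rule eq_by_density_UNIV[where j = j])
    (use assms gdd_continuous C_k_cmult in \<open>auto intro!: continuous_intros simp: gdd_eq_LG LG_cmult\<close>)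

lemma gdd_diff:
  assumes "f \<in> C_k j" "g \<in> C_k j"
  shows "gdd j (\<lambda>y. f y - g y) x = gdd j f x - gdd j g x"
  using gdd_add[OF assms(1) C_k_cmult[OF assms(2), of "-1"], of x] gdd_cmult[OF assms(2), of "-1" x]
  by simp

lemma gdd_0_fun: "gdd j (\<lambda>y. 0) x = 0"
  using gdd_cmult[OF C_k_const[of 0 j], of 0 x] by simp

lemma gdd_sum:
  assumes "\<And>i. i \<in> A \<Longrightarrow> f i \<in> C_k j"
  shows "gdd j (\<lambda>y. \<Sum>i\<in>A. f i y) x = (\<Sum>i\<in>A. gdd j (f i) x)"
  using assms by (induction A rule: infinite_finite_induct) (auto simp: gdd_0_fun gdd_add C_k_sum)

lemma continuous_on_reindex:
  "continuous_on A (\<lambda>x :: nat \<Rightarrow> real. (\<lambda>i. x (\<pi> i)))"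
  by (intro continuous_on_coordinatewise_then_product)
    (auto intro: continuous_on_subset[OF continuous_on_product_coordinates])

text \<open>The recursion for an arbitrary pair of nodes, coincident ones included; it is applied
  later to the base point x 0 and the first node that is not near it.\<close>

lemma gdd_pair:
  assumes f: "f \<in> C_k (Suc j)" and ab: "a \<le> Suc j" "b \<le> Suc j"
  shows "of_real (x a - x b) * gdd (Suc j) f x = gdd j f (skip b x) - gdd j f (skip a x)"
proof (rule eq_by_density_UNIV[where j = "Suc j" and F = "\<lambda>x. of_real (x a - x b) * gdd (Suc j) f x"])
  have f': "f \<in> C_k j" using f by (rule C_k_Suc_lower)
  have sk: "continuous_on UNIV (\<lambda>x :: nat \<Rightarrow> real. gdd j f (skip a x))" for a
    by (rule continuous_on_compose2[OF gdd_continuous[OF f']])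
      (auto simp: skip_def[abs_def] intro!: continuous_on_reindex)
  show "continuous_on UNIV (\<lambda>x. of_real (x a - x b) * gdd (Suc j) f x)"
    by (intro continuous_intros gdd_continuous f continuous_on_product_coordinates)
  show "continuous_on UNIV (\<lambda>x. gdd j f (skip b x) - gdd j f (skip a x))"
    by (intro continuous_intros sk)
  fix x :: "nat \<Rightarrow> real" assume inj: "inj_on x {..Suc j}"
  have inj': "inj_on (skip a x) {..j}" if "a \<le> Suc j" for a
    unfolding skip_def[abs_def] using that
    by (intro comp_inj_on[of "\<lambda>i. if i < a then i else Suc i" _ x, unfolded o_def] inj_on_subset[OF inj])
      (auto simp: inj_on_def)
  show "of_real (x a - x b) * gdd (Suc j) f x = gdd j f (skip b x) - gdd j f (skip a x)"
    using LG_pair[OF _ inj, of a b f] ab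
    by (simp add: gdd_eq_LG[OF f inj] gdd_eq_LG[OF f' inj'] LG_skip del: of_real_diff)
qed

lemma gdd_leibniz:
  assumes f: "f \<in> C_k j" and g: "g \<in> C_k j"
  shows "gdd j (\<lambda>y. f y * g y) x = (\<Sum>i\<le>j. gdd i f x * gdd (j - i) g (\<lambda>l. x (l + i)))"
proof (rule eq_by_density_UNIV[where j = j and F = "gdd j (\<lambda>y. f y * g y)"])
  have f': "f \<in> C_k i" "g \<in> C_k (j - i)" if "i \<le> j" for i
    using C_k_mono[OF f that] C_k_mono[OF g, of "j - i"] by auto
  show "continuous_on UNIV (gdd j (\<lambda>y. f y * g y))"
    by (intro gdd_continuous C_k_mult f g)
  have "continuous_on UNIV (\<lambda>x. gdd (j - i) g (\<lambda>l. x (l + i)))" if "i \<le> j" for i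
    by (rule continuous_on_compose2[OF gdd_continuous[OF f'(2)[OF that]]])
      (auto intro!: continuous_on_reindex)
  then show "continuous_on UNIV (\<lambda>x. \<Sum>i\<le>j. gdd i f x * gdd (j - i) g (\<lambda>l. x (l + i)))"
    using gdd_continuous f' by (intro continuous_intros) auto
  fix x :: "nat \<Rightarrow> real" assume inj: "inj_on x {..j}"
  have "gdd i f x = LG {0..i} f x" if "i \<le> j" for i
    using gdd_eq_LG[OF f'(1)[OF that]] inj_on_subset[OF inj] that by (auto simp: atLeast0AtMost)
  moreover have "gdd (j - i) g (\<lambda>l. x (l + i)) = LG {i..j} g x" if "i \<le> j" for i
  proof -
    have "inj_on (\<lambda>l. x (l + i)) {..j - i}" using that
      by (intro comp_inj_on[of "\<lambda>l. l + i" _ x, unfolded o_def] inj_on_subset[OF inj])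
        (auto simp: inj_on_def)
    moreover have "(\<lambda>l. l + i) ` {..j - i} = {i..j}"
      using that image_add_atLeastAtMost[of i 0 "j - i"] by (simp add: atLeast0AtMost add.commute)
    ultimately show ?thesis
      using gdd_eq_LG[OF f'(2)[OF that]] LG_reindex[of "\<lambda>l. l + i" "{..j - i}" g x] by simp
  qed
  moreover have "gdd j (\<lambda>y. f y * g y) x = LG {0..j} (\<lambda>y. f y * g y) x"
    using gdd_eq_LG[OF C_k_mult[OF f g] inj] by (simp add: atLeast0AtMost)
  moreover have "LG {0..j} (\<lambda>y. f y * g y) x = (\<Sum>i\<le>j. LG {0..i} f x * LG {i..j} g x)"
    using LG_leibniz[of x 0 j f g] inj by (simp add: atLeast0AtMost)
  ultimately show "gdd j (\<lambda>y. f y * g y) x = (\<Sum>i\<le>j. gdd i f x * gdd (j - i) g (\<lambda>l. x (l + i)))"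
    by simp
qed

lemma gdd_diagonal:
  assumes "f \<in> C_k j" "\<And>i. i \<le> j \<Longrightarrow> x i = c"
  shows "gdd j f x = nth_deriv j f c / fact j"
  using assms
proof (induction j arbitrary: f x)
  case (Suc j)
  have "gdd j (vderiv f) (\<lambda>i. x (Suc j) + t * (x i - x (Suc j))) = nth_deriv j (vderiv f) c / fact j" for t
    by (rule Suc.IH) (use Suc.prems in \<open>auto simp: C_k_Suc\<close>)
  then have "gdd (Suc j) f x = integral {0..1} (\<lambda>t. of_real (t ^ j) * (nth_deriv j (vderiv f) c / fact j))"
    by (simp add: gdd.simps(2))
  also have "\<dots> = (1 / of_nat (Suc j)) * (nth_deriv j (vderiv f) c / fact j)"
  proof (rule integral_unique)
    have "((\<lambda>t. t ^ j) has_integral (1 ^ Suc j / of_nat (Suc j) - 0 ^ Suc j / of_nat (Suc j))) {0..1::real}"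
      by (intro fundamental_theorem_of_calculus)
        (auto intro!: derivative_eq_intros simp: has_real_derivative_iff_has_vector_derivative[symmetric] simp del: of_nat_Suc power_Suc)
    from has_integral_mult_left[OF has_integral_of_real[OF this], of "nth_deriv j (vderiv f) c / fact j"]
    show "((\<lambda>t. of_real (t ^ j) * (nth_deriv j (vderiv f) c / fact j)) has_integral
      (1 / of_nat (Suc j)) * (nth_deriv j (vderiv f) c / fact j)) {0..1}" by simp
  qed
  finally show ?case by (simp add: nth_deriv_Suc mult_ac)
qed simp

lemma divdiff_eq_gdd:
  assumes f: "f \<in> C_k j" and x: "x \<in> {..<Suc j} \<rightarrow>\<^sub>E UNIV"
  shows "divdiff j f x = gdd j f x"
proof -
  let ?X = "{..<Suc j} \<rightarrow>\<^sub>E (UNIV :: real set)"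
  \<comment> \<open>Composition with this restriction turns functions on \<open>?X\<close> into
    functions of all sequences, to which density applies; this yields the uniqueness that the
    definite description demands.\<close>
  let ?r = "\<lambda>x :: nat \<Rightarrow> real. restrict x {..<Suc j}"
  have r: "continuous_on UNIV ?r"
  proof (rule continuous_on_coordinatewise_then_product)
    show "continuous_on UNIV (\<lambda>x. ?r x i)" for i
      by (cases "i < Suc j") (simp_all add: restrict_def)
  qed
  have rX: "?r x \<in> ?X" for x by auto
  have rx: "?r x = x" if "x \<in> ?X" for x using that by (auto simp: PiE_def extensional_restrict)
  have "divdiff j f = restrict (gdd j f) ?X"
    unfolding divdiff_def
  proof (rule the_equality, safe)
    show "continuous_on ?X (restrict (gdd j f) ?X)"
      by (subst continuous_on_cong[OF refl, of ?X _ "gdd j f"])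
        (use continuous_on_subset[OF gdd_continuous[OF f] subset_UNIV] in \<open>simp_all\<close>)
    show "restrict (gdd j f) ?X x = divdiff_rec j f x" if "x \<in> ?X" "inj_on x {..<Suc j}" for x
      using gdd_eq_LG[OF f that(2)[unfolded lessThan_Suc_atMost]]
        divdiff_rec_eq_LG[OF that(2)[unfolded lessThan_Suc_atMost], of f] that(1) by simp
    fix F assume F: "F \<in> extensional ?X" "continuous_on ?X F"
      "\<forall>x\<in>?X. inj_on x {..<Suc j} \<longrightarrow> F x = divdiff_rec j f x"
    have "F (?r x) = gdd j f (?r x)" for x
    proof (rule eq_by_density_UNIV[where j = j and F = "\<lambda>x. F (?r x)"])
      show "continuous_on UNIV (\<lambda>x. F (?r x))"
        by (rule continuous_on_compose2[OF F(2) r]) (intro image_subsetI rX)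
      show "continuous_on UNIV (\<lambda>x. gdd j f (?r x))"
        by (rule continuous_on_compose2[OF gdd_continuous[OF f] r]) (rule subset_UNIV)
      fix x :: "nat \<Rightarrow> real" assume "inj_on x {..j}"
      then have i: "inj_on (?r x) {..<Suc j}" "inj_on (?r x) {..j}" by (auto simp: inj_on_def)
      show "F (?r x) = gdd j f (?r x)"
        using F(3) rX i(1) gdd_eq_LG[OF f i(2)] divdiff_rec_eq_LG[OF i(2), of f] by metis
    qed
    then have "F x = gdd j f x" if "x \<in> ?X" for x using rx[OF that] by metis
    then show "F = restrict (gdd j f) ?X"
      using F(1) by (auto simp: extensional_def restrict_def)
  qed auto
  with x show ?thesis by simp
qed

text \<open>Pointwise convergence of the functions is enough: the bounds C n dominate the supremum
  norms, so the divided differences converge uniformly to a continuous function, which is the right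
  one at distinct nodes and hence everywhere.\<close>

lemma sep_gdd_sums:
  assumes S: "convex S" and c: "\<And>i::nat. c i \<in> S" "inj c"
    and f: "f \<in> C_k j" and g: "\<And>n. g n \<in> C_k j"
    and sep: "\<And>n. sep (Suc j) S (C n) (gdd j (g n))" and C: "C sums D"
    and fg: "\<And>y. y \<in> S \<Longrightarrow> (\<lambda>n. g n y) sums f y"
  shows "sep (Suc j) S D (gdd j f)"
proof (rule sep_sums[OF sep C])
  fix x :: "nat \<Rightarrow> real" assume x: "\<And>i. i < Suc j \<Longrightarrow> x i \<in> S"
  let ?X = "{x. \<forall>i. x i \<in> S}"
  let ?F = "\<lambda>x. \<Sum>n. gdd j (g n) x"
  have bd: "norm (gdd j (g n) y) \<le> C n" if "y \<in> ?X" for y n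
    using sep_bound[OF sep] that by auto
  have "uniform_limit ?X (\<lambda>n y. \<Sum>i<n. gdd j (g i) y) ?F sequentially"
    by (rule Weierstrass_m_test[OF bd sums_summable[OF C]])
  then have cont: "continuous_on ?X ?F"
    by (rule uniform_limit_theorem[rotated])
      (auto intro!: always_eventually continuous_intros continuous_on_subset[OF gdd_continuous[OF g]])
  define x' where "x' i = (if i \<le> j then x i else c 0)" for i
  have x'X: "x' \<in> ?X" using x c by (auto simp: x'_def)
  have "?F x' = gdd j f x'"
  proof (rule eq_by_density[OF S c cont])
    show "continuous_on ?X (gdd j f)" using continuous_on_subset[OF gdd_continuous[OF f]] by auto
    fix y assume y: "\<And>i. y i \<in> S" "inj_on y {..j}"
    have "(\<lambda>n. LG {..j} (g n) y) sums LG {..j} f y"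
      unfolding LG_def by (intro sums_sum sums_divide fg y)
    then show "?F y = gdd j f y"
      using y by (simp add: gdd_eq_LG g f sums_iff)
  qed (use x'X in auto)
  moreover have "summable (\<lambda>n. gdd j (g n) x')"
    by (rule summable_comparison_test[OF _ sums_summable[OF C]]) (use bd[OF x'X] in auto)
  ultimately have "(\<lambda>n. gdd j (g n) x') sums gdd j f x'" using summable_sums by force
  then show "(\<lambda>n. gdd j (g n) x) sums gdd j f x"
    using gdd_cong[of j x x'] by (simp add: x'_def)
qed

subsection \<open>Polynomials\<close>

abbreviation rpoly :: "complex poly \<Rightarrow> real \<Rightarrow> complex" where
  "rpoly p \<equiv> \<lambda>t. poly p (of_real t)"

lemma has_vector_derivative_rpoly: "(rpoly p has_vector_derivative rpoly (pderiv p) x) (at x)"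
proof -
  have "(poly p has_field_derivative poly (pderiv p) (of_real x)) (at (of_real x))"
    by (rule poly_DERIV)
  from field_vector_diff_chain_at[OF has_vector_derivative_of_real[OF DERIV_ident] this]
  show ?thesis by (simp add: o_def)
qed

lemma rpoly_C_k: "rpoly p \<in> C_k k"
proof (induction k arbitrary: p)
  case 0
  have "isCont (rpoly p) x" for x
    using has_vector_derivative_rpoly has_vector_derivative_continuous by blast
  then show ?case by (simp add: C_k_0 continuous_at_imp_continuous_on)
next
  case (Suc k)
  show ?case by (rule C_k_SucI(1)[OF has_vector_derivative_rpoly Suc])
qed

lemma vderiv_rpoly: "vderiv (rpoly p) = rpoly (pderiv p)"
  using vector_derivative_at[OF has_vector_derivative_rpoly] by auto

lemma gdd_const: "gdd j (\<lambda>_. c) x = (if j = 0 then c else 0)"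
proof (cases j)
  case (Suc i)
  have "vderiv (\<lambda>_. c) = (\<lambda>_. 0)" by auto
  then show ?thesis by (simp add: Suc gdd.simps(2) gdd_0_fun)
qed simp

lemma vderiv_linear: "vderiv (\<lambda>y. of_real y - c) = (\<lambda>_. 1)"
proof
  fix x :: real
  have "((\<lambda>y. of_real y - c) has_vector_derivative 1 - 0) (at x)"
    using has_vector_derivative_of_real[OF DERIV_ident]
    by (intro has_vector_derivative_diff) (auto intro!: derivative_eq_intros)
  then show "vderiv (\<lambda>y. of_real y - c) x = 1" by (simp add: vector_derivative_at)
qed

lemma gdd_linear: "gdd j (\<lambda>y. of_real y - c) x = (if j = 0 then of_real (x 0) - c else if j = 1 then 1 else 0)"
proof (cases j)
  case (Suc i)
  then show ?thesis by (simp add: gdd.simps(2) vderiv_linear gdd_const)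
qed simp

lemma gdd_mult_linear:
  assumes f: "f \<in> C_k (Suc j)"
  shows "gdd (Suc j) (\<lambda>y. f y * (of_real y - c)) x =
    gdd (Suc j) f x * (of_real (x (Suc j)) - c) + gdd j f x"
proof -
  have "gdd (Suc j) (\<lambda>y. f y * (of_real y - c)) x =
      (\<Sum>i\<le>Suc j. gdd i f x * gdd (Suc j - i) (\<lambda>y. of_real y - c) (\<lambda>l. x (l + i)))"
    by (rule gdd_leibniz[OF f C_k_of_real])
  also have "\<dots> = (\<Sum>i\<in>{j, Suc j}. gdd i f x * gdd (Suc j - i) (\<lambda>y. of_real y - c) (\<lambda>l. x (l + i)))"
    by (rule sum.mono_neutral_right) (auto simp: gdd_linear)
  also have "\<dots> = gdd (Suc j) f x * (of_real (x (Suc j)) - c) + gdd j f x"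
    by (simp add: gdd_linear)
  finally show ?thesis .
qed

text \<open>In \<open>gdd_mult_linear\<close> the last variable costs R and the term of lower order
  costs 1, so each further power of y costs the factor 1 + R, whatever the order j.\<close>

lemma sep_gdd_power:
  assumes S: "S \<in> sets borel" and R: "0 \<le> R" "\<And>y. y \<in> S \<Longrightarrow> \<bar>y\<bar> \<le> R"
  shows "sep (Suc j) S ((1 + R) ^ l) (gdd j (\<lambda>y. of_real y ^ l))"
proof (induction l arbitrary: j)
  case 0
  show ?case using sep_const[OF S, of "Suc j" "if j = 0 then 1 else 0" 1] by (simp add: gdd_const[abs_def])
next
  case (Suc l)
  show ?case
  proof (cases j)
    case 0
    have "sep 1 S ((1 + R) ^ l * R) (\<lambda>x. gdd 0 (\<lambda>y. of_real y ^ l) x * of_real (x 0))"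
      using Suc[of 0] R by (intro sep_mult sep_var[OF _ S]) auto
    then have "sep 1 S ((1 + R) ^ Suc l) (\<lambda>x. gdd 0 (\<lambda>y. of_real y ^ l) x * of_real (x 0))"
      by (rule sep_mono) (use R in \<open>auto simp: mult_ac intro!: mult_right_mono\<close>)
    then show ?thesis using 0 by (simp add: mult_ac)
  next
    case (Suc i)
    have "sep (Suc j) S (((1 + R) ^ l * R) + (1 + R) ^ l)
        (\<lambda>x. gdd (Suc i) (\<lambda>y. of_real y ^ l) x * (of_real (x (Suc i)) - 0) + gdd i (\<lambda>y. of_real y ^ l) x)"
      using Suc.IH[of "Suc i"] sep_reindex[OF Suc.IH[of i], of "\<lambda>i. i" "Suc j"] Suc R
      by (intro sep_add sep_mult sep_var[OF _ S]) auto
    moreover have "gdd (Suc i) (\<lambda>y. of_real y ^ Suc l) x =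
        gdd (Suc i) (\<lambda>y. of_real y ^ l) x * (of_real (x (Suc i)) - 0) + gdd i (\<lambda>y. of_real y ^ l) x" for x
      using gdd_mult_linear[OF C_k_power[OF C_k_of_real[where c = 0]], where c = 0]
      by (simp add: mult_ac)
    ultimately show ?thesis using Suc by (simp add: algebra_simps del: power_Suc) (simp add: algebra_simps)
  qed
qed

lemma sep_gdd_rpoly:
  assumes S: "S \<in> sets borel" and R: "0 \<le> R" "\<And>y. y \<in> S \<Longrightarrow> \<bar>y\<bar> \<le> R"
  shows "sep (Suc j) S (\<Sum>l\<le>degree p. norm (coeff p l) * (1 + R) ^ l) (gdd j (rpoly p))"
proof -
  have pw: "(\<lambda>y. of_real y ^ l) \<in> C_k j" for l
    using C_k_power[OF C_k_of_real[of 0]] by simp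
  have "gdd j (rpoly p) x = (\<Sum>l\<le>degree p. coeff p l * gdd j (\<lambda>y. of_real y ^ l) x)" for x
    unfolding poly_altdef by (subst gdd_sum) (auto intro!: C_k_cmult pw simp: gdd_cmult[OF pw])
  moreover have "sep (Suc j) S (\<Sum>l\<le>degree p. norm (coeff p l) * (1 + R) ^ l)
      (\<lambda>x. \<Sum>l\<le>degree p. coeff p l * gdd j (\<lambda>y. of_real y ^ l) x)"
    by (intro sep_sum sep_cmult[OF sep_gdd_power[OF S R] S]) auto
  ultimately show ?thesis by (simp only: sep_cong)
qed

section \<open>A criterion for membership in \<open>NC\<^sup>k\<close>\<close>

lemma ipt_norm_cong:
  assumes "\<And>x. x \<in> Pi\<^sub>E {..<m} \<Omega> \<Longrightarrow> \<phi> x = \<psi> x"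
  shows "ipt_norm m \<Omega> \<phi> = ipt_norm m \<Omega> \<psi>"
proof -
  have "(is_ipd m \<Omega> \<phi> :: (nat \<Rightarrow> real) measure \<Rightarrow> _) = is_ipd m \<Omega> \<psi>"
    unfolding is_ipd_def fun_eq_iff using assms by simp
  then show ?thesis by (simp add: ipt_norm_def)
qed

lemma divdiff_in_ipt_space:
  assumes f: "f \<in> C_k j" and sep: "sep (Suc j) S C (gdd j f)"
  shows "divdiff j f \<in> ipt_space (Suc j) (\<lambda>_. S)"
proof -
  let ?X = "{..<Suc j} \<rightarrow>\<^sub>E S"
  have eq: "divdiff j f x = gdd j f x" if "x \<in> ?X" for x
    by (rule divdiff_eq_gdd[OF f]) (use that in \<open>auto simp: PiE_def\<close>)
  have "continuous_on ?X (gdd j f)"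
    by (rule continuous_on_subset[OF gdd_continuous[OF f] subset_UNIV])
  then have "continuous_on ?X (divdiff j f)"
    by (subst continuous_on_cong[OF refl eq])
  then have "divdiff j f \<in> borel_measurable (restrict_space borel ?X)"
    by (rule borel_measurable_continuous_on_restrict)
  moreover have "norm (divdiff j f x) \<le> C" if "x \<in> ?X" for x
    unfolding eq[OF that] by (rule sep_bound[OF sep]) (use that in auto)
  then have "bounded (divdiff j f ` ?X)" by (auto simp: bounded_iff)
  moreover have "ipt_norm (Suc j) (\<lambda>_. S) (divdiff j f) < \<infinity>"
    using sep_imp_ipt_norm[OF sep] ipt_norm_cong[of "Suc j" "\<lambda>_. S" "divdiff j f", OF eq]
    by (auto simp: order.strict_iff_order top_unique)
  ultimately show ?thesis unfolding ipt_space_def linf_def by simp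
qed

text \<open>The interval from -(n + 1) to n + 1 and the error 1 / (n + 1) give one sequence of
  polynomials that works for all r and all orders: on [-r, r] the bound applies once n + 1 >=
  r.\<close>

lemma NC_I:
  assumes f: "f \<in> C_k k"
    and approx: "\<And>R \<delta>. 0 < R \<Longrightarrow> 0 < \<delta> \<Longrightarrow>
      \<exists>p. \<forall>j\<le>k. sep (Suc j) {- R..R} \<delta> (gdd j (\<lambda>t. f t - rpoly p t))"
  shows "f \<in> NC k"
proof -
  have "\<exists>p. \<forall>j\<le>k. sep (Suc j) {- real (Suc n)..real (Suc n)} (1 / real (Suc n))
      (gdd j (\<lambda>t. f t - rpoly p t))" for n
    by (rule approx) auto
  then obtain q where q: "\<And>n j. j \<le> k \<Longrightarrow> sep (Suc j) {- real (Suc n)..real (Suc n)} (1 / real (Suc n))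
      (gdd j (\<lambda>t. f t - rpoly (q n) t))" by metis
  have "divdiff j f \<in> ipt_space (Suc j) (\<lambda>_. {-r..r}) \<and>
     (\<forall>n. divdiff j (rpoly (q n)) \<in> ipt_space (Suc j) (\<lambda>_. {-r..r})) \<and>
     (\<lambda>n. ipt_norm (Suc j) (\<lambda>_. {-r..r})
            (\<lambda>x. divdiff j (rpoly (q n)) x - divdiff j f x)) \<longlonglongrightarrow> 0"
    if r: "0 < r" and j: "j \<le> k" for r j
  proof (intro conjI allI)
    have fj: "f \<in> C_k j" using C_k_mono[OF f j] .
    have poly: "\<exists>C. sep (Suc j) {-r..r} C (gdd j (rpoly p))" for p
      using sep_gdd_rpoly[of "{-r..r}" r j p] r by (auto simp: abs_le_iff)
    show "divdiff j (rpoly (q n)) \<in> ipt_space (Suc j) (\<lambda>_. {-r..r})" for n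
      using poly[of "q n"] divdiff_in_ipt_space[OF rpoly_C_k] by blast
    \<comment> \<open>The divided difference of f has finite norm because it differs from that of a
      polynomial by one of norm at most 1.\<close>
    obtain p where p: "sep (Suc j) {- r..r} 1 (gdd j (\<lambda>t. f t - rpoly p t))"
      using approx[OF r, of 1] j by auto
    obtain C where C: "sep (Suc j) {-r..r} C (gdd j (rpoly p))" using poly by blast
    have "sep (Suc j) {- r..r} (1 + C) (gdd j f)"
      by (rule sep_cong[OF sep_add[OF p C]]) (simp add: gdd_diff fj rpoly_C_k)
    then show "divdiff j f \<in> ipt_space (Suc j) (\<lambda>_. {-r..r})"
      by (rule divdiff_in_ipt_space[OF fj])
    have bd: "ipt_norm (Suc j) (\<lambda>_. {-r..r}) (\<lambda>x. divdiff j (rpoly (q n)) x - divdiff j f x)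
        \<le> ennreal (1 / real (Suc n))" if n: "r \<le> real (Suc n)" for n
    proof -
      have "sep (Suc j) {- r..r} (1 / real (Suc n)) (gdd j (\<lambda>t. f t - rpoly (q n) t))"
        by (rule sep_mono[OF q[OF j] order_refl]) (use n in auto)
      from sep_cmult[where c = "-1", OF this]
      have "sep (Suc j) {- r..r} (1 / real (Suc n)) (\<lambda>x. - gdd j (\<lambda>t. f t - rpoly (q n) t) x)"
        by auto
      from sep_imp_ipt_norm[OF this]
      have "ipt_norm (Suc j) (\<lambda>_. {-r..r}) (\<lambda>x. - gdd j (\<lambda>t. f t - rpoly (q n) t) x)
        \<le> ennreal (1 / real (Suc n))" .
      moreover have eq: "- gdd j (\<lambda>t. f t - rpoly (q n) t) x = divdiff j (rpoly (q n)) x - divdiff j f x"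
        if "x \<in> {..<Suc j} \<rightarrow>\<^sub>E {-r..r}" for x
        using divdiff_eq_gdd[OF fj, of x] divdiff_eq_gdd[OF rpoly_C_k, of x j "q n"] that
        by (simp add: gdd_diff fj rpoly_C_k PiE_def)
      have "ipt_norm (Suc j) (\<lambda>_. {-r..r}) (\<lambda>x. - gdd j (\<lambda>t. f t - rpoly (q n) t) x) =
          ipt_norm (Suc j) (\<lambda>_. {-r..r}) (\<lambda>x. divdiff j (rpoly (q n)) x - divdiff j f x)"
        by (rule ipt_norm_cong) (rule eq)
      ultimately show ?thesis by simp
    qed
    show "(\<lambda>n. ipt_norm (Suc j) (\<lambda>_. {-r..r})
            (\<lambda>x. divdiff j (rpoly (q n)) x - divdiff j f x)) \<longlonglongrightarrow> 0"
    proof (rule tendsto_sandwich[OF always_eventually _ tendsto_const])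
      show "\<forall>\<^sub>F n in sequentially. ipt_norm (Suc j) (\<lambda>_. {-r..r})
          (\<lambda>x. divdiff j (rpoly (q n)) x - divdiff j f x) \<le> ennreal (1 / real (Suc n))"
      proof (rule eventually_mono[OF eventually_ge_at_top[of "nat \<lceil>r\<rceil>"]])
        fix n assume "nat \<lceil>r\<rceil> \<le> n"
        then have "r \<le> real (Suc n)" by linarith
        then show "ipt_norm (Suc j) (\<lambda>_. {-r..r})
          (\<lambda>x. divdiff j (rpoly (q n)) x - divdiff j f x) \<le> ennreal (1 / real (Suc n))" by (rule bd)
      qed
      have "(\<lambda>n. ennreal (1 / real (Suc n))) \<longlonglongrightarrow> ennreal 0"
        using LIMSEQ_inverse_real_of_nat by (intro tendsto_ennrealI) (simp add: inverse_eq_divide)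
      then show "(\<lambda>n. ennreal (1 / real (Suc n))) \<longlonglongrightarrow> 0" by simp
    qed simp
  qed
  with f show ?thesis unfolding NC_def by blast
qed

section \<open>Functions with Hoelder continuous derivatives\<close>

subsection \<open>Dyadic cells\<close>

definition cell :: "nat \<Rightarrow> real \<Rightarrow> int" where
  "cell s x = \<lfloor>2 ^ s * x\<rfloor>"

text \<open>The left end point of the dyadic cell of x; it plays the part of a centre. Cells are
  half-open, so {-R..<R} with integral R is a union of cells and \<open>cen\<close> maps it into
  itself.\<close>

definition cen :: "nat \<Rightarrow> real \<Rightarrow> real" where
  "cen s x = of_int (cell s x) / 2 ^ s"

definition near :: "nat \<Rightarrow> nat \<Rightarrow> real \<Rightarrow> real \<Rightarrow> complex" where
  "near W s x y = (if \<bar>cell s x - cell s y\<bar> \<le> int W then 1 else 0)"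

lemma cell_measurable [measurable]: "cell s \<in> measurable borel (count_space UNIV)"
  unfolding cell_def by measurable

lemma cen_measurable [measurable]: "cen s \<in> borel_measurable borel"
  unfolding cen_def by measurable

lemma cen_bounds: "cen s x \<le> x" "x < cen s x + 1 / 2 ^ s"
proof -
  have "real_of_int (cell s x) \<le> 2 ^ s * x" "2 ^ s * x < real_of_int (cell s x) + 1"
    unfolding cell_def by linarith+
  then show "cen s x \<le> x" "x < cen s x + 1 / 2 ^ s"
    unfolding cen_def by (simp_all add: field_simps)
qed

lemma cen_in:
  fixes R :: nat
  assumes "x \<in> {- real R..<real R}"
  shows "cen s x \<in> {- real R..<real R}"
proof -
  have "- (int R * 2 ^ s) \<le> cell s x"
    unfolding cell_def le_floor_iff using mult_right_mono[of "- real R" x "2 ^ s"] assms by (simp add: mult.commute)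
  then have "real_of_int (- (int R * 2 ^ s)) \<le> real_of_int (cell s x)" by (simp only: of_int_le_iff)
  then have "- real R \<le> cen s x" unfolding cen_def by (simp add: field_simps)
  with cen_bounds(1)[of s x] assms show ?thesis by auto
qed

lemma cell_bound:
  fixes R :: nat
  assumes "y \<in> {- real R..<real R}"
  shows "\<bar>cell s y\<bar> \<le> int (R * 2 ^ s)"
proof -
  have "real_of_int (cell s y) = cen s y * 2 ^ s" by (simp add: cen_def)
  moreover have "\<bar>cen s y\<bar> \<le> real R" using cen_in[OF assms, of s] by auto
  ultimately have "\<bar>real_of_int (cell s y)\<bar> \<le> real R * 2 ^ s"
    by (simp add: abs_mult mult_right_mono)
  then have "real_of_int \<bar>cell s y\<bar> \<le> real_of_int (int (R * 2 ^ s))" by simp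
  then show ?thesis by (simp only: of_int_le_iff)
qed

lemma cell_Suc: "cell s x = cell (Suc s) x div 2"
proof -
  have "\<lfloor>(2 ^ Suc s * x) / real_of_int 2\<rfloor> = \<lfloor>2 ^ Suc s * x\<rfloor> div 2"
    by (rule floor_divide_real_eq_div) simp
  then show ?thesis by (simp add: cell_def)
qed

lemma near_refl [simp]: "near W s x x = 1"
  by (simp add: near_def)

lemma near_idem: "near W s x y * near W s x y = near W s x y"
  by (simp add: near_def)

text \<open>Halving the indices turns a difference d into one of size at most (d + 1) / 2, and (W +
  1) / 2 <= W for W >= 1.\<close>

lemma near_nested:
  assumes "1 \<le> W"
  shows "near W s x y * near W (Suc s) x y = near W (Suc s) x y"
proof -
  have "\<bar>cell (Suc s) x div 2 - cell (Suc s) y div 2\<bar> \<le> int W"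
    if "\<bar>cell (Suc s) x - cell (Suc s) y\<bar> \<le> int W"
    using that assms by linarith
  then show ?thesis by (simp add: near_def cell_Suc[of s])
qed

lemma sep_cell_diagonal:
  fixes R :: nat
  assumes "i < m" "j < m"
  shows "sep m {- real R..<real R} 1 (\<lambda>x. if cell s (x i) - cell s (x j) = n then 1 else 0)"
  by (rule sep_diagonal[where L = "R * 2 ^ s"]) (use assms cell_bound in auto)

text \<open>On each of the 2 W + 1 diagonals of neighbouring cells the index difference is a
  constant n, so a function of the difference and one variable becomes a function of that variable.
  This is how quantities attached to two cells turn into elementary tensors.\<close>

lemma sep_near_fun:
  fixes R :: nat
  assumes u: "\<And>n. u n \<in> borel_measurable borel"
    and B: "\<And>n y. \<bar>n\<bar> \<le> int W \<Longrightarrow> y \<in> {- real R..<real R} \<Longrightarrow> norm (u n y) \<le> B" "0 \<le> B"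
    and ilv: "i < m" "l < m" "v < m"
  shows "sep m {- real R..<real R} ((2 * real W + 1) * B)
    (\<lambda>x. near W s (x i) (x l) * u (cell s (x l) - cell s (x i)) (x v))"
proof -
  let ?S = "{- real R..<real R}"
  let ?N = "{- int W..int W}"
  have "sep m ?S (\<Sum>n\<in>?N. 1 * B)
      (\<lambda>x. \<Sum>n\<in>?N. (if cell s (x l) - cell s (x i) = n then 1 else 0) * u n (x v))"
  proof (intro sep_sum sep_mult sep_cell_diagonal sep_var)
    fix n y assume "n \<in> ?N" "y \<in> ?S"
    then show "norm (u n y) \<le> B" by (intro B(1)) auto
  qed (use u B(2) ilv in auto)
  moreover have "(\<Sum>n\<in>?N. 1 * B) = (2 * real W + 1) * B" by simp
  moreover have "(\<Sum>n\<in>?N. (if cell s (x l) - cell s (x i) = n then 1 else 0) * u n (x v)) =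
      near W s (x i) (x l) * u (cell s (x l) - cell s (x i)) (x v)" for x
  proof -
    have "(\<Sum>n\<in>?N. (if cell s (x l) - cell s (x i) = n then 1 else 0) * u n (x v)) =
        (\<Sum>n\<in>?N. if cell s (x l) - cell s (x i) = n then u n (x v) else 0)"
      by (intro sum.cong) auto
    then show ?thesis by (auto simp: near_def)
  qed
  ultimately show ?thesis by (simp only:)
qed

lemma sep_near:
  fixes R :: nat
  assumes "i < m" "l < m"
  shows "sep m {- real R..<real R} (2 * real W + 1) (\<lambda>x. near W s (x i) (x l))"
  using sep_near_fun[where u = "\<lambda>_ _. 1" and B = 1 and v = i] assms by simp

lemma sep_near_prod:
  fixes R :: nat
  assumes "finite A" "i < m" "\<And>a. a \<in> A \<Longrightarrow> l a < m"
  shows "sep m {- real R..<real R} ((2 * real W + 1) ^ card A) (\<lambda>x. \<Prod>a\<in>A. near W s (x i) (x (l a)))"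
proof -
  have "sep m {- real R..<real R} (\<Prod>a\<in>A. 2 * real W + 1) (\<lambda>x. \<Prod>a\<in>A. near W s (x i) (x (l a)))"
    using assms by (intro sep_prod sep_near) auto
  then show ?thesis by simp
qed

text \<open>For index difference n, the centre of the cell of x i is (cell s (x l) - n) / 2^s, a
  function of x l alone. The offset is at most one cell length inside the cell of x l plus W further
  cells.\<close>

lemma sep_near_offset:
  fixes R :: nat
  assumes "i < m" "l < m"
  shows "sep m {- real R..<real R} ((2 * real W + 1) * (real W + 1) * (1 / 2 ^ s))
    (\<lambda>x. near W s (x i) (x l) * (of_real (x l) - of_real (cen s (x i))))"
proof -
  let ?u = "\<lambda>n y. of_real (y - (of_int (cell s y - n) / 2 ^ s)) :: complex"
  have "sep m {- real R..<real R} ((2 * real W + 1) * ((real W + 1) * (1 / 2 ^ s)))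
    (\<lambda>x. near W s (x i) (x l) * ?u (cell s (x l) - cell s (x i)) (x l))"
  proof (rule sep_near_fun)
    fix n y assume n: "\<bar>n\<bar> \<le> int W"
    have "\<bar>y - of_int (cell s y - n) / 2 ^ s\<bar> = \<bar>(y - cen s y) + of_int n / 2 ^ s\<bar>"
      by (simp add: cen_def diff_divide_distrib)
    also have "\<dots> \<le> 1 / 2 ^ s + \<bar>of_int n\<bar> / 2 ^ s"
      using cen_bounds[where s = s and x = y] by (intro order_trans[OF abs_triangle_ineq] add_mono) (auto simp: abs_divide)
    also have "\<dots> \<le> 1 / 2 ^ s + real W / 2 ^ s"
      using n by (intro add_left_mono divide_right_mono) auto
    finally show "norm (?u n y) \<le> (real W + 1) * (1 / 2 ^ s)"
      unfolding norm_of_real by (simp add: add_divide_distrib)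
  qed (use assms in auto)
  then show ?thesis by (simp add: cen_def mult_ac)
qed

text \<open>The expansion in powers of v / n has a ratio of norm at most 1/2 and a leading factor of
  modulus at most 1/2, so the costs add up to 1.\<close>

lemma sep_geometric:
  assumes v: "sep m S 1 v" and S: "S \<in> sets borel" and m: "0 < m" and n: "\<bar>n\<bar> \<ge> (2::int)"
  shows "sep m S 1 (\<lambda>x. 1 / (of_int n + v x))"
proof (rule sep_sums[where C = "\<lambda>p. (1 / 2) * (1 / 2) ^ p"])
  have n2: "norm (1 / of_int n :: complex) \<le> 1 / 2"
  proof -
    have "2 \<le> \<bar>real_of_int n\<bar>" using n by linarith
    then show ?thesis by (simp add: norm_divide divide_simps)
  qed
  show "sep m S ((1 / 2) * (1 / 2) ^ p) (\<lambda>x. (1 / of_int n) * (((- 1 / of_int n) * v x) ^ p))" for p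
    using n2 by (intro sep_mult sep_const[OF S m n2] sep_power[OF _ S m] sep_cmult[OF v S m]) (auto simp: norm_divide)
  show "(\<lambda>p. (1 / 2) * (1 / 2) ^ p) sums (1::real)"
    using sums_mult[OF geometric_sums[of "1/2 :: real"], of "1/2"] by simp
  fix x assume "\<And>i. i < m \<Longrightarrow> x i \<in> S"
  then have v1: "norm (v x) \<le> 1" by (rule sep_bound[OF v])
  have "norm (- 1 / of_int n * v x) \<le> 1 / 2 * 1"
    unfolding norm_mult using n2 v1 by (intro mult_mono) (auto simp: norm_divide)
  then have "(\<lambda>p. (1 / of_int n) * (- 1 / of_int n * v x) ^ p) sums
      ((1 / of_int n) * (1 / (1 - (- 1 / of_int n * v x))))"
    by (intro sums_mult geometric_sums) auto
  moreover have "(1 / of_int n) * (1 / (1 - (- 1 / of_int n * v x))) = 1 / (of_int n + v x)"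
    using n by (simp add: field_simps)
  ultimately show "(\<lambda>p. (1 / of_int n) * (- 1 / of_int n * v x) ^ p) sums (1 / (of_int n + v x))" by simp
qed

text \<open>On a pair of cells whose distance is comparable to their size, the Cauchy kernel is a
  convergent geometric series in the offsets from the centres.\<close>

lemma sep_separated_kernel:
  fixes R :: nat
  assumes il: "i < m" "l < m" and W: "1 \<le> W"
  shows "sep m {- real R..<real R} ((2 * real W + 1) * (4 * real W + 3) * 2 ^ Suc s)
    (\<lambda>x. near W s (x i) (x l) * ((1 - near W (Suc s) (x i) (x l)) / of_real (x i - x l)))"
proof -
  let ?S = "{- real R..<real R}"
  have S: "?S \<in> sets borel" by simp
  \<comment> \<open>Indices at level s + 1 whose halves differ by at most W differ by at most 2 W +
    1; not being near at level s + 1 means more than W. Since W >= 1, every n in N has modulus at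
    least 2, as \<open>sep_geometric\<close> requires.\<close>
  define N where "N = {n. int W + 1 \<le> \<bar>n\<bar> \<and> \<bar>n\<bar> \<le> 2 * int W + 1}"
  have N: "N \<subseteq> {- (2 * int W + 1)..2 * int W + 1}" by (auto simp: N_def)
  then have finN: "finite N" using finite_subset by blast
  have "card N \<le> card {- (2 * int W + 1)..2 * int W + 1}" using N by (intro card_mono) auto
  also have "\<dots> = 4 * W + 3" by simp
  finally have cN: "real (card N) \<le> 4 * real W + 3" by linarith
  \<comment> \<open>The position relative to the midpoint of the cell, in units of the cell length:
    2^(s+1) (x i - x l) = n + \<sigma> (x i) - \<sigma> (x l), and the difference of the two offsets
    has modulus at most 1.\<close>
  define \<sigma> where "\<sigma> y = 2 ^ Suc s * y - of_int (cell (Suc s) y) - 1 / 2" for y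
  have \<sigma>: "\<bar>\<sigma> y\<bar> \<le> 1 / 2" for y unfolding \<sigma>_def cell_def by linarith
  have \<sigma>m: "\<sigma> \<in> borel_measurable borel" unfolding \<sigma>_def by measurable
  have sv: "sep m ?S (1 / 2) (\<lambda>x. of_real (\<sigma> (x v)))" if "v < m" for v
    by (rule sep_var[where g = "\<lambda>y. of_real (\<sigma> y)"]) (use that \<sigma> \<sigma>m in auto)
  have "sep m ?S (1 / 2 + 1 / 2) (\<lambda>x. of_real (\<sigma> (x i)) - of_real (\<sigma> (x l)))"
    by (intro sep_diff sv il) (use il in auto)
  then have sv2: "sep m ?S 1 (\<lambda>x. of_real (\<sigma> (x i)) - of_real (\<sigma> (x l)))" by simp
  let ?t = "\<lambda>n x. (if cell (Suc s) (x i) - cell (Suc s) (x l) = n then 1 else 0) *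
    (1 / (of_int n + (of_real (\<sigma> (x i)) - of_real (\<sigma> (x l))))) :: complex"
  have "sep m ?S (\<Sum>n\<in>N. 1 * 1) (\<lambda>x. \<Sum>n\<in>N. ?t n x)"
  proof (intro sep_sum sep_mult sep_cell_diagonal sep_geometric sv2)
    show "\<bar>n\<bar> \<ge> 2" if "n \<in> N" for n using that W by (auto simp: N_def)
  qed (use finN il in auto)
  then have "sep m ?S ((2 * real W + 1) * (2 ^ Suc s * (\<Sum>n\<in>N. 1 * 1)))
      (\<lambda>x. near W s (x i) (x l) * (2 ^ Suc s * (\<Sum>n\<in>N. ?t n x)))"
    using il by (intro sep_mult[OF sep_near] sep_cmult) (auto simp: norm_power)
  then have 1: "sep m ?S ((2 * real W + 1) * (4 * real W + 3) * 2 ^ Suc s)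
      (\<lambda>x. near W s (x i) (x l) * (2 ^ Suc s * (\<Sum>n\<in>N. ?t n x)))"
    by (rule sep_mono) (use cN in \<open>auto simp: mult_ac intro!: mult_left_mono\<close>)
  show ?thesis
  proof (rule sep_cong[OF 1])
    fix x :: "nat \<Rightarrow> real"
    define d where "d = cell (Suc s) (x i) - cell (Suc s) (x l)"
    have sum: "(\<Sum>n\<in>N. ?t n x) = (if d \<in> N then 1 / (of_int d + (of_real (\<sigma> (x i)) - of_real (\<sigma> (x l)))) else 0)"
    proof -
      have "(\<Sum>n\<in>N. ?t n x) = (\<Sum>n\<in>N. if d = n then 1 / (of_int n + (of_real (\<sigma> (x i)) - of_real (\<sigma> (x l)))) else 0)"
        by (intro sum.cong) (auto simp: d_def)
      then show ?thesis using finN by simp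
    qed
    have e: "of_int d + (of_real (\<sigma> (x i)) - of_real (\<sigma> (x l))) = (2 ^ Suc s * of_real (x i - x l) :: complex)"
    proof -
      have "real_of_int d + (\<sigma> (x i) - \<sigma> (x l)) = 2 ^ Suc s * (x i - x l)"
        by (simp add: d_def \<sigma>_def algebra_simps)
      then have "complex_of_real (real_of_int d + (\<sigma> (x i) - \<sigma> (x l))) = of_real (2 ^ Suc s * (x i - x l))"
        by (simp only:)
      then show ?thesis by simp
    qed
    have "near W s (x i) (x l) = 1 \<Longrightarrow> d \<in> N \<longleftrightarrow> near W (Suc s) (x i) (x l) = 0"
      unfolding N_def near_def d_def cell_Suc[of s] mem_Collect_eq abs_le_iff
      by (simp split: if_splits) linarith
    moreover have "near W s (x i) (x l) = 0 \<or> near W s (x i) (x l) = 1"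
      "near W (Suc s) (x i) (x l) = 0 \<or> near W (Suc s) (x i) (x l) = 1" by (auto simp: near_def)
    ultimately show "near W s (x i) (x l) * (2 ^ Suc s * (\<Sum>n\<in>N. ?t n x)) =
        near W s (x i) (x l) * ((1 - near W (Suc s) (x i) (x l)) / of_real (x i - x l))"
      unfolding sum e by auto
  qed
qed

subsection \<open>Local polynomials\<close>

lemma C_k_power_linear: "(\<lambda>y. (of_real y - c) ^ l) \<in> C_k k"
  by (intro C_k_power C_k_of_real)

lemma gdd_power_linear_Suc:
  "gdd (Suc j) (\<lambda>y. (of_real y - c) ^ Suc l) x =
    gdd (Suc j) (\<lambda>y. (of_real y - c) ^ l) x * (of_real (x (Suc j)) - c) + gdd j (\<lambda>y. (of_real y - c) ^ l) x"
  using gdd_mult_linear[OF C_k_power_linear, where c = c] by (simp add: mult.commute)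

lemma gdd_power_linear_less: "l < j \<Longrightarrow> gdd j (\<lambda>y. (of_real y - c) ^ l) x = 0"
proof (induction l arbitrary: j)
  case (Suc l)
  then obtain i where "j = Suc i" by (cases j) auto
  with Suc show ?case by (simp add: gdd_power_linear_Suc del: power_Suc)
qed (simp add: gdd_const)

lemma gdd_power_linear_eq: "gdd j (\<lambda>y. (of_real y - c) ^ j) x = 1"
  by (induction j) (simp_all add: gdd_const gdd_power_linear_Suc gdd_power_linear_less del: power_Suc)

lemma gdd_power_linear_diagonal:
  assumes "\<And>i. i \<le> j \<Longrightarrow> x i = b"
  shows "gdd j (\<lambda>y. (of_real y - c) ^ l) x = of_nat (l choose j) * (of_real b - c) ^ (l - j)"
  using assms
proof (induction l arbitrary: j)
  case 0
  then show ?case by (cases j) (simp_all add: gdd_const)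
next
  case (Suc l)
  show ?case
  proof (cases j)
    case 0
    then show ?thesis using Suc.prems by simp
  next
    case (Suc i)
    have "gdd (Suc i) (\<lambda>y. (of_real y - c) ^ Suc l) x =
        of_nat (l choose Suc i) * (of_real b - c) ^ (l - Suc i) * (of_real b - c) +
        of_nat (l choose i) * (of_real b - c) ^ (l - i)"
      unfolding gdd_power_linear_Suc using Suc.IH[of "Suc i"] Suc.IH[of i] Suc.prems Suc by simp
    also have "of_nat (l choose Suc i) * (of_real b - c) ^ (l - Suc i) * (of_real b - c) =
        of_nat (l choose Suc i) * (of_real b - c) ^ (l - i)"
    proof (cases "l < Suc i")
      case False
      then have "l - i = Suc (l - Suc i)" by simp
      then show ?thesis by simp
    qed (simp add: binomial_eq_0)
    finally show ?thesis using Suc by (simp add: algebra_simps)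
  qed
qed

text \<open>The base point x 0 is kept apart from the nodes x 1, ..., x (j + 1), so that it may
  later be one of the nodes or a node just removed. Each further factor y - c either contributes an
  offset of size 2^-s or lowers the order by one; this yields the exponent l - j, truncated at
  0.\<close>

lemma sep_local_power:
  fixes R :: nat
  shows "\<exists>K\<ge>0. \<forall>s. sep (Suc (Suc j)) {- real R..<real R} (K * (1 / 2 ^ s) ^ (l - j))
    (\<lambda>x. (\<Prod>i\<le>j. near W s (x 0) (x (Suc i))) *
      gdd j (\<lambda>y. (of_real y - of_real (cen s (x 0))) ^ l) (\<lambda>i. x (Suc i)))"
proof (induction l arbitrary: j)
  case 0
  show ?case
  proof (intro exI[of _ "(2 * real W + 1) ^ Suc j"] conjI allI)
    fix s
    have "sep (Suc (Suc j)) {- real R..<real R} ((2 * real W + 1) ^ card {..j} * 1)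
      (\<lambda>x. (\<Prod>i\<le>j. near W s (x 0) (x (Suc i))) * (if j = 0 then 1 else 0))"
      by (intro sep_mult sep_near_prod sep_const) auto
    then show "sep (Suc (Suc j)) {- real R..<real R} ((2 * real W + 1) ^ Suc j * (1 / 2 ^ s) ^ (0 - j))
      (\<lambda>x. (\<Prod>i\<le>j. near W s (x 0) (x (Suc i))) *
        gdd j (\<lambda>y. (of_real y - of_real (cen s (x 0))) ^ 0) (\<lambda>i. x (Suc i)))"
      by (simp add: gdd_const)
  qed simp
next
  case (Suc l)
  let ?S = "{- real R..<real R}"
  let ?A = "(2 * real W + 1) * (real W + 1)"
  have A: "0 \<le> ?A" by simp
  obtain K1 where K1: "0 \<le> K1" "\<And>s. sep (Suc (Suc j)) ?S (K1 * (1 / 2 ^ s) ^ (l - j))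
    (\<lambda>x. (\<Prod>i\<le>j. near W s (x 0) (x (Suc i))) *
      gdd j (\<lambda>y. (of_real y - of_real (cen s (x 0))) ^ l) (\<lambda>i. x (Suc i)))"
    using Suc.IH[of j] by blast
  have first: "sep (Suc (Suc j)) ?S (K1 * ?A * (1 / 2 ^ s) ^ (Suc l - j))
    (\<lambda>x. (\<Prod>i\<le>j. near W s (x 0) (x (Suc i))) *
      (gdd j (\<lambda>y. (of_real y - of_real (cen s (x 0))) ^ l) (\<lambda>i. x (Suc i)) *
        (of_real (x (Suc j)) - of_real (cen s (x 0)))))" for s
  proof -
    have "sep (Suc (Suc j)) ?S ((K1 * (1 / 2 ^ s) ^ (l - j)) * (?A * (1 / 2 ^ s)))
      (\<lambda>x. ((\<Prod>i\<le>j. near W s (x 0) (x (Suc i))) *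
        gdd j (\<lambda>y. (of_real y - of_real (cen s (x 0))) ^ l) (\<lambda>i. x (Suc i))) *
        (near W s (x 0) (x (Suc j)) * (of_real (x (Suc j)) - of_real (cen s (x 0)))))"
      by (intro sep_mult[OF K1(2) sep_near_offset]) auto
    then have "sep (Suc (Suc j)) ?S (K1 * ?A * (1 / 2 ^ s) ^ (Suc l - j))
      (\<lambda>x. ((\<Prod>i\<le>j. near W s (x 0) (x (Suc i))) *
        gdd j (\<lambda>y. (of_real y - of_real (cen s (x 0))) ^ l) (\<lambda>i. x (Suc i))) *
        (near W s (x 0) (x (Suc j)) * (of_real (x (Suc j)) - of_real (cen s (x 0)))))"
    proof (rule sep_mono)
      \<comment> \<open>For l < j the natural subtraction truncates and Suc (l - j) exceeds Suc l -
        j; the extra power is at most 1.\<close>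
      have "(1 / 2 ^ s) ^ Suc (l - j) \<le> (1 / 2 ^ s :: real) ^ (Suc l - j)"
        by (rule power_decreasing) auto
      then have "(K1 * ?A) * (1 / 2 ^ s) ^ Suc (l - j) \<le> (K1 * ?A) * (1 / 2 ^ s) ^ (Suc l - j)"
        using K1(1) A by (intro mult_left_mono) auto
      then show "(K1 * (1 / 2 ^ s) ^ (l - j)) * (?A * (1 / 2 ^ s)) \<le> K1 * ?A * (1 / 2 ^ s) ^ (Suc l - j)"
        by (simp add: mult_ac)
    qed simp
    then show ?thesis
    proof (rule sep_cong)
      fix x :: "nat \<Rightarrow> real"
      have "(\<Prod>i\<le>j. near W s (x 0) (x (Suc i))) =
          near W s (x 0) (x (Suc j)) * (\<Prod>i\<in>{..j} - {j}. near W s (x 0) (x (Suc i)))"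
        by (rule prod.remove) auto
      then have idem: "(\<Prod>i\<le>j. near W s (x 0) (x (Suc i))) * near W s (x 0) (x (Suc j)) =
          (\<Prod>i\<le>j. near W s (x 0) (x (Suc i)))"
        using near_idem[of W s "x 0" "x (Suc j)"] by (auto simp: mult_ac)
      have swap: "(P * g) * (e * u) = (P * e) * (g * u)" for P g e u :: complex
        by (simp add: mult_ac)
      show "(\<Prod>i\<le>j. near W s (x 0) (x (Suc i))) *
          gdd j (\<lambda>y. (of_real y - of_real (cen s (x 0))) ^ l) (\<lambda>i. x (Suc i)) *
          (near W s (x 0) (x (Suc j)) * (of_real (x (Suc j)) - of_real (cen s (x 0)))) =
        (\<Prod>i\<le>j. near W s (x 0) (x (Suc i))) *
          (gdd j (\<lambda>y. (of_real y - of_real (cen s (x 0))) ^ l) (\<lambda>i. x (Suc i)) *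
            (of_real (x (Suc j)) - of_real (cen s (x 0))))"
        unfolding swap idem ..
    qed
  qed
  show ?case
  proof (cases j)
    case 0
    show ?thesis
      by (rule exI[of _ "K1 * ?A"]) (use first K1(1) 0 in \<open>simp add: mult_ac\<close>)
  next
    case (Suc i)
    obtain K2 where K2: "0 \<le> K2" "\<And>s. sep (Suc (Suc i)) ?S (K2 * (1 / 2 ^ s) ^ (l - i))
      (\<lambda>x. (\<Prod>a\<le>i. near W s (x 0) (x (Suc a))) *
        gdd i (\<lambda>y. (of_real y - of_real (cen s (x 0))) ^ l) (\<lambda>a. x (Suc a)))"
      using Suc.IH[of i] by blast
    show ?thesis
    proof (intro exI[of _ "K1 * ?A + (2 * real W + 1) * K2"] conjI allI)
      show "0 \<le> K1 * ?A + (2 * real W + 1) * K2" using K1(1) K2(1) by simp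
      fix s
      have "sep (Suc (Suc j)) ?S (K2 * (1 / 2 ^ s) ^ (l - i))
        (\<lambda>x. (\<Prod>a\<le>i. near W s (x 0) (x (Suc a))) *
          gdd i (\<lambda>y. (of_real y - of_real (cen s (x 0))) ^ l) (\<lambda>a. x (Suc a)))"
        using sep_reindex[OF K2(2)[of s], of "\<lambda>a. a" "Suc (Suc j)"] Suc by simp
      from sep_add[OF first sep_mult[OF sep_near this]]
      have "sep (Suc (Suc j)) ?S (K1 * ?A * (1 / 2 ^ s) ^ (Suc l - j) +
          (2 * real W + 1) * (K2 * (1 / 2 ^ s) ^ (l - i)))
        (\<lambda>x. (\<Prod>i\<le>j. near W s (x 0) (x (Suc i))) *
            (gdd j (\<lambda>y. (of_real y - of_real (cen s (x 0))) ^ l) (\<lambda>i. x (Suc i)) *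
              (of_real (x (Suc j)) - of_real (cen s (x 0)))) +
          near W s (x 0) (x (Suc j)) * ((\<Prod>a\<le>i. near W s (x 0) (x (Suc a))) *
            gdd i (\<lambda>y. (of_real y - of_real (cen s (x 0))) ^ l) (\<lambda>a. x (Suc a))))" by simp
      then show "sep (Suc (Suc j)) ?S ((K1 * ?A + (2 * real W + 1) * K2) * (1 / 2 ^ s) ^ (Suc l - j))
        (\<lambda>x. (\<Prod>i\<le>j. near W s (x 0) (x (Suc i))) *
          gdd j (\<lambda>y. (of_real y - of_real (cen s (x 0))) ^ Suc l) (\<lambda>i. x (Suc i)))"
      proof (rule sep_cong[OF sep_mono[OF _ _ order_refl]])
        show "K1 * ?A * (1 / 2 ^ s) ^ (Suc l - j) + (2 * real W + 1) * (K2 * (1 / 2 ^ s) ^ (l - i))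
            \<le> (K1 * ?A + (2 * real W + 1) * K2) * (1 / 2 ^ s) ^ (Suc l - j)"
          using Suc by (simp only: diff_Suc_Suc) (simp only: distrib_right mult.assoc order_refl)
        fix x :: "nat \<Rightarrow> real"
        have alg: "p * n * (g * o' + h) = p * n * (g * o') + n * (p * h)" for p n g o' h :: complex
          by (simp add: algebra_simps)
        show "(\<Prod>i\<le>j. near W s (x 0) (x (Suc i))) *
            (gdd j (\<lambda>y. (of_real y - of_real (cen s (x 0))) ^ l) (\<lambda>i. x (Suc i)) *
              (of_real (x (Suc j)) - of_real (cen s (x 0)))) +
          near W s (x 0) (x (Suc j)) * ((\<Prod>a\<le>i. near W s (x 0) (x (Suc a))) *
            gdd i (\<lambda>y. (of_real y - of_real (cen s (x 0))) ^ l) (\<lambda>a. x (Suc a))) =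
          (\<Prod>i\<le>j. near W s (x 0) (x (Suc i))) *
            gdd j (\<lambda>y. (of_real y - of_real (cen s (x 0))) ^ Suc l) (\<lambda>i. x (Suc i))"
          unfolding Suc gdd_power_linear_Suc prod.atMost_Suc alg ..
      qed
    qed
  qed
qed

subsection \<open>Taylor polynomials at the cell centres\<close>

definition tay :: "nat \<Rightarrow> (real \<Rightarrow> complex) \<Rightarrow> real \<Rightarrow> real \<Rightarrow> complex" where
  "tay k f b y = (\<Sum>l\<le>k. nth_deriv l f b / fact l * (of_real y - of_real b) ^ l)"

text \<open>The l-th Taylor coefficient at a of f minus its Taylor polynomial of degree k at b; by
  \<open>tay_rebase\<close> it is also the coefficient of (y - a)^l in the difference of the two
  Taylor polynomials.\<close>

definition tcoef :: "nat \<Rightarrow> (real \<Rightarrow> complex) \<Rightarrow> nat \<Rightarrow> real \<Rightarrow> real \<Rightarrow> complex" where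
  "tcoef k f l a b =
     (nth_deriv l f a - (\<Sum>p\<le>k - l. nth_deriv (l + p) f b * of_real (a - b) ^ p / fact p)) / fact l"

text \<open>The conditions of a Whitney jet of class C^(k,\<epsilon>) on I. They stand in for the
  Hoelder condition because it is these Taylor remainders that enter the cell estimates.\<close>

definition jet :: "nat \<Rightarrow> real set \<Rightarrow> real \<Rightarrow> real \<Rightarrow> (real \<Rightarrow> complex) \<Rightarrow> bool" where
  "jet k I \<epsilon> M f \<longleftrightarrow> f \<in> C_k k \<and> 0 \<le> M \<and> (\<forall>l\<le>k. \<forall>a\<in>I. \<forall>b\<in>I.
     norm (tcoef k f l a b) \<le> M * \<bar>a - b\<bar> ^ (k - l) * \<bar>a - b\<bar> powr \<epsilon>)"

lemma tay_rebase:
  "tay k f a y - tay k f b y = (\<Sum>l\<le>k. tcoef k f l a b * (of_real y - of_real a) ^ l)"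
proof -
  let ?F = "\<lambda>l. nth_deriv l f b"
  let ?Y = "of_real y - of_real a :: complex"
  let ?D = "of_real (a - b) :: complex"
  let ?g = "\<lambda>l p. ?F (l + p) * ?Y ^ l * ?D ^ p / (fact l * fact p)"
  have "tay k f b y = (\<Sum>n\<le>k. ?F n / fact n * (?Y + ?D) ^ n)"
    by (simp add: tay_def)
  also have "\<dots> = (\<Sum>n\<le>k. \<Sum>l\<le>n. ?g l (n - l))"
  proof (intro sum.cong refl)
    fix n
    have "?F n / fact n * (?Y + ?D) ^ n = (\<Sum>l\<le>n. ?F n / fact n * (of_nat (n choose l) * ?Y ^ l * ?D ^ (n - l)))"
      by (simp only: binomial_ring sum_distrib_left)
    also have "\<dots> = (\<Sum>l\<le>n. ?g l (n - l))"
      by (intro sum.cong refl) (simp add: binomial_fact field_simps)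
    finally show "?F n / fact n * (?Y + ?D) ^ n = (\<Sum>l\<le>n. ?g l (n - l))" .
  qed
  also have "\<dots> = (\<Sum>(l, p)\<in>{(l, p). l + p \<le> k}. ?g l p)"
    by (rule sum.triangle_reindex_eq[symmetric])
  also have "{(l, p). l + p \<le> k} = Sigma {..k} (\<lambda>l. {..k - l})" by auto
  also have "(\<Sum>(l, p)\<in>Sigma {..k} (\<lambda>l. {..k - l}). ?g l p) = (\<Sum>l\<le>k. \<Sum>p\<le>k - l. ?g l p)"
    by (rule sum.Sigma[symmetric]) auto
  also have "\<dots> = (\<Sum>l\<le>k. (\<Sum>p\<le>k - l. ?F (l + p) * ?D ^ p / fact p) / fact l * ?Y ^ l)"
    by (intro sum.cong refl) (simp add: sum_divide_distrib sum_distrib_left sum_distrib_right field_simps)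
  finally show ?thesis
    unfolding tay_def[of k f a] tcoef_def
    by (simp add: sum_subtractf[symmetric] diff_divide_distrib left_diff_distrib)
qed

lemma tay_C_k: "tay k f b \<in> C_k j"
  unfolding tay_def by (intro C_k_sum C_k_cmult C_k_power_linear)

lemma gdd_tay_diff:
  "gdd j (\<lambda>y. tay k f a y - tay k f b y) x =
    (\<Sum>l\<le>k. tcoef k f l a b * gdd j (\<lambda>y. (of_real y - of_real a) ^ l) x)"
  unfolding tay_rebase
  by (subst gdd_sum) (auto intro!: C_k_cmult C_k_power_linear simp: gdd_cmult[OF C_k_power_linear])

lemma gdd_tay:
  "gdd j (tay k f b) x = (\<Sum>l\<le>k. nth_deriv l f b / fact l * gdd j (\<lambda>y. (of_real y - of_real b) ^ l) x)"
  unfolding tay_def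
  by (subst gdd_sum) (auto intro!: C_k_cmult C_k_power_linear simp: gdd_cmult[OF C_k_power_linear] simp del: times_divide_eq_left)

text \<open>On the diagonal a divided difference of order j is the j-th Taylor coefficient. This is
  what makes the localised differences tend to 0 there.\<close>

lemma gdd_tay_diagonal:
  assumes f: "f \<in> C_k k" and j: "j \<le> k" and x: "\<And>i. i \<le> j \<Longrightarrow> x i = a"
  shows "gdd j (\<lambda>y. f y - tay k f b y) x = tcoef k f j a b"
proof -
  have "gdd j (tay k f b) x = (\<Sum>l\<le>k. nth_deriv l f b / fact l * (of_nat (l choose j) * of_real (a - b) ^ (l - j)))"
    unfolding gdd_tay using gdd_power_linear_diagonal[OF x] by simp
  also have "\<dots> = (\<Sum>l\<in>{j..k}. nth_deriv l f b / fact l * (of_nat (l choose j) * of_real (a - b) ^ (l - j)))"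
    by (rule sum.mono_neutral_right) (auto simp: binomial_eq_0)
  also have "\<dots> = (\<Sum>p\<le>k - j. nth_deriv (j + p) f b / fact (j + p) * (of_nat ((j + p) choose j) * of_real (a - b) ^ p))"
    by (rule sum.reindex_bij_witness[of _ "\<lambda>p. j + p" "\<lambda>l. l - j"]) (use j in auto)
  also have "\<dots> = (\<Sum>p\<le>k - j. nth_deriv (j + p) f b * of_real (a - b) ^ p / fact p) / fact j"
    unfolding sum_divide_distrib by (intro sum.cong refl) (simp add: binomial_fact field_simps)
  finally have "gdd j (tay k f b) x = (\<Sum>p\<le>k - j. nth_deriv (j + p) f b * of_real (a - b) ^ p / fact p) / fact j" .
  then show ?thesis
    using gdd_diagonal[OF C_k_mono[OF f j], of x a] x
    by (simp add: gdd_diff C_k_mono[OF f j] tay_C_k tcoef_def diff_divide_distrib)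
qed

lemma nth_deriv_measurable: "f \<in> C_k k \<Longrightarrow> l \<le> k \<Longrightarrow> nth_deriv l f \<in> borel_measurable borel"
  using C_k_mono[of f k l] by (auto simp: C_k_def intro: borel_measurable_continuous_onI)

lemma tcoef_measurable:
  assumes "f \<in> C_k k" "l \<le> k" "a \<in> borel_measurable borel" "b \<in> borel_measurable borel"
  shows "(\<lambda>y. tcoef k f l (a y) (b y)) \<in> borel_measurable borel"
proof -
  have [measurable]: "a \<in> borel_measurable borel" "b \<in> borel_measurable borel" by fact+
  have "(\<lambda>y. nth_deriv (l + p) f (b y)) \<in> borel_measurable borel" if "p \<le> k - l" for p
    by (rule measurable_compose[OF assms(4) nth_deriv_measurable[OF assms(1)]]) (use assms(2) that in auto)
  then have "(\<lambda>y. \<Sum>p\<le>k - l. nth_deriv (l + p) f (b y) * of_real (a y - b y) ^ p / fact p) \<in> borel_measurable borel"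
    by (intro borel_measurable_sum borel_measurable_divide borel_measurable_times) auto
  moreover have "(\<lambda>y. nth_deriv l f (a y)) \<in> borel_measurable borel"
    by (rule measurable_compose[OF assms(3) nth_deriv_measurable[OF assms(1,2)]])
  ultimately show ?thesis unfolding tcoef_def by (intro borel_measurable_divide borel_measurable_diff) auto
qed

lemma powr_half_power: "(1 / 2 ^ s) powr \<epsilon> = (2 powr - \<epsilon>) ^ s" for \<epsilon> :: real
proof -
  have "(1 / 2 ^ s) powr \<epsilon> = (2 powr (- real s)) powr \<epsilon>"
    by (simp add: powr_minus powr_realpow divide_inverse)
  also have "\<dots> = (2 powr - \<epsilon>) powr real s" by (simp add: powr_powr mult.commute)
  also have "\<dots> = (2 powr - \<epsilon>) ^ s" by (simp add: powr_realpow)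
  finally show ?thesis .
qed

lemma cen_Suc_diff: "\<bar>cen (Suc s) y - cen s y\<bar> \<le> 1 / 2 ^ Suc s"
proof -
  have "cell (Suc s) y - 2 * cell s y = cell (Suc s) y mod 2"
    unfolding cell_Suc[of s] by (simp add: minus_mult_div_eq_mod)
  then have "\<bar>cell (Suc s) y - 2 * cell s y\<bar> \<le> 1" by simp
  then have "\<bar>real_of_int (cell (Suc s) y) - 2 * real_of_int (cell s y)\<bar> \<le> 1" by linarith
  moreover have "cen (Suc s) y - cen s y = (real_of_int (cell (Suc s) y) - 2 * real_of_int (cell s y)) / 2 ^ Suc s"
    unfolding cen_def by (simp add: field_simps)
  ultimately show ?thesis by (simp add: abs_divide divide_right_mono)
qed

text \<open>A coefficient of size D 2^(-s (k-l)) meets a local power of size 2^(-s (l-j)), so no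
  degree l exceeds the order 2^(-s (k-j)). The coefficients u are left abstract because they depend
  on one variable in the change of scale and on two cells in the change of base point.\<close>

lemma sep_local_polynomial:
  fixes R :: nat
  assumes "j \<le> k"
  shows "\<exists>K\<ge>0. \<forall>s D u. 0 \<le> D \<longrightarrow>
    (\<forall>l\<le>k. sep (Suc (Suc j)) {- real R..<real R} (D * (1 / 2 ^ s) ^ (k - l)) (u l)) \<longrightarrow>
    sep (Suc (Suc j)) {- real R..<real R} (K * D * (1 / 2 ^ s) ^ (k - j))
      (\<lambda>x. \<Sum>l\<le>k. u l x * ((\<Prod>i\<le>j. near W s (x 0) (x (Suc i))) *
        gdd j (\<lambda>y. (of_real y - of_real (cen s (x 0))) ^ l) (\<lambda>i. x (Suc i))))"
proof -
  let ?I = "{- real R..<real R}"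
  have "\<forall>l. \<exists>K\<ge>0. \<forall>s. sep (Suc (Suc j)) ?I (K * (1 / 2 ^ s) ^ (l - j))
    (\<lambda>x. (\<Prod>i\<le>j. near W s (x 0) (x (Suc i))) *
      gdd j (\<lambda>y. (of_real y - of_real (cen s (x 0))) ^ l) (\<lambda>i. x (Suc i)))"
    by (intro allI sep_local_power)
  from choice[OF this] obtain K where K0: "\<forall>l. 0 \<le> K l \<and> (\<forall>s. sep (Suc (Suc j)) ?I (K l * (1 / 2 ^ s) ^ (l - j))
    (\<lambda>x. (\<Prod>i\<le>j. near W s (x 0) (x (Suc i))) *
      gdd j (\<lambda>y. (of_real y - of_real (cen s (x 0))) ^ l) (\<lambda>i. x (Suc i))))"
    by (rule exE)
  note K = K0[THEN spec, THEN conjunct1] K0[THEN spec, THEN conjunct2, THEN spec]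
  show ?thesis
  proof (intro exI[of _ "\<Sum>l\<le>k. K l"] conjI allI impI)
    show "0 \<le> (\<Sum>l\<le>k. K l)" using K(1) by (intro sum_nonneg)
    fix s D u assume D: "0 \<le> (D::real)"
      and u: "\<forall>l\<le>k. sep (Suc (Suc j)) ?I (D * (1 / 2 ^ s) ^ (k - l)) (u l)"
    have "sep (Suc (Suc j)) ?I (\<Sum>l\<le>k. (D * (1 / 2 ^ s) ^ (k - l)) * (K l * (1 / 2 ^ s) ^ (l - j)))
      (\<lambda>x. \<Sum>l\<le>k. u l x * ((\<Prod>i\<le>j. near W s (x 0) (x (Suc i))) *
        gdd j (\<lambda>y. (of_real y - of_real (cen s (x 0))) ^ l) (\<lambda>i. x (Suc i))))"
      by (intro sep_sum sep_mult K(2)) (use u in auto)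
    then show "sep (Suc (Suc j)) ?I ((\<Sum>l\<le>k. K l) * D * (1 / 2 ^ s) ^ (k - j))
      (\<lambda>x. \<Sum>l\<le>k. u l x * ((\<Prod>i\<le>j. near W s (x 0) (x (Suc i))) *
        gdd j (\<lambda>y. (of_real y - of_real (cen s (x 0))) ^ l) (\<lambda>i. x (Suc i))))"
    proof (rule sep_mono)
      show "(\<Sum>l\<le>k. (D * (1 / 2 ^ s) ^ (k - l)) * (K l * (1 / 2 ^ s) ^ (l - j)))
          \<le> (\<Sum>l\<le>k. K l) * D * (1 / 2 ^ s) ^ (k - j)"
        unfolding sum_distrib_right
      proof (rule sum_mono)
        fix l assume l: "l \<in> {..k}"
        have "(1 / 2 ^ s) ^ (k - l) * (1 / 2 ^ s) ^ (l - j) = (1 / 2 ^ s :: real) ^ ((k - l) + (l - j))"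
          by (simp add: power_add)
        also have "\<dots> \<le> (1 / 2 ^ s) ^ (k - j)"
          by (rule power_decreasing) (use l in auto)
        finally have "(K l * D) * ((1 / 2 ^ s) ^ (k - l) * (1 / 2 ^ s) ^ (l - j)) \<le> (K l * D) * (1 / 2 ^ s) ^ (k - j)"
          using K(1) D by (intro mult_left_mono) auto
        then show "(D * (1 / 2 ^ s) ^ (k - l)) * (K l * (1 / 2 ^ s) ^ (l - j)) \<le> K l * D * (1 / 2 ^ s) ^ (k - j)"
          by (simp add: mult_ac)
      qed
    qed simp
  qed
qed

lemma jet_tcoef_le:
  assumes "jet k I \<epsilon> M f" "l \<le> k" "a \<in> I" "b \<in> I" "\<bar>a - b\<bar> \<le> d" "0 < \<epsilon>"
  shows "norm (tcoef k f l a b) \<le> M * d ^ (k - l) * d powr \<epsilon>"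
proof -
  have "norm (tcoef k f l a b) \<le> M * \<bar>a - b\<bar> ^ (k - l) * \<bar>a - b\<bar> powr \<epsilon>"
    using assms by (auto simp: jet_def)
  also have "\<dots> \<le> M * d ^ (k - l) * d powr \<epsilon>"
    using assms by (intro mult_mono mult_left_mono power_mono powr_mono2 mult_nonneg_nonneg zero_le_power) (auto simp: jet_def)
  finally show ?thesis .
qed

lemma sep_tay_refine:
  fixes R :: nat
  assumes "j \<le> k" and \<epsilon>: "0 < \<epsilon>"
  shows "\<exists>K\<ge>0. \<forall>f M s. jet k {- real R..<real R} \<epsilon> M f \<longrightarrow>
    sep (Suc j) {- real R..<real R} (K * M * ((1 / 2 ^ Suc s) ^ (k - j) * (2 powr - \<epsilon>) ^ Suc s))
      (\<lambda>x. (\<Prod>i\<le>j. near W (Suc s) (x 0) (x i)) *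
        gdd j (\<lambda>y. tay k f (cen (Suc s) (x 0)) y - tay k f (cen s (x 0)) y) x)"
proof -
  let ?I = "{- real R..<real R}"
  obtain K where K0: "0 \<le> K \<and> (\<forall>s D u. 0 \<le> D \<longrightarrow>
    (\<forall>l\<le>k. sep (Suc (Suc j)) ?I (D * (1 / 2 ^ s) ^ (k - l)) (u l)) \<longrightarrow>
    sep (Suc (Suc j)) ?I (K * D * (1 / 2 ^ s) ^ (k - j))
      (\<lambda>x. \<Sum>l\<le>k. u l x * ((\<Prod>i\<le>j. near W s (x 0) (x (Suc i))) *
        gdd j (\<lambda>y. (of_real y - of_real (cen s (x 0))) ^ l) (\<lambda>i. x (Suc i)))))"
    using sep_local_polynomial[OF assms(1), of R W] by (rule exE)
  note K = K0[THEN conjunct1] K0[THEN conjunct2, rule_format]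
  show ?thesis
  proof (intro exI[of _ K] conjI allI impI)
    fix f M s assume jet: "jet k ?I \<epsilon> M f"
    let ?q = "2 powr - \<epsilon>"
    let ?u = "\<lambda>l (x :: nat \<Rightarrow> real). tcoef k f l (cen (Suc s) (x 0)) (cen s (x 0))"
    have "sep (Suc (Suc j)) ?I ((M * ?q ^ Suc s) * (1 / 2 ^ Suc s) ^ (k - l)) (?u l)" if l: "l \<le> k" for l
    proof (rule sep_var[where g = "\<lambda>y. tcoef k f l (cen (Suc s) y) (cen s y)"])
      show "norm (tcoef k f l (cen (Suc s) y) (cen s y)) \<le> M * ?q ^ Suc s * (1 / 2 ^ Suc s) ^ (k - l)"
        if "y \<in> ?I" for y
        using jet_tcoef_le[OF jet l cen_in[OF that] cen_in[OF that] cen_Suc_diff \<epsilon>]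
        by (simp only: powr_half_power mult_ac)
    qed (use jet l in \<open>auto simp: jet_def intro!: tcoef_measurable\<close>)
    then have "sep (Suc (Suc j)) ?I (K * (M * ?q ^ Suc s) * (1 / 2 ^ Suc s) ^ (k - j))
      (\<lambda>x. \<Sum>l\<le>k. ?u l x * ((\<Prod>i\<le>j. near W (Suc s) (x 0) (x (Suc i))) *
        gdd j (\<lambda>y. (of_real y - of_real (cen (Suc s) (x 0))) ^ l) (\<lambda>i. x (Suc i))))"
      by (intro K(2)) (use jet in \<open>auto simp: jet_def\<close>)
    \<comment> \<open>Both 0 and 1 are sent to 0: the base point is identified with the first
      node.\<close>
    from sep_reindex[OF this, of "\<lambda>i. i - 1" "Suc j"]
    have "sep (Suc j) ?I (K * (M * ?q ^ Suc s) * (1 / 2 ^ Suc s) ^ (k - j))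
      (\<lambda>x. \<Sum>l\<le>k. ?u l x * ((\<Prod>i\<le>j. near W (Suc s) (x 0) (x i)) *
        gdd j (\<lambda>y. (of_real y - of_real (cen (Suc s) (x 0))) ^ l) x))" by simp
    moreover have "K * (M * ?q ^ Suc s) * (1 / 2 ^ Suc s) ^ (k - j) = K * M * ((1 / 2 ^ Suc s) ^ (k - j) * ?q ^ Suc s)"
      by (simp only: mult_ac)
    ultimately show "sep (Suc j) ?I (K * M * ((1 / 2 ^ Suc s) ^ (k - j) * ?q ^ Suc s))
      (\<lambda>x. (\<Prod>i\<le>j. near W (Suc s) (x 0) (x i)) *
        gdd j (\<lambda>y. tay k f (cen (Suc s) (x 0)) y - tay k f (cen s (x 0)) y) x)"
      unfolding gdd_tay_diff sum_distrib_left by (simp only: mult.left_commute)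
  qed (rule K(1))
qed

text \<open>The change of base point from x 0 to x 1 within one scale. The two centres are at most W
  2^-s apart, whence the factor W^(k-l) W^\<epsilon> <= W^(k+1); the factor 2 W + 1 counts the index
  differences.\<close>

lemma sep_tay_neighbour:
  fixes R :: nat
  assumes "j \<le> k" and \<epsilon>: "0 < \<epsilon>" "\<epsilon> \<le> 1" and W: "1 \<le> W"
  shows "\<exists>K\<ge>0. \<forall>f M s. jet k {- real R..<real R} \<epsilon> M f \<longrightarrow>
    sep (Suc (Suc j)) {- real R..<real R} (K * M * ((1 / 2 ^ s) ^ (k - j) * (2 powr - \<epsilon>) ^ s))
      (\<lambda>x. (\<Prod>i\<le>j. near W s (x 0) (x (Suc i))) *
        gdd j (\<lambda>y. tay k f (cen s (x 0)) y - tay k f (cen s (x 1)) y) (\<lambda>i. x (Suc i)))"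
proof -
  let ?I = "{- real R..<real R}"
  obtain K where K0: "0 \<le> K \<and> (\<forall>s D u. 0 \<le> D \<longrightarrow>
    (\<forall>l\<le>k. sep (Suc (Suc j)) ?I (D * (1 / 2 ^ s) ^ (k - l)) (u l)) \<longrightarrow>
    sep (Suc (Suc j)) ?I (K * D * (1 / 2 ^ s) ^ (k - j))
      (\<lambda>x. \<Sum>l\<le>k. u l x * ((\<Prod>i\<le>j. near W s (x 0) (x (Suc i))) *
        gdd j (\<lambda>y. (of_real y - of_real (cen s (x 0))) ^ l) (\<lambda>i. x (Suc i)))))"
    using sep_local_polynomial[OF assms(1), of R W] by (rule exE)
  note K = K0[THEN conjunct1] K0[THEN conjunct2, rule_format]
  show ?thesis
  proof (intro exI[of _ "K * ((2 * real W + 1) * real W ^ Suc k)"] conjI allI impI)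
    show "0 \<le> K * ((2 * real W + 1) * real W ^ Suc k)" using K(1) by simp
    fix f M s assume jet: "jet k ?I \<epsilon> M f"
    let ?q = "2 powr - \<epsilon>"
    let ?c = "\<lambda>n y. cen s y + of_int n / 2 ^ s"
    \<comment> \<open>For some y the shifted centre leaves \<open>?I\<close>, where the jet gives no
      bound. The value 0 there is harmless: for actual points the shifted centre is cen s (x 1),
      which lies in \<open>?I\<close>.\<close>
    let ?v = "\<lambda>l n y. if ?c n y \<in> ?I then tcoef k f l (cen s y) (?c n y) else 0"
    let ?u = "\<lambda>l (x :: nat \<Rightarrow> real). near W s (x 0) (x 1) * tcoef k f l (cen s (x 0)) (cen s (x 1))"
    let ?D = "(2 * real W + 1) * real W ^ Suc k * M * ?q ^ s"
    have M: "0 \<le> M" using jet by (simp add: jet_def)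
    have "sep (Suc (Suc j)) ?I (?D * (1 / 2 ^ s) ^ (k - l)) (?u l)" if l: "l \<le> k" for l
    proof -
      have "sep (Suc (Suc j)) ?I ((2 * real W + 1) * (real W ^ Suc k * M * ?q ^ s * (1 / 2 ^ s) ^ (k - l)))
        (\<lambda>x. near W s (x 0) (x 1) * ?v l (cell s (x 1) - cell s (x 0)) (x 0))"
      proof (rule sep_near_fun[where u = "?v l"])
        fix n y assume n: "\<bar>n\<bar> \<le> int W" and y: "y \<in> ?I"
        show "norm (?v l n y) \<le> real W ^ Suc k * M * ?q ^ s * (1 / 2 ^ s) ^ (k - l)"
        proof (cases "?c n y \<in> ?I")
          case True
          have "\<bar>real_of_int n\<bar> \<le> real W" using n by linarith
          then have d: "\<bar>cen s y - ?c n y\<bar> \<le> real W * (1 / 2 ^ s)"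
            by (simp add: abs_divide divide_right_mono)
          have "norm (?v l n y) \<le> M * (real W * (1 / 2 ^ s)) ^ (k - l) * (real W * (1 / 2 ^ s)) powr \<epsilon>"
            using jet_tcoef_le[OF jet l cen_in[OF y] True d \<epsilon>(1)] True by simp
          also have "\<dots> = (real W ^ (k - l) * real W powr \<epsilon>) * (M * ?q ^ s * (1 / 2 ^ s) ^ (k - l))"
            by (simp only: power_mult_distrib powr_mult powr_half_power mult_ac)
          also have "\<dots> \<le> (real W ^ k * real W) * (M * ?q ^ s * (1 / 2 ^ s) ^ (k - l))"
          proof -
            have "real W powr \<epsilon> \<le> real W powr 1" using W \<epsilon> by (intro powr_mono) auto
            then have "real W powr \<epsilon> \<le> real W" using W by simp
            then show ?thesis using W M by (intro mult_right_mono mult_mono power_increasing) auto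
          qed
          finally show ?thesis by (simp add: mult_ac)
        next
          case False
          then have "?v l n y = 0" by (rule if_not_P)
          then have "norm (?v l n y) = 0" by (simp only: norm_zero)
          also have "0 \<le> real W ^ Suc k * M * ?q ^ s * (1 / 2 ^ s) ^ (k - l)" using M by simp
          finally show ?thesis .
        qed
      next
        fix n
        have "(\<lambda>y. tcoef k f l (cen s y) (?c n y)) \<in> borel_measurable borel"
          by (rule tcoef_measurable) (use jet l in \<open>auto simp: jet_def\<close>)
        then show "?v l n \<in> borel_measurable borel" by measurable
      qed (use M in auto)
      then show ?thesis
      proof (rule sep_cong[OF sep_mono[OF _ _ order_refl]])
        fix x assume x: "\<And>i. i < Suc (Suc j) \<Longrightarrow> x i \<in> ?I"
        have "?c (cell s (x 1) - cell s (x 0)) (x 0) = cen s (x 1)"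
          by (simp add: cen_def field_simps)
        moreover have "cen s (x 1) \<in> ?I" using cen_in[OF x[of 1]] by simp
        ultimately show "near W s (x 0) (x 1) * ?v l (cell s (x 1) - cell s (x 0)) (x 0) = ?u l x"
          by simp
      qed (simp add: mult_ac)
    qed
    then have "sep (Suc (Suc j)) ?I (K * ?D * (1 / 2 ^ s) ^ (k - j))
      (\<lambda>x. \<Sum>l\<le>k. ?u l x * ((\<Prod>i\<le>j. near W s (x 0) (x (Suc i))) *
        gdd j (\<lambda>y. (of_real y - of_real (cen s (x 0))) ^ l) (\<lambda>i. x (Suc i))))"
      by (intro K(2)) (use M in auto)
    then show "sep (Suc (Suc j)) ?I (K * ((2 * real W + 1) * real W ^ Suc k) * M * ((1 / 2 ^ s) ^ (k - j) * ?q ^ s))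
      (\<lambda>x. (\<Prod>i\<le>j. near W s (x 0) (x (Suc i))) *
        gdd j (\<lambda>y. tay k f (cen s (x 0)) y - tay k f (cen s (x 1)) y) (\<lambda>i. x (Suc i)))"
    proof (rule sep_cong[OF sep_mono[OF _ _ order_refl]])
      show "K * ?D * (1 / 2 ^ s) ^ (k - j) \<le> K * ((2 * real W + 1) * real W ^ Suc k) * M * ((1 / 2 ^ s) ^ (k - j) * ?q ^ s)"
        by (simp only: mult_ac order_refl)
      fix x :: "nat \<Rightarrow> real"
      have "(\<Prod>i\<le>j. near W s (x 0) (x (Suc i))) = near W s (x 0) (x 1) * (\<Prod>i\<in>{..j} - {0}. near W s (x 0) (x (Suc i)))"
        using prod.remove[of "{..j}" 0 "\<lambda>i. near W s (x 0) (x (Suc i))"] by simp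
      then have P: "near W s (x 0) (x 1) * (\<Prod>i\<le>j. near W s (x 0) (x (Suc i))) = (\<Prod>i\<le>j. near W s (x 0) (x (Suc i)))"
        using near_idem[of W s "x 0" "x 1"] by (metis mult.assoc)
      have alg: "(n * t) * (p * g) = (n * p) * (t * g)" for n t p g :: complex by (simp add: mult_ac)
      show "(\<Sum>l\<le>k. ?u l x * ((\<Prod>i\<le>j. near W s (x 0) (x (Suc i))) *
          gdd j (\<lambda>y. (of_real y - of_real (cen s (x 0))) ^ l) (\<lambda>i. x (Suc i)))) =
        (\<Prod>i\<le>j. near W s (x 0) (x (Suc i))) *
          gdd j (\<lambda>y. tay k f (cen s (x 0)) y - tay k f (cen s (x 1)) y) (\<lambda>i. x (Suc i))"
        unfolding gdd_tay_diff sum_distrib_left alg P ..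
    qed
  qed
qed

text \<open>For factors 0 and 1 this sorts the points at which the product vanishes by the first
  index whose factor is 0.\<close>

lemma prod_telescope:
  fixes t :: "nat \<Rightarrow> complex"
  shows "(\<Sum>i\<le>n. (\<Prod>a<i. t a) * (1 - t i)) = 1 - (\<Prod>a\<le>n. t a)"
  by (induction n) (simp_all add: algebra_simps lessThan_Suc_atMost[symmetric] del: atMost_Suc)

lemma prod_skip:
  assumes "b \<le> Suc j"
  shows "(\<Prod>a\<le>Suc j. g (x a)) = g (x b) * (\<Prod>a\<le>j. g (skip b x a) :: complex)"
proof -
  let ?\<pi> = "\<lambda>i. if i < b then i else Suc i"
  have "(\<Prod>a\<le>Suc j. g (x a)) = g (x b) * (\<Prod>a\<in>{..Suc j} - {b}. g (x a))"
    using assms by (intro prod.remove) auto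
  also have "{..Suc j} - {b} = ?\<pi> ` {..j}"
  proof
    show "{..Suc j} - {b} \<subseteq> ?\<pi> ` {..j}"
    proof
      fix i assume i: "i \<in> {..Suc j} - {b}"
      show "i \<in> ?\<pi> ` {..j}"
        using i assms by (intro image_eqI[of _ _ "if i < b then i else i - 1"]) auto
    qed
  qed (use assms in auto)
  also have "(\<Prod>a\<in>?\<pi> ` {..j}. g (x a)) = (\<Prod>a\<le>j. g (skip b x a))"
    by (subst prod.reindex) (auto simp: inj_on_def skip_def)
  finally show ?thesis .
qed

subsection \<open>Induction over the order of the divided difference\<close>

text \<open>The localised divided difference below has norm \<open>O(2\<^sup>-\<^sup>s\<^sup>(\<^sup>k\<^sup>-\<^sup>j\<^sup>+\<^sup>\<epsilon>\<^sup>))\<close>. The induction on \<open>j\<close> treats all widths \<open>W\<close> at once,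
  because dropping the base point \<open>x\<^sub>0\<close> in the recursion doubles the width.\<close>

definition star :: "nat \<Rightarrow> nat \<Rightarrow> nat \<Rightarrow> (nat \<Rightarrow> real) \<Rightarrow> complex" where
  "star W s j x = (\<Prod>i\<le>j. near W s (x 0) (x i))"

definition Hloc :: "nat \<Rightarrow> nat \<Rightarrow> nat \<Rightarrow> (real \<Rightarrow> complex) \<Rightarrow> nat \<Rightarrow> (nat \<Rightarrow> real) \<Rightarrow> complex" where
  "Hloc W k j f s x = star W s j x * gdd j (\<lambda>y. f y - tay k f (cen s (x 0)) y) x"

lemma star_eq: "star W s j x = (if \<forall>i\<le>j. \<bar>cell s (x 0) - cell s (x i)\<bar> \<le> int W then 1 else 0)"
  by (auto simp: star_def near_def)

lemma star_nested: "1 \<le> W \<Longrightarrow> star W s j x * star W (Suc s) j x = star W (Suc s) j x"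
  unfolding star_def prod.distrib[symmetric] by (simp add: near_nested)

lemma sep_star:
  fixes R :: nat
  shows "sep (Suc j) {- real R..<real R} ((2 * real W + 1) ^ Suc j) (star W s j)"
  unfolding star_def[abs_def] using sep_near_prod[of "{..j}" 0 "Suc j" "\<lambda>a. a" R W s] by simp

lemma skip_eq: "skip b x = (\<lambda>i. x (if i < b then i else Suc i))"
  by (simp add: skip_def[abs_def])

text \<open>Deleting the node x i keeps the base point. Deleting x 0 makes x 1 the base: nodes
  within W cells of x 0 lie within 2 W cells of x 1, and replacing one Taylor polynomial by the
  other leaves the correction term.\<close>

lemma Hloc_skip:
  assumes f: "f \<in> C_k k" and j: "j \<le> k" and i: "1 \<le> i" "i \<le> Suc j"
  shows "star W s (Suc j) x * (gdd j (\<lambda>y. f y - tay k f (cen s (x 0)) y) (skip i x) -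
      gdd j (\<lambda>y. f y - tay k f (cen s (x 0)) y) (skip 0 x)) =
    near W s (x 0) (x i) * Hloc W k j f s (skip i x) -
    (star W s (Suc j) x * Hloc (2 * W) k j f s (skip 0 x) -
      (\<Prod>a\<le>j. near W s (x 0) (x (Suc a))) *
        gdd j (\<lambda>y. tay k f (cen s (x 0)) y - tay k f (cen s (x 1)) y) (\<lambda>a. x (Suc a)))"
proof -
  have fj: "f \<in> C_k j" using C_k_mono[OF f j] .
  have s0: "skip 0 x = (\<lambda>a. x (Suc a))" by (simp add: skip_eq)
  have x0: "skip i x 0 = x 0" using i by (simp add: skip_def)
  have 1: "star W s (Suc j) x * gdd j (\<lambda>y. f y - tay k f (cen s (x 0)) y) (skip i x) =
      near W s (x 0) (x i) * Hloc W k j f s (skip i x)"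
    unfolding Hloc_def star_def x0 using prod_skip[OF i(2), of "near W s (x 0)" x] by simp
  have st: "star W s (Suc j) x = (\<Prod>a\<le>j. near W s (x 0) (x (Suc a)))"
    unfolding star_def by (simp add: prod.atMost_Suc_shift del: prod.atMost_Suc)
  have nb: "star W s (Suc j) x * star (2 * W) s j (skip 0 x) = star W s (Suc j) x"
  proof (cases "\<forall>a\<le>Suc j. \<bar>cell s (x 0) - cell s (x a)\<bar> \<le> int W")
    case True
    have "\<bar>cell s (x 1) - cell s (x (Suc a))\<bar> \<le> int (2 * W)" if "a \<le> j" for a
    proof -
      have "\<bar>cell s (x 0) - cell s (x (Suc a))\<bar> \<le> int W" "\<bar>cell s (x 0) - cell s (x 1)\<bar> \<le> int W"
        using True that by auto
      then show ?thesis by linarith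
    qed
    then have "star (2 * W) s j (skip 0 x) = 1" unfolding star_eq s0 by simp
    then show ?thesis by simp
  next
    case False
    then have "star W s (Suc j) x = 0" unfolding star_eq by auto
    then show ?thesis by simp
  qed
  have "gdd j (\<lambda>y. f y - tay k f (cen s (x 0)) y) (skip 0 x) =
      gdd j (\<lambda>y. f y - tay k f (cen s (x 1)) y) (skip 0 x) -
      gdd j (\<lambda>y. tay k f (cen s (x 0)) y - tay k f (cen s (x 1)) y) (skip 0 x)"
    by (simp add: gdd_diff fj tay_C_k)
  moreover have "star W s (Suc j) x * gdd j (\<lambda>y. f y - tay k f (cen s (x 1)) y) (skip 0 x) =
      star W s (Suc j) x * Hloc (2 * W) k j f s (skip 0 x)"
  proof -
    have "star W s (Suc j) x * Hloc (2 * W) k j f s (skip 0 x) =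
        (star W s (Suc j) x * star (2 * W) s j (skip 0 x)) *
        gdd j (\<lambda>y. f y - tay k f (cen s (skip 0 x 0)) y) (skip 0 x)"
      unfolding Hloc_def by (rule mult.assoc[symmetric])
    then show ?thesis unfolding nb by (auto simp: s0)
  qed
  ultimately have 2: "star W s (Suc j) x * gdd j (\<lambda>y. f y - tay k f (cen s (x 0)) y) (skip 0 x) =
      star W s (Suc j) x * Hloc (2 * W) k j f s (skip 0 x) -
      (\<Prod>a\<le>j. near W s (x 0) (x (Suc a))) *
        gdd j (\<lambda>y. tay k f (cen s (x 0)) y - tay k f (cen s (x 1)) y) (\<lambda>a. x (Suc a))"
    unfolding st s0 by (simp only: right_diff_distrib)
  show ?thesis unfolding right_diff_distrib 1 2 ..
qed

definition Hbound :: "nat \<Rightarrow> nat \<Rightarrow> real \<Rightarrow> nat \<Rightarrow> nat \<Rightarrow> real \<Rightarrow> bool" where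
  "Hbound R k \<epsilon> W j K \<longleftrightarrow> 0 \<le> K \<and> (\<forall>f M s. jet k {- real R..<real R} \<epsilon> M f \<longrightarrow>
     sep (Suc j) {- real R..<real R} (K * M * ((1 / 2 ^ s) ^ (k - j) * (2 powr - \<epsilon>) ^ s)) (Hloc W k j f s))"

lemma Hbound_0: "0 < \<epsilon> \<Longrightarrow> Hbound R k \<epsilon> W 0 1"
  unfolding Hbound_def
proof (intro conjI allI impI)
  fix f M s assume \<epsilon>: "0 < \<epsilon>" and jet: "jet k {- real R..<real R} \<epsilon> M f"
  let ?I = "{- real R..<real R}"
  have f: "f \<in> C_k k" and M: "0 \<le> M" using jet by (auto simp: jet_def)
  have eq: "f y - tay k f b y = tcoef k f 0 y b" for y b
    using gdd_tay_diagonal[OF f, of 0 "\<lambda>_. y" y b] by simp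
  have "sep (Suc 0) ?I (M * (1 / 2 ^ s) ^ k * (2 powr - \<epsilon>) ^ s) (\<lambda>x. tcoef k f 0 (x 0) (cen s (x 0)))"
  proof (rule sep_var[where g = "\<lambda>y. tcoef k f 0 y (cen s y)"])
    show "norm (tcoef k f 0 y (cen s y)) \<le> M * (1 / 2 ^ s) ^ k * (2 powr - \<epsilon>) ^ s" if "y \<in> ?I" for y
      using jet_tcoef_le[OF jet _ that cen_in[OF that], of 0 s "1 / 2 ^ s"] \<epsilon>
        cen_bounds[where s = s and x = y] by (simp add: powr_half_power)
    show "(\<lambda>y. tcoef k f 0 y (cen s y)) \<in> borel_measurable borel"
      by (rule tcoef_measurable[OF f]) auto
  qed (use M in auto)
  then show "sep (Suc 0) ?I (1 * M * ((1 / 2 ^ s) ^ (k - 0) * (2 powr - \<epsilon>) ^ s)) (Hloc W k 0 f s)"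
    unfolding Hloc_def[abs_def] star_def by (simp add: eq mult_ac)
qed simp

text \<open>If all nodes coincide, the value is a Taylor coefficient, which the jet makes small;
  otherwise some node is eventually too many cells away from x 0 and the cutoff is 0. Pointwise
  convergence is all that \<open>sep_sums\<close> asks of the telescoping series.\<close>

lemma Hloc_tendsto_0:
  fixes R :: nat
  assumes jet: "jet k {- real R..<real R} \<epsilon> M f" and \<epsilon>: "0 < \<epsilon>" and j: "j \<le> k"
    and x: "x 0 \<in> {- real R..<real R}"
  shows "(\<lambda>N. Hloc W k j f (n + N) x) \<longlonglongrightarrow> 0"
proof (cases "\<forall>i\<le>j. x i = x 0")
  case True
  have f: "f \<in> C_k k" and M: "0 \<le> M" using jet by (auto simp: jet_def)
  let ?q = "2 powr - \<epsilon>"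
  have q: "0 \<le> ?q" "?q < 1" using \<epsilon> powr_less_mono[of "- \<epsilon>" 0 2] by auto
  have bound: "norm (Hloc W k j f (n + N) x) \<le> M * ?q ^ N" for N
  proof -
    have "gdd j (\<lambda>y. f y - tay k f (cen (n + N) (x 0)) y) x = tcoef k f j (x 0) (cen (n + N) (x 0))"
      by (rule gdd_tay_diagonal[OF f j]) (use True in blast)
    moreover have "\<bar>cell (n + N) (x 0) - cell (n + N) (x i)\<bar> \<le> int W" if "i \<le> j" for i
    proof -
      have "x i = x 0" using True that by blast
      then show ?thesis by (simp only: diff_self abs_zero of_nat_0_le_iff)
    qed
    then have "star W (n + N) j x = 1" unfolding star_eq by simp
    ultimately have "norm (Hloc W k j f (n + N) x) = norm (tcoef k f j (x 0) (cen (n + N) (x 0)))"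
      unfolding Hloc_def by (simp only: mult_1_left)
    also have "\<dots> \<le> M * (1 / 2 ^ (n + N)) ^ (k - j) * ?q ^ (n + N)"
      using jet_tcoef_le[OF jet j x cen_in[OF x], of "n + N" "1 / 2 ^ (n + N)"] \<epsilon>
        cen_bounds[where s = "n + N" and x = "x 0"] by (simp add: powr_half_power)
    also have "\<dots> \<le> M * 1 * ?q ^ N"
    proof (intro mult_mono mult_left_mono)
      show "(1 / 2 ^ (n + N)) ^ (k - j) \<le> (1::real)" by (rule power_le_one) auto
      show "?q ^ (n + N) \<le> ?q ^ N" using q by (intro power_decreasing) auto
    qed (use M q in auto)
    finally show ?thesis by simp
  qed
  have "(\<lambda>N. M * ?q ^ N) \<longlonglongrightarrow> M * 0"
    using q by (intro tendsto_mult tendsto_const LIMSEQ_power_zero) auto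
  then have "(\<lambda>N. M * ?q ^ N) \<longlonglongrightarrow> 0" by simp
  then show ?thesis
    by (rule Lim_null_comparison[OF always_eventually[OF allI[OF bound]]])
next
  case False
  then obtain i where i: "i \<le> j" "x i \<noteq> x 0" by auto
  let ?d = "\<bar>x i - x 0\<bar>"
  have d: "0 < ?d" using i by simp
  obtain N0 where N0: "(real W + 1) / ?d < 2 ^ N0" using real_arch_pow[of 2 "(real W + 1) / ?d"] by auto
  have "Hloc W k j f (n + N) x = 0" if N: "N0 \<le> N" for N
  proof -
    have "(2::real) ^ N0 \<le> 2 ^ (n + N)" by (rule power_increasing) (use N in auto)
    with N0 have "(real W + 1) / ?d < 2 ^ (n + N)" by linarith
    then have "real W + 1 < 2 ^ (n + N) * ?d" using d by (simp add: field_simps)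
    also have "\<dots> = \<bar>2 ^ (n + N) * x i - 2 ^ (n + N) * x 0\<bar>"
      by (simp add: abs_mult right_diff_distrib[symmetric])
    finally have "real W + 1 < \<bar>2 ^ (n + N) * x i - 2 ^ (n + N) * x 0\<bar>" .
    then have "\<not> \<bar>cell (n + N) (x 0) - cell (n + N) (x i)\<bar> \<le> int W"
      unfolding cell_def by linarith
    then show ?thesis using i by (auto simp: Hloc_def star_eq)
  qed
  then show ?thesis by (intro tendsto_eventually) (auto simp: eventually_at_top_linorder)
qed

text \<open>With G for the divided difference of the remainder and S for the cutoff, S_m G_m -
  S_(m+1) G_(m+1) is split as S_(m+1) (G_m - G_(m+1)) + (S_m - S_(m+1)) G_m. The first part compares
  Taylor polynomials; in the second, \<open>prod_telescope\<close> singles out the first node x i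
  that is not near x 0 at level m + 1, and \<open>gdd_pair\<close> for 0 and i lowers the
  order.\<close>

lemma Hloc_step:
  assumes W: "1 \<le> W" and f: "f \<in> C_k k" and j: "Suc j \<le> k"
  shows "Hloc W k (Suc j) f m x - Hloc W k (Suc j) f (Suc m) x =
    (\<Prod>i\<le>Suc j. near W (Suc m) (x 0) (x i)) *
      gdd (Suc j) (\<lambda>y. tay k f (cen (Suc m) (x 0)) y - tay k f (cen m (x 0)) y) x +
    (\<Sum>i\<in>{1..Suc j}. (\<Prod>a\<in>{..<i}. near W (Suc m) (x 0) (x a)) *
      (near W m (x 0) (x i) * ((1 - near W (Suc m) (x 0) (x i)) / of_real (x 0 - x i))) *
      (star W m (Suc j) x * (gdd j (\<lambda>y. f y - tay k f (cen m (x 0)) y) (skip i x) -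
        gdd j (\<lambda>y. f y - tay k f (cen m (x 0)) y) (skip 0 x))))"
proof -
  let ?R = "\<lambda>m y. f y - tay k f (cen m (x 0)) y"
  let ?G = "\<lambda>m. gdd (Suc j) (?R m) x"
  let ?n = "\<lambda>i. near W (Suc m) (x 0) (x i)"
  have fj: "f \<in> C_k (Suc j)" using C_k_mono[OF f j] .
  have R: "?R m \<in> C_k (Suc j)" by (intro C_k_diff fj tay_C_k)
  have T: "gdd (Suc j) (\<lambda>y. tay k f (cen (Suc m) (x 0)) y - tay k f (cen m (x 0)) y) x = ?G m - ?G (Suc m)"
    by (simp add: gdd_diff fj tay_C_k)
  have P: "(x0 - xi) * g = d \<Longrightarrow> x0 \<noteq> xi \<Longrightarrow> t / (x0 - xi) * d = t * g" for x0 xi g d t :: complex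
    by auto
  have summand: "(near W m (x 0) (x i) * ((1 - ?n i) / of_real (x 0 - x i))) *
      (star W m (Suc j) x * (gdd j (?R m) (skip i x) - gdd j (?R m) (skip 0 x))) =
      (1 - ?n i) * (star W m (Suc j) x * ?G m)" if i: "i \<in> {1..Suc j}" for i
  \<comment> \<open>If \<open>?n i = 1\<close>, which includes x i = x 0, both sides vanish;
    otherwise the division by x 0 - x i is legitimate.\<close>
  proof (cases "?n i = 1")
    case False
    then have ne: "x 0 \<noteq> x i" by auto
    have pair: "of_real (x 0 - x i) * ?G m = gdd j (?R m) (skip i x) - gdd j (?R m) (skip 0 x)"
      using gdd_pair[OF R, of 0 i x] i by simp
    have "star W m (Suc j) x \<noteq> 0 \<Longrightarrow> near W m (x 0) (x i) = 1"
      using i by (auto simp: star_eq near_def split: if_splits)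
    then have st: "near W m (x 0) (x i) * star W m (Suc j) x = star W m (Suc j) x" by auto
    have "(near W m (x 0) (x i) * ((1 - ?n i) / of_real (x 0 - x i))) *
      (star W m (Suc j) x * (gdd j (?R m) (skip i x) - gdd j (?R m) (skip 0 x))) =
      (near W m (x 0) (x i) * star W m (Suc j) x) * ((1 - ?n i) / of_real (x 0 - x i) *
      (of_real (x 0 - x i) * ?G m))"
      unfolding pair by (simp only: mult_ac)
    also have "\<dots> = star W m (Suc j) x * ((1 - ?n i) * ?G m)"
      unfolding st using ne by (simp del: of_real_diff)
    finally show ?thesis by (simp only: mult_ac)
  qed simp
  have "(\<Sum>i\<in>{1..Suc j}. (\<Prod>a\<in>{..<i}. ?n a) *
      (near W m (x 0) (x i) * ((1 - ?n i) / of_real (x 0 - x i))) *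
      (star W m (Suc j) x * (gdd j (?R m) (skip i x) - gdd j (?R m) (skip 0 x)))) =
      (\<Sum>i\<in>{1..Suc j}. ((\<Prod>a<i. ?n a) * (1 - ?n i)) * (star W m (Suc j) x * ?G m))"
  proof (intro sum.cong refl)
    fix i assume i: "i \<in> {1..Suc j}"
    show "(\<Prod>a\<in>{..<i}. ?n a) *
        (near W m (x 0) (x i) * ((1 - ?n i) / of_real (x 0 - x i))) *
        (star W m (Suc j) x * (gdd j (?R m) (skip i x) - gdd j (?R m) (skip 0 x))) =
      ((\<Prod>a<i. ?n a) * (1 - ?n i)) * (star W m (Suc j) x * ?G m)"
      using arg_cong[OF summand[OF i], of "\<lambda>z. (\<Prod>a<i. ?n a) * z"] by (simp only: mult.assoc)
  qed
  also have "\<dots> = (\<Sum>i\<in>{1..Suc j}. (\<Prod>a<i. ?n a) * (1 - ?n i)) * (star W m (Suc j) x * ?G m)"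
    by (rule sum_distrib_right[symmetric])
  also have "(\<Sum>i\<in>{1..Suc j}. (\<Prod>a<i. ?n a) * (1 - ?n i)) = (\<Sum>i\<le>Suc j. (\<Prod>a<i. ?n a) * (1 - ?n i))"
  proof (rule sum.mono_neutral_left)
    show "\<forall>i\<in>{..Suc j} - {1..Suc j}. (\<Prod>a<i. ?n a) * (1 - ?n i) = 0"
    proof
      fix i assume "i \<in> {..Suc j} - {1..Suc j}"
      then have "i = 0" by auto
      then show "(\<Prod>a<i. ?n a) * (1 - ?n i) = 0" by simp
    qed
  qed auto
  also have "\<dots> = 1 - star W (Suc m) (Suc j) x"
    unfolding star_def by (rule prod_telescope)
  also have "(1 - star W (Suc m) (Suc j) x) * (star W m (Suc j) x * ?G m) =
      (star W m (Suc j) x - star W (Suc m) (Suc j) x) * ?G m"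
  proof -
    have "(1 - b) * (a * g) = (a - a * b) * g" for a b g :: complex by (simp add: algebra_simps)
    then show ?thesis by (simp only: star_nested[OF W])
  qed
  finally show ?thesis
    unfolding T Hloc_def star_def[symmetric] by (simp add: algebra_simps)
qed

text \<open>The kernel of norm of order 2^m is paid for by the gain 2^-m of order j over order j +
  1, since k - j = Suc (k - Suc j). Both parts of \<open>Hloc_step\<close> at level n + s are then,
  up to constants, the claimed size at level n times 2^(-s \<epsilon>); the geometric series in s
  gives the denominator of K.\<close>

lemma Hbound_Suc:
  assumes W: "1 \<le> W" and \<epsilon>: "0 < \<epsilon>" "\<epsilon> \<le> 1" and j: "Suc j \<le> k"
    and IH1: "Hbound R k \<epsilon> W j K1" and IH2: "Hbound R k \<epsilon> (2 * W) j K2"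
  shows "\<exists>K. Hbound R k \<epsilon> W (Suc j) K"
proof -
  let ?I = "{- real R..<real R}"
  let ?q = "2 powr - \<epsilon>"
  let ?e = "k - Suc j"
  have q: "0 < ?q" "?q < 1" using \<epsilon> powr_less_mono[of "- \<epsilon>" 0 2] by auto
  have kj: "k - j = Suc ?e" using j by simp
  have I: "?I \<in> sets borel" by simp
  obtain KA where KA0: "0 \<le> KA \<and> (\<forall>f M s. jet k ?I \<epsilon> M f \<longrightarrow>
    sep (Suc (Suc j)) ?I (KA * M * ((1 / 2 ^ Suc s) ^ ?e * ?q ^ Suc s))
      (\<lambda>x. (\<Prod>i\<le>Suc j. near W (Suc s) (x 0) (x i)) *
        gdd (Suc j) (\<lambda>y. tay k f (cen (Suc s) (x 0)) y - tay k f (cen s (x 0)) y) x))"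
    using sep_tay_refine[OF j \<epsilon>(1), of R W] by (rule exE)
  note KA = KA0[THEN conjunct1] KA0[THEN conjunct2, rule_format]
  obtain K3 where K30: "0 \<le> K3 \<and> (\<forall>f M s. jet k ?I \<epsilon> M f \<longrightarrow>
    sep (Suc (Suc j)) ?I (K3 * M * ((1 / 2 ^ s) ^ (k - j) * ?q ^ s))
      (\<lambda>x. (\<Prod>i\<le>j. near W s (x 0) (x (Suc i))) *
        gdd j (\<lambda>y. tay k f (cen s (x 0)) y - tay k f (cen s (x 1)) y) (\<lambda>i. x (Suc i))))"
    using sep_tay_neighbour[OF Suc_leD[OF j] \<epsilon> W, of R] by (rule exE)
  note K3 = K30[THEN conjunct1] K30[THEN conjunct2, rule_format]
  have K1: "0 \<le> K1" "\<And>f M s. jet k ?I \<epsilon> M f \<Longrightarrow>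
      sep (Suc j) ?I (K1 * M * ((1 / 2 ^ s) ^ (k - j) * ?q ^ s)) (Hloc W k j f s)"
    using IH1 by (auto simp: Hbound_def)
  have K2: "0 \<le> K2" "\<And>f M s. jet k ?I \<epsilon> M f \<Longrightarrow>
      sep (Suc j) ?I (K2 * M * ((1 / 2 ^ s) ^ (k - j) * ?q ^ s)) (Hloc (2 * W) k j f s)"
    using IH2 by (auto simp: Hbound_def)
  define w where "w = 2 * real W + 1"
  have w: "1 \<le> w" by (simp add: w_def)
  define Kb where "Kb = w * K1 + (w ^ Suc (Suc j) * K2 + K3)"
  have Kb: "0 \<le> Kb" using w K1(1) K2(1) K3(1) by (simp add: Kb_def)
  define KB where "KB = (\<Sum>i\<in>{1..Suc j}. w ^ i * (w * (4 * real W + 3) * 2) * Kb)"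
  have KB: "0 \<le> KB" unfolding KB_def using w Kb by (intro sum_nonneg) auto
  define K where "K = (KA + KB) / (1 - ?q)"
  have "sep (Suc (Suc j)) ?I (K * M * ((1 / 2 ^ n) ^ ?e * ?q ^ n)) (Hloc W k (Suc j) f n)"
    if jet: "jet k ?I \<epsilon> M f" for f M n
  proof -
    have f: "f \<in> C_k k" and M: "0 \<le> M" using jet by (auto simp: jet_def)
    define A where "A m x = (\<Prod>i\<le>Suc j. near W (Suc m) (x 0) (x i)) *
      gdd (Suc j) (\<lambda>y. tay k f (cen (Suc m) (x 0)) y - tay k f (cen m (x 0)) y) x" for m x
    define br where "br m i x = star W m (Suc j) x * (gdd j (\<lambda>y. f y - tay k f (cen m (x 0)) y) (skip i x) -
        gdd j (\<lambda>y. f y - tay k f (cen m (x 0)) y) (skip 0 x))" for m i x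
    define B where "B m x = (\<Sum>i\<in>{1..Suc j}. (\<Prod>a\<in>{..<i}. near W (Suc m) (x 0) (x a)) *
      (near W m (x 0) (x i) * ((1 - near W (Suc m) (x 0) (x i)) / of_real (x 0 - x i))) * br m i x)" for m x
    have br: "sep (Suc (Suc j)) ?I (Kb * M * ((1 / 2 ^ m) ^ (k - j) * ?q ^ m)) (br m i)"
      if i: "i \<in> {1..Suc j}" for m i
    proof -
      let ?c = "M * ((1 / 2 ^ m) ^ (k - j) * ?q ^ m)"
      have sk: "sep (Suc (Suc j)) ?I C (\<lambda>x. \<phi> (skip b x))" if "sep (Suc j) ?I C \<phi>" for C \<phi> b
        unfolding skip_eq by (rule sep_reindex[OF that]) auto
      have 1: "sep (Suc (Suc j)) ?I (w * (K1 * ?c)) (\<lambda>x. near W m (x 0) (x i) * Hloc W k j f m (skip i x))"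
        unfolding w_def using K1(2)[OF jet, of m] i
        by (intro sep_mult[OF sep_near sk]) (auto simp: mult.assoc)
      have 2: "sep (Suc (Suc j)) ?I (w ^ Suc (Suc j) * (K2 * ?c))
          (\<lambda>x. star W m (Suc j) x * Hloc (2 * W) k j f m (skip 0 x))"
        unfolding w_def using K2(2)[OF jet, of m]
        by (intro sep_mult[OF sep_star sk]) (auto simp: mult.assoc)
      have "sep (Suc (Suc j)) ?I (w * (K1 * ?c) + (w ^ Suc (Suc j) * (K2 * ?c) + K3 * M * ((1 / 2 ^ m) ^ (k - j) * ?q ^ m)))
        (\<lambda>x. near W m (x 0) (x i) * Hloc W k j f m (skip i x) -
          (star W m (Suc j) x * Hloc (2 * W) k j f m (skip 0 x) -
            (\<Prod>a\<le>j. near W m (x 0) (x (Suc a))) *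
              gdd j (\<lambda>y. tay k f (cen m (x 0)) y - tay k f (cen m (x 1)) y) (\<lambda>a. x (Suc a))))"
        by (rule sep_diff[OF 1 sep_diff[OF 2 K3(2)[OF jet] I] I]) auto
      then show ?thesis
      proof (rule sep_cong[OF sep_mono[OF _ _ order_refl]])
        show "w * (K1 * ?c) + (w ^ Suc (Suc j) * (K2 * ?c) + K3 * M * ((1 / 2 ^ m) ^ (k - j) * ?q ^ m))
            \<le> Kb * M * ((1 / 2 ^ m) ^ (k - j) * ?q ^ m)"
          unfolding Kb_def by (simp only: distrib_right mult.assoc order_refl)
      qed (simp only: br_def Hloc_skip[OF f Suc_leD[OF j]] i[unfolded atLeastAtMost_iff])
    qed
    have sA: "sep (Suc (Suc j)) ?I (KA * M * ((1 / 2 ^ Suc m) ^ ?e * ?q ^ Suc m)) (A m)" for m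
      unfolding A_def[abs_def] by (rule KA(2)[OF jet])
    have sB: "sep (Suc (Suc j)) ?I (KB * M * ((1 / 2 ^ m) ^ ?e * ?q ^ m)) (B m)" for m
    proof -
      have "sep (Suc (Suc j)) ?I (\<Sum>i\<in>{1..Suc j}. w ^ card {..<i} * (w * (4 * real W + 3) * 2 ^ Suc m) *
          (Kb * M * ((1 / 2 ^ m) ^ (k - j) * ?q ^ m))) (B m)"
        unfolding B_def[abs_def]
      proof (rule sep_sum)
        fix i assume i: "i \<in> {1..Suc j}"
        show "sep (Suc (Suc j)) ?I (w ^ card {..<i} * (w * (4 * real W + 3) * 2 ^ Suc m) *
            (Kb * M * ((1 / 2 ^ m) ^ (k - j) * ?q ^ m)))
          (\<lambda>x. (\<Prod>a\<in>{..<i}. near W (Suc m) (x 0) (x a)) *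
            (near W m (x 0) (x i) * ((1 - near W (Suc m) (x 0) (x i)) / of_real (x 0 - x i))) * br m i x)"
          unfolding w_def
          by (rule sep_mult[OF sep_mult[OF sep_near_prod sep_separated_kernel] br[OF i, unfolded w_def]])
            (use i W in auto)
      qed simp
      moreover have "(\<Sum>i\<in>{1..Suc j}. w ^ card {..<i} * (w * (4 * real W + 3) * 2 ^ Suc m) *
          (Kb * M * ((1 / 2 ^ m) ^ (k - j) * ?q ^ m))) = KB * M * ((1 / 2 ^ m) ^ ?e * ?q ^ m)"
        unfolding KB_def sum_distrib_right kj
        by (intro sum.cong refl) (simp add: field_simps)
      ultimately show ?thesis by simp
    qed
    have cost: "KA * M * ((1 / 2 ^ Suc (n + s)) ^ ?e * ?q ^ Suc (n + s)) + KB * M * ((1 / 2 ^ (n + s)) ^ ?e * ?q ^ (n + s))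
        \<le> (KA + KB) * M * ((1 / 2 ^ n) ^ ?e * ?q ^ n) * ?q ^ s" for s
    proof -
      have le: "(1 / 2 ^ m) ^ ?e * ?q ^ m \<le> (1 / 2 ^ n) ^ ?e * ?q ^ (n + s)" if "n + s \<le> m" for m
      proof (intro mult_mono power_mono power_decreasing)
        show "1 / 2 ^ m \<le> (1 / 2 ^ n :: real)" using that by (intro divide_left_mono power_increasing) auto
      qed (use q that in auto)
      have "KA * M * ((1 / 2 ^ Suc (n + s)) ^ ?e * ?q ^ Suc (n + s)) \<le> KA * M * ((1 / 2 ^ n) ^ ?e * ?q ^ (n + s))"
        using le[of "Suc (n + s)"] KA(1) M by (intro mult_left_mono) auto
      moreover have "KB * M * ((1 / 2 ^ (n + s)) ^ ?e * ?q ^ (n + s)) \<le> KB * M * ((1 / 2 ^ n) ^ ?e * ?q ^ (n + s))"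
        using le[of "n + s"] KB M by (intro mult_left_mono) auto
      ultimately show ?thesis by (simp add: power_add algebra_simps)
    qed
    show ?thesis
    proof (rule sep_sums[where C = "\<lambda>s. (KA + KB) * M * ((1 / 2 ^ n) ^ ?e * ?q ^ n) * ?q ^ s"
          and \<phi> = "\<lambda>s x. A (n + s) x + B (n + s) x"])
      show "sep (Suc (Suc j)) ?I ((KA + KB) * M * ((1 / 2 ^ n) ^ ?e * ?q ^ n) * ?q ^ s)
          (\<lambda>x. A (n + s) x + B (n + s) x)" for s
        by (rule sep_mono[OF sep_add[OF sA sB] cost order_refl])
      have "(\<lambda>s. (KA + KB) * M * ((1 / 2 ^ n) ^ ?e * ?q ^ n) * ?q ^ s) sums
          ((KA + KB) * M * ((1 / 2 ^ n) ^ ?e * ?q ^ n) * (1 / (1 - ?q)))"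
        using q by (intro sums_mult geometric_sums) auto
      then show "(\<lambda>s. (KA + KB) * M * ((1 / 2 ^ n) ^ ?e * ?q ^ n) * ?q ^ s) sums
          (K * M * ((1 / 2 ^ n) ^ ?e * ?q ^ n))" by (simp add: K_def mult_ac)
      fix x :: "nat \<Rightarrow> real" assume x: "\<And>i. i < Suc (Suc j) \<Longrightarrow> x i \<in> ?I"
      have step: "Hloc W k (Suc j) f m x - Hloc W k (Suc j) f (Suc m) x = A m x + B m x" for m
        unfolding A_def B_def br_def by (rule Hloc_step[OF W f j])
      have part: "(\<Sum>s<N. A (n + s) x + B (n + s) x) = Hloc W k (Suc j) f n x - Hloc W k (Suc j) f (n + N) x" for N
        by (induction N) (simp_all add: step[symmetric])
      have "(\<lambda>N. Hloc W k (Suc j) f n x - Hloc W k (Suc j) f (n + N) x) \<longlonglongrightarrow> Hloc W k (Suc j) f n x - 0"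
        by (intro tendsto_diff tendsto_const Hloc_tendsto_0[OF jet \<epsilon>(1) j]) (use x in auto)
      then show "(\<lambda>s. A (n + s) x + B (n + s) x) sums Hloc W k (Suc j) f n x"
        unfolding sums_def part by simp
    qed
  qed
  moreover have "0 \<le> K" unfolding K_def using KA(1) KB q by simp
  ultimately have "Hbound R k \<epsilon> W (Suc j) K" unfolding Hbound_def by blast
  then show ?thesis ..
qed

lemma Hbound_exists:
  assumes "0 < \<epsilon>" "\<epsilon> \<le> 1"
  shows "j \<le> k \<Longrightarrow> 1 \<le> W \<Longrightarrow> \<exists>K. Hbound R k \<epsilon> W j K"
proof (induction j arbitrary: W)
  case 0
  then show ?case using Hbound_0[OF assms(1)] by blast
next
  case (Suc j)
  obtain K1 where K1: "Hbound R k \<epsilon> W j K1" using Suc.IH[of W] Suc.prems by auto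
  obtain K2 where K2: "Hbound R k \<epsilon> (2 * W) j K2" using Suc.IH[of "2 * W"] Suc.prems by auto
  show ?case by (rule Hbound_Suc[OF Suc.prems(2) assms Suc.prems(1) K1 K2])
qed

text \<open>At level \<open>0\<close> and with width \<open>2 R\<close> all cells are neighbours, so the cutoff disappears.\<close>

lemma sep_gdd_jet:
  fixes R :: nat
  assumes \<epsilon>: "0 < \<epsilon>" "\<epsilon> \<le> 1" and R: "1 \<le> R"
  shows "\<exists>K\<ge>0. \<forall>f M. jet k {- real R..<real R} \<epsilon> M f \<longrightarrow>
    (\<forall>y\<in>{- real R..<real R}. norm (nth_deriv k f y) \<le> M) \<longrightarrow>
    sep (Suc k) {- real R..<real R} (K * M) (gdd k f)"
proof -
  let ?I = "{- real R..<real R}"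
  obtain K where K: "Hbound R k \<epsilon> (2 * R) k K" using Hbound_exists[OF \<epsilon>, of k k "2 * R" R] R by auto
  show ?thesis
  proof (intro exI[of _ "K + 1"] conjI allI impI)
    show "0 \<le> K + 1" using K by (simp add: Hbound_def)
    fix f M assume jet: "jet k ?I \<epsilon> M f" and bd: "\<forall>y\<in>?I. norm (nth_deriv k f y) \<le> M"
    have f: "f \<in> C_k k" and M: "0 \<le> M" using jet by (auto simp: jet_def)
    have H: "sep (Suc k) ?I (K * M) (Hloc (2 * R) k k f 0)"
      using K jet unfolding Hbound_def by (metis diff_self_eq_0 mult.right_neutral power_0)
    \<comment> \<open>Divided differences of order k kill the powers below k, so of the Taylor
      polynomial only the leading coefficient survives. The jet does not control it, hence the
      separate bound on the k-th derivative.\<close>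
    have T: "sep (Suc k) ?I M (\<lambda>x. nth_deriv k f (cen 0 (x 0)) / fact k)"
    proof (rule sep_var[where g = "\<lambda>y. nth_deriv k f (cen 0 y) / fact k"])
      show "(\<lambda>y. nth_deriv k f (cen 0 y) / fact k) \<in> borel_measurable borel"
        using measurable_compose[OF cen_measurable nth_deriv_measurable[OF f order_refl]] by measurable
      show "norm (nth_deriv k f (cen 0 y) / fact k) \<le> M" if "y \<in> ?I" for y
      proof -
        have "norm (nth_deriv k f (cen 0 y) / fact k) = norm (nth_deriv k f (cen 0 y)) / fact k"
          by (simp add: norm_divide)
        also have "\<dots> \<le> norm (nth_deriv k f (cen 0 y)) / 1"
          by (intro divide_left_mono) auto
        also have "\<dots> \<le> M" using bd cen_in[OF that, of 0] by simp
        finally show ?thesis .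
      qed
    qed (use M in auto)
    have "sep (Suc k) ?I (K * M + M) (gdd k f)"
    proof (rule sep_cong[OF sep_add[OF H T]])
      fix x assume x: "\<And>i. i < Suc k \<Longrightarrow> x i \<in> ?I"
      have "\<bar>cell 0 (x 0) - cell 0 (x i)\<bar> \<le> int (2 * R)" if "i \<le> k" for i
        using cell_bound[OF x[of 0], of 0] cell_bound[OF x[of i], of 0] that by simp
      then have "star (2 * R) 0 k x = 1" unfolding star_eq by simp
      moreover have "gdd k (tay k f (cen 0 (x 0))) x = nth_deriv k f (cen 0 (x 0)) / fact k"
      proof -
        have "gdd k (tay k f (cen 0 (x 0))) x = (\<Sum>l\<in>{k}. nth_deriv l f (cen 0 (x 0)) / fact l *
            gdd k (\<lambda>y. (of_real y - of_real (cen 0 (x 0))) ^ l) x)"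
          unfolding gdd_tay by (rule sum.mono_neutral_right) (auto simp: gdd_power_linear_less)
        then show ?thesis by (simp add: gdd_power_linear_eq)
      qed
      ultimately show "Hloc (2 * R) k k f 0 x + nth_deriv k f (cen 0 (x 0)) / fact k = gdd k f x"
        by (simp add: Hloc_def gdd_diff f tay_C_k)
    qed
    then show "sep (Suc k) ?I ((K + 1) * M) (gdd k f)" by (simp add: algebra_simps)
  qed
qed

subsection \<open>Polynomial approximation\<close>

lemma vector_mean_value_bound:
  fixes f :: "real \<Rightarrow> 'a::real_normed_vector"
  assumes "\<And>t. (f has_vector_derivative f' t) (at t)"
    and "\<And>t. t \<in> closed_segment a b \<Longrightarrow> norm (f' t) \<le> B"
  shows "norm (f b - f a) \<le> B * \<bar>b - a\<bar>"
proof -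
  have "norm (f b - f a) \<le> B * norm (b - a)"
  proof (rule differentiable_bound[of "closed_segment a b" f "\<lambda>t h. h *\<^sub>R f' t"])
    show "(f has_derivative (\<lambda>h. h *\<^sub>R f' t)) (at t within closed_segment a b)" for t
      using has_vector_derivative_at_within[OF assms(1)] by (simp add: has_vector_derivative_def)
    show "onorm (\<lambda>h. h *\<^sub>R f' t) \<le> B" if "t \<in> closed_segment a b" for t
      by (rule onorm_le) (use mult_right_mono[OF assms(2)[OF that] abs_ge_zero] in \<open>simp add: mult.commute\<close>)
  qed auto
  then show ?thesis by simp
qed

lemma nth_deriv_has_vector_derivative:
  assumes "f \<in> C_k k" "i < k"
  shows "(nth_deriv i f has_vector_derivative nth_deriv (Suc i) f x) (at x)"
  using assms by (auto simp: C_k_def nth_deriv_Suc' vector_derivative_works)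

lemma has_vector_derivative_monomial:
  "((\<lambda>t. c * (of_real (t - b) ^ Suc p / fact (Suc p))) has_vector_derivative
    (c * (of_real (t - b) ^ p / fact p) :: complex)) (at t)"
proof -
  have "((\<lambda>t. (t - b) ^ Suc p / fact (Suc p)) has_field_derivative
      (real (Suc p) * (t - b) ^ p) / fact (Suc p)) (at t)"
    by (auto intro!: derivative_eq_intros simp del: power_Suc of_nat_Suc)
  moreover have "(real (Suc p) * (t - b) ^ p) / fact (Suc p) = (t - b) ^ p / fact p"
    by (simp add: field_simps del: of_nat_Suc)
  ultimately have "((\<lambda>t. (t - b) ^ Suc p / fact (Suc p)) has_field_derivative (t - b) ^ p / fact p) (at t)"
    by simp
  from has_vector_derivative_mult_right[OF has_vector_derivative_of_real[OF this], of c]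
  show ?thesis by simp
qed

text \<open>Downward induction on l: the derivative of the remainder of order l is the remainder of
  order l + 1, and the former vanishes at b.\<close>

lemma Holder_Taylor_remainder:
  assumes f: "f \<in> C_k k" and I: "convex I" and M: "0 \<le> M" and \<epsilon>: "0 < \<epsilon>"
    and H: "\<And>x y. x \<in> I \<Longrightarrow> y \<in> I \<Longrightarrow> norm (nth_deriv k f x - nth_deriv k f y) \<le> M * \<bar>x - y\<bar> powr \<epsilon>"
    and "l \<le> k" "a \<in> I" "b \<in> I"
  shows "norm (nth_deriv l f a - (\<Sum>p\<le>k - l. nth_deriv (l + p) f b * of_real (a - b) ^ p / fact p))
    \<le> M * \<bar>a - b\<bar> ^ (k - l) * \<bar>a - b\<bar> powr \<epsilon>"
  using assms(6,7)
proof (induction "k - l" arbitrary: l a)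
  case 0
  then show ?case using H[of a b] \<open>b \<in> I\<close> by simp
next
  case (Suc d)
  have l: "l < k" and d: "k - Suc l = d" using Suc.hyps by auto
  let ?g = "\<lambda>t. nth_deriv l f t - (nth_deriv l f b +
      (\<Sum>p\<le>d. nth_deriv (l + Suc p) f b * (of_real (t - b) ^ Suc p / fact (Suc p))))"
  let ?g' = "\<lambda>t. nth_deriv (Suc l) f t - (\<Sum>p\<le>d. nth_deriv (Suc l + p) f b * (of_real (t - b) ^ p / fact p))"
  have g: "nth_deriv l f t - (\<Sum>p\<le>k - l. nth_deriv (l + p) f b * of_real (t - b) ^ p / fact p) = ?g t" for t
    unfolding Suc.hyps(2)[symmetric] by (simp add: sum.atMost_Suc_shift del: power_Suc fact_Suc sum.atMost_Suc)
  have "norm (?g a - ?g b) \<le> (M * \<bar>a - b\<bar> ^ d * \<bar>a - b\<bar> powr \<epsilon>) * \<bar>a - b\<bar>"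
  proof (rule vector_mean_value_bound)
    show "(?g has_vector_derivative ?g' t) (at t)" for t
    proof -
      have "(?g has_vector_derivative nth_deriv (Suc l) f t - (0 +
          (\<Sum>p\<le>d. nth_deriv (l + Suc p) f b * (of_real (t - b) ^ p / fact p)))) (at t)"
        by (intro has_vector_derivative_diff has_vector_derivative_add has_vector_derivative_const
            has_vector_derivative_sum has_vector_derivative_monomial nth_deriv_has_vector_derivative[OF f l])
      then show ?thesis by simp
    qed
    fix t assume t: "t \<in> closed_segment b a"
    then have tI: "t \<in> I" using I Suc.prems \<open>b \<in> I\<close> closed_segment_subset[of b I a] by auto
    have tb: "\<bar>t - b\<bar> \<le> \<bar>a - b\<bar>" using t by (auto simp: closed_segment_eq_real_ivl split: if_splits)
    have "norm (?g' t) \<le> M * \<bar>t - b\<bar> ^ d * \<bar>t - b\<bar> powr \<epsilon>"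
      using Suc.hyps(1)[of "Suc l" t] l d tI by simp
    also have "\<dots> \<le> M * \<bar>a - b\<bar> ^ d * \<bar>a - b\<bar> powr \<epsilon>"
      using tb M \<epsilon> by (intro mult_mono mult_left_mono power_mono powr_mono2) auto
    finally show "norm (?g' t) \<le> M * \<bar>a - b\<bar> ^ d * \<bar>a - b\<bar> powr \<epsilon>" .
  qed
  moreover have "?g b = 0" by simp
  ultimately have "norm (?g a) \<le> (M * \<bar>a - b\<bar> ^ d * \<bar>a - b\<bar> powr \<epsilon>) * \<bar>a - b\<bar>" by simp
  then show ?case unfolding g unfolding Suc.hyps(2)[symmetric] by (simp add: mult_ac)
qed

lemma Holder_imp_jet:
  assumes "f \<in> C_k k" "convex I" "0 \<le> M" "0 < \<epsilon>"
    and "\<And>x y. x \<in> I \<Longrightarrow> y \<in> I \<Longrightarrow> norm (nth_deriv k f x - nth_deriv k f y) \<le> M * \<bar>x - y\<bar> powr \<epsilon>"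
  shows "jet k I \<epsilon> M f"
  unfolding jet_def
proof (intro conjI allI impI ballI assms)
  fix l a b assume l: "l \<le> k" and ab: "a \<in> I" "b \<in> I"
  have "norm (tcoef k f l a b) \<le>
      norm (nth_deriv l f a - (\<Sum>p\<le>k - l. nth_deriv (l + p) f b * of_real (a - b) ^ p / fact p)) / 1"
    unfolding tcoef_def norm_divide by (intro divide_left_mono) (auto simp: norm_fact)
  also have "\<dots> \<le> M * \<bar>a - b\<bar> ^ (k - l) * \<bar>a - b\<bar> powr \<epsilon>"
    using Holder_Taylor_remainder[OF assms l ab] by simp
  finally show "norm (tcoef k f l a b) \<le> M * \<bar>a - b\<bar> ^ (k - l) * \<bar>a - b\<bar> powr \<epsilon>" .
qed

lemma abs_le_powr:
  assumes "\<bar>d\<bar> \<le> L" "1 \<le> L" "0 < \<epsilon>" "\<epsilon> \<le> (1::real)"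
  shows "\<bar>d\<bar> \<le> L * \<bar>d\<bar> powr \<epsilon>"
proof (cases "d = 0")
  case False
  have "\<bar>d\<bar> = \<bar>d\<bar> powr (1 - \<epsilon>) * \<bar>d\<bar> powr \<epsilon>"
    using False by (simp add: powr_add[symmetric])
  also have "\<dots> \<le> L powr (1 - \<epsilon>) * \<bar>d\<bar> powr \<epsilon>"
    using assms by (intro mult_right_mono powr_mono2) auto
  also have "\<dots> \<le> L powr 1 * \<bar>d\<bar> powr \<epsilon>"
    using assms by (intro mult_right_mono powr_mono) auto
  finally show ?thesis using assms by simp
qed simp

text \<open>For j < k the j-th derivative is Lipschitz with constant B; on an interval of length 2 R
  this is a Hoelder bound with constant 2 R B, so \<open>sep_gdd_jet\<close> applies at every
  order.\<close>

lemma sep_gdd_Holder: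
  fixes R :: nat
  assumes \<epsilon>: "0 < \<epsilon>" "\<epsilon> \<le> 1" and R: "1 \<le> R"
  shows "\<exists>K\<ge>0. \<forall>f B. f \<in> C_k k \<longrightarrow>
    (\<forall>i\<le>k. \<forall>y\<in>{- real R..<real R}. norm (nth_deriv i f y) \<le> B) \<longrightarrow>
    (\<forall>x\<in>{- real R..<real R}. \<forall>y\<in>{- real R..<real R}.
      norm (nth_deriv k f x - nth_deriv k f y) \<le> B * \<bar>x - y\<bar> powr \<epsilon>) \<longrightarrow>
    (\<forall>j\<le>k. sep (Suc j) {- real R..<real R} (K * B) (gdd j f))"
proof -
  let ?I = "{- real R..<real R}"
  have "\<forall>j. \<exists>K. 0 \<le> K \<and> (\<forall>f M. jet j ?I \<epsilon> M f \<longrightarrow>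
    (\<forall>y\<in>?I. norm (nth_deriv j f y) \<le> M) \<longrightarrow> sep (Suc j) ?I (K * M) (gdd j f))"
    using sep_gdd_jet[OF \<epsilon> R] by blast
  from choice[OF this] obtain K where K0: "\<forall>j. 0 \<le> K j \<and> (\<forall>f M. jet j ?I \<epsilon> M f \<longrightarrow>
    (\<forall>y\<in>?I. norm (nth_deriv j f y) \<le> M) \<longrightarrow> sep (Suc j) ?I (K j * M) (gdd j f))"
    by (rule exE)
  note K = K0[THEN spec, THEN conjunct1] K0[THEN spec, THEN conjunct2, rule_format]
  show ?thesis
  proof (intro exI[of _ "(\<Sum>j\<le>k. K j) * (2 * real R)"] conjI allI impI)
    show "0 \<le> (\<Sum>j\<le>k. K j) * (2 * real R)" using K(1) by (intro mult_nonneg_nonneg sum_nonneg) auto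
    fix f B j
    assume f: "f \<in> C_k k" and bd: "\<forall>i\<le>k. \<forall>y\<in>?I. norm (nth_deriv i f y) \<le> B"
      and H: "\<forall>x\<in>?I. \<forall>y\<in>?I. norm (nth_deriv k f x - nth_deriv k f y) \<le> B * \<bar>x - y\<bar> powr \<epsilon>"
      and j: "j \<le> k"
    have "norm (nth_deriv j f (- real R)) \<le> B" using bd j R by simp
    then have B: "0 \<le> B" using norm_ge_zero order_trans by blast
    have R2: "1 \<le> 2 * real R" using R by simp
    have BR: "B \<le> B * (2 * real R)" using mult_left_mono[OF R2 B] by simp
    have "jet j ?I \<epsilon> (B * (2 * real R)) f"
    proof (rule Holder_imp_jet[OF C_k_mono[OF f j]])
      fix x y assume xy: "x \<in> ?I" "y \<in> ?I"
      show "norm (nth_deriv j f x - nth_deriv j f y) \<le> B * (2 * real R) * \<bar>x - y\<bar> powr \<epsilon>"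
      proof (cases "j = k")
        case True
        then have "norm (nth_deriv j f x - nth_deriv j f y) \<le> B * \<bar>x - y\<bar> powr \<epsilon>" using H xy by simp
        also have "\<dots> \<le> B * (2 * real R) * \<bar>x - y\<bar> powr \<epsilon>" using BR by (intro mult_right_mono) auto
        finally show ?thesis .
      next
        case False
        then have jk: "j < k" using j by simp
        have "norm (nth_deriv j f x - nth_deriv j f y) \<le> B * \<bar>x - y\<bar>"
        proof (rule vector_mean_value_bound[OF nth_deriv_has_vector_derivative[OF f jk]])
          fix t assume "t \<in> closed_segment y x"
          then have "t \<in> ?I" using closed_segment_subset[of y ?I x] xy by auto
          then show "norm (nth_deriv (Suc j) f t) \<le> B" using bd jk by simp
        qed
        also have "\<dots> \<le> B * (2 * real R * \<bar>x - y\<bar> powr \<epsilon>)"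
          using abs_le_powr[of "x - y" "2 * real R" \<epsilon>] xy R2 \<epsilon> B by (intro mult_left_mono) auto
        finally show ?thesis by (simp add: mult_ac)
      qed
    qed (use B \<epsilon> in auto)
    moreover have "\<forall>y\<in>?I. norm (nth_deriv j f y) \<le> B * (2 * real R)"
      using bd j BR by (meson order_trans)
    ultimately have "sep (Suc j) ?I (K j * (B * (2 * real R))) (gdd j f)"
      by (intro K(2)) auto
    then show "sep (Suc j) ?I ((\<Sum>j\<le>k. K j) * (2 * real R) * B) (gdd j f)"
    proof (rule sep_mono)
      have "K j \<le> (\<Sum>j\<le>k. K j)" using K(1) j by (intro member_le_sum) auto
      then have "K j * (B * (2 * real R)) \<le> (\<Sum>j\<le>k. K j) * (B * (2 * real R))"
        using B by (intro mult_right_mono) auto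
      then show "K j * (B * (2 * real R)) \<le> (\<Sum>j\<le>k. K j) * (2 * real R) * B" by (simp add: mult_ac)
    qed simp
  qed
qed

lemma Weierstrass_rpoly:
  fixes u :: "real \<Rightarrow> complex"
  assumes S: "compact S" "continuous_on S u" and e: "0 < e"
  shows "\<exists>Q. \<forall>x\<in>S. norm (u x - rpoly Q x) \<le> e"
proof -
  have "\<exists>Q :: complex poly. \<forall>x\<in>S. norm (of_real (v x) - rpoly Q x) < e / 2"
    if v: "continuous_on S v" for v :: "real \<Rightarrow> real"
  proof -
    obtain g where g: "real_polynomial_function g" "\<And>x. x \<in> S \<Longrightarrow> \<bar>v x - g x\<bar> < e / 2"
      using Stone_Weierstrass_real_polynomial_function[OF S(1) v, of "e / 2"] e by auto
    obtain a n where a: "g = (\<lambda>x. \<Sum>i\<le>n. a i * x ^ i)"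
      using g(1) unfolding real_polynomial_function_iff_sum by auto
    have "rpoly (\<Sum>i\<le>n. monom (of_real (a i)) i) x = of_real (g x)" for x
      by (simp add: a poly_sum poly_monom)
    then have "norm (of_real (v x) - rpoly (\<Sum>i\<le>n. monom (of_real (a i)) i) x) < e / 2" if "x \<in> S" for x
      using g(2)[OF that] by (simp add: norm_of_real of_real_diff[symmetric] del: of_real_diff)
    then show ?thesis by blast
  qed
  from this[of "\<lambda>x. Re (u x)"] this[of "\<lambda>x. Im (u x)"] obtain Q1 Q2 where
    Q: "\<forall>x\<in>S. norm (of_real (Re (u x)) - rpoly Q1 x) < e / 2"
      "\<forall>x\<in>S. norm (of_real (Im (u x)) - rpoly Q2 x) < e / 2"
    using S(2) by (auto intro!: continuous_intros)
  have "norm (u x - rpoly (Q1 + smult \<i> Q2) x) \<le> e" if "x \<in> S" for x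
  proof -
    have "u x - rpoly (Q1 + smult \<i> Q2) x =
        (of_real (Re (u x)) - rpoly Q1 x) + \<i> * (of_real (Im (u x)) - rpoly Q2 x)"
      by (subst complex_eq[of "u x"]) (simp add: algebra_simps)
    also have "norm \<dots> \<le> norm (of_real (Re (u x)) - rpoly Q1 x) + norm (of_real (Im (u x)) - rpoly Q2 x)"
      by (rule order_trans[OF norm_triangle_ineq]) (simp add: norm_mult)
    also have "\<dots> \<le> e" using Q that by fastforce
    finally show ?thesis .
  qed
  then show ?thesis by blast
qed

lemma pderiv_surj: "\<exists>P. pderiv P = (Q :: complex poly)"
proof -
  have "pderiv (\<Sum>i\<le>degree Q. monom (coeff Q i / of_nat (Suc i)) (Suc i)) =
      (\<Sum>i\<le>degree Q. monom (coeff Q i) i)"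
  proof -
    have "pderiv (\<Sum>i\<in>A. p i) = (\<Sum>i\<in>A. pderiv (p i))" for A and p :: "nat \<Rightarrow> complex poly"
      by (induction A rule: infinite_finite_induct) (auto simp: pderiv_add)
    then show ?thesis by (simp add: pderiv_monom del: of_nat_Suc)
  qed
  then show ?thesis using poly_as_sum_of_monoms by metis
qed

lemma nth_deriv_rpoly: "nth_deriv i (rpoly p) = rpoly ((pderiv ^^ i) p)"
  by (induction i arbitrary: p) (simp_all add: nth_deriv_Suc vderiv_rpoly funpow_swap1)

lemma iterated_antiderivative:
  "\<exists>p :: complex poly. (pderiv ^^ k) p = P \<and> (\<forall>i<k. poly ((pderiv ^^ i) p) 0 = c i)"
proof (induction k arbitrary: c)
  case (Suc k)
  obtain p1 where p1: "(pderiv ^^ k) p1 = P" "\<forall>i<k. poly ((pderiv ^^ i) p1) 0 = c (Suc i)"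
    using Suc[of "\<lambda>i. c (Suc i)"] by auto
  obtain A where A: "pderiv A = p1" using pderiv_surj by blast
  define p where "p = A + [:c 0 - poly A 0:]"
  have p: "pderiv p = p1" by (simp add: p_def A pderiv_add pderiv_pCons)
  have "poly ((pderiv ^^ i) p) 0 = c i" if "i < Suc k" for i
  proof (cases i)
    case (Suc i')
    then show ?thesis using p1(2) that p by (simp add: funpow_swap1)
  qed (simp add: p_def)
  moreover have "(pderiv ^^ Suc k) p = P" using p p1(1) by (simp add: funpow_swap1)
  ultimately show ?case by blast
qed simp

lemma nth_deriv_diff:
  assumes "f \<in> C_k k" "g \<in> C_k k" "i \<le> k"
  shows "nth_deriv i (\<lambda>y. f y - g y) = (\<lambda>y. nth_deriv i f y - nth_deriv i g y)"
  using assms(3)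
proof (induction i)
  case (Suc i)
  have "vderiv (\<lambda>y. nth_deriv i f y - nth_deriv i g y) x = nth_deriv (Suc i) f x - nth_deriv (Suc i) g x" for x
    using Suc.prems assms(1,2)
    by (intro vector_derivative_at has_vector_derivative_diff nth_deriv_has_vector_derivative) auto
  then show ?case using Suc by (simp add: nth_deriv_Suc')
qed simp

text \<open>A difference quotient of an antiderivative is a \<open>C\<^sup>1\<close> mollification that preserves the
  Hoelder modulus; approximating its derivative uniformly by polynomials gives an approximation
  in every weaker Hoelder norm.\<close>

lemma Holder_polynomial_approximation:
  fixes g \<Gamma> :: "real \<Rightarrow> complex"
  assumes der: "\<And>x. (\<Gamma> has_vector_derivative g x) (at x)" and cont: "continuous_on UNIV g"
    and H: "\<And>x y. norm (g x - g y) \<le> M * \<bar>x - y\<bar> powr (1/4)" and M: "0 \<le> M"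
    and \<delta>: "0 < \<delta>" and R: "1 \<le> R"
  shows "\<exists>P. (\<forall>x\<in>{-R..R}. norm (g x - rpoly P x) \<le> \<delta>) \<and>
    (\<forall>x\<in>{-R..R}. \<forall>y\<in>{-R..R}. norm ((g x - rpoly P x) - (g y - rpoly P y)) \<le> \<delta> * \<bar>x - y\<bar> powr (1/8))"
proof -
  \<comment> \<open>The power 8 undoes the exponent 1/8, so that 2 M h^(1/8) <= \<delta> / 2; M + 1
    avoids a zero denominator.\<close>
  define h where "h = min 1 ((\<delta> / (4 * (M + 1))) powr 8)"
  have dM: "0 < \<delta> / (4 * (M + 1))" using \<delta> M by (intro divide_pos_pos) auto
  have h: "0 < h" "h \<le> 1" using dM by (auto simp: h_def)
  have h8: "2 * M * h powr (1/8) \<le> \<delta> / 2"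
  proof -
    have "h powr (1/8) \<le> ((\<delta> / (4 * (M + 1))) powr 8) powr (1/8)"
      using h by (intro powr_mono2) (auto simp: h_def)
    also have "\<dots> = \<delta> / (4 * (M + 1))" using powr_one[OF less_imp_le[OF dM]] by (subst powr_powr) simp
    finally have "2 * M * h powr (1/8) \<le> 2 * M * (\<delta> / (4 * (M + 1)))"
      using M by (intro mult_left_mono) auto
    also have "\<dots> \<le> \<delta> / 2" using M \<delta> by (simp add: field_simps)
    finally show ?thesis .
  qed
  have h4: "M * h powr (1/4) \<le> \<delta> / 2"
  proof -
    have "h powr (1/4) \<le> h powr (1/8)" using h by (intro powr_mono') auto
    then have "M * h powr (1/4) \<le> 2 * M * h powr (1/8)" using M by (intro mult_mono) auto
    with h8 show ?thesis by simp
  qed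
  define G where "G x = (\<Gamma> (x + h) - \<Gamma> x) / of_real h" for x
  define G' where "G' x = (g (x + h) - g x) / of_real h" for x
  have der_shift: "((\<lambda>t. \<Gamma> (t + c)) has_vector_derivative g (t + c)) (at t)" for c t
  proof -
    have "((\<lambda>t. t + c) has_vector_derivative 1 + 0) (at t)"
      by (intro has_vector_derivative_add has_vector_derivative_id has_vector_derivative_const)
    from vector_diff_chain_at[OF this der] show ?thesis by (simp add: o_def)
  qed
  have derG: "(G has_vector_derivative G' x) (at x)" for x
    unfolding G_def G'_def by (intro has_vector_derivative_divide has_vector_derivative_diff der_shift der)
  have Gg: "norm (G x - g x) \<le> M * h powr (1/4)" for x
  proof -
    have "norm ((\<Gamma> (h + x) - h *\<^sub>R g x) - (\<Gamma> (0 + x) - 0 *\<^sub>R g x)) \<le> (M * h powr (1/4)) * \<bar>h - 0\<bar>"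
    proof (rule vector_mean_value_bound[where f = "\<lambda>t. \<Gamma> (t + x) - t *\<^sub>R g x"])
      show "((\<lambda>t. \<Gamma> (t + x) - t *\<^sub>R g x) has_vector_derivative g (t + x) - 1 *\<^sub>R g x) (at t)" for t
        by (intro has_vector_derivative_diff der_shift) (auto intro!: derivative_eq_intros)
      fix t assume "t \<in> closed_segment 0 h"
      then have t: "0 \<le> t" "t \<le> h" using h by (auto simp: closed_segment_eq_real_ivl)
      have "norm (g (t + x) - 1 *\<^sub>R g x) \<le> M * t powr (1/4)" using H[of "t + x" x] t by simp
      also have "\<dots> \<le> M * h powr (1/4)" using t M by (intro mult_left_mono powr_mono2) auto
      finally show "norm (g (t + x) - 1 *\<^sub>R g x) \<le> M * h powr (1/4)" .
    qed
    moreover have "(\<Gamma> (h + x) - h *\<^sub>R g x) - (\<Gamma> (0 + x) - 0 *\<^sub>R g x) = of_real h * (G x - g x)"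
      using h by (simp add: G_def scaleR_conv_of_real field_simps)
    ultimately have "h * norm (G x - g x) \<le> h * (M * h powr (1/4))"
      using h by (simp add: norm_mult mult_ac)
    then show ?thesis using h by simp
  qed
  have GG: "norm (G x - G y) \<le> M * \<bar>x - y\<bar> powr (1/4)" for x y
  proof -
    have "norm ((\<Gamma> (h + x) - \<Gamma> (h + y)) - (\<Gamma> (0 + x) - \<Gamma> (0 + y))) \<le> (M * \<bar>x - y\<bar> powr (1/4)) * \<bar>h - 0\<bar>"
    proof (rule vector_mean_value_bound[where f = "\<lambda>t. \<Gamma> (t + x) - \<Gamma> (t + y)"])
      show "((\<lambda>t. \<Gamma> (t + x) - \<Gamma> (t + y)) has_vector_derivative g (t + x) - g (t + y)) (at t)" for t
        by (intro has_vector_derivative_diff der_shift)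
      show "norm (g (t + x) - g (t + y)) \<le> M * \<bar>x - y\<bar> powr (1/4)" for t using H[of "t + x" "t + y"] by simp
    qed
    moreover have "(\<Gamma> (h + x) - \<Gamma> (h + y)) - (\<Gamma> (0 + x) - \<Gamma> (0 + y)) = of_real h * (G x - G y)"
      using h by (simp add: G_def field_simps)
    ultimately have "h * norm (G x - G y) \<le> h * (M * \<bar>x - y\<bar> powr (1/4))"
      using h by (simp add: norm_mult mult_ac)
    then show ?thesis using h by simp
  qed
  \<comment> \<open>Distances in [-R, R] are at most 2 R, so the Lipschitz constant \<eta> yields
    the Hoelder constant 2 R \<eta> = \<delta> / 2.\<close>
  define \<eta> where "\<eta> = \<delta> / (4 * R)"
  have \<eta>: "0 < \<eta>" using \<delta> R by (simp add: \<eta>_def)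
  have "continuous_on {-R..R} (\<lambda>x. g (x + h))"
    by (rule continuous_on_compose2[OF cont]) (auto intro!: continuous_on_add continuous_on_id continuous_on_const)
  moreover have "continuous_on {-R..R} g" by (rule continuous_on_subset[OF cont subset_UNIV])
  ultimately have G'_cont: "continuous_on {-R..R} G'"
    unfolding G'_def using h by (intro continuous_on_divide continuous_on_diff continuous_on_const) auto
  obtain Q where Q0: "\<forall>x\<in>{-R..R}. norm (G' x - rpoly Q x) \<le> \<eta>"
    using Weierstrass_rpoly[OF compact_Icc G'_cont \<eta>] by (rule exE)
  note Q = Q0[rule_format]
  obtain A where A: "pderiv A = Q" using pderiv_surj by blast
  define P where "P = A + [:G 0 - poly A 0:]"
  have dP: "(rpoly P has_vector_derivative rpoly Q x) (at x)" for x
    using has_vector_derivative_rpoly[of P x] by (simp add: P_def pderiv_add pderiv_pCons A)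
  have GP: "norm ((G x - rpoly P x) - (G y - rpoly P y)) \<le> \<eta> * \<bar>x - y\<bar>" if "x \<in> {-R..R}" "y \<in> {-R..R}" for x y
  proof (rule vector_mean_value_bound)
    show "((\<lambda>x. G x - rpoly P x) has_vector_derivative G' t - rpoly Q t) (at t)" for t
      by (intro has_vector_derivative_diff derG dP)
    show "norm (G' t - rpoly Q t) \<le> \<eta>" if "t \<in> closed_segment y x" for t
    proof (rule Q)
      show "t \<in> {-R..R}" using that \<open>x \<in> {-R..R}\<close> \<open>y \<in> {-R..R}\<close> closed_segment_subset[of y "{-R..R}" x] by auto
    qed
  qed
  have G0: "G 0 - rpoly P 0 = 0" by (simp add: P_def)
  show ?thesis
  proof (intro exI[of _ P] conjI ballI)
    fix x assume x: "x \<in> {-R..R}"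
    have "norm (g x - rpoly P x) \<le> norm (G x - g x) + norm (G x - rpoly P x)"
      using norm_triangle_ineq4[of "G x - rpoly P x" "G x - g x"] by (simp add: algebra_simps)
    also have "\<dots> \<le> \<delta> / 2 + \<eta> * \<bar>x - 0\<bar>"
      using Gg[of x] h4 GP[OF x, of 0] G0 R by (intro add_mono) auto
    also have "\<eta> * \<bar>x - 0\<bar> \<le> \<eta> * R" using x \<eta> by (intro mult_left_mono) auto
    also have "\<delta> / 2 + \<eta> * R \<le> \<delta>" using R \<delta> by (simp add: \<eta>_def)
    finally show "norm (g x - rpoly P x) \<le> \<delta>" by simp
  next
    fix x y assume xy: "x \<in> {-R..R}" "y \<in> {-R..R}"
    let ?d = "\<bar>x - y\<bar>"
    have 1: "norm ((g x - G x) - (g y - G y)) \<le> \<delta> / 2 * ?d powr (1/8)"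
    proof -
      have "norm ((g x - G x) - (g y - G y)) \<le> 2 * M * h powr (1/8) * ?d powr (1/8)"
      \<comment> \<open>Interpolation: below the scale h both g and G are Hoelder of exponent 1/4,
        and half of the exponent is traded for h^(1/8); above it the uniform distance M h^(1/4)
        suffices.\<close>
      proof (cases "?d \<le> h")
        case True
        have "norm ((g x - G x) - (g y - G y)) = norm ((g x - g y) - (G x - G y))" by (simp add: algebra_simps)
        also have "\<dots> \<le> M * ?d powr (1/4) + M * ?d powr (1/4)"
          using norm_triangle_ineq4[of "g x - g y" "G x - G y"] H[of x y] GG[of x y] by linarith
        also have "?d powr (1/4) = ?d powr (1/8) * ?d powr (1/8)" by (simp add: powr_add[symmetric])
        also have "M * (?d powr (1/8) * ?d powr (1/8)) + M * (?d powr (1/8) * ?d powr (1/8)) =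
            2 * M * (?d powr (1/8)) * ?d powr (1/8)" by simp
        also have "\<dots> \<le> 2 * M * h powr (1/8) * ?d powr (1/8)"
          using True M by (intro mult_right_mono mult_left_mono powr_mono2) auto
        finally show ?thesis .
      next
        case False
        have "norm ((g x - G x) - (g y - G y)) \<le> M * h powr (1/4) + M * h powr (1/4)"
          using norm_triangle_ineq4[of "g x - G x" "g y - G y"] Gg[of x] Gg[of y]
            norm_minus_commute[of "g x" "G x"] norm_minus_commute[of "g y" "G y"] by linarith
        also have "h powr (1/4) = h powr (1/8) * h powr (1/8)" by (simp add: powr_add[symmetric])
        also have "M * (h powr (1/8) * h powr (1/8)) + M * (h powr (1/8) * h powr (1/8)) =
            2 * M * (h powr (1/8)) * h powr (1/8)" by simp
        also have "\<dots> \<le> 2 * M * h powr (1/8) * ?d powr (1/8)"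
          using False h M by (intro mult_left_mono powr_mono2) auto
        finally show ?thesis .
      qed
      also have "\<dots> \<le> \<delta> / 2 * ?d powr (1/8)" using h8 by (intro mult_right_mono) auto
      finally show ?thesis .
    qed
    have 2: "norm ((G x - rpoly P x) - (G y - rpoly P y)) \<le> \<delta> / 2 * ?d powr (1/8)"
    proof -
      have "norm ((G x - rpoly P x) - (G y - rpoly P y)) \<le> \<eta> * ?d" by (rule GP[OF xy])
      also have "\<dots> \<le> \<eta> * (2 * R * ?d powr (1/8))"
        using xy R \<eta> by (intro mult_left_mono abs_le_powr) auto
      also have "\<dots> = \<delta> / 2 * ?d powr (1/8)" using R by (simp add: \<eta>_def)
      finally show ?thesis .
    qed
    have "(g x - rpoly P x) - (g y - rpoly P y) =
        ((g x - G x) - (g y - G y)) + ((G x - rpoly P x) - (G y - rpoly P y))" by simp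
    then have "norm ((g x - rpoly P x) - (g y - rpoly P y)) \<le>
        norm ((g x - G x) - (g y - G y)) + norm ((G x - rpoly P x) - (G y - rpoly P y))"
      by (metis norm_triangle_ineq)
    with 1 2 show "norm ((g x - rpoly P x) - (g y - rpoly P y)) \<le> \<delta> * ?d powr (1/8)"
      by (simp add: field_simps)
  qed
qed

text \<open>Since k >= 1, the derivative of order k - 1 is available as the antiderivative that the
  mollification uses. The polynomial approximating the k-th derivative is integrated k times with
  the initial values of f at 0, so each lower order costs a factor R.\<close>

lemma Holder_imp_NC:
  assumes k: "1 \<le> k" and f: "f \<in> Holder k (1/4)"
  shows "f \<in> NC k"
proof -
  have fk: "f \<in> C_k k" using f by (simp add: Holder_def)
  obtain M0 where M0: "\<And>x y. x \<noteq> y \<Longrightarrow> norm (nth_deriv k f x - nth_deriv k f y) / \<bar>x - y\<bar> powr (1/4) \<le> M0"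
    using f unfolding Holder_def bdd_above_def by blast
  define M where "M = max 0 M0"
  have M: "0 \<le> M" by (simp add: M_def)
  have H: "norm (nth_deriv k f x - nth_deriv k f y) \<le> M * \<bar>x - y\<bar> powr (1/4)" for x y
  proof (cases "x = y")
    case False
    then have "norm (nth_deriv k f x - nth_deriv k f y) / \<bar>x - y\<bar> powr (1/4) \<le> M"
      using M0[OF False] by (simp add: M_def)
    then show ?thesis using False by (simp add: divide_le_eq)
  qed simp
  have cont: "continuous_on UNIV (nth_deriv k f)" using fk by (simp add: C_k_def)
  have k1: "Suc (k - 1) = k" using k by simp
  have der: "(nth_deriv (k - 1) f has_vector_derivative nth_deriv k f x) (at x)" for x
    using nth_deriv_has_vector_derivative[OF fk, of "k - 1" x] k k1 by simp
  show ?thesis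
  proof (rule NC_I[OF fk])
    fix r \<delta> :: real assume r: "0 < r" and \<delta>: "0 < \<delta>"
    define R where "R = nat \<lceil>r\<rceil> + 1"
    have R: "1 \<le> R" "r < real R" unfolding R_def by linarith+
    let ?I = "{- real R..<real R}"
    obtain K where K0: "0 \<le> K \<and> (\<forall>f B. f \<in> C_k k \<longrightarrow>
      (\<forall>i\<le>k. \<forall>y\<in>?I. norm (nth_deriv i f y) \<le> B) \<longrightarrow>
      (\<forall>x\<in>?I. \<forall>y\<in>?I. norm (nth_deriv k f x - nth_deriv k f y) \<le> B * \<bar>x - y\<bar> powr (1/8)) \<longrightarrow>
      (\<forall>j\<le>k. sep (Suc j) ?I (K * B) (gdd j f)))"
      by (rule exE[OF sep_gdd_Holder[of "1/8" R k]]) (use R in auto)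
    note K = K0[THEN conjunct1] K0[THEN conjunct2, rule_format]
    define \<delta>' where "\<delta>' = \<delta> / ((K + 1) * real R ^ k)"
    have RK: "1 \<le> real R ^ k" by (rule one_le_power) (use R in linarith)
    have \<delta>': "0 < \<delta>'" unfolding \<delta>'_def
    proof (intro divide_pos_pos mult_pos_pos \<delta>)
      show "0 < K + 1" using K(1) by linarith
      show "0 < real R ^ k" using RK by linarith
    qed
    have "1 \<le> real R" using R by simp
    from Holder_polynomial_approximation[OF der cont H M \<delta>' this]
    obtain P where P0: "(\<forall>x\<in>{- real R..real R}. norm (nth_deriv k f x - rpoly P x) \<le> \<delta>') \<and>
      (\<forall>x\<in>{- real R..real R}. \<forall>y\<in>{- real R..real R}.
        norm ((nth_deriv k f x - rpoly P x) - (nth_deriv k f y - rpoly P y)) \<le> \<delta>' * \<bar>x - y\<bar> powr (1/8))"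
      by (rule exE)
    note P = P0[THEN conjunct1, rule_format] P0[THEN conjunct2, rule_format]
    obtain p where p: "(pderiv ^^ k) p = P" "\<And>i. i < k \<Longrightarrow> poly ((pderiv ^^ i) p) 0 = nth_deriv i f 0"
      using iterated_antiderivative[of k P "\<lambda>i. nth_deriv i f 0"] by auto
    let ?h = "\<lambda>t. f t - rpoly p t"
    have h: "?h \<in> C_k k" by (intro C_k_diff fk rpoly_C_k)
    have hd: "nth_deriv i ?h y = nth_deriv i f y - rpoly ((pderiv ^^ i) p) y" if "i \<le> k" for i y
      using nth_deriv_diff[OF fk rpoly_C_k that, of p] by (simp add: nth_deriv_rpoly)
    have bound: "norm (nth_deriv i ?h y) \<le> real R ^ (k - i) * \<delta>'" if "i \<le> k" "y \<in> {- real R..real R}" for i y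
      using that
    proof (induction "k - i" arbitrary: i y)
      case 0
      then show ?case using P(1) p(1) by (simp add: hd)
    next
      case (Suc d)
      have i: "i < k" and d: "d = k - Suc i" using Suc.hyps(2) by linarith+
      have "norm (nth_deriv i ?h y - nth_deriv i ?h 0) \<le> (real R ^ d * \<delta>') * \<bar>y - 0\<bar>"
      proof (rule vector_mean_value_bound[OF nth_deriv_has_vector_derivative[OF h i]])
        fix t assume t: "t \<in> closed_segment 0 y"
        have "closed_segment 0 y \<subseteq> {- real R..real R}"
          by (rule closed_segment_subset) (use Suc.prems(2) in \<open>simp_all add: convex_real_interval\<close>)
        with t have "t \<in> {- real R..real R}" by (rule subsetD[rotated])
        then show "norm (nth_deriv (Suc i) ?h t) \<le> real R ^ d * \<delta>'"
          using Suc.hyps(1)[OF d, of t] i unfolding d[symmetric] by (simp only: Suc_le_eq)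
      qed
      moreover have "nth_deriv i ?h 0 = 0" using hd[of i 0] p(2)[OF i] i by simp
      ultimately have "norm (nth_deriv i ?h y) \<le> (real R ^ d * \<delta>') * \<bar>y\<bar>" by simp
      also have "\<dots> \<le> (real R ^ d * \<delta>') * real R" using Suc.prems \<delta>' by (intro mult_left_mono) auto
      finally show ?case unfolding Suc.hyps(2)[symmetric] by (simp only: power_Suc mult_ac)
    qed
    let ?B = "real R ^ k * \<delta>'"
    have "\<forall>j\<le>k. sep (Suc j) ?I (K * ?B) (gdd j ?h)"
    proof (intro allI impI K(2)[OF h])
      fix i y assume "i \<le> k" "y \<in> ?I"
      then have "norm (nth_deriv i ?h y) \<le> real R ^ (k - i) * \<delta>'" by (intro bound) auto
      also have "\<dots> \<le> ?B" using R \<delta>' by (intro mult_right_mono power_increasing) auto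
      finally show "norm (nth_deriv i ?h y) \<le> ?B" .
    next
      fix x y assume xy: "x \<in> ?I" "y \<in> ?I"
      have "norm (nth_deriv k ?h x - nth_deriv k ?h y) \<le> \<delta>' * \<bar>x - y\<bar> powr (1/8)"
        using P(2)[of x y] xy p(1) by (simp add: hd)
      also have "\<dots> \<le> ?B * \<bar>x - y\<bar> powr (1/8)" using RK \<delta>' by (intro mult_right_mono) auto
      finally show "norm (nth_deriv k ?h x - nth_deriv k ?h y) \<le> ?B * \<bar>x - y\<bar> powr (1/8)" .
    qed auto
    moreover have "K * ?B \<le> \<delta>"
    proof -
      have "K * ?B = \<delta> * (K / (K + 1))" proof -
        have "real R ^ k \<noteq> 0" using RK by linarith
        then show ?thesis by (simp add: \<delta>'_def)
      qed
      also have "\<dots> \<le> \<delta> * 1" using K(1) \<delta> by (intro mult_left_mono) auto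
      finally show ?thesis by simp
    qed
    moreover have "{- r..r} \<subseteq> ?I" using R(2) by auto
    ultimately have "\<forall>j\<le>k. sep (Suc j) {- r..r} \<delta> (gdd j ?h)"
      by (meson sep_mono)
    then show "\<exists>p. \<forall>j\<le>k. sep (Suc j) {- r..r} \<delta> (gdd j (\<lambda>t. f t - rpoly p t))" by blast
  qed
qed

section \<open>Complex measures\<close>

definition tvar :: "(real set \<Rightarrow> complex) \<Rightarrow> real set \<Rightarrow> ennreal" where
  "tvar \<mu> A = (SUP E \<in> {E :: nat \<Rightarrow> real set. range E \<subseteq> sets borel \<and> disjoint_family E \<and> (\<Union>n. E n) = A}.
     \<Sum>n. ennreal (norm (\<mu> (E n))))"

section \<open>Countable additivity of the total variation\<close>

lemma total_variation_eq: "total_variation \<mu> = measure_of UNIV (sets borel) (tvar \<mu>)"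
  by (simp add: total_variation_def tvar_def[abs_def])

lemma complex_measure_sums:
  fixes A :: "nat \<Rightarrow> real set"
  assumes "complex_measure \<mu>" "\<And>n. A n \<in> sets borel" "disjoint_family A"
  shows "(\<lambda>n. \<mu> (A n)) sums \<mu> (\<Union>n. A n)"
proof -
  have "range A \<subseteq> sets borel" using assms(2) by auto
  with assms(1,3) show ?thesis unfolding complex_measure_def by blast
qed

lemma complex_measure_empty:
  assumes "complex_measure \<mu>"
  shows "\<mu> {} = 0"
proof -
  from complex_measure_sums[OF assms, of "\<lambda>_. {}"]
  have "summable (\<lambda>n::nat. \<mu> {})" by (auto simp: disjoint_family_on_def sums_iff)
  from summable_LIMSEQ_zero[OF this] show ?thesis by (simp add: LIMSEQ_const_iff)
qed

lemma ennreal_norm_sums_le: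
  fixes f :: "nat \<Rightarrow> complex"
  assumes "f sums s"
  shows "ennreal (norm s) \<le> (\<Sum>n. ennreal (norm (f n)))"
proof (rule LIMSEQ_le_const2)
  show "(\<lambda>n. ennreal (norm (\<Sum>i<n. f i))) \<longlonglongrightarrow> ennreal (norm s)"
    using assms unfolding sums_def by (intro tendsto_ennrealI tendsto_norm)
  have "ennreal (norm (\<Sum>i<n. f i)) \<le> (\<Sum>n. ennreal (norm (f n)))" for n
  proof -
    have "ennreal (norm (\<Sum>i<n. f i)) \<le> ennreal (\<Sum>i<n. norm (f i))"
      by (intro ennreal_leI norm_sum)
    also have "\<dots> = (\<Sum>i<n. ennreal (norm (f i)))" by (simp add: sum_ennreal)
    also have "\<dots> \<le> (\<Sum>n. ennreal (norm (f n)))" by (rule sum_le_suminf) auto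
    finally show ?thesis .
  qed
  then show "\<exists>N. \<forall>n\<ge>N. ennreal (norm (\<Sum>i<n. f i)) \<le> (\<Sum>n. ennreal (norm (f n)))" by blast
qed

lemma suminf_commute_ennreal:
  fixes f :: "nat \<Rightarrow> nat \<Rightarrow> ennreal"
  shows "(\<Sum>n. \<Sum>i. f n i) = (\<Sum>i. \<Sum>n. f n i)"
proof -
  have "(\<integral>\<^sup>+n. (\<Sum>i. f n i) \<partial>count_space UNIV) = (\<Sum>i. \<integral>\<^sup>+n. f n i \<partial>count_space UNIV)"
    by (rule nn_integral_suminf) auto
  then show ?thesis by (simp add: nn_integral_count_space_nat)
qed

lemma tvar_upper_partition:
  fixes E :: "nat \<Rightarrow> real set"
  assumes "\<And>n. E n \<in> sets borel" "disjoint_family E"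
  shows "(\<Sum>n. ennreal (norm (\<mu> (E n)))) \<le> tvar \<mu> (\<Union>n. E n)"
  unfolding tvar_def by (rule SUP_upper) (use assms in auto)

lemma tvar_upper:
  assumes I: "finite I" and F: "\<And>i. i \<in> I \<Longrightarrow> F i \<in> sets borel" "\<And>i. i \<in> I \<Longrightarrow> F i \<subseteq> A"
    and dF: "disjoint_family_on F I" and A: "A \<in> sets borel"
  shows "(\<Sum>i\<in>I. ennreal (norm (\<mu> (F i)))) \<le> tvar \<mu> A"
proof -
  obtain e where e: "bij_betw e {0..<card I} I" using ex_bij_betw_nat_finite[OF I] by blast
  have eI: "e n \<in> I" if "n < card I" for n using bij_betwE[OF e] that by auto
  \<comment> \<open>The finite family is completed to a countable partition of A by the rest of A
    and empty sets; the extra terms only increase the sum.\<close>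
  define E where "E n = (if n < card I then F (e n) else if n = card I then A - (\<Union>i\<in>I. F i) else {})" for n
  have UN: "(\<Union>i\<in>I. F i) \<in> sets borel" using I F by (intro sets.finite_UN) auto
  have E: "E n \<in> sets borel" for n using F eI A UN by (auto simp: E_def)
  have dE: "disjoint_family E"
    unfolding disjoint_family_on_def
  proof (intro ballI impI)
    fix m n :: nat assume "m \<noteq> n"
    show "E m \<inter> E n = {}"
    proof (cases "m < card I \<and> n < card I")
      case True
      then have "e m \<noteq> e n" using \<open>m \<noteq> n\<close> bij_betw_imp_inj_on[OF e] by (auto simp: inj_on_def)
      then have "F (e m) \<inter> F (e n) = {}" using dF eI True by (auto simp: disjoint_family_on_def)
      then show ?thesis using True by (simp add: E_def)
    next
      case False
      then show ?thesis using \<open>m \<noteq> n\<close> eI by (auto simp: E_def)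
    qed
  qed
  have UE: "(\<Union>n. E n) = A"
  proof
    show "(\<Union>n. E n) \<subseteq> A" using F(2) eI by (auto simp: E_def split: if_splits)
    show "A \<subseteq> (\<Union>n. E n)"
    proof
      fix x assume x: "x \<in> A"
      show "x \<in> (\<Union>n. E n)"
      proof (cases "x \<in> (\<Union>i\<in>I. F i)")
        case True
        then obtain i where i: "i \<in> I" "x \<in> F i" by auto
        then obtain n where "n < card I" "e n = i"
          using bij_betw_imp_surj_on[OF e] by (metis atLeastLessThan_iff imageE)
        with i have "x \<in> E n" by (simp add: E_def)
        then show ?thesis by blast
      next
        case False
        with x have "x \<in> E (card I)" by (simp add: E_def)
        then show ?thesis by blast
      qed
    qed
  qed
  have "(\<Sum>i\<in>I. ennreal (norm (\<mu> (F i)))) = (\<Sum>n\<in>{0..<card I}. ennreal (norm (\<mu> (F (e n)))))"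
    by (rule sum.reindex_bij_betw[OF e, symmetric])
  also have "\<dots> = (\<Sum>n\<in>{0..<card I}. ennreal (norm (\<mu> (E n))))"
    by (intro sum.cong) (auto simp: E_def)
  also have "\<dots> \<le> (\<Sum>n. ennreal (norm (\<mu> (E n))))" by (rule sum_le_suminf) auto
  also have "\<dots> \<le> tvar \<mu> A" using tvar_upper_partition[OF E dE] by (simp add: UE)
  finally show ?thesis .
qed

text \<open>Partitions of A and of B together partition the union. The estimate is made for finite
  parts of them, indexed by a disjoint sum, and passes to the suprema.\<close>

lemma tvar_superadditive:
  assumes AB: "A \<in> sets borel" "B \<in> sets borel" "A \<inter> B = {}"
  shows "tvar \<mu> A + tvar \<mu> B \<le> tvar \<mu> (A \<union> B)"
proof -
  let ?P = "\<lambda>A. {E :: nat \<Rightarrow> real set. range E \<subseteq> sets borel \<and> disjoint_family E \<and> (\<Union>n. E n) = A}"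
  let ?s = "\<lambda>E. \<Sum>n. ennreal (norm (\<mu> (E n)))"
  have ne: "?P A \<noteq> {}" if "A \<in> sets borel" for A
  proof -
    have "(\<lambda>n::nat. if n = 0 then A else {}) \<in> ?P A"
      using that by (auto simp: disjoint_family_on_def split: if_splits)
    then show ?thesis by blast
  qed
  have le: "?s E + ?s F \<le> tvar \<mu> (A \<union> B)" if E: "E \<in> ?P A" and F: "F \<in> ?P B" for E F
  proof (rule ennreal_suminf_bound_add)
    fix N
    have "?s F + (\<Sum>n<N. ennreal (norm (\<mu> (E n)))) \<le> tvar \<mu> (A \<union> B)"
    proof (rule ennreal_suminf_bound_add)
      fix N'
      let ?I = "Inl ` {..<N} \<union> Inr ` {..<N'} :: (nat + nat) set"
      let ?G = "\<lambda>i. case i of Inl n \<Rightarrow> E n | Inr n \<Rightarrow> F n"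
      have "(\<Sum>i\<in>?I. ennreal (norm (\<mu> (?G i)))) \<le> tvar \<mu> (A \<union> B)"
      proof (rule tvar_upper)
        show "disjoint_family_on ?G ?I"
          using E F AB(3) unfolding disjoint_family_on_def by (auto split: sum.split)
      qed (use E F AB in \<open>auto split: sum.split\<close>)
      moreover have "(\<Sum>i\<in>?I. ennreal (norm (\<mu> (?G i)))) =
          (\<Sum>n<N. ennreal (norm (\<mu> (E n)))) + (\<Sum>n<N'. ennreal (norm (\<mu> (F n))))"
        by (subst sum.union_disjoint) (auto simp: sum.reindex)
      ultimately show "(\<Sum>n<N'. ennreal (norm (\<mu> (F n)))) + (\<Sum>n<N. ennreal (norm (\<mu> (E n))))
          \<le> tvar \<mu> (A \<union> B)" by (simp add: add.commute)
    qed
    then show "(\<Sum>n<N. ennreal (norm (\<mu> (E n)))) + ?s F \<le> tvar \<mu> (A \<union> B)" by (simp add: add.commute)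
  qed
  have "tvar \<mu> A + tvar \<mu> B = (SUP E\<in>?P A. ?s E + tvar \<mu> B)"
    unfolding tvar_def[of \<mu> A] by (rule ennreal_SUP_add_left[OF ne[OF AB(1)], symmetric])
  also have "\<dots> = (SUP E\<in>?P A. SUP F\<in>?P B. ?s E + ?s F)"
    unfolding tvar_def[of \<mu> B] by (simp only: ennreal_SUP_add_right[OF ne[OF AB(2)]])
  also have "\<dots> \<le> tvar \<mu> (A \<union> B)" by (intro SUP_least le)
  finally show ?thesis .
qed

lemma tvar_mono:
  assumes "A \<in> sets borel" "B \<in> sets borel" "A \<subseteq> B"
  shows "tvar \<mu> A \<le> tvar \<mu> B"
proof -
  have "tvar \<mu> A \<le> tvar \<mu> A + tvar \<mu> (B - A)" by simp
  also have "\<dots> \<le> tvar \<mu> (A \<union> (B - A))" using assms by (intro tvar_superadditive) auto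
  also have "A \<union> (B - A) = B" using assms by auto
  finally show ?thesis .
qed

lemma tvar_empty: "complex_measure \<mu> \<Longrightarrow> tvar \<mu> {} = 0"
proof -
  assume \<mu>: "complex_measure \<mu>"
  have "(\<Sum>n. ennreal (norm (\<mu> (E n)))) \<le> 0" if "(\<Union>n. E n) = {}" for E :: "nat \<Rightarrow> real set"
  proof -
    have "E n = {}" for n using that by auto
    then show ?thesis using complex_measure_empty[OF \<mu>] by simp
  qed
  then have "tvar \<mu> {} \<le> 0" unfolding tvar_def by (intro SUP_least) auto
  then show ?thesis by simp
qed

text \<open>One inequality is finite superadditivity in the limit. For the other, a partition of the
  union is refined by the sets A i and the double sum is exchanged.\<close>

lemma tvar_countably_additive:
  assumes \<mu>: "complex_measure \<mu>"
  shows "countably_additive (sets borel) (tvar \<mu>)"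
proof (rule countably_additiveI)
  fix A :: "nat \<Rightarrow> real set"
  assume A: "range A \<subseteq> sets borel" "disjoint_family A" "(\<Union>n. A n) \<in> sets borel"
  have Am: "A n \<in> sets borel" for n using A by auto
  show "(\<Sum>n. tvar \<mu> (A n)) = tvar \<mu> (\<Union>n. A n)"
  proof (rule antisym)
    have fin: "(\<Sum>n<N. tvar \<mu> (A n)) \<le> tvar \<mu> (\<Union>n<N. A n)" for N
    proof (induction N)
      case (Suc N)
      have "(\<Sum>n<Suc N. tvar \<mu> (A n)) \<le> tvar \<mu> (\<Union>n<N. A n) + tvar \<mu> (A N)"
        using Suc by (simp add: add_right_mono)
      also have "\<dots> \<le> tvar \<mu> ((\<Union>n<N. A n) \<union> A N)"
      proof (rule tvar_superadditive)
        show "(\<Union>n<N. A n) \<inter> A N = {}"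
          using A(2) unfolding disjoint_family_on_def by (auto dest: less_imp_neq)
      qed (use Am in auto)
      also have "(\<Union>n<N. A n) \<union> A N = (\<Union>n<Suc N. A n)" by (auto simp: lessThan_Suc)
      finally show ?case .
    qed (simp add: tvar_empty[OF \<mu>])
    have "(\<Sum>n. tvar \<mu> (A n)) + 0 \<le> tvar \<mu> (\<Union>n. A n)"
    proof (rule ennreal_suminf_bound_add)
      fix N
      have "(\<Sum>n<N. tvar \<mu> (A n)) \<le> tvar \<mu> (\<Union>n<N. A n)" by (rule fin)
      also have "\<dots> \<le> tvar \<mu> (\<Union>n. A n)" using Am A(3) by (intro tvar_mono) auto
      finally show "(\<Sum>n<N. tvar \<mu> (A n)) + 0 \<le> tvar \<mu> (\<Union>n. A n)" by simp
    qed
    then show "(\<Sum>n. tvar \<mu> (A n)) \<le> tvar \<mu> (\<Union>n. A n)" by simp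
    show "tvar \<mu> (\<Union>n. A n) \<le> (\<Sum>n. tvar \<mu> (A n))"
      unfolding tvar_def[of \<mu> "\<Union>n. A n"]
    proof (rule SUP_least, clarify)
      fix E :: "nat \<Rightarrow> real set"
      assume E: "range E \<subseteq> sets borel" "disjoint_family E" "(\<Union>n. E n) = (\<Union>n. A n)"
      have Em: "E n \<in> sets borel" for n using E by auto
      have "(\<Sum>n. ennreal (norm (\<mu> (E n)))) \<le> (\<Sum>n. \<Sum>i. ennreal (norm (\<mu> (E n \<inter> A i))))"
      proof (rule suminf_le)
        fix n
        have "(\<lambda>i. \<mu> (E n \<inter> A i)) sums \<mu> (\<Union>i. E n \<inter> A i)"
        proof (rule complex_measure_sums[OF \<mu>])
          show "disjoint_family (\<lambda>i. E n \<inter> A i)" using A(2) by (auto simp: disjoint_family_on_def)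
        qed (use Em Am in auto)
        moreover have "(\<Union>i. E n \<inter> A i) = E n" using E(3) by auto
        ultimately show "ennreal (norm (\<mu> (E n))) \<le> (\<Sum>i. ennreal (norm (\<mu> (E n \<inter> A i))))"
          using ennreal_norm_sums_le by metis
      qed auto
      also have "\<dots> = (\<Sum>i. \<Sum>n. ennreal (norm (\<mu> (E n \<inter> A i))))" by (rule suminf_commute_ennreal)
      also have "\<dots> \<le> (\<Sum>i. tvar \<mu> (A i))"
      proof (rule suminf_le)
        fix i
        have "(\<Sum>n. ennreal (norm (\<mu> (E n \<inter> A i)))) \<le> tvar \<mu> (\<Union>n. E n \<inter> A i)"
        proof (rule tvar_upper_partition)
          show "disjoint_family (\<lambda>n. E n \<inter> A i)" using E(2) by (auto simp: disjoint_family_on_def)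
        qed (use Em Am in auto)
        moreover have "(\<Union>n. E n \<inter> A i) = A i" using E(3) by auto
        ultimately show "(\<Sum>n. ennreal (norm (\<mu> (E n \<inter> A i)))) \<le> tvar \<mu> (A i)" by simp
      qed auto
      finally show "(\<Sum>n. ennreal (norm (\<mu> (E n)))) \<le> (\<Sum>n. tvar \<mu> (A n))" .
    qed
  qed
qed

lemma sets_total_variation: "sets (total_variation \<mu>) = sets borel"
  unfolding total_variation_eq using sets.sigma_sets_eq[of "borel :: real measure"]
  by (subst sets_measure_of) auto

lemma emeasure_total_variation:
  assumes "complex_measure \<mu>" "A \<in> sets borel"
  shows "emeasure (total_variation \<mu>) A = tvar \<mu> A"
  unfolding total_variation_eq
proof (rule emeasure_measure_of_sigma)
  show "sigma_algebra UNIV (sets (borel :: real measure))"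
    using sets.sigma_algebra_axioms[of "borel :: real measure"] by simp
qed (use assms tvar_empty tvar_countably_additive in \<open>auto simp: positive_def\<close>)

section \<open>Jordan parts: domination and finiteness\<close>

lemma sets_pos_part: "sets (pos_part_measure \<nu>) = sets borel"
  unfolding pos_part_measure_def using sets.sigma_sets_eq[of "borel :: real measure"]
  by (subst sets_measure_of) auto

text \<open>If the set function of \<^const>\<open>pos_part_measure\<close> failed to be a measure, the command
  \<^const>\<open>measure_of\<close> would return the zero measure; both cases are covered at once.\<close>

lemma emeasure_pos_part_cases:
  obtains "\<And>A. emeasure (pos_part_measure \<nu>) A = 0"
  | "\<And>A. A \<in> sets borel \<Longrightarrow> emeasure (pos_part_measure \<nu>) A = (SUP B \<in> {B \<in> sets borel. B \<subseteq> A}. ennreal (\<nu> B))"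
proof (cases "measure_space UNIV (sets borel) (\<lambda>A. SUP B \<in> {B \<in> sets borel. B \<subseteq> A}. ennreal (\<nu> B))")
  case True
  then show ?thesis
    using sets.sigma_sets_eq[of "borel :: real measure"]
    by (intro that(2)) (simp add: pos_part_measure_def emeasure_measure_of_conv)
next
  case False
  then show ?thesis
    using sets.sigma_sets_eq[of "borel :: real measure"]
    by (intro that(1)) (simp add: pos_part_measure_def emeasure_measure_of_conv)
qed

text \<open>It transfers the moment condition from the total variation, for which it is stated, to
  the Jordan parts, which define the integral.\<close>

lemma pos_part_le_total_variation:
  assumes \<mu>: "complex_measure \<mu>" and \<nu>: "\<And>B. \<nu> B \<le> norm (\<mu> B)"
  shows "pos_part_measure \<nu> \<le> total_variation \<mu>"
proof -
  have sp: "space (pos_part_measure \<nu>) = space (total_variation \<mu>)"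
    using sets_eq_imp_space_eq[of "pos_part_measure \<nu>" "total_variation \<mu>"]
    by (simp add: sets_pos_part sets_total_variation)
  have "emeasure (pos_part_measure \<nu>) A \<le> emeasure (total_variation \<mu>) A" for A
  proof (cases "A \<in> sets borel")
    case True
    show ?thesis
    proof (cases rule: emeasure_pos_part_cases[of \<nu>])
      case 2
      have "(SUP B \<in> {B \<in> sets borel. B \<subseteq> A}. ennreal (\<nu> B)) \<le> tvar \<mu> A"
      proof (rule SUP_least)
        fix B assume "B \<in> {B \<in> sets borel. B \<subseteq> A}"
        then have "ennreal (norm (\<mu> B)) \<le> tvar \<mu> A"
          using tvar_upper[of "{()}" "\<lambda>_. B" A \<mu>] True by (auto simp: disjoint_family_on_def)
        then show "ennreal (\<nu> B) \<le> tvar \<mu> A" using \<nu>[of B] ennreal_leI order_trans by blast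
      qed
      then show ?thesis using True 2[OF True] emeasure_total_variation[OF \<mu> True] by simp
    qed simp
  qed (simp add: emeasure_notin_sets sets_pos_part)
  then show ?thesis
    by (auto simp: le_measure_iff sp sets_pos_part sets_total_variation le_fun_def)
qed

text \<open>A set of infinite positive part contains a subset of infinite positive part whose
  complement in it has \<open>\<bar>\<nu>\<bar> \<ge> 1\<close>; iterating this contradicts countable additivity.\<close>

lemma finite_measure_pos_part:
  assumes \<nu>: "\<And>A :: nat \<Rightarrow> real set. (\<And>n. A n \<in> sets borel) \<Longrightarrow> disjoint_family A \<Longrightarrow>
    (\<lambda>n. \<nu> (A n)) sums (\<nu> (\<Union>n. A n) :: real)"
  shows "finite_measure (pos_part_measure \<nu>)"
proof (rule finite_measureI, cases rule: emeasure_pos_part_cases[of \<nu>])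
  case 2
  let ?M = "pos_part_measure \<nu>"
  have sp: "space ?M = UNIV" using sets_eq_imp_space_eq[OF sets_pos_part[of \<nu>]] by simp
  have \<nu>0: "\<nu> {} = 0"
  proof -
    have "summable (\<lambda>n::nat. \<nu> {})"
      using \<nu>[of "\<lambda>_. {}"] by (auto simp: disjoint_family_on_def sums_iff)
    from summable_LIMSEQ_zero[OF this] show ?thesis by (simp add: LIMSEQ_const_iff)
  qed
  have add: "\<nu> (E - B) = \<nu> E - \<nu> B" if "E \<in> sets borel" "B \<in> sets borel" "B \<subseteq> E" for E B
  proof -
    let ?A = "\<lambda>n::nat. if n = 0 then B else if n = 1 then E - B else {}"
    have "(\<lambda>n. \<nu> (?A n)) sums \<nu> (\<Union>n. ?A n)"
      using that by (intro \<nu>) (auto simp: disjoint_family_on_def)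
    moreover have "(\<Union>n. ?A n) = E" using that by (auto split: if_splits)
    moreover have "(\<lambda>n. \<nu> (?A n)) sums (\<Sum>n\<in>{0, 1}. \<nu> (?A n))"
      by (rule sums_finite) (auto simp: \<nu>0)
    ultimately have "\<nu> E = \<nu> B + \<nu> (E - B)" using sums_unique2 by fastforce
    then show ?thesis by simp
  qed
  define P where "P E \<longleftrightarrow> E \<in> sets borel \<and> emeasure ?M E = \<infinity>" for E
  have step: "\<exists>E'. P E' \<and> E' \<subseteq> E \<and> 1 \<le> \<bar>\<nu> (E - E')\<bar>" if E: "P E" for E
  proof -
    have Em: "E \<in> sets borel" using E by (simp add: P_def)
    have "emeasure ?M E = \<infinity>" using E by (simp only: P_def)
    \<comment> \<open>A subset B with \<nu> B > 1 + |\<nu> E| forces |\<nu> (E - B)| > 1 too, so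
      whichever of B and E - B keeps infinite mass, the set removed is large.\<close>
    then have "ennreal (1 + \<bar>\<nu> E\<bar>) < emeasure ?M E" by simp
    then have "ennreal (1 + \<bar>\<nu> E\<bar>) < (SUP B \<in> {B \<in> sets borel. B \<subseteq> E}. ennreal (\<nu> B))"
      unfolding 2[OF Em] .
    then obtain B where B: "B \<in> sets borel" "B \<subseteq> E" "ennreal (1 + \<bar>\<nu> E\<bar>) < ennreal (\<nu> B)"
      unfolding less_SUP_iff by blast
    have Bb: "1 + \<bar>\<nu> E\<bar> < \<nu> B"
      using B(3) ennreal_leI[of "\<nu> B" "1 + \<bar>\<nu> E\<bar>"] by (meson not_le)
    have d: "\<nu> (E - B) = \<nu> E - \<nu> B" by (rule add[OF Em B(1,2)])
    have "emeasure ?M B + emeasure ?M (E - B) = emeasure ?M (B \<union> (E - B))"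
      using B Em by (intro plus_emeasure) (auto simp: sets_pos_part)
    also have "B \<union> (E - B) = E" using B by auto
    finally have "emeasure ?M B = \<infinity> \<or> emeasure ?M (E - B) = \<infinity>"
      using E by (auto simp: P_def)
    then show ?thesis
    proof
      assume "emeasure ?M B = \<infinity>"
      then show ?thesis using B d Bb by (intro exI[of _ B]) (auto simp: P_def)
    next
      assume i: "emeasure ?M (E - B) = \<infinity>"
      have "E - (E - B) = B" using B by auto
      then show ?thesis using i B Em Bb by (intro exI[of _ "E - B"]) (auto simp: P_def)
    qed
  qed
  show "emeasure ?M (space ?M) \<noteq> \<infinity>"
  proof
    assume "emeasure ?M (space ?M) = \<infinity>"
    then have "P UNIV" by (simp add: P_def sp)
    then have "\<exists>f. \<forall>n. P (f n) \<and> (f (Suc n) \<subseteq> f n \<and> 1 \<le> \<bar>\<nu> (f n - f (Suc n))\<bar>)"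
      by (intro dependent_nat_choice) (use step in auto)
    then obtain f where f: "\<And>n. P (f n)" "\<And>n. f (Suc n) \<subseteq> f n" "\<And>n. 1 \<le> \<bar>\<nu> (f n - f (Suc n))\<bar>" by auto
    have dec: "f n \<subseteq> f m" if "m \<le> n" for m n by (rule lift_Suc_antimono_le[of f, OF f(2) that])
    have dis: "disjoint_family (\<lambda>n. f n - f (Suc n))"
      unfolding disjoint_family_on_def
    proof (intro ballI impI)
      fix m n :: nat assume "m \<noteq> n"
      then consider "Suc m \<le> n" | "Suc n \<le> m" by linarith
      then show "(f m - f (Suc m)) \<inter> (f n - f (Suc n)) = {}"
        using dec[of "Suc m" n] dec[of "Suc n" m] by cases blast+
    qed
    have fm: "f n \<in> sets borel" for n using f(1)[of n] by (simp only: P_def)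
    have "(\<lambda>n. \<nu> (f n - f (Suc n))) sums \<nu> (\<Union>n. f n - f (Suc n))"
      by (rule \<nu>[OF _ dis]) (intro sets.Diff fm)
    then have "summable (\<lambda>n. \<nu> (f n - f (Suc n)))" by (rule sums_summable)
    then have "(\<lambda>n. \<nu> (f n - f (Suc n))) \<longlonglongrightarrow> 0" by (rule summable_LIMSEQ_zero)
    from tendsto_norm_zero[OF this]
    have "\<forall>\<^sub>F n in sequentially. norm (\<nu> (f n - f (Suc n))) < 1"
      by (rule order_tendstoD(2)) simp
    then obtain N where "norm (\<nu> (f N - f (Suc N))) < 1"
      unfolding eventually_sequentially by blast
    with f(3)[of N] show False by simp
  qed
qed simp

subsection \<open>Fourier transforms of positive measures\<close>

definition moment :: "nat \<Rightarrow> real measure \<Rightarrow> bool" where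
  "moment k M \<longleftrightarrow> sets M = sets borel \<and> finite_measure M \<and> integrable M (\<lambda>\<xi>. \<bar>\<xi>\<bar> ^ k)"

definition FT :: "real measure \<Rightarrow> real \<Rightarrow> complex" where
  "FT M t = (LINT \<xi>|M. exp (\<i> * of_real (t * \<xi>)))"

text \<open>The four measures are the Jordan parts of the real and imaginary parts. For k >= 1 the
  moment condition says nothing about the mass near 0, so finiteness has to come from countable
  additivity, through \<open>finite_measure_pos_part\<close>.\<close>

lemma Wiener_decomposition:
  assumes "g \<in> Wiener k"
  obtains M1 M2 M3 M4 where "moment k M1" "moment k M2" "moment k M3" "moment k M4"
    "\<And>t. g t = FT M1 t - FT M2 t + \<i> * (FT M3 t - FT M4 t)"
proof -
  obtain \<mu> where \<mu>: "complex_measure \<mu>"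
    and fin: "(\<integral>\<^sup>+ \<xi>. ennreal (\<bar>\<xi>\<bar> ^ k) \<partial>total_variation \<mu>) < \<infinity>"
    and g: "\<And>t. g t = cm_integral \<mu> (\<lambda>\<xi>. exp (\<i> * of_real (t * \<xi>)))"
    using assms unfolding Wiener_def by blast
  have mom: "moment k (pos_part_measure \<nu>)"
    if le: "\<And>B. \<nu> B \<le> norm (\<mu> B)"
      and sums: "\<And>A :: nat \<Rightarrow> real set. (\<lambda>n. \<mu> (A n)) sums \<mu> (\<Union>n. A n) \<Longrightarrow> (\<lambda>n. \<nu> (A n)) sums \<nu> (\<Union>n. A n)" for \<nu>
    unfolding moment_def
  proof (intro conjI)
    show s: "sets (pos_part_measure \<nu>) = sets borel" by (rule sets_pos_part)
    show "finite_measure (pos_part_measure \<nu>)"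
      by (rule finite_measure_pos_part) (intro sums complex_measure_sums[OF \<mu>])
    have "(\<integral>\<^sup>+ \<xi>. ennreal (\<bar>\<xi>\<bar> ^ k) \<partial>pos_part_measure \<nu>) \<le> (\<integral>\<^sup>+ \<xi>. ennreal (\<bar>\<xi>\<bar> ^ k) \<partial>total_variation \<mu>)"
      by (rule nn_integral_mono_measure)
        (use pos_part_le_total_variation[OF \<mu> le] in \<open>auto simp: sets_pos_part sets_total_variation\<close>)
    then show "integrable (pos_part_measure \<nu>) (\<lambda>\<xi>. \<bar>\<xi>\<bar> ^ k)"
      unfolding integrable_iff_bounded using fin
      by (auto simp: measurable_cong_sets[OF s refl] power_abs intro: order.strict_trans1)
  qed
  show thesis
  proof (rule that)
    show "moment k (pos_part_measure (\<lambda>A. Re (\<mu> A)))"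
      by (rule mom) (auto simp: complex_Re_le_cmod intro: sums_Re)
    show "moment k (pos_part_measure (\<lambda>A. - Re (\<mu> A)))"
      by (rule mom) (use abs_Re_le_cmod in \<open>auto simp: abs_le_iff intro!: sums_minus sums_Re\<close>)
    show "moment k (pos_part_measure (\<lambda>A. Im (\<mu> A)))"
      by (rule mom) (use abs_Im_le_cmod in \<open>auto simp: abs_le_iff intro!: sums_Im\<close>)
    show "moment k (pos_part_measure (\<lambda>A. - Im (\<mu> A)))"
      by (rule mom) (use abs_Im_le_cmod in \<open>auto simp: abs_le_iff intro!: sums_minus sums_Im\<close>)
  qed (simp add: g cm_integral_def FT_def)
qed

lemma exp_i_diff_le: "norm (exp (\<i> * of_real (s * \<xi>)) - exp (\<i> * of_real (t * \<xi>))) \<le> \<bar>\<xi>\<bar> * \<bar>s - t\<bar>"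
proof (rule vector_mean_value_bound[where f = "\<lambda>u. exp (\<i> * of_real (u * \<xi>))"])
  show "((\<lambda>u. exp (\<i> * of_real (u * \<xi>))) has_vector_derivative
      \<i> * of_real \<xi> * exp (\<i> * of_real (u * \<xi>))) (at u)" for u
  proof -
    have "((\<lambda>z. exp (\<i> * (z * of_real \<xi>))) has_field_derivative
        \<i> * of_real \<xi> * exp (\<i> * (of_real u * of_real \<xi>))) (at (of_real u))"
      by (auto intro!: derivative_eq_intros)
    from has_vector_derivative_real_field[OF this] show ?thesis by simp
  qed
  show "norm (\<i> * of_real \<xi> * exp (\<i> * of_real (u * \<xi>))) \<le> \<bar>\<xi>\<bar>" for u
    using norm_exp_i_times[of "u * \<xi>"] by (simp add: norm_mult)
qed

lemma moment_integrable:
  assumes "moment k M" "j \<le> k"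
  shows "integrable M (\<lambda>\<xi>. \<bar>\<xi>\<bar> ^ j)"
proof -
  interpret finite_measure M using assms by (simp add: moment_def)
  have [measurable_cong]: "sets M = sets borel" using assms by (simp add: moment_def)
  show ?thesis
  proof (rule Bochner_Integration.integrable_bound[of M "\<lambda>\<xi>. 1 + \<bar>\<xi>\<bar> ^ k"])
    show "integrable M (\<lambda>\<xi>. 1 + \<bar>\<xi>\<bar> ^ k)" using assms by (simp add: moment_def)
    have "\<bar>\<xi>\<bar> ^ j \<le> 1 + \<bar>\<xi>\<bar> ^ k" for \<xi> :: real
    proof (cases "\<bar>\<xi>\<bar> \<le> 1")
      case True
      then have "\<bar>\<xi>\<bar> ^ j \<le> 1" by (intro power_le_one) auto
      then show ?thesis by (simp add: add_increasing2)
    next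
      case False
      then have "\<bar>\<xi>\<bar> ^ j \<le> \<bar>\<xi>\<bar> ^ k" using assms by (intro power_increasing) auto
      then show ?thesis by simp
    qed
    then show "AE \<xi> in M. norm (\<bar>\<xi>\<bar> ^ j) \<le> norm (1 + \<bar>\<xi>\<bar> ^ k)" by (auto simp: power_abs abs_of_nonneg)
  qed measurable
qed

lemma FT_weight_integrable:
  assumes "moment k M" "j \<le> k"
  shows "integrable M (\<lambda>\<xi>. (\<i> * of_real \<xi>) ^ j * exp (\<i> * of_real (t * \<xi>)))"
proof -
  have [measurable_cong]: "sets M = sets borel" using assms by (simp add: moment_def)
  show ?thesis
    by (rule Bochner_Integration.integrable_bound[OF moment_integrable[OF assms]])
      (auto simp: norm_mult norm_power norm_exp_i_times[of "t * _", simplified])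
qed

text \<open>Dominated convergence along sequences: by \<open>exp_i_diff_le\<close> the difference
  quotients are bounded by |\<xi>|^(j+1), which is integrable because j < k.\<close>

lemma FT_weight_derivative:
  assumes M: "moment k M" and j: "j < k"
  shows "((\<lambda>t. LINT \<xi>|M. (\<i> * of_real \<xi>) ^ j * exp (\<i> * of_real (t * \<xi>))) has_vector_derivative
    (LINT \<xi>|M. (\<i> * of_real \<xi>) ^ Suc j * exp (\<i> * of_real (t * \<xi>)))) (at t)"
proof -
  have [measurable_cong]: "sets M = sets borel" using M by (simp add: moment_def)
  let ?q = "\<lambda>j s \<xi>. (\<i> * of_real \<xi>) ^ j * exp (\<i> * of_real (s * \<xi>))"
  let ?G = "\<lambda>j s. LINT \<xi>|M. ?q j s \<xi>"
  have int: "integrable M (?q j s)" "integrable M (?q (Suc j) s)" for s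
    using FT_weight_integrable[OF M less_imp_le[OF j]] FT_weight_integrable[OF M Suc_leI[OF j]] by blast+
  have "((\<lambda>s. norm (?G j s - ?G j t - (s - t) *\<^sub>R ?G (Suc j) t) / norm (s - t)) \<longlongrightarrow> 0) (at t)"
    unfolding tendsto_at_iff_sequentially o_def
  proof (intro allI impI)
    fix X assume X: "\<forall>i. X i \<in> UNIV - {t}" "X \<longlonglongrightarrow> t"
    then have ne: "X i \<noteq> t" for i by auto
    have "(\<lambda>i. LINT \<xi>|M. (?q j (X i) \<xi> - ?q j t \<xi>) / of_real (X i - t)) \<longlonglongrightarrow> ?G (Suc j) t"
    proof (rule integral_dominated_convergence[where w = "\<lambda>\<xi>. \<bar>\<xi>\<bar> ^ Suc j"])
      show "integrable M (\<lambda>\<xi>. \<bar>\<xi>\<bar> ^ Suc j)" by (rule moment_integrable[OF M Suc_leI[OF j]])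
      show "AE \<xi> in M. (\<lambda>i. (?q j (X i) \<xi> - ?q j t \<xi>) / of_real (X i - t)) \<longlonglongrightarrow> ?q (Suc j) t \<xi>"
      proof (rule AE_I2)
        fix \<xi>
        have "((\<lambda>z. (\<i> * of_real \<xi>) ^ j * exp (\<i> * (z * of_real \<xi>))) has_field_derivative
            (\<i> * of_real \<xi>) ^ Suc j * exp (\<i> * (of_real t * of_real \<xi>))) (at (of_real t))"
          by (auto intro!: derivative_eq_intros)
        then have "((\<lambda>z. ((\<i> * of_real \<xi>) ^ j * exp (\<i> * (z * of_real \<xi>)) -
            (\<i> * of_real \<xi>) ^ j * exp (\<i> * (of_real t * of_real \<xi>))) / (z - of_real t)) \<longlongrightarrow>
            (\<i> * of_real \<xi>) ^ Suc j * exp (\<i> * (of_real t * of_real \<xi>))) (at (of_real t))"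
          by (simp add: has_field_derivative_iff)
        moreover have "filterlim (\<lambda>i. complex_of_real (X i)) (at (of_real t)) sequentially"
          unfolding filterlim_at using X(2) ne by (auto intro: tendsto_of_real)
        ultimately show "(\<lambda>i. (?q j (X i) \<xi> - ?q j t \<xi>) / of_real (X i - t)) \<longlonglongrightarrow> ?q (Suc j) t \<xi>"
          using filterlim_compose[of _ _ "at (of_real t)" "\<lambda>i. complex_of_real (X i)" sequentially] by simp
      qed
      fix i
      show "AE \<xi> in M. norm ((?q j (X i) \<xi> - ?q j t \<xi>) / of_real (X i - t)) \<le> \<bar>\<xi>\<bar> ^ Suc j"
      proof (rule AE_I2)
        fix \<xi>
        have "norm (?q j (X i) \<xi> - ?q j t \<xi>) =
            \<bar>\<xi>\<bar> ^ j * norm (exp (\<i> * of_real (X i * \<xi>)) - exp (\<i> * of_real (t * \<xi>)))"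
          by (simp add: right_diff_distrib[symmetric] norm_mult norm_power del: of_real_mult)
        also have "\<dots> \<le> \<bar>\<xi>\<bar> ^ j * (\<bar>\<xi>\<bar> * \<bar>X i - t\<bar>)" by (intro mult_left_mono exp_i_diff_le) auto
        finally have "norm (?q j (X i) \<xi> - ?q j t \<xi>) \<le> \<bar>\<xi>\<bar> ^ Suc j * \<bar>X i - t\<bar>" by (simp add: mult_ac)
        then show "norm ((?q j (X i) \<xi> - ?q j t \<xi>) / of_real (X i - t)) \<le> \<bar>\<xi>\<bar> ^ Suc j"
          using ne[of i] by (simp add: norm_divide divide_le_eq del: of_real_diff)
      qed
    qed measurable
    then have "(\<lambda>i. (?G j (X i) - ?G j t) / of_real (X i - t)) \<longlonglongrightarrow> ?G (Suc j) t"
      using int by simp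
    then have "(\<lambda>i. norm ((?G j (X i) - ?G j t) / of_real (X i - t) - ?G (Suc j) t)) \<longlonglongrightarrow> 0"
      by (simp add: LIM_zero tendsto_norm_zero)
    moreover have "norm ((?G j (X i) - ?G j t) / of_real (X i - t) - ?G (Suc j) t) =
        norm (?G j (X i) - ?G j t - (X i - t) *\<^sub>R ?G (Suc j) t) / norm (X i - t)" for i
    proof -
      have "a / of_real (X i - t) - b = (a - (X i - t) *\<^sub>R b) / of_real (X i - t)" for a b :: complex
        using ne[of i] by (simp add: scaleR_conv_of_real diff_divide_distrib del: of_real_diff)
      then show ?thesis by (simp add: norm_divide del: of_real_diff)
    qed
    ultimately show "(\<lambda>i. norm (?G j (X i) - ?G j t - (X i - t) *\<^sub>R ?G (Suc j) t) / norm (X i - t)) \<longlonglongrightarrow> 0"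
      by simp
  qed
  then show ?thesis
    unfolding has_vector_derivative_def has_derivative_iff_norm by (simp add: bounded_linear_scaleR_left)
qed

lemma FT_weight_continuous:
  assumes M: "moment k M" and j: "j \<le> k"
  shows "continuous_on UNIV (\<lambda>t. LINT \<xi>|M. (\<i> * of_real \<xi>) ^ j * exp (\<i> * of_real (t * \<xi>)))"
  unfolding continuous_on_sequentially o_def
proof (intro allI impI ballI)
  have [measurable_cong]: "sets M = sets borel" using M by (simp add: moment_def)
  fix X :: "nat \<Rightarrow> real" and t assume X: "(\<forall>n. X n \<in> UNIV) \<and> X \<longlonglongrightarrow> t"
  show "(\<lambda>n. LINT \<xi>|M. (\<i> * of_real \<xi>) ^ j * exp (\<i> * of_real (X n * \<xi>))) \<longlonglongrightarrow>
      (LINT \<xi>|M. (\<i> * of_real \<xi>) ^ j * exp (\<i> * of_real (t * \<xi>)))"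
  proof (rule integral_dominated_convergence[where w = "\<lambda>\<xi>. \<bar>\<xi>\<bar> ^ j"])
    show "integrable M (\<lambda>\<xi>. \<bar>\<xi>\<bar> ^ j)" by (rule moment_integrable[OF M j])
    show "AE \<xi> in M. (\<lambda>n. (\<i> * of_real \<xi>) ^ j * exp (\<i> * of_real (X n * \<xi>))) \<longlonglongrightarrow>
        (\<i> * of_real \<xi>) ^ j * exp (\<i> * of_real (t * \<xi>))"
      using X by (intro AE_I2 tendsto_intros) auto
    show "AE \<xi> in M. norm ((\<i> * of_real \<xi>) ^ j * exp (\<i> * of_real (X n * \<xi>))) \<le> \<bar>\<xi>\<bar> ^ j" for n
      using norm_exp_i_times[of "X n * _"] by (auto simp: norm_mult norm_power)
  qed measurable
qed

lemma FT_C_k: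
  assumes M: "moment k M"
  shows "FT M \<in> C_k k"
    and "j \<le> k \<Longrightarrow> nth_deriv j (FT M) = (\<lambda>t. LINT \<xi>|M. (\<i> * of_real \<xi>) ^ j * exp (\<i> * of_real (t * \<xi>)))"
proof -
  have nd: "nth_deriv j (FT M) = (\<lambda>t. LINT \<xi>|M. (\<i> * of_real \<xi>) ^ j * exp (\<i> * of_real (t * \<xi>)))"
    if "j \<le> k" for j using that
  proof (induction j)
    case 0
    then show ?case by (simp add: FT_def[abs_def])
  next
    case (Suc j)
    then show ?case
      using vector_derivative_at[OF FT_weight_derivative[OF M, of j]] by (simp add: nth_deriv_Suc')
  qed
  then show "j \<le> k \<Longrightarrow> nth_deriv j (FT M) = (\<lambda>t. LINT \<xi>|M. (\<i> * of_real \<xi>) ^ j * exp (\<i> * of_real (t * \<xi>)))" .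
  show "FT M \<in> C_k k"
    unfolding C_k_def mem_Collect_eq
  proof (intro conjI allI impI)
    fix j t assume "j < k"
    then show "nth_deriv j (FT M) differentiable at t"
      using FT_weight_derivative[OF M, of j t] nd[of j] by (simp add: differentiableI_vector)
  qed (use FT_weight_continuous[OF M order_refl] nd in simp)
qed

section \<open>Wiener functions\<close>

text \<open>The approximation required by \<open>NC_I\<close>, for one fixed interval. The functions
  with this property form a linear space closed under series that converge in the tensor norms, so
  Fourier transforms can be treated piece by piece.\<close>

definition approximable :: "nat \<Rightarrow> real \<Rightarrow> (real \<Rightarrow> complex) \<Rightarrow> bool" where
  "approximable k r f \<longleftrightarrow> f \<in> C_k k \<and>
     (\<forall>\<delta>>0. \<exists>p. \<forall>j\<le>k. sep (Suc j) {-r..r} \<delta> (gdd j (\<lambda>t. f t - rpoly p t)))"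

lemma approximableD: "approximable k r f \<Longrightarrow> f \<in> C_k k"
  by (simp add: approximable_def)

lemma approximable_rpoly: "approximable k r (rpoly p)"
  unfolding approximable_def
proof (intro conjI allI impI)
  fix \<delta> :: real assume "0 < \<delta>"
  then have "\<forall>j\<le>k. sep (Suc j) {-r..r} \<delta> (gdd j (\<lambda>t. rpoly p t - rpoly p t))"
    using sep_zero[of \<delta>] by (simp add: gdd_0_fun[abs_def])
  then show "\<exists>q. \<forall>j\<le>k. sep (Suc j) {-r..r} \<delta> (gdd j (\<lambda>t. rpoly p t - rpoly q t))" by blast
qed (rule rpoly_C_k)

lemma approximable_add:
  assumes "approximable k r f" "approximable k r g"
  shows "approximable k r (\<lambda>y. f y + g y)"
  unfolding approximable_def
proof (intro conjI allI impI)
  have fg: "f \<in> C_k k" "g \<in> C_k k" using assms approximableD by auto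
  show "(\<lambda>y. f y + g y) \<in> C_k k" using fg by (rule C_k_add)
  fix \<delta> :: real assume "0 < \<delta>"
  then have d: "0 < \<delta> / 2" by simp
  obtain p where p: "\<forall>j\<le>k. sep (Suc j) {-r..r} (\<delta> / 2) (gdd j (\<lambda>t. f t - rpoly p t))"
    using assms(1) d unfolding approximable_def by blast
  obtain q where q: "\<forall>j\<le>k. sep (Suc j) {-r..r} (\<delta> / 2) (gdd j (\<lambda>t. g t - rpoly q t))"
    using assms(2) d unfolding approximable_def by blast
  have "sep (Suc j) {-r..r} \<delta> (gdd j (\<lambda>t. f t + g t - rpoly (p + q) t))" if j: "j \<le> k" for j
  proof -
    have eq: "(\<lambda>t. f t + g t - rpoly (p + q) t) = (\<lambda>t. (f t - rpoly p t) + (g t - rpoly q t))" by auto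
    have "sep (Suc j) {-r..r} (\<delta> / 2 + \<delta> / 2) (gdd j (\<lambda>t. (f t - rpoly p t) + (g t - rpoly q t)))"
      by (rule sep_cong[OF sep_add[OF p[rule_format, OF j] q[rule_format, OF j]]])
        (simp add: gdd_add C_k_diff rpoly_C_k C_k_mono[OF fg(1) j] C_k_mono[OF fg(2) j])
    then show ?thesis unfolding eq by simp
  qed
  then show "\<exists>p. \<forall>j\<le>k. sep (Suc j) {-r..r} \<delta> (gdd j (\<lambda>t. f t + g t - rpoly p t))" by blast
qed

lemma approximable_cmult:
  assumes "approximable k r f"
  shows "approximable k r (\<lambda>y. c * f y)"
  unfolding approximable_def
proof (intro conjI allI impI)
  have f: "f \<in> C_k k" using assms approximableD by auto
  show "(\<lambda>y. c * f y) \<in> C_k k" using f by (rule C_k_cmult)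
  fix \<delta> :: real assume \<delta>: "0 < \<delta>"
  then have d: "0 < \<delta> / (norm c + 1)" by (simp add: add_nonneg_pos)
  obtain p where p: "\<forall>j\<le>k. sep (Suc j) {-r..r} (\<delta> / (norm c + 1)) (gdd j (\<lambda>t. f t - rpoly p t))"
    using assms d unfolding approximable_def by blast
  have c: "norm c * (\<delta> / (norm c + 1)) \<le> \<delta>"
  proof -
    have "norm c / (norm c + 1) \<le> 1" by (simp add: divide_le_eq_1 add_nonneg_pos)
    from mult_right_mono[OF this less_imp_le[OF \<delta>]] show ?thesis by simp
  qed
  have "sep (Suc j) {-r..r} \<delta> (gdd j (\<lambda>t. c * f t - rpoly (smult c p) t))" if j: "j \<le> k" for j
  proof -
    have eq: "(\<lambda>t. c * f t - rpoly (smult c p) t) = (\<lambda>t. c * (f t - rpoly p t))"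
      by (auto simp: algebra_simps)
    show ?thesis unfolding eq
      by (rule sep_cong[OF sep_cmult[OF p[rule_format, OF j] _ _ c]])
        (auto simp: gdd_cmult C_k_diff rpoly_C_k C_k_mono[OF f j])
  qed
  then show "\<exists>p. \<forall>j\<le>k. sep (Suc j) {-r..r} \<delta> (gdd j (\<lambda>t. c * f t - rpoly p t))" by blast
qed

lemma approximable_sum: "(\<And>i. i \<in> A \<Longrightarrow> approximable k r (f i)) \<Longrightarrow> approximable k r (\<lambda>y. \<Sum>i\<in>A. f i y)"
proof (induction A rule: infinite_finite_induct)
  case (insert x F)
  then show ?case by (auto intro: approximable_add)
qed (use approximable_rpoly[of k r 0] in auto)

lemma sep_gdd_sums_Icc:
  assumes r: "0 < r" and f: "f \<in> C_k j" and g: "\<And>n. g n \<in> C_k j"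
    and "\<And>n. sep (Suc j) {-r..r} (C n) (gdd j (g n))" "C sums D"
    and "\<And>y. y \<in> {-r..r} \<Longrightarrow> (\<lambda>n. g n y) sums f y"
  shows "sep (Suc j) {-r..r} D (gdd j f)"
proof (rule sep_gdd_sums[where c = "\<lambda>i. r / real (Suc i)", OF _ _ _ f g assms(4-6)])
  have "r / real (Suc i) \<le> r" for i using r by (simp add: divide_le_eq mult_le_cancel_left1)
  then show "r / real (Suc i) \<in> {-r..r}" for i
    using r by (auto intro: order_trans[of _ 0])
  show "inj (\<lambda>i. r / real (Suc i))" using r by (auto simp: inj_def field_simps)
qed auto

text \<open>A partial sum is approximated by a polynomial, and the rest has tensor norm at most the
  tail of c; the terms c n serve all orders j <= k at once.\<close>

lemma approximable_sums:
  assumes r: "0 < r" and f: "f \<in> C_k k" and g: "\<And>n. approximable k r (g n)"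
    and sep: "\<And>j n. j \<le> k \<Longrightarrow> sep (Suc j) {-r..r} (c n) (gdd j (g n))" and c: "summable c"
    and sums: "\<And>y. y \<in> {-r..r} \<Longrightarrow> (\<lambda>n. g n y) sums f y"
  shows "approximable k r f"
  unfolding approximable_def
proof (intro conjI allI impI f)
  fix \<delta> :: real assume "0 < \<delta>"
  then have d: "0 < \<delta> / 2" by simp
  obtain N where N: "norm (\<Sum>i. c (i + N)) < \<delta> / 2" using suminf_exist_split[OF d c] by blast
  let ?h = "\<lambda>y. \<Sum>n<N. g n y"
  have h: "approximable k r ?h" by (rule approximable_sum) (rule g)
  obtain p where p: "\<forall>j\<le>k. sep (Suc j) {-r..r} (\<delta> / 2) (gdd j (\<lambda>t. ?h t - rpoly p t))"
    using h d unfolding approximable_def by blast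
  have "sep (Suc j) {-r..r} \<delta> (gdd j (\<lambda>t. f t - rpoly p t))" if j: "j \<le> k" for j
  proof -
    have Cj: "f \<in> C_k j" "?h \<in> C_k j" "g n \<in> C_k j" for n
      using C_k_mono[OF f j] C_k_mono[OF approximableD[OF h] j] C_k_mono[OF approximableD[OF g] j] by auto
    have "sep (Suc j) {-r..r} (\<Sum>i. c (i + N)) (gdd j (\<lambda>t. f t - ?h t))"
    proof (rule sep_gdd_sums_Icc[OF r C_k_diff[OF Cj(1,2)]])
      show "g (n + N) \<in> C_k j" for n by (rule Cj(3))
      show "sep (Suc j) {-r..r} (c (n + N)) (gdd j (g (n + N)))" for n by (rule sep[OF j])
      show "(\<lambda>i. c (i + N)) sums (\<Sum>i. c (i + N))"
        using c summable_ignore_initial_segment summable_sums by blast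
      show "(\<lambda>n. g (n + N) y) sums (f y - ?h y)" if "y \<in> {-r..r}" for y
        using sums_split_initial_segment[OF sums[OF that], of N] by simp
    qed
    then have t: "sep (Suc j) {-r..r} (\<delta> / 2) (gdd j (\<lambda>t. f t - ?h t))"
      by (rule sep_mono) (use N in auto)
    have eq: "(\<lambda>t. f t - rpoly p t) = (\<lambda>t. (f t - ?h t) + (?h t - rpoly p t))" by auto
    have "sep (Suc j) {-r..r} (\<delta> / 2 + \<delta> / 2) (gdd j (\<lambda>t. (f t - ?h t) + (?h t - rpoly p t)))"
      by (rule sep_cong[OF sep_add[OF t p[rule_format, OF j]]])
        (rule gdd_add[symmetric], (intro C_k_diff rpoly_C_k Cj)+)
    then show ?thesis unfolding eq by simp
  qed
  then show "\<exists>p. \<forall>j\<le>k. sep (Suc j) {-r..r} \<delta> (gdd j (\<lambda>t. f t - rpoly p t))" by blast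
qed

lemma power_series_bound:
  assumes r: "0 < r" and f: "f \<in> C_k k"
    and sums: "\<And>y. y \<in> {-r..r} \<Longrightarrow> (\<lambda>l. a l * of_real y ^ l) sums f y"
    and D: "(\<lambda>l. b l * (1 + r) ^ l) sums D" and b: "\<And>l. norm (a l) \<le> b l"
  shows "approximable k r f" "j \<le> k \<Longrightarrow> sep (Suc j) {-r..r} D (gdd j f)"
proof -
  have pw: "(\<lambda>y. of_real y ^ l) \<in> C_k i" for l i using C_k_power[OF C_k_of_real[of 0]] by simp
  have summand: "(\<lambda>y. a l * of_real y ^ l) \<in> C_k i" for l i by (intro C_k_cmult pw)
  have cost: "sep (Suc i) {-r..r} (b l * (1 + r) ^ l) (gdd i (\<lambda>y. a l * of_real y ^ l))" for i l
  proof (rule sep_cong)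
    show "sep (Suc i) {-r..r} (b l * (1 + r) ^ l) (\<lambda>x. a l * gdd i (\<lambda>y. of_real y ^ l) x)"
      by (rule sep_cmult[OF sep_gdd_power[of _ r]]) (use r b in \<open>auto simp: abs_le_iff intro!: mult_right_mono\<close>)
  qed (simp add: gdd_cmult[OF pw])
  show "approximable k r f"
  proof (rule approximable_sums[OF r f _ cost sums_summable[OF D] sums])
    show "approximable k r (\<lambda>y. a l * of_real y ^ l)" for l
      using approximable_rpoly[of k r "monom (a l) l"] by (simp add: poly_monom)
  qed auto
  show "j \<le> k \<Longrightarrow> sep (Suc j) {-r..r} D (gdd j f)"
    by (rule sep_gdd_sums_Icc[OF r C_k_mono[OF f] summand cost D sums]) auto
qed

section \<open>Exponentials and Fourier transforms of pieces of a measure\<close>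

lemma sep_gdd_mult:
  assumes f: "f \<in> C_k j" "\<And>i. i \<le> j \<Longrightarrow> sep (Suc i) S (C i) (gdd i f)"
    and g: "g \<in> C_k j" "\<And>i. i \<le> j \<Longrightarrow> sep (Suc i) S (D i) (gdd i g)"
  shows "sep (Suc j) S (\<Sum>i\<le>j. C i * D (j - i)) (gdd j (\<lambda>y. f y * g y))"
proof (rule sep_cong)
  show "sep (Suc j) S (\<Sum>i\<le>j. C i * D (j - i)) (\<lambda>x. \<Sum>i\<le>j. gdd i f x * gdd (j - i) g (\<lambda>l. x (l + i)))"
  proof (intro sep_sum sep_mult)
    fix i assume i: "i \<in> {..j}"
    show "sep (Suc j) S (C i) (gdd i f)"
      using sep_reindex[OF f(2)[of i], of "\<lambda>l. l" "Suc j"] i by simp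
    show "sep (Suc j) S (D (j - i)) (\<lambda>x. gdd (j - i) g (\<lambda>l. x (l + i)))"
      by (rule sep_reindex[OF g(2)]) (use i in auto)
  qed simp
qed (simp add: gdd_leibniz[OF f(1) g(1)])

definition ee :: "real \<Rightarrow> real \<Rightarrow> complex" where
  "ee d y = exp (\<i> * of_real (y * d))"

lemma ee_C_k: "(\<lambda>y. c * ee d y) \<in> C_k k"
proof (induction k arbitrary: c)
  case 0
  show ?case unfolding C_k_0 ee_def by (intro continuous_intros)
next
  case (Suc k)
  show ?case
  proof (rule C_k_SucI(1))
    fix x
    have "((\<lambda>z. c * exp (\<i> * (z * of_real d))) has_field_derivative
        (c * (\<i> * of_real d)) * exp (\<i> * (of_real x * of_real d))) (at (of_real x))"
      by (auto intro!: derivative_eq_intros)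
    from has_vector_derivative_real_field[OF this]
    show "((\<lambda>y. c * ee d y) has_vector_derivative (c * (\<i> * of_real d)) * ee d x) (at x)"
      by (simp add: ee_def)
  qed (rule Suc)
qed

lemma ee_norm: "norm (ee d y) = 1"
  unfolding ee_def by (rule norm_exp_i_times)

lemma sep_ee_unit:
  assumes r: "0 < r" and d: "\<bar>d\<bar> \<le> 1"
  shows "sep (Suc j) {-r..r} (exp (1 + r)) (gdd j (ee d))"
proof (rule power_series_bound(2)[OF r])
  show "ee d \<in> C_k j" using ee_C_k[of 1 d j] by simp
  show "(\<lambda>l. (\<i> * of_real d) ^ l / fact l * of_real y ^ l) sums ee d y" for y
    using exp_converges[of "\<i> * of_real (y * d)"]
    by (simp add: ee_def scaleR_conv_of_real field_simps power_mult_distrib)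
  show "(\<lambda>l. 1 / fact l * (1 + r) ^ l) sums exp (1 + r)"
    using exp_converges[of "1 + r"] by (simp add: field_simps)
  show "norm ((\<i> * of_real d) ^ l / fact l :: complex) \<le> 1 / fact l" for l
    using d by (auto simp: norm_divide norm_power norm_mult intro!: divide_right_mono power_le_one)
qed auto

text \<open>The constant \<open>1\<close> at order \<open>0\<close> is what keeps the bound for \<open>e\<^sup>n\<close> polynomial in \<open>n\<close>.\<close>

lemma sep_ee_nat:
  assumes r: "0 < r" and \<sigma>: "\<bar>\<sigma>\<bar> \<le> 1" and K: "K = fact k * exp (1 + r)" and "j \<le> k"
  shows "sep (Suc j) {-r..r} ((real n * K) ^ j / fact j) (gdd j (ee (real n * \<sigma>)))"
  using \<open>j \<le> k\<close>
proof (induction n arbitrary: j)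
  case 0
  have "ee (real 0 * \<sigma>) = (\<lambda>y. 1)" by (auto simp: ee_def)
  then show ?case
    using sep_const[of "{-r..r}" "Suc 0" 1 1] sep_zero[of 0]
    by (cases j) (simp_all add: gdd_const[abs_def])
next
  case (Suc n)
  have E: "1 \<le> exp (1 + r)" using r by simp
  have K1: "1 \<le> K" unfolding K using E fact_ge_1[of k] by (metis mult_mono' mult_1 zero_le_one)
  \<comment> \<open>The choice K = k! exp (1 + r) makes the plain bound exp (1 + r) at most K^i / i!
    for 1 <= i <= k; for i = 0 unimodularity gives 1. With bounds of the form x^i / i! the Leibniz
    sum is the binomial expansion of (n K + K)^j / j!.\<close>
  have unit: "sep (Suc i) {-r..r} (K ^ i / fact i) (gdd i (ee \<sigma>))" if i: "i \<le> k" for i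
  proof (cases i)
    case 0
    have "sep (Suc 0) {-r..r} 1 (\<lambda>x. ee \<sigma> (x 0))"
    proof (rule sep_var)
      show "ee \<sigma> \<in> borel_measurable borel"
        using C_k_continuous[OF ee_C_k[of 1 \<sigma> 0]] by (simp add: borel_measurable_continuous_onI)
    qed (auto simp: ee_norm)
    from sep_cong[OF this, of "gdd 0 (ee \<sigma>)"] show ?thesis using 0 by simp
  next
    case (Suc i')
    have "fact i \<le> (fact k :: real)" using i by (intro fact_mono) 
    then have "fact i * exp (1 + r) \<le> K" unfolding K by (intro mult_right_mono) auto
    also have "K \<le> K ^ i" using K1 Suc by (intro self_le_power) auto
    finally have "exp (1 + r) \<le> K ^ i / fact i" by (simp add: field_simps)
    then show ?thesis by (rule sep_mono[OF sep_ee_unit[OF r \<sigma>]]) simp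
  qed
  have eC: "ee d \<in> C_k j" for d using ee_C_k[of 1 d j] by simp
  have eq: "ee (real (Suc n) * \<sigma>) = (\<lambda>y. ee (real n * \<sigma>) y * ee \<sigma> y)"
    by (auto simp: ee_def exp_add[symmetric] algebra_simps)
  have "sep (Suc j) {-r..r} (\<Sum>i\<le>j. ((real n * K) ^ i / fact i) * (K ^ (j - i) / fact (j - i)))
      (gdd j (\<lambda>y. ee (real n * \<sigma>) y * ee \<sigma> y))"
    by (rule sep_gdd_mult[OF eC _ eC]) (use Suc unit in auto)
  moreover have "(\<Sum>i\<le>j. ((real n * K) ^ i / fact i) * (K ^ (j - i) / fact (j - i))) =
      (real (Suc n) * K) ^ j / fact j"
  proof -
    have "(real (Suc n) * K) ^ j = (real n * K + K) ^ j" by (simp add: algebra_simps)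
    also have "\<dots> = (\<Sum>i\<le>j. real (j choose i) * (real n * K) ^ i * K ^ (j - i))"
      by (rule binomial_ring)
    finally show ?thesis
      by (simp add: sum_divide_distrib binomial_fact field_simps)
  qed
  ultimately show ?case unfolding eq by simp
qed

definition restr :: "real measure \<Rightarrow> real set \<Rightarrow> real measure" where
  "restr M B = density M (\<lambda>\<xi>. ennreal (indicator B \<xi>))"

lemma restr_moment:
  assumes M: "moment k M" and B: "B \<in> sets borel"
  shows "moment k (restr M B)"
    and "FT (restr M B) y = (LINT \<xi>|M. indicator B \<xi> *\<^sub>R exp (\<i> * of_real (y * \<xi>)))"
proof -
  have s[measurable_cong]: "sets M = sets borel" using M by (simp add: moment_def)
  interpret finite_measure M using M by (simp add: moment_def)
  have B'[measurable]: "B \<in> sets M" using B s by simp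
  show "moment k (restr M B)"
    unfolding moment_def
  proof (intro conjI)
    show "sets (restr M B) = sets borel" by (simp add: restr_def s)
    have "emeasure (restr M B) (space (restr M B)) = emeasure M B"
    proof -
      have "emeasure (restr M B) (space M) = (\<integral>\<^sup>+ \<xi>. ennreal (indicator B \<xi>) * indicator (space M) \<xi> \<partial>M)"
        unfolding restr_def by (rule emeasure_density) auto
      also have "\<dots> = (\<integral>\<^sup>+ \<xi>. indicator B \<xi> \<partial>M)"
        by (intro nn_integral_cong) (auto simp: indicator_def)
      finally show ?thesis by (simp add: restr_def)
    qed
    then show "finite_measure (restr M B)"
      by (intro finite_measureI) (simp add: emeasure_eq_measure)
    have "integrable M (\<lambda>\<xi>. indicator B \<xi> *\<^sub>R (\<bar>\<xi>\<bar> ^ k))"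
      by (rule Bochner_Integration.integrable_bound[of M "\<lambda>\<xi>. \<bar>\<xi>\<bar> ^ k"])
        (use M in \<open>auto simp: moment_def indicator_def\<close>)
    then show "integrable (restr M B) (\<lambda>\<xi>. \<bar>\<xi>\<bar> ^ k)"
      unfolding restr_def by (subst integrable_density) auto
  qed
  show "FT (restr M B) y = (LINT \<xi>|M. indicator B \<xi> *\<^sub>R exp (\<i> * of_real (y * \<xi>)))"
    unfolding FT_def restr_def by (subst integral_density) auto
qed

text \<open>Removing the character of frequency d translates the measure to within L of 0. The
  transform is then a power series in y with l-th coefficient at most L^l / l! times the mass of B,
  and the cost (1 + r)^l of y^l makes the sum an exponential.\<close>

lemma restr_power_series:
  assumes M: "moment k M" and B: "B \<in> sets borel" and r: "0 < r" and L: "0 \<le> L"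
    and near: "\<And>\<xi>. \<xi> \<in> B \<Longrightarrow> \<bar>\<xi> - d\<bar> \<le> L"
  shows "approximable k r (\<lambda>y. ee (- d) y * FT (restr M B) y)"
    and "j \<le> k \<Longrightarrow> sep (Suc j) {-r..r} (measure M B * exp (L * (1 + r))) (gdd j (\<lambda>y. ee (- d) y * FT (restr M B) y))"
proof -
  have s[measurable_cong]: "sets M = sets borel" using M by (simp add: moment_def)
  interpret finite_measure M using M by (simp add: moment_def)
  have B'[measurable]: "B \<in> sets M" using B s by simp
  define a where "a l = \<i> ^ l / fact l * (LINT \<xi>|M. indicator B \<xi> *\<^sub>R (of_real (\<xi> - d) ^ l :: complex))" for l
  have C: "(\<lambda>y. ee (- d) y * FT (restr M B) y) \<in> C_k k"
    using C_k_mult[OF ee_C_k[of 1 "- d" k] FT_C_k(1)[OF restr_moment(1)[OF M B]]] by simp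
  have intB: "integrable M (\<lambda>\<xi>. indicator B \<xi> :: real)" by (simp add: emeasure_eq_measure)
  have Lb: "norm (indicator B \<xi> *\<^sub>R (of_real (\<xi> - d) ^ l :: complex)) \<le> L ^ l * indicator B \<xi>" for \<xi> l
    using near[of \<xi>] by (auto simp: indicator_def norm_power simp del: of_real_diff intro!: power_mono)
  have intl: "integrable M (\<lambda>\<xi>. indicator B \<xi> *\<^sub>R (of_real (\<xi> - d) ^ l :: complex))" for l
    by (rule Bochner_Integration.integrable_bound[of M "\<lambda>\<xi>. L ^ l * indicator B \<xi>"])
      (use intB Lb L in \<open>auto intro: order_trans[OF Lb]\<close>)
  have b: "norm (a l) \<le> measure M B * L ^ l / fact l" for l
  proof -
    have "norm (LINT \<xi>|M. indicator B \<xi> *\<^sub>R (of_real (\<xi> - d) ^ l :: complex)) \<le> (LINT \<xi>|M. L ^ l * indicator B \<xi>)"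
      by (rule Bochner_Integration.integral_norm_bound_integral[OF intl]) (use intB Lb in auto)
    also have "\<dots> = L ^ l * measure M B" using sets_eq_imp_space_eq[OF s] by simp
    finally show ?thesis
      by (simp add: a_def norm_mult norm_divide norm_power divide_right_mono mult_ac)
  qed
  have sums: "(\<lambda>l. a l * of_real y ^ l) sums (ee (- d) y * FT (restr M B) y)" for y
  proof -
    let ?f = "\<lambda>l \<xi>. indicator B \<xi> *\<^sub>R ((\<i> * of_real (y * (\<xi> - d))) ^ l / fact l) :: complex"
    have f_eq: "?f l \<xi> = (\<i> ^ l / fact l * of_real y ^ l) * (indicator B \<xi> *\<^sub>R (of_real (\<xi> - d) ^ l))" for l \<xi>
      by (simp add: power_mult_distrib scaleR_conv_of_real mult_ac)
    have intf: "integrable M (?f l)" for l unfolding f_eq by (rule integrable_mult_right) (rule intl)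
    have fn: "norm (?f l \<xi>) \<le> (\<bar>y\<bar> * L) ^ l / fact l * indicator B \<xi>" for l \<xi>
    proof -
      have "norm (?f l \<xi>) = (\<bar>y\<bar> ^ l / fact l) * norm (indicator B \<xi> *\<^sub>R (of_real (\<xi> - d) ^ l :: complex))"
        unfolding f_eq norm_mult[of _ "indicator B \<xi> *\<^sub>R _"] by (simp add: norm_mult norm_divide norm_power)
      also have "\<dots> \<le> (\<bar>y\<bar> ^ l / fact l) * (L ^ l * indicator B \<xi>)" by (intro mult_left_mono Lb) auto
      finally show ?thesis by (simp add: power_mult_distrib mult_ac)
    qed
    have sm: "summable (\<lambda>l. (\<bar>y\<bar> * L) ^ l / fact l)"
      using summable_exp[of "\<bar>y\<bar> * L"] by (simp add: divide_inverse mult.commute)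
    have "(\<lambda>l. LINT \<xi>|M. ?f l \<xi>) sums (LINT \<xi>|M. (\<Sum>l. ?f l \<xi>))"
    proof (rule sums_integral[OF intf])
      show "AE \<xi> in M. summable (\<lambda>l. norm (?f l \<xi>))"
      proof (rule AE_I2)
        fix \<xi>
        have "summable (\<lambda>l. (\<bar>y\<bar> * L) ^ l / fact l * indicator B \<xi>)" by (rule summable_mult2[OF sm])
        then show "summable (\<lambda>l. norm (?f l \<xi>))"
          by (rule summable_comparison_test[rotated]) (use fn in \<open>auto intro!: exI[of _ 0]\<close>)
      qed
      have "norm (LINT \<xi>|M. norm (?f l \<xi>)) \<le> (\<bar>y\<bar> * L) ^ l / fact l * measure M B" for l
      proof -
        have "(LINT \<xi>|M. norm (?f l \<xi>)) \<le> (LINT \<xi>|M. (\<bar>y\<bar> * L) ^ l / fact l * indicator B \<xi>)"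
          by (rule integral_mono[OF integrable_norm[OF intf] integrable_mult_right[OF intB] fn])
        also have "\<dots> = (\<bar>y\<bar> * L) ^ l / fact l * measure M B" using sets_eq_imp_space_eq[OF s] by simp
        finally show ?thesis unfolding real_norm_def by (subst abs_of_nonneg) (rule integral_nonneg_AE, simp_all)
      qed
      then show "summable (\<lambda>l. LINT \<xi>|M. norm (?f l \<xi>))"
        by (intro summable_comparison_test[OF _ summable_mult2[OF sm]]) auto
    qed
    moreover have "(LINT \<xi>|M. ?f l \<xi>) = a l * of_real y ^ l" for l
      unfolding f_eq a_def integral_mult_right_zero by (simp only: mult_ac)
    moreover have "(LINT \<xi>|M. (\<Sum>l. ?f l \<xi>)) = ee (- d) y * FT (restr M B) y"
    proof -
      have "(\<Sum>l. ?f l \<xi>) = ee (- d) y * (indicator B \<xi> *\<^sub>R exp (\<i> * of_real (y * \<xi>)))" for \<xi>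
      proof -
        have "(\<lambda>l. (\<i> * of_real (y * (\<xi> - d))) ^ l / fact l) sums exp (\<i> * of_real (y * (\<xi> - d)))"
          using exp_converges[of "\<i> * of_real (y * (\<xi> - d))"] by (simp add: scaleR_conv_of_real field_simps)
        from sums_scaleR_right[OF this, of "indicator B \<xi>"]
        have "(\<Sum>l. ?f l \<xi>) = indicator B \<xi> *\<^sub>R exp (\<i> * of_real (y * (\<xi> - d)))" by (simp add: sums_iff)
        also have "exp (\<i> * of_real (y * (\<xi> - d))) = ee (- d) y * exp (\<i> * of_real (y * \<xi>))"
          unfolding ee_def exp_add[symmetric] by (simp add: algebra_simps)
        finally show ?thesis by simp
      qed
      then show ?thesis
        unfolding restr_moment(2)[OF M B] by (simp only: integral_mult_right_zero)
    qed
    ultimately show ?thesis by (simp only:)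
  qed
  have D: "(\<lambda>l. measure M B * L ^ l / fact l * (1 + r) ^ l) sums (measure M B * exp (L * (1 + r)))"
  proof -
    have eq: "measure M B * L ^ l / fact l * (1 + r) ^ l = measure M B * ((L * (1 + r)) ^ l /\<^sub>R fact l)" for l
      by (simp only: power_mult_distrib divide_inverse real_scaleR_def mult_ac)
    show ?thesis unfolding eq by (intro sums_mult exp_converges)
  qed
  show "approximable k r (\<lambda>y. ee (- d) y * FT (restr M B) y)"
    by (rule power_series_bound(1)[OF r C sums D b])
  show "j \<le> k \<Longrightarrow> sep (Suc j) {-r..r} (measure M B * exp (L * (1 + r))) (gdd j (\<lambda>y. ee (- d) y * FT (restr M B) y))"
    by (rule power_series_bound(2)[OF r C sums D b])
qed

definition icell :: "nat \<Rightarrow> real set" where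
  "icell n = {\<xi>. \<lfloor>\<xi>\<rfloor> = int_decode n}"

lemma icell_eq: "\<xi> \<in> icell n \<longleftrightarrow> n = int_encode \<lfloor>\<xi>\<rfloor>"
  by (auto simp: icell_def)

lemma icell_borel: "icell n \<in> sets borel"
proof -
  have "icell n = {of_int (int_decode n)..<of_int (int_decode n) + 1}"
    by (auto simp: icell_def floor_eq_iff)
  then show ?thesis by simp
qed

text \<open>By \<open>sep_ee_nat\<close> the character of frequency d costs a polynomial in |d| of
  degree at most k, and the remaining factor costs a multiple of the mass of the cell; the Leibniz
  rule combines the two.\<close>

lemma sep_FT_icell:
  assumes M: "moment k M" and r: "0 < r" and K: "K = fact k * exp (1 + r)" and j: "j \<le> k"
  shows "sep (Suc j) {-r..r}
    (real (Suc k) * (1 + K) ^ k * exp (1 + r) * ((1 + \<bar>real_of_int (int_decode n)\<bar>) ^ k * measure M (icell n)))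
    (gdd j (FT (restr M (icell n))))"
proof -
  let ?d = "int_decode n"
  let ?B = "icell n"
  let ?m = "measure M ?B"
  let ?A = "\<lambda>y. ee (- of_int ?d) y * FT (restr M ?B) y"
  let ?N = "real (nat \<bar>?d\<bar>)"
  have near: "\<bar>\<xi> - of_int ?d\<bar> \<le> 1" if "\<xi> \<in> ?B" for \<xi>
    using that unfolding icell_def by simp linarith
  have A: "sep (Suc i) {-r..r} (?m * exp (1 + r)) (gdd i ?A)" if "i \<le> k" for i
    using restr_power_series(2)[OF M icell_borel r _ near that] by simp
  have AC: "?A \<in> C_k j"
    using restr_power_series(1)[OF M icell_borel r _ near] approximableD C_k_mono[OF _ j] by force
  \<comment> \<open>\<open>sep_ee_nat\<close> treats natural multiples of a frequency of modulus at
    most 1, so the integer d is written as |d| sgn d.\<close>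
  have dN: "ee (of_int ?d) = ee (?N * of_int (sgn ?d))"
  proof -
    have "real_of_int ?d = ?N * of_int (sgn ?d)" by (simp add: sgn_if)
    then show ?thesis by simp
  qed
  have e: "sep (Suc i) {-r..r} ((?N * K) ^ i / fact i) (gdd i (ee (of_int ?d)))" if "i \<le> k" for i
    unfolding dN by (rule sep_ee_nat[OF r _ K that]) (simp add: sgn_if)
  have eC: "ee (of_int ?d) \<in> C_k j" using ee_C_k[of 1 _ j] by simp
  have eq: "FT (restr M ?B) = (\<lambda>y. ee (of_int ?d) y * ?A y)"
  proof
    fix y
    have "ee (of_int ?d) y * ee (- of_int ?d) y = 1"
      unfolding ee_def exp_add[symmetric] by (simp add: algebra_simps)
    then show "FT (restr M ?B) y = ee (of_int ?d) y * ?A y" by (simp add: mult.assoc[symmetric])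
  qed
  have "sep (Suc j) {-r..r} (\<Sum>i\<le>j. ((?N * K) ^ i / fact i) * (?m * exp (1 + r))) (gdd j (\<lambda>y. ee (of_int ?d) y * ?A y))"
  proof (rule sep_gdd_mult[OF eC _ AC])
    fix i assume "i \<le> j"
    then have i: "i \<le> k" using j by simp
    show "sep (Suc i) {-r..r} ((?N * K) ^ i / fact i) (gdd i (ee (of_int ?d)))" by (rule e[OF i])
    show "sep (Suc i) {-r..r} (?m * exp (1 + r)) (gdd i ?A)" by (rule A[OF i])
  qed
  then have "sep (Suc j) {-r..r} (\<Sum>i\<le>j. ((?N * K) ^ i / fact i) * (?m * exp (1 + r))) (gdd j (FT (restr M ?B)))"
    by (simp only: eq[symmetric])
  then show ?thesis
  proof (rule sep_mono)
    have K0: "0 \<le> K" by (simp add: K)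
    have Nd: "?N = \<bar>real_of_int ?d\<bar>" by simp
    let ?X = "(1 + \<bar>real_of_int ?d\<bar>) * (1 + K)"
    have X1: "1 \<le> ?X" using K0 mult_mono[of 1 "1 + \<bar>real_of_int ?d\<bar>" 1 "1 + K"] by simp
    have le: "(?N * K) ^ i / fact i \<le> ?X ^ k" if "i \<le> j" for i
    proof -
      have "(?N * K) ^ i / fact i \<le> (?N * K) ^ i / 1"
        using K0 by (intro divide_left_mono) auto
      also have "\<dots> \<le> ?X ^ i"
        unfolding Nd div_by_1 using K0 by (intro power_mono mult_mono) auto
      also have "\<dots> \<le> ?X ^ k" using X1 that j by (intro power_increasing) auto
      finally show ?thesis .
    qed
    have "(\<Sum>i\<le>j. ((?N * K) ^ i / fact i) * (?m * exp (1 + r))) \<le> (\<Sum>i\<le>j. ?X ^ k * (?m * exp (1 + r)))"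
      by (intro sum_mono mult_right_mono le) auto
    also have "\<dots> = real (Suc j) * (?X ^ k * (?m * exp (1 + r)))" by simp
    also have "\<dots> \<le> real (Suc k) * (?X ^ k * (?m * exp (1 + r)))"
      using j X1 by (intro mult_right_mono) auto
    also have "\<dots> = real (Suc k) * (1 + K) ^ k * exp (1 + r) * ((1 + \<bar>real_of_int ?d\<bar>) ^ k * ?m)"
      by (simp only: power_mult_distrib mult_ac)
    finally show "(\<Sum>i\<le>j. ((?N * K) ^ i / fact i) * (?m * exp (1 + r)))
        \<le> real (Suc k) * (1 + K) ^ k * exp (1 + r) * ((1 + \<bar>real_of_int ?d\<bar>) ^ k * ?m)" .
  qed simp
qed

text \<open>Here the series is centred at 0. The bound that comes with it grows exponentially with
  the distance of the cell from 0 and is useless for summation, but for a single cell only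
  approximability is wanted.\<close>

lemma approximable_FT_icell:
  assumes "moment k M" "0 < r"
  shows "approximable k r (FT (restr M (icell n)))"
proof -
  have "\<bar>\<xi> - 0\<bar> \<le> \<bar>real_of_int (int_decode n)\<bar> + 1" if "\<xi> \<in> icell n" for \<xi>
    using that unfolding icell_def by simp linarith
  from restr_power_series(1)[OF assms(1) icell_borel assms(2) _ this]
  have "approximable k r (\<lambda>y. ee (- 0) y * FT (restr M (icell n)) y)" by simp
  then show ?thesis by (simp add: ee_def)
qed

lemma icell_moment_summable:
  assumes M: "moment k M"
  shows "summable (\<lambda>n. (1 + \<bar>real_of_int (int_decode n)\<bar>) ^ k * measure M (icell n))"
proof (rule summableI_nonneg_bounded)
  have s[measurable_cong]: "sets M = sets borel" using M by (simp add: moment_def)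
  interpret finite_measure M using M by (simp add: moment_def)
  have B[measurable]: "icell n \<in> sets M" for n using icell_borel s by simp
  \<comment> \<open>On the cell of d one has |d| <= |\<xi>| + 1, so the weight (1 + |d|)^k is at
    most (2 + |\<xi>|)^k; splitting at |\<xi>| = 2 dominates the latter by 4^k + 2^k
    |\<xi>|^k.\<close>
  let ?w = "\<lambda>\<xi>::real. (2 + \<bar>\<xi>\<bar>) ^ k"
  have wi: "integrable M ?w"
  proof (rule Bochner_Integration.integrable_bound[of M "\<lambda>\<xi>. 4 ^ k + 2 ^ k * \<bar>\<xi>\<bar> ^ k"])
    show "integrable M (\<lambda>\<xi>. 4 ^ k + 2 ^ k * \<bar>\<xi>\<bar> ^ k)" using M by (simp add: moment_def)
    have "?w \<xi> \<le> 4 ^ k + 2 ^ k * \<bar>\<xi>\<bar> ^ k" for \<xi>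
    proof (cases "\<bar>\<xi>\<bar> \<le> 2")
      case True
      then have "?w \<xi> \<le> 4 ^ k" by (intro power_mono) auto
      then show ?thesis by (simp add: add_increasing2)
    next
      case False
      then have "?w \<xi> \<le> (2 * \<bar>\<xi>\<bar>) ^ k" by (intro power_mono) auto
      then show ?thesis by (simp add: power_mult_distrib add_increasing)
    qed
    then show "AE \<xi> in M. norm (?w \<xi>) \<le> norm (4 ^ k + 2 ^ k * \<bar>\<xi>\<bar> ^ k)" by auto
  qed measurable
  have iw: "integrable M (\<lambda>\<xi>. indicator (icell n) \<xi> * ?w \<xi>)" for n
    by (rule Bochner_Integration.integrable_bound[OF wi]) (auto simp: indicator_def)
  have le: "(1 + \<bar>real_of_int (int_decode n)\<bar>) ^ k * measure M (icell n) \<le> (LINT \<xi>|M. indicator (icell n) \<xi> * ?w \<xi>)" for n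
  proof -
    have "(LINT \<xi>|M. (1 + \<bar>real_of_int (int_decode n)\<bar>) ^ k * indicator (icell n) \<xi>) \<le> (LINT \<xi>|M. indicator (icell n) \<xi> * ?w \<xi>)"
    proof (rule integral_mono)
      show "integrable M (\<lambda>\<xi>. (1 + \<bar>real_of_int (int_decode n)\<bar>) ^ k * indicator (icell n) \<xi>)"
        by (simp add: emeasure_eq_measure)
      fix \<xi>
      show "(1 + \<bar>real_of_int (int_decode n)\<bar>) ^ k * indicator (icell n) \<xi> \<le> indicator (icell n) \<xi> * ?w \<xi>"
      proof (cases "\<xi> \<in> icell n")
        case True
        then have "\<bar>real_of_int (int_decode n)\<bar> \<le> \<bar>\<xi>\<bar> + 1" unfolding icell_def by simp linarith
        then have "(1 + \<bar>real_of_int (int_decode n)\<bar>) ^ k \<le> ?w \<xi>" by (intro power_mono) auto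
        then show ?thesis using True by simp
      qed simp
    qed (rule iw)
    then show ?thesis using sets_eq_imp_space_eq[OF s] by simp
  qed
  show "(\<Sum>n<N. (1 + \<bar>real_of_int (int_decode n)\<bar>) ^ k * measure M (icell n)) \<le> (LINT \<xi>|M. ?w \<xi>)" for N
  proof -
    have "(\<Sum>n<N. (1 + \<bar>real_of_int (int_decode n)\<bar>) ^ k * measure M (icell n)) \<le>
        (\<Sum>n<N. LINT \<xi>|M. indicator (icell n) \<xi> * ?w \<xi>)" by (intro sum_mono le)
    also have "\<dots> = (LINT \<xi>|M. (\<Sum>n<N. indicator (icell n) \<xi> * ?w \<xi>))"
      by (rule Bochner_Integration.integral_sum[symmetric]) (rule iw)
    also have "\<dots> \<le> (LINT \<xi>|M. ?w \<xi>)"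
    proof (rule integral_mono[OF _ wi])
      fix \<xi>
      have "(\<Sum>n<N. indicator (icell n) \<xi> * ?w \<xi>) = (\<Sum>n<N. if n = int_encode \<lfloor>\<xi>\<rfloor> then ?w \<xi> else 0)"
        by (intro sum.cong) (auto simp: indicator_def icell_eq)
      also have "\<dots> \<le> ?w \<xi>" by (auto simp: sum.delta)
      finally show "(\<Sum>n<N. indicator (icell n) \<xi> * ?w \<xi>) \<le> ?w \<xi>" .
    qed (rule Bochner_Integration.integrable_sum[OF iw])
    finally show ?thesis .
  qed
qed auto

lemma approximable_FT:
  assumes M: "moment k M" and r: "0 < r"
  shows "approximable k r (FT M)"
proof (rule approximable_sums[OF r FT_C_k(1)[OF M] approximable_FT_icell[OF M r] sep_FT_icell[OF M r refl]
      summable_mult[OF icell_moment_summable[OF M]]])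
  fix y
  have s[measurable_cong]: "sets M = sets borel" using M by (simp add: moment_def)
  interpret finite_measure M using M by (simp add: moment_def)
  have B[measurable]: "icell n \<in> sets M" for n using icell_borel s by simp
  let ?f = "\<lambda>n \<xi>. indicator (icell n) \<xi> *\<^sub>R exp (\<i> * of_real (y * \<xi>))"
  have nf: "norm (?f n \<xi>) = indicator (icell n) \<xi>" for n \<xi>
    using norm_exp_i_times[of "y * \<xi>"] by (simp add: indicator_def)
  have single: "?f n \<xi> = (if n = int_encode \<lfloor>\<xi>\<rfloor> then exp (\<i> * of_real (y * \<xi>)) else 0)" for n \<xi>
    by (auto simp: indicator_def icell_eq)
  have "(\<lambda>n. LINT \<xi>|M. ?f n \<xi>) sums (LINT \<xi>|M. (\<Sum>n. ?f n \<xi>))"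
  proof (rule sums_integral)
    show "integrable M (?f n)" for n
      by (rule integrable_const_bound[where B = 1]) (auto simp: nf indicator_def)
    show "AE \<xi> in M. summable (\<lambda>n. norm (?f n \<xi>))"
      unfolding nf by (auto simp: indicator_def icell_eq intro!: AE_I2 summable_finite[of "{int_encode \<lfloor>_\<rfloor>}"])
    have "summable (\<lambda>n. measure M (icell n))"
    proof (rule summable_comparison_test[OF _ icell_moment_summable[OF M]], intro exI allI impI)
      fix n
      have "1 \<le> (1 + \<bar>real_of_int (int_decode n)\<bar>) ^ k" by (rule one_le_power) simp
      from mult_right_mono[OF this, of "measure M (icell n)"]
      show "norm (measure M (icell n)) \<le> (1 + \<bar>real_of_int (int_decode n)\<bar>) ^ k * measure M (icell n)" by simp
    qed
    then show "summable (\<lambda>n. LINT \<xi>|M. norm (?f n \<xi>))"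
      unfolding nf using sets_eq_imp_space_eq[OF s] by simp
  qed
  moreover have "(\<Sum>n. ?f n \<xi>) = exp (\<i> * of_real (y * \<xi>))" for \<xi>
    unfolding single using sums_single[of "int_encode \<lfloor>\<xi>\<rfloor>" "\<lambda>_. exp (\<i> * of_real (y * \<xi>))"]
    by (simp add: sums_iff)
  ultimately show "(\<lambda>n. FT (restr M (icell n)) y) sums FT M y"
    unfolding restr_moment(2)[OF M icell_borel] FT_def[of M] by simp
qed

lemma Wiener_loc_imp_NC:
  assumes "f \<in> Wiener_loc k"
  shows "f \<in> NC k"
proof (rule NC_I)
  show f: "f \<in> C_k k" using assms by (simp add: Wiener_loc_def)
  fix r \<delta> :: real assume r: "0 < r" and \<delta>: "0 < \<delta>"
  obtain g where g: "g \<in> Wiener k" "\<And>x. x \<in> {-r..r} \<Longrightarrow> g x = f x"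
    using assms r unfolding Wiener_loc_def by blast
  obtain M1 M2 M3 M4 where M: "moment k M1" "moment k M2" "moment k M3" "moment k M4"
    and g_eq: "\<And>t. g t = FT M1 t - FT M2 t + \<i> * (FT M3 t - FT M4 t)"
    using Wiener_decomposition[OF g(1)] by metis
  have "approximable k r (\<lambda>t. FT M1 t + (- 1) * FT M2 t + \<i> * (FT M3 t + (- 1) * FT M4 t))"
    by (intro approximable_add approximable_cmult approximable_FT M r)
  moreover have "(\<lambda>t. FT M1 t + (- 1) * FT M2 t + \<i> * (FT M3 t + (- 1) * FT M4 t)) = g"
    by (auto simp: g_eq)
  ultimately have approximable: "approximable k r g" by simp
  then obtain p where p: "\<And>j. j \<le> k \<Longrightarrow> sep (Suc j) {-r..r} \<delta> (gdd j (\<lambda>t. g t - rpoly p t))"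
    using \<delta> unfolding approximable_def by blast
  have "sep (Suc j) {-r..r} \<delta> (gdd j (\<lambda>t. f t - rpoly p t))" if j: "j \<le> k" for j
  proof (rule sep_cong[OF p[OF j]])
    fix x :: "nat \<Rightarrow> real" assume x: "\<And>i. i < Suc j \<Longrightarrow> x i \<in> {-r..r}"
    show "gdd j (\<lambda>t. g t - rpoly p t) x = gdd j (\<lambda>t. f t - rpoly p t) x"
    proof (rule gdd_eq_on[of "{-r..r}" "\<lambda>i. r / real (Suc i)"])
      have "r / real (Suc i) \<le> r" for i using r by (simp add: divide_le_eq mult_le_cancel_left1)
      then show "r / real (Suc i) \<in> {-r..r}" for i
        using r by (auto intro: order_trans[of _ 0])
      show "inj (\<lambda>i. r / real (Suc i))" using r by (auto simp: inj_def field_simps)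
    qed (use x g(2) C_k_mono[OF f j] C_k_mono[OF approximableD[OF approximable] j] rpoly_C_k C_k_diff in auto)
  qed
  then show "\<exists>p. \<forall>j\<le>k. sep (Suc j) {-r..r} \<delta> (gdd j (\<lambda>t. f t - rpoly p t))" by blast
qed

section \<open>The function \<open>\<kappa>\<close>\<close>

subsection \<open>Hoelder continuity\<close>

definition chirp :: "real \<Rightarrow> complex" where
  "chirp x = indicator {0<..} x * of_real (sqrt x) * exp (- (\<i> / of_real x))"

lemma kappa_eq: "kappa \<psi> x = \<psi> x * chirp x"
  by (simp add: kappa_def chirp_def)

lemma chirp_norm: "norm (chirp x) = (if 0 < x then sqrt x else 0)"
proof -
  have "norm (exp (- (\<i> / of_real x))) = 1"
    using norm_exp_i_times[of "- 1 / x"] by (simp add: divide_inverse)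
  then show ?thesis by (simp add: chirp_def norm_mult indicator_def)
qed

lemma chirp_derivative:
  assumes "0 < x"
  shows "(chirp has_vector_derivative
    exp (- (\<i> / of_real x)) * of_real (1 / (2 * sqrt x)) + of_real (sqrt x) * (exp (- (\<i> / of_real x)) * (\<i> / of_real x ^ 2))) (at x)"
proof -
  have "((\<lambda>x. of_real (sqrt x) :: complex) has_vector_derivative of_real (1 / (2 * sqrt x))) (at x)"
    by (rule has_vector_derivative_of_real)
      (use assms in \<open>auto intro!: derivative_eq_intros simp: field_simps\<close>)
  moreover have "((\<lambda>z. exp (- (\<i> / z))) has_field_derivative exp (- (\<i> / of_real x)) * (\<i> / of_real x ^ 2)) (at (of_real x))"
    using assms by (auto intro!: derivative_eq_intros simp: power2_eq_square)
  from has_vector_derivative_real_field[OF this]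
  have "((\<lambda>x. exp (- (\<i> / of_real x))) has_vector_derivative exp (- (\<i> / of_real x)) * (\<i> / of_real x ^ 2)) (at x)" .
  ultimately have "((\<lambda>x. of_real (sqrt x) * exp (- (\<i> / of_real x))) has_vector_derivative
    of_real (sqrt x) * (exp (- (\<i> / of_real x)) * (\<i> / of_real x ^ 2)) + of_real (1 / (2 * sqrt x)) * exp (- (\<i> / of_real x))) (at x)"
    by (rule has_vector_derivative_mult)
  then have "(chirp has_vector_derivative
    of_real (sqrt x) * (exp (- (\<i> / of_real x)) * (\<i> / of_real x ^ 2)) + of_real (1 / (2 * sqrt x)) * exp (- (\<i> / of_real x))) (at x)"
    by (rule has_vector_derivative_transform_within_open[of _ _ _ "{0<..}"])
      (use assms in \<open>auto simp: chirp_def\<close>)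
  then show ?thesis by (simp add: add.commute mult.commute)
qed

text \<open>For \<open>y - x \<le> x\<^sup>2\<close> the oscillation is controlled by \<open>\<bar>\<kappa>'\<bar> \<le> 2 x\<^sup>-\<^sup>3\<^sup>/\<^sup>2\<close>, otherwise by the size
  \<open>\<bar>\<kappa>\<bar> \<le> x\<^sup>1\<^sup>/\<^sup>2\<close>.\<close>

lemma chirp_Holder_aux:
  assumes "x \<le> y" "y \<le> 2"
  shows "norm (chirp x - chirp y) \<le> 4 * (y - x) powr (1/4)"
proof -
  let ?d = "y - x"
  have half: "sqrt t = t powr (1/4) * t powr (1/4)" if "0 \<le> t" for t :: real
    using that by (simp add: powr_add[symmetric] powr_half_sqrt)
  have small: "sqrt t \<le> 2 * t powr (1/4)" if "0 \<le> t" "t \<le> 2" for t :: real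
  proof -
    have "t powr (1/4) \<le> 2 powr (1/4)" using that by (intro powr_mono2) auto
    also have "\<dots> \<le> 2 powr 1" by (intro powr_mono) auto
    finally show ?thesis unfolding half[OF that(1)] by (intro mult_right_mono) auto
  qed
  show ?thesis
  proof (cases "x \<le> 0")
    case True
    show ?thesis
    proof (cases "0 < y")
      case pos: True
      have "norm (chirp x - chirp y) \<le> norm (chirp x) + norm (chirp y)" by (rule norm_triangle_ineq4)
      also have "\<dots> = sqrt y" using True pos by (simp add: chirp_norm)
      also have "\<dots> \<le> 2 * y powr (1/4)" using pos assms by (intro small) auto
      also have "\<dots> \<le> 4 * ?d powr (1/4)" using True pos by (intro mult_mono powr_mono2) auto
      finally show ?thesis .
    qed (use True in \<open>simp add: chirp_def\<close>)
  next
    case False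
    then have x: "0 < x" by simp
    have d: "0 \<le> ?d" using assms by simp
    show ?thesis
    proof (cases "?d \<le> x ^ 2")
      case True
      have "norm (chirp y - chirp x) \<le> (2 * x powr (- 3/2)) * \<bar>y - x\<bar>"
      proof -
        have "norm (chirp y - chirp x) \<le> (2 * x powr (- 3/2)) * norm (y - x)"
        proof (rule differentiable_bound[of "{x..y}" chirp "\<lambda>t h. h *\<^sub>R (exp (- (\<i> / of_real t)) * of_real (1 / (2 * sqrt t)) +
            of_real (sqrt t) * (exp (- (\<i> / of_real t)) * (\<i> / of_real t ^ 2)))"])
          fix t assume t: "t \<in> {x..y}"
          then have tp: "0 < t" "t \<le> 2" using x assms by auto
          show "(chirp has_derivative (\<lambda>h. h *\<^sub>R (exp (- (\<i> / of_real t)) * of_real (1 / (2 * sqrt t)) +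
            of_real (sqrt t) * (exp (- (\<i> / of_real t)) * (\<i> / of_real t ^ 2))))) (at t within {x..y})"
            using has_vector_derivative_at_within[OF chirp_derivative[OF tp(1)]]
            by (simp add: has_vector_derivative_def)
          have ne: "norm (exp (- (\<i> / of_real t))) = 1"
            using norm_exp_i_times[of "- 1 / t"] by (simp add: divide_inverse)
          have st: "0 < sqrt t" "sqrt t * sqrt t = t" using tp by auto
          have p1: "sqrt t / t ^ 2 = t powr (- 3/2)"
          proof -
            have "t powr (- 3/2) = t powr (1/2) / t powr 2" by (simp add: powr_diff[symmetric])
            also have "t powr 2 = t ^ 2" using tp(1) by simp
            also have "t powr (1/2) = sqrt t" using tp by (intro powr_half_sqrt) auto
            finally show ?thesis by (rule sym)
          qed
          \<comment> \<open>This amounts to t^2 <= 2 t, where the restriction to t <= 2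
            enters.\<close>
          have p2: "1 / (2 * sqrt t) \<le> sqrt t / t ^ 2"
          proof -
            have "t * t \<le> 2 * t" using tp by (intro mult_right_mono) auto
            then have "1 * t ^ 2 \<le> sqrt t * (2 * sqrt t)"
              using st(2) by (simp only: power2_eq_square mult.left_commute mult_1_left)
            moreover have "0 < t ^ 2" "0 < 2 * sqrt t" using tp(1) by simp_all
            ultimately show ?thesis by (simp only: pos_divide_le_eq times_divide_eq_left pos_le_divide_eq)
          qed
          have "norm (exp (- (\<i> / of_real t)) * of_real (1 / (2 * sqrt t)) +
            of_real (sqrt t) * (exp (- (\<i> / of_real t)) * (\<i> / of_real t ^ 2))) \<le> 1 / (2 * sqrt t) + sqrt t / t ^ 2"
            by (rule order_trans[OF norm_triangle_ineq]) (use tp ne in \<open>simp add: norm_mult norm_divide norm_power\<close>)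
          also have "\<dots> \<le> 2 * t powr (- 3/2)" using p1 p2 by simp
          also have "\<dots> \<le> 2 * x powr (- 3/2)" using t x by (intro mult_left_mono powr_mono2') auto
          finally have nb: "norm (exp (- (\<i> / of_real t)) * of_real (1 / (2 * sqrt t)) +
            of_real (sqrt t) * (exp (- (\<i> / of_real t)) * (\<i> / of_real t ^ 2))) \<le> 2 * x powr (- 3/2)" .
          show "onorm (\<lambda>h. h *\<^sub>R (exp (- (\<i> / of_real t)) * of_real (1 / (2 * sqrt t)) +
            of_real (sqrt t) * (exp (- (\<i> / of_real t)) * (\<i> / of_real t ^ 2)))) \<le> 2 * x powr (- 3/2)"
            by (rule onorm_le) (use mult_right_mono[OF nb abs_ge_zero] in \<open>simp add: mult.commute\<close>)
        qed (use assms in auto)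
        then show ?thesis by simp
      qed
      \<comment> \<open>Since \<open>?d\<close> <= x^2, the part with exponent 3/4 is at most
        x^(3/2) and cancels the growth of the derivative, which leaves the exponent 1/4.\<close>
      also have "\<dots> = 2 * x powr (- 3/2) * (?d powr (3/4) * ?d powr (1/4))"
        using d by (simp add: powr_add[symmetric])
      also have "\<dots> \<le> 2 * x powr (- 3/2) * ((x ^ 2) powr (3/4) * ?d powr (1/4))"
        using True d by (intro mult_left_mono mult_right_mono powr_mono2) auto
      also have "(x ^ 2) powr (3/4) = x powr (3/2)" using x by (simp add: powr_numeral[symmetric] powr_powr del: powr_numeral)
      also have "2 * x powr (- 3/2) * (x powr (3/2) * ?d powr (1/4)) = 2 * (x powr (- 3/2) * x powr (3/2)) * ?d powr (1/4)"
        by (simp only: mult_ac)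
      also have "x powr (- 3/2) * x powr (3/2) = 1" using x by (simp add: powr_add[symmetric])
      also have "2 * 1 * ?d powr (1/4) \<le> 4 * ?d powr (1/4)" by simp
      finally show ?thesis by (simp add: norm_minus_commute)
    next
      case False
      then have xd: "x ^ 2 \<le> ?d" by simp
      have "x = sqrt (x ^ 2)" using x by simp
      also have "\<dots> \<le> sqrt ?d" using xd by (rule real_sqrt_le_mono)
      finally have "sqrt x \<le> sqrt (sqrt ?d)" by (rule real_sqrt_le_mono)
      also have "sqrt (sqrt ?d) = ?d powr (1/4)" using d by (simp add: powr_half_sqrt[symmetric] powr_powr)
      finally have sx: "sqrt x \<le> ?d powr (1/4)" .
      have "norm (chirp x - chirp y) \<le> norm (chirp x) + norm (chirp y)" by (rule norm_triangle_ineq4)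
      also have "\<dots> = sqrt x + sqrt (x + ?d)" using x assms by (simp add: chirp_norm)
      also have "\<dots> \<le> sqrt x + (sqrt x + sqrt ?d)" using x d by (intro add_left_mono sqrt_add_le_add_sqrt) auto
      also have "\<dots> \<le> ?d powr (1/4) + (?d powr (1/4) + 2 * ?d powr (1/4))"
        using sx small[OF d] assms x by (intro add_mono) auto
      finally show ?thesis by simp
    qed
  qed
qed

lemma chirp_Holder:
  assumes "x \<le> 2" "y \<le> 2"
  shows "norm (chirp x - chirp y) \<le> 4 * \<bar>x - y\<bar> powr (1/4)"
  using chirp_Holder_aux[of x y] chirp_Holder_aux[of y x] assms
  by (cases "x \<le> y") (auto simp: norm_minus_commute abs_if)

text \<open>A bounded Lipschitz \<psi> covers both the smooth \<psi> of the theorem and the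
  piecewise linear \<open>cutoff\<close>. Since \<open>chirp_Holder\<close> holds up to 2 only, both
  arguments are clipped at 2, where \<psi> vanishes by continuity.\<close>

lemma kappa_Holder:
  fixes \<psi> :: "real \<Rightarrow> complex"
  assumes L: "\<And>x y. norm (\<psi> x - \<psi> y) \<le> L * \<bar>x - y\<bar>" "0 \<le> L" and A: "\<And>x. norm (\<psi> x) \<le> A"
    and supp: "\<And>x. 2 < x \<Longrightarrow> \<psi> x = 0"
  shows "norm (kappa \<psi> x - kappa \<psi> y) \<le> (8 * A + 2 * L) * \<bar>x - y\<bar> powr (1/4)"
proof -
  have A0: "0 \<le> A" using A[of 0] norm_ge_zero order_trans by blast
  have \<psi>2: "\<psi> 2 = 0"
  proof (rule ccontr)
    assume ne: "\<psi> 2 \<noteq> 0"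
    then have N: "0 < norm (\<psi> 2)" by simp
    define e where "e = norm (\<psi> 2) / (L + 1)"
    have e: "0 < e" using N L(2) by (simp add: e_def)
    have "norm (\<psi> 2) \<le> L * e" using L(1)[of 2 "2 + e"] supp[of "2 + e"] e by simp
    moreover have "norm (\<psi> 2) = L * e + e"
    proof -
      have "(L + 1) * e = norm (\<psi> 2)" using L(2) by (simp add: e_def)
      then show ?thesis by (simp add: distrib_right)
    qed
    ultimately show False using e by simp
  qed
  have \<psi>H: "norm (\<psi> x - \<psi> y) \<le> (L + 2 * A) * \<bar>x - y\<bar> powr (1/4)" for x y
  proof (cases "\<bar>x - y\<bar> \<le> 1")
    case True
    have "\<bar>x - y\<bar> powr 1 \<le> \<bar>x - y\<bar> powr (1/4)" using True by (intro powr_mono') auto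
    then have "L * \<bar>x - y\<bar> \<le> L * \<bar>x - y\<bar> powr (1/4)" using L(2) by (intro mult_left_mono) auto
    also have "\<dots> \<le> (L + 2 * A) * \<bar>x - y\<bar> powr (1/4)" using A0 by (intro mult_right_mono) auto
    finally show ?thesis using L(1)[of x y] by linarith
  next
    case False
    have "norm (\<psi> x - \<psi> y) \<le> 2 * A"
      using norm_triangle_ineq4[of "\<psi> x" "\<psi> y"] A[of x] A[of y] by linarith
    also have "\<dots> \<le> (L + 2 * A) * \<bar>x - y\<bar> powr (1/4)"
    proof -
      have "1 \<le> \<bar>x - y\<bar> powr (1/4)" using False by (intro ge_one_powr_ge_zero) auto
      then have "(2 * A) * 1 \<le> (L + 2 * A) * \<bar>x - y\<bar> powr (1/4)" using A0 L(2) by (intro mult_mono) auto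
      then show ?thesis by simp
    qed
    finally show ?thesis .
  qed
  have main: "norm (kappa \<psi> x - kappa \<psi> y) \<le> (8 * A + 2 * L) * \<bar>x - y\<bar> powr (1/4)" if "x \<le> 2" "y \<le> 2" for x y
  proof -
    have "norm (chirp y) \<le> 2"
    proof -
      have "sqrt y \<le> sqrt 4" using that by (intro real_sqrt_le_mono) auto
      then show ?thesis by (simp add: chirp_norm)
    qed
    have "kappa \<psi> x - kappa \<psi> y = \<psi> x * (chirp x - chirp y) + (\<psi> x - \<psi> y) * chirp y"
      by (simp add: kappa_eq algebra_simps)
    also have "norm \<dots> \<le> norm (\<psi> x) * norm (chirp x - chirp y) + norm (\<psi> x - \<psi> y) * norm (chirp y)"
      by (rule order_trans[OF norm_triangle_ineq]) (simp add: norm_mult)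
    also have "\<dots> \<le> A * (4 * \<bar>x - y\<bar> powr (1/4)) + ((L + 2 * A) * \<bar>x - y\<bar> powr (1/4)) * 2"
      using A[of x] chirp_Holder[OF that] \<psi>H[of x y] \<open>norm (chirp y) \<le> 2\<close> A0 L(2)
      by (intro add_mono mult_mono) auto
    finally show ?thesis by (simp add: algebra_simps)
  qed
  have clip: "kappa \<psi> x = kappa \<psi> (min x 2)" for x
    using supp[of x] \<psi>2 by (cases "x \<le> 2") (auto simp: kappa_eq min_def)
  have "norm (kappa \<psi> (min x 2) - kappa \<psi> (min y 2)) \<le> (8 * A + 2 * L) * \<bar>min x 2 - min y 2\<bar> powr (1/4)"
    by (rule main) auto
  also have "\<dots> \<le> (8 * A + 2 * L) * \<bar>x - y\<bar> powr (1/4)"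
    using A0 L(2) by (intro mult_left_mono powr_mono2) auto
  finally show ?thesis unfolding clip[symmetric] .
qed

lemma C_c_inf_Lipschitz:
  assumes \<psi>: "\<psi> \<in> C_c_inf" and supp: "closure {x. \<psi> x \<noteq> 0} \<subseteq> {-2..2}"
  obtains L A where "\<And>x y. norm (\<psi> x - \<psi> y) \<le> L * \<bar>x - y\<bar>" "0 \<le> L" "\<And>x. norm (\<psi> x) \<le> A"
    "\<And>x. 2 < x \<Longrightarrow> \<psi> x = 0"
proof -
  have C1: "\<psi> \<in> C_k (Suc 0)" using \<psi> unfolding C_c_inf_def mem_Collect_eq by (rule conjunct1[THEN spec])
  have out: "\<psi> x = 0" if "2 < \<bar>x\<bar>" for x
  proof (rule ccontr)
    assume "\<psi> x \<noteq> 0"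
    then have "x \<in> closure {x. \<psi> x \<noteq> 0}" by (intro subsetD[OF closure_subset]) simp
    then have "x \<in> {-2..2}" using supp by blast
    with that show False by auto
  qed
  have bounded: "\<exists>B\<ge>0. \<forall>x. norm (h x) \<le> B" if h: "continuous_on UNIV h" "\<And>x. 2 < \<bar>x\<bar> \<Longrightarrow> h x = 0"
    for h :: "real \<Rightarrow> complex"
  proof -
    have "compact (h ` {-2..2})"
      by (intro compact_continuous_image continuous_on_subset[OF h(1)]) auto
    then have "bounded (h ` {-2..2})" by (rule compact_imp_bounded)
    then obtain B where B: "0 < B" "\<forall>z\<in>h ` {-2..2}. norm z \<le> B" unfolding bounded_pos by blast
    have "norm (h x) \<le> B" for x
    proof (cases "2 < \<bar>x\<bar>")
      case False
      then have "x \<in> {-2..2}" by auto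
      then show ?thesis using B(2) by blast
    qed (use h(2) B(1) in simp)
    then show ?thesis using B(1) by (intro exI[of _ B]) auto
  qed
  have der: "(\<psi> has_vector_derivative vderiv \<psi> x) (at x)" for x using C_k_SucD[OF C1] .
  have vd: "continuous_on UNIV (vderiv \<psi>)" using C1 by (simp add: C_k_Suc C_k_0)
  have vd0: "vderiv \<psi> x = 0" if "2 < \<bar>x\<bar>" for x
  proof -
    have "((\<lambda>_. 0) has_vector_derivative 0) (at x)" by (rule has_vector_derivative_const)
    moreover have "open {x::real. 2 < \<bar>x\<bar>}" by (intro open_Collect_less continuous_intros)
    ultimately have "(\<psi> has_vector_derivative 0) (at x)"
      by (rule has_vector_derivative_transform_within_open[of _ _ _ "{x. 2 < \<bar>x\<bar>}"]) (use that out in auto)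
    then show ?thesis by (rule vector_derivative_at)
  qed
  obtain L where L: "0 \<le> L" "\<And>x. norm (vderiv \<psi> x) \<le> L" using bounded[OF vd vd0] by blast
  obtain A where A: "\<And>x. norm (\<psi> x) \<le> A" using bounded[OF C_k_continuous[OF C1] out] by blast
  have "norm (\<psi> x - \<psi> y) \<le> L * \<bar>x - y\<bar>" for x y
    by (rule vector_mean_value_bound[OF der L(2)])
  with L(1) A out show thesis by (intro that) auto
qed

subsection \<open>Oscillatory integrals\<close>

text \<open>Integration by parts with the primitive exp (i \<Phi>) / (i p). The boundary terms give
  2 / m; as q keeps one sign, the integral of |q| / p^2 is the modulus of 1 / p b - 1 / p a, again
  at most 2 / m.\<close>

lemma van_der_Corput:
  fixes \<Phi> p q :: "real \<Rightarrow> real"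
  assumes ab: "a \<le> b" and m: "0 < m"
    and \<Phi>: "\<And>t. t \<in> {a..b} \<Longrightarrow> (\<Phi> has_field_derivative p t) (at t)"
    and p: "\<And>t. t \<in> {a..b} \<Longrightarrow> (p has_field_derivative q t) (at t)"
    and q: "continuous_on {a..b} q"
    and pl: "\<And>t. t \<in> {a..b} \<Longrightarrow> m \<le> \<bar>p t\<bar>"
    and sgn: "(\<forall>t\<in>{a..b}. 0 \<le> q t) \<or> (\<forall>t\<in>{a..b}. q t \<le> 0)"
  shows "norm (integral {a..b} (\<lambda>t. exp (\<i> * of_real (\<Phi> t)))) \<le> 4 / m"
proof -
  let ?e = "\<lambda>t. exp (\<i> * of_real (\<Phi> t)) :: complex"
  have p0: "p t \<noteq> 0" if "t \<in> {a..b}" for t using pl[OF that] m by auto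
  have ce: "continuous_on {a..b} ?e"
  proof -
    have "continuous_on {a..b} \<Phi>" using \<Phi> by (intro continuous_at_imp_continuous_on ballI DERIV_isCont)
    then show ?thesis by (intro continuous_intros)
  qed
  have cp: "continuous_on {a..b} p" using p by (intro continuous_at_imp_continuous_on ballI DERIV_isCont)
  let ?F = "\<lambda>t. ?e t / (\<i> * of_real (p t))"
  let ?R = "\<lambda>t. ?e t * of_real (q t / (p t) ^ 2) / \<i>"
  have dF: "(?F has_vector_derivative ?e t - ?R t) (at t within {a..b})" if t: "t \<in> {a..b}" for t
  proof -
    have de: "(?e has_vector_derivative (\<i> * of_real (p t)) * ?e t) (at t)"
    proof -
      have "((\<lambda>z. exp (\<i> * z)) has_field_derivative \<i> * exp (\<i> * of_real (\<Phi> t))) (at (of_real (\<Phi> t)))"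
        by (auto intro!: derivative_eq_intros)
      from field_vector_diff_chain_at[OF has_vector_derivative_of_real[OF \<Phi>[OF t]] this]
      show ?thesis by (simp add: o_def mult_ac)
    qed
    have "((\<lambda>t. inverse (p t)) has_field_derivative - (inverse (p t) * q t * inverse (p t))) (at t)"
      using DERIV_inverse'[OF p[OF t] p0[OF t]] by simp
    from has_vector_derivative_of_real[OF this]
    have "((\<lambda>t. of_real (inverse (p t)) :: complex) has_vector_derivative of_real (- (inverse (p t) * q t * inverse (p t)))) (at t)" .
    from has_vector_derivative_mult[OF de this]
    have "((\<lambda>t. ?e t * of_real (inverse (p t))) has_vector_derivative
        ?e t * of_real (- (inverse (p t) * q t * inverse (p t))) + ((\<i> * of_real (p t)) * ?e t) * of_real (inverse (p t))) (at t)" .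
    from has_vector_derivative_mult_right[OF this, of "1 / \<i>"]
    have "((\<lambda>t. 1 / \<i> * (?e t * of_real (inverse (p t)))) has_vector_derivative
        1 / \<i> * (?e t * of_real (- (inverse (p t) * q t * inverse (p t))) + ((\<i> * of_real (p t)) * ?e t) * of_real (inverse (p t)))) (at t)" .
    moreover have "(\<lambda>t. 1 / \<i> * (?e t * of_real (inverse (p t)))) = ?F" by (auto simp: divide_inverse mult_ac)
    moreover have "1 / \<i> * (?e t * of_real (- (inverse (p t) * q t * inverse (p t))) + ((\<i> * of_real (p t)) * ?e t) * of_real (inverse (p t))) = ?e t - ?R t"
      using p0[OF t] by (simp add: divide_inverse power2_eq_square algebra_simps)
    ultimately show ?thesis using has_vector_derivative_at_within by metis
  qed
  have cR: "continuous_on {a..b} ?R"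
    using p0 by (intro continuous_intros ce cp q) auto
  have intFR: "((\<lambda>t. ?e t - ?R t) has_integral ?F b - ?F a) {a..b}"
    by (rule fundamental_theorem_of_calculus[OF ab dF])
  have split: "integral {a..b} ?e = (?F b - ?F a) + integral {a..b} ?R"
  proof -
    have "integral {a..b} (\<lambda>t. ?e t - ?R t) = integral {a..b} ?e - integral {a..b} ?R"
      by (rule Henstock_Kurzweil_Integration.integral_diff) (intro integrable_continuous_real ce cR)+
    with integral_unique[OF intFR] have "?F b - ?F a = integral {a..b} ?e - integral {a..b} ?R" by (rule trans[OF sym])
    then show ?thesis by (simp only: diff_add_cancel)
  qed
  have FB: "norm (?F t) \<le> 1 / m" if "t \<in> {a..b}" for t
    using pl[OF that] m norm_exp_i_times[of "\<Phi> t"]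
    by (simp add: norm_divide norm_mult divide_left_mono frac_le)
  have IR: "norm (integral {a..b} ?R) \<le> 2 / m"
  proof -
    have inv: "((\<lambda>t. - inverse (p t)) has_vector_derivative q t / (p t) ^ 2) (at t within {a..b})" if t: "t \<in> {a..b}" for t
    proof -
      have "((\<lambda>t. - inverse (p t)) has_field_derivative - (- (inverse (p t) * q t * inverse (p t)))) (at t)"
        by (rule DERIV_minus[OF DERIV_inverse'[OF p[OF t] p0[OF t]]])
      then show ?thesis
        by (simp add: has_real_derivative_iff_has_vector_derivative divide_inverse power2_eq_square mult_ac has_vector_derivative_at_within)
    qed
    have qi: "((\<lambda>t. q t / (p t) ^ 2) has_integral (- inverse (p b) - (- inverse (p a)))) {a..b}"
      by (rule fundamental_theorem_of_calculus[OF ab inv])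
    have nR: "norm (?R t) = \<bar>q t / (p t) ^ 2\<bar>" for t
      using norm_exp_i_times[of "\<Phi> t"] by (simp add: norm_divide norm_mult norm_power)
    have ip: "\<bar>inverse (p t)\<bar> \<le> 1 / m" if "t \<in> {a..b}" for t
      using pl[OF that] m by (simp add: divide_inverse le_imp_inverse_le)
    have "((\<lambda>t. \<bar>q t / (p t) ^ 2\<bar>) has_integral \<bar>- inverse (p b) - (- inverse (p a))\<bar>) {a..b}"
      using sgn
    proof
      assume s: "\<forall>t\<in>{a..b}. 0 \<le> q t"
      have "((\<lambda>t. \<bar>q t / (p t) ^ 2\<bar>) has_integral (- inverse (p b) - (- inverse (p a)))) {a..b}"
        by (rule has_integral_eq[OF _ qi]) (use s in \<open>auto simp: abs_of_nonneg\<close>)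
      moreover have "0 \<le> - inverse (p b) - (- inverse (p a))"
        by (rule has_integral_nonneg[OF qi]) (use s in auto)
      ultimately show ?thesis by simp
    next
      assume s: "\<forall>t\<in>{a..b}. q t \<le> 0"
      have "((\<lambda>t. \<bar>q t / (p t) ^ 2\<bar>) has_integral - (- inverse (p b) - (- inverse (p a)))) {a..b}"
        by (rule has_integral_eq[OF _ has_integral_neg[OF qi]])
          (use s in \<open>auto simp: abs_of_nonpos divide_nonpos_nonneg\<close>)
      moreover from this have "0 \<le> - (- inverse (p b) - (- inverse (p a)))"
        by (rule has_integral_nonneg) auto
      ultimately show ?thesis by (simp add: abs_of_nonpos)
    qed
    then have hi: "((\<lambda>t. \<bar>q t / (p t) ^ 2\<bar>) has_integral \<bar>- inverse (p b) - (- inverse (p a))\<bar>) {a..b}" .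
    have "norm (integral {a..b} ?R) \<le> integral {a..b} (\<lambda>t. \<bar>q t / (p t) ^ 2\<bar>)"
      by (rule integral_norm_bound_integral[OF integrable_continuous_real[OF cR] has_integral_integrable[OF hi]])
        (simp only: nR order_refl)
    also have "\<dots> = \<bar>- inverse (p b) - (- inverse (p a))\<bar>" by (rule integral_unique[OF hi])
    also have "\<dots> \<le> \<bar>inverse (p b)\<bar> + \<bar>inverse (p a)\<bar>" by linarith
    also have "\<dots> \<le> 1 / m + 1 / m" using ab by (intro add_mono ip) auto
    finally show ?thesis by simp
  qed
  have "norm (integral {a..b} ?e) \<le> (norm (?F b) + norm (?F a)) + 2 / m"
    unfolding split by (rule order_trans[OF norm_triangle_ineq]) (intro add_mono norm_triangle_ineq4 IR)
  also have "\<dots> \<le> (1 / m + 1 / m) + 2 / m" using FB[of a] FB[of b] ab by (intro add_mono) auto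
  finally show ?thesis by simp
qed

lemma chirp_phase_derivatives:
  fixes t :: real
  assumes "0 < t"
  shows "((\<lambda>v. v ^ 2 + \<xi> / v ^ 2) has_field_derivative 2 * t - 2 * \<xi> / t ^ 3) (at t)"
    and "((\<lambda>v. 2 * v - 2 * \<xi> / v ^ 3) has_field_derivative 2 + 6 * \<xi> / t ^ 4) (at t)"
proof -
  have "((\<lambda>v. v ^ 2 + \<xi> / v ^ 2) has_field_derivative 2 * t + (0 * t ^ 2 - \<xi> * (2 * t)) / (t ^ 2 * t ^ 2)) (at t)"
    using assms by (auto intro!: derivative_eq_intros)
  moreover have "(0 * t ^ 2 - \<xi> * (2 * t)) / (t ^ 2 * t ^ 2) = - (2 * \<xi> / t ^ 3)"
    using assms by (simp add: field_simps eval_nat_numeral)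
  ultimately show "((\<lambda>v. v ^ 2 + \<xi> / v ^ 2) has_field_derivative 2 * t - 2 * \<xi> / t ^ 3) (at t)" by simp
  have "((\<lambda>v. 2 * v - 2 * \<xi> / v ^ 3) has_field_derivative 2 - (0 * t ^ 3 - 2 * \<xi> * (3 * t ^ 2)) / (t ^ 3 * t ^ 3)) (at t)"
    using assms by (auto intro!: derivative_eq_intros)
  moreover have "(0 * t ^ 3 - 2 * \<xi> * (3 * t ^ 2)) / (t ^ 3 * t ^ 3) = - (6 * \<xi> / t ^ 4)"
    using assms by (simp add: field_simps eval_nat_numeral)
  ultimately show "((\<lambda>v. 2 * v - 2 * \<xi> / v ^ 3) has_field_derivative 2 + 6 * \<xi> / t ^ 4) (at t)" by simp
qed

definition osc :: "real \<Rightarrow> real \<Rightarrow> complex" where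
  "osc \<xi> v = exp (\<i> * of_real (v ^ 2 + \<xi> / v ^ 2))"

lemma norm_osc: "norm (osc \<xi> v) = 1"
  unfolding osc_def by (rule norm_exp_i_times)

lemma continuous_on_osc:
  assumes "1 \<le> a"
  shows "continuous_on {a..b} (osc \<xi>)"
proof -
  have "continuous_on {a..b} (\<lambda>v. v ^ 2 + \<xi> / v ^ 2)"
    using assms by (intro continuous_intros) auto
  then show ?thesis
    unfolding osc_def by (intro continuous_on_exp continuous_on_mult continuous_on_of_real continuous_on_const)
qed

lemma osc_integrable:
  assumes "1 \<le> a"
  shows "osc \<xi> integrable_on {a..b}"
  by (rule integrable_continuous_real) (rule continuous_on_osc[OF assms])

lemma osc_integral_monotone_piece:
  assumes a: "1 \<le> a" and p: "\<And>t. t \<in> {a..b} \<Longrightarrow> 2 \<le> \<bar>2 * t - 2 * \<xi> / t ^ 3\<bar>"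
    and q: "(\<forall>t\<in>{a..b}. 0 \<le> 2 + 6 * \<xi> / t ^ 4) \<or> (\<forall>t\<in>{a..b}. 2 + 6 * \<xi> / t ^ 4 \<le> 0)"
  shows "norm (integral {a..b} (osc \<xi>)) \<le> 2"
proof (cases "a \<le> b")
  case True
  have "norm (integral {a..b} (\<lambda>t. exp (\<i> * of_real (t ^ 2 + \<xi> / t ^ 2)))) \<le> 4 / 2"
  proof (rule van_der_Corput[OF True _ _ _ _ p q])
    fix t assume "t \<in> {a..b}"
    then have t: "0 < t" using a by simp
    show "((\<lambda>t. t ^ 2 + \<xi> / t ^ 2) has_field_derivative 2 * t - 2 * \<xi> / t ^ 3) (at t)"
      and "((\<lambda>t. 2 * t - 2 * \<xi> / t ^ 3) has_field_derivative 2 + 6 * \<xi> / t ^ 4) (at t)"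
      by (rule chirp_phase_derivatives[OF t])+
  next
    show "continuous_on {a..b} (\<lambda>t. 2 + 6 * \<xi> / t ^ 4)" using a by (intro continuous_intros) auto
  qed simp_all
  then show ?thesis by (simp add: osc_def[abs_def])
qed simp

text \<open>The derivative 2 t - 2 \<xi> / t^3 of the phase is at least 2 for t >= 1, so there is no
  stationary point; the interval is cut at the zero r of the second derivative 2 + 6 \<xi> / t^4,
  whose sign must not change.\<close>

lemma osc_integral_nonpos:
  assumes a: "1 \<le> a" and \<xi>: "\<xi> \<le> 0" and r: "0 \<le> r" "r ^ 4 = - 3 * \<xi>"
    and s: "b \<le> r \<or> r \<le> a"
  shows "norm (integral {a..b} (osc \<xi>)) \<le> 2"
proof (rule osc_integral_monotone_piece[OF a])
  fix t assume t: "t \<in> {a..b}"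
  have "0 \<le> - (2 * \<xi> / t ^ 3)" using \<xi> t a by (simp add: divide_nonpos_nonneg)
  then show "2 \<le> \<bar>2 * t - 2 * \<xi> / t ^ 3\<bar>" using t a by auto
next
  have q: "2 + 6 * \<xi> / t ^ 4 = 2 * (t ^ 4 - r ^ 4) / t ^ 4" if "0 < t" for t
    using that r(2) by (simp add: field_simps)
  show "(\<forall>t\<in>{a..b}. 0 \<le> 2 + 6 * \<xi> / t ^ 4) \<or> (\<forall>t\<in>{a..b}. 2 + 6 * \<xi> / t ^ 4 \<le> 0)"
    using s
  proof
    assume br: "b \<le> r"
    have "2 + 6 * \<xi> / t ^ 4 \<le> 0" if t: "t \<in> {a..b}" for t
    proof -
      have t0: "0 < t" using t a by simp
      have "t ^ 4 \<le> r ^ 4" using t t0 br by (intro power_mono) auto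
      then show ?thesis unfolding q[OF t0] by (intro divide_nonpos_nonneg) auto
    qed
    then show ?thesis by blast
  next
    assume ra: "r \<le> a"
    have "0 \<le> 2 + 6 * \<xi> / t ^ 4" if t: "t \<in> {a..b}" for t
    proof -
      have t0: "0 < t" using t a by simp
      have "r ^ 4 \<le> t ^ 4" using t r(1) ra by (intro power_mono) auto
      then show ?thesis unfolding q[OF t0] by (intro divide_nonneg_nonneg) auto
    qed
    then show ?thesis by blast
  qed
qed

text \<open>The phase is stationary at w. Its derivative is 2 (t - w) times a quotient that is at
  least 1, so it has modulus at least 2 at distance 1 or more from w.\<close>

lemma osc_integral_pos:
  assumes a: "1 \<le> a" and \<xi>: "0 \<le> \<xi>" and w: "0 \<le> w" "w ^ 4 = \<xi>"
    and s: "b \<le> w - 1 \<or> w + 1 \<le> a"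
  shows "norm (integral {a..b} (osc \<xi>)) \<le> 2"
proof (rule osc_integral_monotone_piece[OF a])
  fix t assume t: "t \<in> {a..b}"
  have t0: "0 < t" using t a by simp
  have p: "2 * t - 2 * \<xi> / t ^ 3 = 2 * ((t - w) * (t ^ 3 + t ^ 2 * w + t * w ^ 2 + w ^ 3) / t ^ 3)"
    using t0 w(2)[symmetric] by (simp add: field_simps eval_nat_numeral)
  have ge: "1 \<le> (t ^ 3 + t ^ 2 * w + t * w ^ 2 + w ^ 3) / t ^ 3"
    using t0 w(1) by (simp add: le_divide_eq)
  have "1 \<le> \<bar>t - w\<bar>" using s t by auto
  then have "1 * 1 \<le> \<bar>t - w\<bar> * ((t ^ 3 + t ^ 2 * w + t * w ^ 2 + w ^ 3) / t ^ 3)"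
    using ge by (intro mult_mono) auto
  also have "\<dots> = \<bar>(t - w) * (t ^ 3 + t ^ 2 * w + t * w ^ 2 + w ^ 3) / t ^ 3\<bar>"
    using ge by (simp only: abs_mult times_divide_eq_right[symmetric] abs_of_nonneg order_trans[OF zero_le_one])
  finally show "2 \<le> \<bar>2 * t - 2 * \<xi> / t ^ 3\<bar>" unfolding p by (simp only: abs_mult)
next
  show "(\<forall>t\<in>{a..b}. 0 \<le> 2 + 6 * \<xi> / t ^ 4) \<or> (\<forall>t\<in>{a..b}. 2 + 6 * \<xi> / t ^ 4 \<le> 0)"
    using \<xi> by (intro disjI1 ballI add_nonneg_nonneg divide_nonneg_nonneg) auto
qed

lemma osc_integral_bound:
  assumes V: "1 \<le> V"
  shows "norm (integral {1..V} (osc \<xi>)) \<le> 6"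
proof -
  \<comment> \<open>Clipping moves the dividing points r or w - 1, w + 1 into [1, V]; pieces outside
    become degenerate. Each van der Corput piece contributes 2, and for \<xi> > 0 the piece around w
    has length at most 2, hence 6 in total.\<close>
  define clip where "clip t = max 1 (min V t)" for t :: real
  have cl: "1 \<le> clip t" "clip t \<le> V" "clip t = 1 \<or> clip t \<le> t" "clip t = V \<or> t \<le> clip t" for t
    using V by (auto simp: clip_def)
  have split: "integral {a..b} (osc \<xi>) + integral {b..c} (osc \<xi>) = integral {a..c} (osc \<xi>)"
    if "1 \<le> a" "a \<le> b" "b \<le> c" for a b c
    using that by (intro Henstock_Kurzweil_Integration.integral_combine osc_integrable)
  show ?thesis
  proof (cases "\<xi> \<le> 0")
    case True
    define r where "r = root 4 (- 3 * \<xi>)"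
    have r: "0 \<le> r" "r ^ 4 = - 3 * \<xi>" using True by (auto simp: r_def)
    let ?c = "clip r"
    have "norm (integral {1..?c} (osc \<xi>)) \<le> 2"
    proof (cases "?c = 1")
      case False
      then show ?thesis using cl(3)[of r] by (intro osc_integral_nonpos[OF _ True r]) auto
    qed simp
    moreover have "norm (integral {?c..V} (osc \<xi>)) \<le> 2"
    proof (cases "?c = V")
      case False
      then show ?thesis using cl(1,4)[of r] by (intro osc_integral_nonpos[OF _ True r]) auto
    qed simp
    ultimately show ?thesis
      using split[of 1 ?c V] cl(1,2)[of r] norm_triangle_ineq[of "integral {1..?c} (osc \<xi>)" "integral {?c..V} (osc \<xi>)"]
      by simp
  next
    case False
    then have \<xi>: "0 \<le> \<xi>" by simp
    define w where "w = root 4 \<xi>"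
    have w: "0 \<le> w" "w ^ 4 = \<xi>" using \<xi> by (auto simp: w_def)
    let ?a = "clip (w - 1)" and ?b = "clip (w + 1)"
    have ab: "?a \<le> ?b" "?b \<le> ?a + 2" by (auto simp: clip_def)
    have 1: "norm (integral {1..?a} (osc \<xi>)) \<le> 2"
    proof (cases "?a = 1")
      case False
      then show ?thesis using cl(3)[of "w - 1"] by (intro osc_integral_pos[OF _ \<xi> w]) auto
    qed simp
    have 2: "norm (integral {?b..V} (osc \<xi>)) \<le> 2"
    proof (cases "?b = V")
      case False
      then show ?thesis using cl(1,4)[of "w + 1"] by (intro osc_integral_pos[OF _ \<xi> w]) auto
    qed simp
    have 3: "norm (integral {?a..?b} (osc \<xi>)) \<le> 2"
    proof -
      have "norm (integral {?a..?b} (osc \<xi>)) \<le> integral {?a..?b} (\<lambda>_. 1 :: real)"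
        using cl(1)[of "w - 1"]
        by (intro integral_norm_bound_integral osc_integrable) (auto simp: norm_osc)
      then show ?thesis using ab by simp
    qed
    have "integral {1..V} (osc \<xi>) = (integral {1..?a} (osc \<xi>) + integral {?a..?b} (osc \<xi>)) + integral {?b..V} (osc \<xi>)"
      using split[of 1 ?a ?b] split[of 1 ?b V] cl(1,2) ab(1) by simp
    also have "norm \<dots> \<le> (2 + 2) + 2"
      by (intro order_trans[OF norm_triangle_ineq] add_mono 1 2 3)
    finally show ?thesis by simp
  qed
qed

text \<open>By Fubini the phases v^2 and \<xi> / v^2 combine to that of \<open>osc\<close>, whose
  integral over v is at most 6 uniformly in \<xi> and V, so only the k-th moment remains.\<close>

lemma moment_chirp_bound:
  assumes M: "moment k M" and V: "1 \<le> V"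
  shows "norm (integral {1..V} (\<lambda>v. exp (\<i> * of_real (v ^ 2)) *
      (LINT \<xi>|M. (\<i> * of_real \<xi>) ^ k * exp (\<i> * of_real (1 / v ^ 2 * \<xi>))))) \<le> 6 * (LINT \<xi>|M. \<bar>\<xi>\<bar> ^ k)"
proof -
  have s[measurable_cong]: "sets M = sets borel" using M by (simp add: moment_def)
  interpret M: finite_measure M using M by (simp add: moment_def)
  define N where "N = restrict_space lborel {1..V}"
  have sN: "sets N = sets (restrict_space borel {1..V})" by (simp add: N_def sets_restrict_space)
  interpret N: finite_measure N
    by (rule finite_measureI) (use V in \<open>simp add: N_def space_restrict_space emeasure_restrict_space\<close>)
  interpret pair_sigma_finite N M by unfold_locales
  let ?h = "\<lambda>v \<xi>. (\<i> * of_real \<xi>) ^ k * osc \<xi> v"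
  let ?G = "\<lambda>t. LINT \<xi>|M. (\<i> * of_real \<xi>) ^ k * exp (\<i> * of_real (t * \<xi>))"
  have inN: "integral {1..V} f = (LINT v|N. f v)" if "continuous_on {1..V} f" for f :: "real \<Rightarrow> complex"
  proof -
    have "set_integrable lborel {1..V} f" by (rule borel_integrable_atLeastAtMost'[OF that])
    from set_borel_integral_eq_integral(2)[OF this]
    show ?thesis by (simp add: N_def integral_restrict_space set_lebesgue_integral_def)
  qed
  have nh: "norm (?h v \<xi>) = \<bar>\<xi>\<bar> ^ k" for v \<xi> by (simp add: norm_mult norm_power norm_osc)
  have mh: "(\<lambda>(v, \<xi>). ?h v \<xi>) \<in> borel_measurable (N \<Otimes>\<^sub>M M)"
  proof -
    have "(\<lambda>v. v) \<in> borel_measurable N" unfolding N_def by (intro measurable_restrict_space1) simp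
    then have 1[measurable]: "(\<lambda>z. fst z) \<in> borel_measurable (N \<Otimes>\<^sub>M M)"
      by (rule measurable_compose[OF measurable_fst])
    have "(\<lambda>v. v) \<in> borel_measurable M" by measurable
    then have 2[measurable]: "(\<lambda>z. snd z) \<in> borel_measurable (N \<Otimes>\<^sub>M M)"
      by (rule measurable_compose[OF measurable_snd])
    show ?thesis unfolding osc_def case_prod_beta by measurable
  qed
  have int: "integrable (N \<Otimes>\<^sub>M M) (\<lambda>(v, \<xi>). ?h v \<xi>)"
  proof (rule Fubini_integrable[OF mh])
    show "integrable N (\<lambda>v. LINT \<xi>|M. norm (case (v, \<xi>) of (v, \<xi>) \<Rightarrow> ?h v \<xi>))"
      unfolding prod.case nh by simp
    show "AE v in N. integrable M (\<lambda>\<xi>. case (v, \<xi>) of (v, \<xi>) \<Rightarrow> ?h v \<xi>)"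
    proof (rule AE_I2)
      fix v assume v: "v \<in> space N"
      have "(\<lambda>\<xi>. ?h v \<xi>) \<in> borel_measurable M" unfolding osc_def by measurable
      then show "integrable M (\<lambda>\<xi>. case (v, \<xi>) of (v, \<xi>) \<Rightarrow> ?h v \<xi>)"
        unfolding prod.case
        by (rule Bochner_Integration.integrable_bound[OF moment_integrable[OF M order_refl]]) (simp add: nh)
    qed
  qed
  have pt: "exp (\<i> * of_real (v ^ 2)) * ?G (1 / v ^ 2) = (LINT \<xi>|M. ?h v \<xi>)" for v
  proof -
    have "?h v \<xi> = exp (\<i> * of_real (v ^ 2)) * ((\<i> * of_real \<xi>) ^ k * exp (\<i> * of_real (1 / v ^ 2 * \<xi>)))" for \<xi>
      by (simp add: osc_def distrib_left exp_add)
    then have "(LINT \<xi>|M. ?h v \<xi>) =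
        (LINT \<xi>|M. exp (\<i> * of_real (v ^ 2)) * ((\<i> * of_real \<xi>) ^ k * exp (\<i> * of_real (1 / v ^ 2 * \<xi>))))"
      by (intro Bochner_Integration.integral_cong refl)
    also have "\<dots> = exp (\<i> * of_real (v ^ 2)) * ?G (1 / v ^ 2)" by (rule integral_mult_right_zero)
    finally show ?thesis by (rule sym)
  qed
  have "continuous_on {1..V} (\<lambda>v. exp (\<i> * of_real (v ^ 2)) * ?G (1 / v ^ 2))"
  proof -
    have "continuous_on {1..V} (\<lambda>v::real. 1 / v ^ 2)" by (intro continuous_intros) auto
    then have "continuous_on {1..V} (\<lambda>v. ?G (1 / v ^ 2))"
      by (rule continuous_on_compose2[OF FT_weight_continuous[OF M order_refl]]) auto
    then show ?thesis by (intro continuous_on_mult continuous_on_exp continuous_on_of_real continuous_on_power continuous_on_const continuous_on_id)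
  qed
  then have "integral {1..V} (\<lambda>v. exp (\<i> * of_real (v ^ 2)) * ?G (1 / v ^ 2)) =
      (LINT v|N. exp (\<i> * of_real (v ^ 2)) * ?G (1 / v ^ 2))" by (rule inN)
  also have "\<dots> = (LINT v|N. LINT \<xi>|M. ?h v \<xi>)" unfolding pt ..
  also have "\<dots> = (LINT \<xi>|M. LINT v|N. ?h v \<xi>)" by (rule Fubini_integral[OF int, symmetric])
  also have "\<dots> = (LINT \<xi>|M. (\<i> * of_real \<xi>) ^ k * integral {1..V} (osc \<xi>))"
  proof (rule Bochner_Integration.integral_cong[OF refl])
    fix \<xi>
    from inN[OF continuous_on_osc[OF order_refl]] show "(LINT v|N. ?h v \<xi>) = (\<i> * of_real \<xi>) ^ k * integral {1..V} (osc \<xi>)" by simp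
  qed
  also have "norm \<dots> \<le> (LINT \<xi>|M. norm ((\<i> * of_real \<xi>) ^ k * integral {1..V} (osc \<xi>)))"
    by (rule integral_norm_bound)
  also have "\<dots> \<le> (LINT \<xi>|M. 6 * \<bar>\<xi>\<bar> ^ k)"
  proof (rule integral_mono')
    show "integrable M (\<lambda>\<xi>. 6 * \<bar>\<xi>\<bar> ^ k)" using moment_integrable[OF M order_refl] by simp
    fix \<xi>
    have "norm ((\<i> * of_real \<xi>) ^ k * integral {1..V} (osc \<xi>)) = \<bar>\<xi>\<bar> ^ k * norm (integral {1..V} (osc \<xi>))"
      by (simp add: norm_mult norm_power)
    also have "\<dots> \<le> \<bar>\<xi>\<bar> ^ k * 6" by (intro mult_left_mono osc_integral_bound V) simp
    finally show "norm ((\<i> * of_real \<xi>) ^ k * integral {1..V} (osc \<xi>)) \<le> 6 * \<bar>\<xi>\<bar> ^ k" by simp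
  qed simp
  finally show ?thesis by simp
qed

subsection \<open>Failure of the Wiener property\<close>

lemma vderiv_cong_open:
  assumes "open S" "\<And>y. y \<in> S \<Longrightarrow> f y = g y" "x \<in> S"
  shows "vderiv f x = vderiv g x"
proof -
  have "(f has_vector_derivative D) (at x) \<longleftrightarrow> (g has_vector_derivative D) (at x)" for D
    using has_vector_derivative_transform_within_open[of f D x S g]
      has_vector_derivative_transform_within_open[of g D x S f] assms by auto
  then show ?thesis by (simp add: vector_derivative_def)
qed

lemma nth_deriv_cong_open:
  assumes S: "open S" and eq: "\<And>y. y \<in> S \<Longrightarrow> f y = g y" and x: "x \<in> S"
  shows "nth_deriv j f x = nth_deriv j g x"
  using x
proof (induction j arbitrary: x)
  case (Suc j)
  show ?case unfolding nth_deriv_Suc' by (rule vderiv_cong_open[OF S Suc.IH Suc.prems])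
qed (simp add: eq)

lemma Wiener_nth_deriv:
  assumes "g \<in> Wiener k"
  obtains M1 M2 M3 M4 where "moment k M1" "moment k M2" "moment k M3" "moment k M4"
    "\<And>t. nth_deriv k g t = nth_deriv k (FT M1) t - nth_deriv k (FT M2) t +
      \<i> * (nth_deriv k (FT M3) t - nth_deriv k (FT M4) t)"
proof -
  obtain M1 M2 M3 M4 where M: "moment k M1" "moment k M2" "moment k M3" "moment k M4"
    and g: "\<And>t. g t = FT M1 t - FT M2 t + \<i> * (FT M3 t - FT M4 t)"
    by (rule Wiener_decomposition[OF assms]) blast
  have "nth_deriv j g = (\<lambda>t. nth_deriv j (FT M1) t - nth_deriv j (FT M2) t +
      \<i> * (nth_deriv j (FT M3) t - nth_deriv j (FT M4) t))" if "j \<le> k" for j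
    using that
  proof (induction j)
    case 0
    then show ?case using g by auto
  next
    case (Suc j)
    then have j: "j < k" by simp
    show ?case
    proof
      fix t
      note D = nth_deriv_has_vector_derivative[OF FT_C_k(1) j]
      have "((\<lambda>t. nth_deriv j (FT M1) t - nth_deriv j (FT M2) t + \<i> * (nth_deriv j (FT M3) t - nth_deriv j (FT M4) t))
          has_vector_derivative (nth_deriv (Suc j) (FT M1) t - nth_deriv (Suc j) (FT M2) t +
          \<i> * (nth_deriv (Suc j) (FT M3) t - nth_deriv (Suc j) (FT M4) t))) (at t)"
        by (intro has_vector_derivative_add has_vector_derivative_diff has_vector_derivative_mult_right D M)
      from vector_derivative_at[OF this]
      show "nth_deriv (Suc j) g t = nth_deriv (Suc j) (FT M1) t - nth_deriv (Suc j) (FT M2) t +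
          \<i> * (nth_deriv (Suc j) (FT M3) t - nth_deriv (Suc j) (FT M4) t)"
        using Suc.IH j by (simp only: nth_deriv_Suc' less_imp_le)
    qed
  qed
  from this[OF order_refl] show thesis by (intro that[OF M]) simp
qed

lemma exp_times_chirp:
  assumes v: "1 \<le> v"
  shows "exp (\<i> * of_real (v ^ 2)) * chirp (1 / v ^ 2) = of_real (1 / v)"
proof -
  have "chirp (1 / v ^ 2) = of_real (1 / v) * exp (- (\<i> * of_real (v ^ 2)))"
    using v by (simp add: chirp_def real_sqrt_divide)
  then show ?thesis by (simp add: exp_minus)
qed

lemma chirp_not_Wiener_loc:
  assumes eq: "\<And>x. 0 < x \<Longrightarrow> x \<le> 1 \<Longrightarrow> nth_deriv k f x = chirp x"
  shows "f \<notin> Wiener_loc k"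
proof
  assume "f \<in> Wiener_loc k"
  then have "\<forall>r>0. \<exists>g\<in>Wiener k. \<forall>x\<in>{-r..r}. g x = f x" by (simp add: Wiener_loc_def)
  \<comment> \<open>The interval [-2, 2] contains a neighbourhood of (0, 1], so the equality of the
    functions passes to their k-th derivatives there.\<close>
  then have "\<exists>g\<in>Wiener k. \<forall>x\<in>{-2..2}. g x = f x" by (rule allE[of _ 2]) simp
  then obtain g where g: "g \<in> Wiener k" "\<forall>x\<in>{-2..2}. g x = f x" by (rule bexE)
  obtain M1 M2 M3 M4 where M: "moment k M1" "moment k M2" "moment k M3" "moment k M4"
    and nd: "\<And>t. nth_deriv k g t = nth_deriv k (FT M1) t - nth_deriv k (FT M2) t +
      \<i> * (nth_deriv k (FT M3) t - nth_deriv k (FT M4) t)"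
    by (rule Wiener_nth_deriv[OF g(1)]) blast
  define m where "m M = 6 * (LINT \<xi>|M. \<bar>\<xi>\<bar> ^ k)" for M :: "real measure"
  define I where "I M V = integral {1..V} (\<lambda>v. exp (\<i> * of_real (v ^ 2)) * nth_deriv k (FT M) (1 / v ^ 2))"
    for M and V :: real
  have I: "norm (I M V) \<le> m M" if "moment k M" "1 \<le> V" for M V
    using moment_chirp_bound[OF that] FT_C_k(2)[OF that(1) order_refl] by (simp add: I_def m_def)
  have int: "(\<lambda>v. exp (\<i> * of_real (v ^ 2)) * nth_deriv k (FT M) (1 / v ^ 2)) integrable_on {1..V}"
    if "moment k M" for M V
  proof (rule integrable_continuous_real)
    have "continuous_on UNIV (nth_deriv k (FT M))" using FT_C_k(1)[OF that] by (simp add: C_k_def)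
    moreover have "continuous_on {1..V} (\<lambda>v::real. 1 / v ^ 2)" by (intro continuous_intros) auto
    ultimately have "continuous_on {1..V} (\<lambda>v. nth_deriv k (FT M) (1 / v ^ 2))"
      by (rule continuous_on_compose2) auto
    then show "continuous_on {1..V} (\<lambda>v. exp (\<i> * of_real (v ^ 2)) * nth_deriv k (FT M) (1 / v ^ 2))"
      by (intro continuous_on_mult continuous_on_exp continuous_on_of_real continuous_on_power continuous_on_const continuous_on_id)
  qed
  have bound: "ln V \<le> m M1 + m M2 + (m M3 + m M4)" if V: "1 \<le> V" for V :: real
  proof -
    have "((\<lambda>v. of_real (1 / v) :: complex) has_integral of_real (ln V) - of_real (ln 1)) {1..V}"
    proof (rule fundamental_theorem_of_calculus[OF V])
      fix v assume "v \<in> {1..V}"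
      then have "(ln has_field_derivative 1 / v) (at v)" by (intro DERIV_ln_divide) auto
      then show "((\<lambda>v. of_real (ln v) :: complex) has_vector_derivative of_real (1 / v)) (at v within {1..V})"
        by (rule has_vector_derivative_at_within[OF has_vector_derivative_of_real])
    qed
    then have ln: "((\<lambda>v. of_real (1 / v) :: complex) has_integral of_real (ln V)) {1..V}" by simp
    have "((\<lambda>v. exp (\<i> * of_real (v ^ 2)) * nth_deriv k (FT M1) (1 / v ^ 2) - exp (\<i> * of_real (v ^ 2)) * nth_deriv k (FT M2) (1 / v ^ 2) +
        \<i> * (exp (\<i> * of_real (v ^ 2)) * nth_deriv k (FT M3) (1 / v ^ 2) - exp (\<i> * of_real (v ^ 2)) * nth_deriv k (FT M4) (1 / v ^ 2)))
        has_integral I M1 V - I M2 V + \<i> * (I M3 V - I M4 V)) {1..V}"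
      unfolding I_def
      by (intro has_integral_add has_integral_diff has_integral_mult_right integrable_integral int M)
    moreover have "exp (\<i> * of_real (v ^ 2)) * nth_deriv k (FT M1) (1 / v ^ 2) - exp (\<i> * of_real (v ^ 2)) * nth_deriv k (FT M2) (1 / v ^ 2) +
        \<i> * (exp (\<i> * of_real (v ^ 2)) * nth_deriv k (FT M3) (1 / v ^ 2) - exp (\<i> * of_real (v ^ 2)) * nth_deriv k (FT M4) (1 / v ^ 2))
        = of_real (1 / v)" if v: "v \<in> {1..V}" for v
    proof -
      have x: "0 < 1 / v ^ 2" "1 / v ^ 2 \<le> 1" using v by (auto simp: divide_le_eq)
      have "1 / v ^ 2 \<in> {-2<..<2}" unfolding greaterThanLessThan_iff using x by linarith
      then have "nth_deriv k g (1 / v ^ 2) = nth_deriv k f (1 / v ^ 2)"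
        by (rule nth_deriv_cong_open[rotated 2]) (use g(2) in auto)
      also have "\<dots> = chirp (1 / v ^ 2)" by (rule eq[OF x])
      finally have "exp (\<i> * of_real (v ^ 2)) * nth_deriv k g (1 / v ^ 2) = of_real (1 / v)"
        using exp_times_chirp[of v] v by simp
      then show ?thesis unfolding nd by (simp only: algebra_simps)
    qed
    ultimately have "((\<lambda>v. of_real (1 / v) :: complex) has_integral I M1 V - I M2 V + \<i> * (I M3 V - I M4 V)) {1..V}"
      by (rule has_integral_eq[rotated])
    from has_integral_unique[OF ln this]
    have "norm (of_real (ln V) :: complex) = norm ((I M1 V - I M2 V) + \<i> * (I M3 V - I M4 V))" by (rule arg_cong)
    also have "\<dots> \<le> norm (I M1 V - I M2 V) + norm (I M3 V - I M4 V)"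
      by (rule order_trans[OF norm_triangle_ineq]) (simp add: norm_mult)
    also have "\<dots> \<le> (norm (I M1 V) + norm (I M2 V)) + (norm (I M3 V) + norm (I M4 V))"
      by (intro add_mono norm_triangle_ineq4)
    also have "\<dots> \<le> (m M1 + m M2) + (m M3 + m M4)" by (intro add_mono I M V)
    finally show ?thesis using V by (simp add: norm_of_real)
  qed
  define B where "B = m M1 + m M2 + (m M3 + m M4)"
  have "ln (exp (\<bar>B\<bar> + 1)) \<le> B" unfolding B_def by (rule bound) simp
  then show False by simp
qed

section \<open>The witness for strictness\<close>

lemma C_k_antiderivative:
  assumes g: "continuous_on UNIV (g :: real \<Rightarrow> complex)"
  shows "\<exists>f\<in>C_k k. nth_deriv k f = g"
proof (induction k)
  case 0
  then show ?case using g by (intro bexI[of _ g]) (simp_all add: C_k_0)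
next
  case (Suc k)
  then obtain h where h: "h \<in> C_k k" "nth_deriv k h = g" by (rule bexE)
  obtain f where f: "\<And>x. (f has_vector_derivative h x) (at x)"
  proof
    fix x :: real
    \<comment> \<open>Integrals over {a..b} with a > b are 0, so at most one of the two terms is
      active for each sign of x, and \<open>?F\<close> is an antiderivative on both sides of
      0.\<close>
    let ?F = "\<lambda>x. integral {0..x} h - integral {x..0} h"
    have ch: "continuous_on S h" for S using C_k_continuous[OF h(1)] continuous_on_subset by blast
    have io: "h integrable_on {a..b}" for a b by (intro integrable_continuous_real ch)
    define c where "c = - \<bar>x\<bar> - 1"
    define d where "d = \<bar>x\<bar> + 1"
    have cd: "c < x" "x < d" "c < 0" "0 < d" by (auto simp: c_def d_def)
    have "((\<lambda>y. integral {c..y} h) has_vector_derivative h x) (at x within {c..d})"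
      by (rule integral_has_vector_derivative[OF ch]) (use cd in auto)
    then have "((\<lambda>y. integral {c..y} h) has_vector_derivative h x) (at x within {c<..<d})"
      by (rule has_vector_derivative_within_subset) auto
    then have "((\<lambda>y. integral {c..y} h) has_vector_derivative h x) (at x)"
      by (rule has_vector_derivative_within_open[THEN iffD1, rotated 2]) (use cd(1,2) in auto)
    then have "((\<lambda>y. integral {c..y} h - integral {c..0} h) has_vector_derivative h x - 0) (at x)"
      by (intro has_vector_derivative_diff has_vector_derivative_const)
    moreover have "integral {c..y} h - integral {c..0} h = ?F y" if "y \<in> {c<..<d}" for y
    proof (cases "0 \<le> y")
      case True
      then have "integral {c..0} h + integral {0..y} h = integral {c..y} h"
        using cd by (intro Henstock_Kurzweil_Integration.integral_combine io) auto
      moreover have "integral {y..0} h = 0" using True by (cases "y = 0") auto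
      ultimately show ?thesis by (simp add: algebra_simps)
    next
      case False
      then have "integral {c..y} h + integral {y..0} h = integral {c..0} h"
        using cd that by (intro Henstock_Kurzweil_Integration.integral_combine io) auto
      then show ?thesis using False by (simp add: algebra_simps)
    qed
    ultimately show "(?F has_vector_derivative h x) (at x)"
      using has_vector_derivative_transform_within_open[of "\<lambda>y. integral {c..y} h - integral {c..0} h" "h x" x "{c<..<d}" ?F] cd
      by auto
  qed
  have v: "vderiv f = h" using vector_derivative_at[OF f] by (rule ext)
  have "f \<in> C_k (Suc k)" unfolding C_k_Suc v using f h(1) by (auto intro: differentiableI_vector)
  moreover have "nth_deriv (Suc k) f = g" by (simp add: nth_deriv_Suc v h(2))
  ultimately show ?case by (intro bexI)
qed

lemma HolderI:
  assumes f: "f \<in> C_k k" and H: "\<And>x y. norm (nth_deriv k f x - nth_deriv k f y) \<le> C * \<bar>x - y\<bar> powr \<epsilon>"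
  shows "f \<in> Holder k \<epsilon>"
proof -
  have "bdd_above {norm (nth_deriv k f x - nth_deriv k f y) / \<bar>x - y\<bar> powr \<epsilon> | x y. x \<noteq> y}"
  proof (rule bdd_aboveI[of _ C])
    fix z assume "z \<in> {norm (nth_deriv k f x - nth_deriv k f y) / \<bar>x - y\<bar> powr \<epsilon> | x y. x \<noteq> y}"
    then obtain x y where xy: "z = norm (nth_deriv k f x - nth_deriv k f y) / \<bar>x - y\<bar> powr \<epsilon>" "x \<noteq> y" by blast
    have "0 < \<bar>x - y\<bar> powr \<epsilon>" using xy(2) by simp
    then show "z \<le> C" using H[of x y] unfolding xy(1) by (simp only: pos_divide_le_eq)
  qed
  with f show ?thesis by (simp add: Holder_def)
qed

lemma kappa_antiderivative:
  assumes L: "\<And>x y. norm (\<psi> x - \<psi> y) \<le> L * \<bar>x - y\<bar>" "0 \<le> L" and A: "\<And>x. norm (\<psi> x) \<le> A"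
    and supp: "\<And>x. 2 < x \<Longrightarrow> \<psi> x = 0" and one: "\<And>x. x \<in> {-1..1} \<Longrightarrow> \<psi> x = 1"
    and f: "f \<in> C_k k" "nth_deriv k f = kappa \<psi>"
  shows "f \<in> Holder k (1/4) - Wiener_loc k"
proof
  show "f \<in> Holder k (1/4)"
    by (rule HolderI[OF f(1)]) (unfold f(2), rule kappa_Holder[OF L A supp])
  show "f \<notin> Wiener_loc k"
    by (rule chirp_not_Wiener_loc) (simp add: f(2) kappa_eq one)
qed

text \<open>The strict inclusion needs a witness when no \<psi> is given. The Hoelder bound asks for
  a Lipschitz factor only, so a piecewise linear function replaces the construction of a smooth
  bump.\<close>

definition cutoff :: "real \<Rightarrow> complex" where
  "cutoff x = of_real (max 0 (min 1 (2 - \<bar>x\<bar>)))"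

lemma cutoff_Lipschitz: "norm (cutoff x - cutoff y) \<le> 1 * \<bar>x - y\<bar>"
proof -
  have "norm (cutoff x - cutoff y) = \<bar>max 0 (min 1 (2 - \<bar>x\<bar>)) - max 0 (min 1 (2 - \<bar>y\<bar>))\<bar>"
    unfolding cutoff_def of_real_diff[symmetric] norm_of_real ..
  also have "\<dots> \<le> 1 * \<bar>x - y\<bar>" by (simp add: max_def min_def abs_if)
  finally show ?thesis .
qed

lemma cutoff_values: "norm (cutoff x) \<le> 1" "2 < x \<Longrightarrow> cutoff x = 0" "x \<in> {-1..1} \<Longrightarrow> cutoff x = 1"
  by (auto simp: cutoff_def norm_of_real max_def min_def abs_if)

lemma continuous_kappa_cutoff: "continuous_on UNIV (kappa cutoff)"
proof (rule continuous_at_imp_continuous_on, rule ballI)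
  fix x :: real
  have bd: "norm (kappa cutoff y - kappa cutoff x) \<le> 10 * \<bar>y - x\<bar> powr (1/4)" for y
    using kappa_Holder[of cutoff 1 1, OF cutoff_Lipschitz _ cutoff_values(1,2), of y x] by simp
  have lim: "((\<lambda>y. 10 * \<bar>y - x\<bar> powr (1/4)) \<longlongrightarrow> 0) (at x)"
  proof -
    have "((\<lambda>y. \<bar>y - x\<bar>) \<longlongrightarrow> 0) (at x)"
      using tendsto_rabs[OF tendsto_diff[OF tendsto_ident_at tendsto_const[of x]], of x UNIV] by simp
    from tendsto_zero_powrI[OF this tendsto_const[of "1/4"]]
    have "((\<lambda>y. \<bar>y - x\<bar> powr (1/4)) \<longlongrightarrow> 0) (at x)" by simp
    from tendsto_mult_right_zero[OF this, of 10] show ?thesis .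
  qed
  have "((\<lambda>y. kappa cutoff y - kappa cutoff x) \<longlongrightarrow> 0) (at x)"
    by (rule Lim_null_comparison[OF always_eventually lim]) (intro allI bd)
  then show "isCont (kappa cutoff) x" unfolding isCont_def by (rule Lim_null[THEN iffD2])
qed

theorem theorem3p4p1:
  fixes k :: nat
  assumes "k \<ge> 1"
  shows "Wiener_loc k \<subset> NC k \<and>
    (\<forall>\<psi> f. \<psi> \<in> C_c_inf \<longrightarrow> (\<forall>x\<in>{-1..1}. \<psi> x = 1) \<longrightarrow> closure {x. \<psi> x \<noteq> 0} \<subseteq> {-2..2} \<longrightarrow>
       f \<in> C_k k \<longrightarrow> nth_deriv k f = kappa \<psi> \<longrightarrow>
       f \<in> Holder k (1/4) - Wiener_loc k) \<and>
    Holder k (1/4) - Wiener_loc k \<subseteq> NC k - Wiener_loc k"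
proof (intro conjI allI impI)
  show "Holder k (1/4) - Wiener_loc k \<subseteq> NC k - Wiener_loc k"
    using Holder_imp_NC[OF assms] by blast
  obtain f where f: "f \<in> C_k k" "nth_deriv k f = kappa cutoff"
    using C_k_antiderivative[OF continuous_kappa_cutoff, of k] by (rule bexE)
  have "f \<in> Holder k (1/4) - Wiener_loc k"
    by (rule kappa_antiderivative[of cutoff 1 1, OF cutoff_Lipschitz _ cutoff_values f]) simp
  then have "f \<in> NC k" "f \<notin> Wiener_loc k" using Holder_imp_NC[OF assms] by auto
  moreover have "Wiener_loc k \<subseteq> NC k" using Wiener_loc_imp_NC by (rule subsetI)
  ultimately show "Wiener_loc k \<subset> NC k" by blast
next
  fix \<psi> f
  assume \<psi>: "\<psi> \<in> C_c_inf" "\<forall>x\<in>{-1..1}. \<psi> x = 1" "closure {x. \<psi> x \<noteq> 0} \<subseteq> {-2..2}"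
    and f: "f \<in> C_k k" "nth_deriv k f = kappa \<psi>"
  obtain L A where LA: "\<And>x y. norm (\<psi> x - \<psi> y) \<le> L * \<bar>x - y\<bar>" "0 \<le> L" "\<And>x. norm (\<psi> x) \<le> A"
    "\<And>x. 2 < x \<Longrightarrow> \<psi> x = 0"
    by (rule C_c_inf_Lipschitz[OF \<psi>(1,3)]) (rule that)
  show "f \<in> Holder k (1/4) - Wiener_loc k"
    by (rule kappa_antiderivative[OF LA bspec[OF \<psi>(2)] f])
qed

end
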